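(* Let $f:[0,+\infty)\to[0,+\infty)$ be a smooth function with $f(r)=\sin^{2}r$ for $0\le r\le\frac{7\pi}{8}$, $f(r)>0$ for $\frac{7\pi}{8}\le r\le\pi$, and $f(r)=r^{2}$ for $r\ge\pi$. Let $\mathcal M=\mathbb R\times\mathbb R^{3}$ with the Lorentzian metric which, with $t$ the coordinate on the first factor and $(r,\vartheta,\varphi)$ polar coordinates on $\mathbb R^{3}$, is $$g=-dt^{2}+dr^{2}+f(r)\,(d\vartheta^{2}+\sin^{2}\vartheta\,d\varphi^{2}),$$ and let $T=\partial_t$. For any function $h:[0,+\infty)\to[0,+\infty)$ with $h(t)\,\log^{2}(2+t)\to0$ as $t\to+\infty$, there exists $t_{0}>0$ such that for any $\tau>t_{0}$ one can construct a smooth solution $\psi$ (depending on $\tau$) of $\square_g\psi=0$ on $(\mathcal M,g)$, with finite $T$-energy on the hypersurfaces $\{t=\mathrm{const}\}$, such that $$\int_{\{t=\tau\}\cap\{r\le\frac{3\pi}{4}\}}J_{\mu}^{T}(\psi)n^{\mu}>h(\tau)\Big(\int_{\{t=0\}}(1+r)\,J_{\mu}^{T}(\psi)n^{\mu}+\int_{\{t=0\}}J_{\mu}^{T}(T\psi)n^{\mu}\Big).$$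
   Context: $J^{T}_{\mu}(\psi)=Q_{\mu\nu}(\psi)T^{\nu}$ with $Q_{\mu\nu}(\psi)=\frac12(\partial_\mu\psi\,\partial_\nu\bar\psi+\partial_\mu\bar\psi\,\partial_\nu\psi)-\frac12(\partial^\lambda\psi\,\partial_\lambda\bar\psi)g_{\mu\nu}$, and $n=\partial_t$ is the future unit normal of $\{t=\mathrm{const}\}$; thus $J^{T}_{\mu}(\psi)n^{\mu}=\frac12\big(|\partial_t\psi|^{2}+|\nabla\psi|^{2}_{g_0}\big)$, where $g_0=dr^{2}+f(r)(d\vartheta^{2}+\sin^{2}\vartheta\,d\varphi^{2})$ is the induced metric on $\mathbb R^{3}$. Integrals over $\{t=\mathrm{const}\}$ use the volume form of $g_0$. Solutions are complex-valued; $\square_g=-\partial_t^2+\Delta_{g_0}$. The "$T$-energy" on $\{t=c\}$ is $\int_{\{t=c\}}J^{T}_{\mu}(\psi)n^{\mu}$. *)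

theory Defs
  imports "HOL-Analysis.Analysis"
begin

section \<open>Smooth functions\<close>

primrec Ck :: "nat \<Rightarrow> ('a::euclidean_space \<Rightarrow> 'b::real_normed_vector) \<Rightarrow> bool" where
  "Ck 0 u \<longleftrightarrow> continuous_on UNIV u"
| "Ck (Suc k) u \<longleftrightarrow> (\<forall>x. u differentiable at x) \<and>
     (\<forall>b\<in>Basis. Ck k (\<lambda>x. frechet_derivative u (at x) b))"

definition smooth :: "('a::euclidean_space \<Rightarrow> 'b::real_normed_vector) \<Rightarrow> bool" where
  "smooth u \<longleftrightarrow> (\<forall>k. Ck k u)"

text \<open>Smoothness on a closed set (here the half line, where it amounts to smoothness up to the
  boundary): existence of a smooth extension. Values outside the set are irrelevant.\<close>

definition smooth_on_closed ::
    "'a set \<Rightarrow> ('a::euclidean_space \<Rightarrow> 'b::real_normed_vector) \<Rightarrow> bool" where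
  "smooth_on_closed S u \<longleftrightarrow> (\<exists>U. smooth U \<and> (\<forall>x\<in>S. U x = u x))"

section \<open>Coordinate expressions for a pseudo-Riemannian metric\<close>

text \<open>A metric in global coordinates on \<open>real ^ 'n\<close> is its field of coefficient matrices
  \<open>g\<^sub>\<mu>\<^sub>\<nu>\<close>; \<open>matrix_inv\<close> supplies \<open>g\<^sup>\<mu>\<^sup>\<nu>\<close>.\<close>

definition pd :: "'n \<Rightarrow> (real ^ 'n \<Rightarrow> complex) \<Rightarrow> real ^ 'n \<Rightarrow> complex" where
  "pd \<mu> u p = frechet_derivative u (at p) (axis \<mu> 1)"

definition sqrt_det :: "(real ^ 'n \<Rightarrow> real ^ 'n ^ 'n) \<Rightarrow> real ^ 'n \<Rightarrow> real" where
  "sqrt_det g p = sqrt \<bar>det (g p)\<bar>"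

definition wave_op :: "(real ^ 'n \<Rightarrow> real ^ 'n ^ 'n) \<Rightarrow> (real ^ 'n \<Rightarrow> complex) \<Rightarrow> real ^ 'n \<Rightarrow> complex" where
  "wave_op g u p = (\<Sum>\<mu>\<in>UNIV. pd \<mu> (\<lambda>q. of_real (sqrt_det g q) *
       (\<Sum>\<nu>\<in>UNIV. of_real (matrix_inv (g q) $ \<mu> $ \<nu>) * pd \<nu> u q)) p) / of_real (sqrt_det g p)"

text \<open>The defining expression is invariant under complex conjugation, so \<open>Re\<close> only changes the type.\<close>

definition Q_tensor ::
    "(real ^ 'n \<Rightarrow> real ^ 'n ^ 'n) \<Rightarrow> (real ^ 'n \<Rightarrow> complex) \<Rightarrow> 'n \<Rightarrow> 'n \<Rightarrow> real ^ 'n \<Rightarrow> real" where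
  "Q_tensor g u \<mu> \<nu> p =
     (let v = (\<lambda>q. cnj (u q)) in
      Re ((pd \<mu> u p * pd \<nu> v p + pd \<mu> v p * pd \<nu> u p) / 2
        - (\<Sum>\<rho>\<in>UNIV. \<Sum>\<kappa>\<in>UNIV. of_real (matrix_inv (g p) $ \<rho> $ \<kappa>) * pd \<kappa> u p * pd \<rho> v p) / 2
          * of_real (g p $ \<mu> $ \<nu>)))"

definition J_current ::
    "(real ^ 'n \<Rightarrow> real ^ 'n ^ 'n) \<Rightarrow> real ^ 'n \<Rightarrow> (real ^ 'n \<Rightarrow> complex) \<Rightarrow> 'n \<Rightarrow> real ^ 'n \<Rightarrow> real" where
  "J_current g X u \<mu> p = (\<Sum>\<nu>\<in>UNIV. Q_tensor g u \<mu> \<nu> p * X $ \<nu>)"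

section \<open>The spacetime\<close>

text \<open>Spacetime coordinates are indexed by \<open>3 option\<close>: \<open>None\<close> is the time
  index and \<open>Some i\<close> the Cartesian coordinate \<open>x\<^sub>i\<close> on \<open>real ^ 3\<close>.\<close>

type_synonym spacetime = "real ^ (3 option)"

definition event :: "real \<Rightarrow> real ^ 3 \<Rightarrow> spacetime" where
  "event t x = (\<chi> \<mu>. case \<mu> of None \<Rightarrow> t | Some i \<Rightarrow> x $ i)"

definition space_part :: "spacetime \<Rightarrow> real ^ 3" where
  "space_part p = (\<chi> i. p $ Some i)"

text \<open>\<open>dr\<^sup>2 + f(r) (d\<theta>\<^sup>2 + sin\<^sup>2\<theta> d\<phi>\<^sup>2)\<close> in Cartesian coordinates, with \<open>r = norm x\<close>:
  \<open>dr\<close> has components \<open>x\<^sub>i / r\<close>, and the round metric of the unit sphere is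
  \<open>(\<delta>\<^sub>i\<^sub>j - x\<^sub>i x\<^sub>j / r\<^sup>2) / r\<^sup>2\<close>. If \<open>f r = sin\<^sup>2 r\<close> near \<open>0\<close>, this extends
  smoothly to the origin by the identity matrix. Lemma \<open>g0_polar\<close> below recovers the polar form.\<close>

definition g0 :: "(real \<Rightarrow> real) \<Rightarrow> real ^ 3 \<Rightarrow> real ^ 3 ^ 3" where
  "g0 f x = (\<chi> i j. if x = 0 then mat 1 $ i $ j
     else x $ i * x $ j / (norm x)\<^sup>2
       + f (norm x) * ((mat 1 $ i $ j - x $ i * x $ j / (norm x)\<^sup>2) / (norm x)\<^sup>2))"

definition g_metric :: "(real \<Rightarrow> real) \<Rightarrow> spacetime \<Rightarrow> real ^ (3 option) ^ (3 option)" where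
  "g_metric f p = (\<chi> \<mu> \<nu>. case (\<mu>, \<nu>) of
       (None, None) \<Rightarrow> - 1
     | (Some i, Some j) \<Rightarrow> g0 f (space_part p) $ i $ j
     | _ \<Rightarrow> 0)"

definition polar :: "real \<Rightarrow> real \<Rightarrow> real \<Rightarrow> real ^ 3" where
  "polar r \<theta> \<phi> = vector [r * sin \<theta> * cos \<phi>, r * sin \<theta> * sin \<phi>, r * cos \<theta>]"

lemma norm_polar:
  assumes "r \<ge> 0"
  shows "norm (polar r \<theta> \<phi>) = r"
proof -
  have "(r * sin \<theta> * cos \<phi>)\<^sup>2 + (r * sin \<theta> * sin \<phi>)\<^sup>2 + (r * cos \<theta>)\<^sup>2
      = r\<^sup>2 * ((sin \<theta>)\<^sup>2 * ((sin \<phi>)\<^sup>2 + (cos \<phi>)\<^sup>2) + (cos \<theta>)\<^sup>2)"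
    by (simp add: power_mult_distrib algebra_simps del: sin_cos_squared_add sin_cos_squared_add2)
  also have "\<dots> = r\<^sup>2" by simp
  finally show ?thesis
    using assms by (simp add: polar_def norm_vec_def L2_set_def sum_3)
qed

lemma g0_polar:
  assumes r: "(r has_real_derivative r') (at s)" "r s > 0"
    and \<theta>: "(\<theta> has_real_derivative \<theta>') (at s)"
    and \<phi>: "(\<phi> has_real_derivative \<phi>') (at s)"
  obtains v where "((\<lambda>s. polar (r s) (\<theta> s) (\<phi> s)) has_vector_derivative v) (at s)"
    and "v \<bullet> (g0 f (polar (r s) (\<theta> s) (\<phi> s)) *v v)
           = r'\<^sup>2 + f (r s) * (\<theta>'\<^sup>2 + (sin (\<theta> s))\<^sup>2 * \<phi>'\<^sup>2)"
proof -
  define v :: "real ^ 3" where "v = vector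
    [r' * sin (\<theta> s) * cos (\<phi> s) + r s * (\<theta>' * cos (\<theta> s)) * cos (\<phi> s) - r s * sin (\<theta> s) * (\<phi>' * sin (\<phi> s)),
     r' * sin (\<theta> s) * sin (\<phi> s) + r s * (\<theta>' * cos (\<theta> s)) * sin (\<phi> s) + r s * sin (\<theta> s) * (\<phi>' * cos (\<phi> s)),
     r' * cos (\<theta> s) - r s * (\<theta>' * sin (\<theta> s))]"
  define x where "x = polar (r s) (\<theta> s) (\<phi> s)"
  have d: "((\<lambda>s. polar (r s) (\<theta> s) (\<phi> s)) has_vector_derivative v) (at s)"
  proof -
    have "((\<lambda>s. polar (r s) (\<theta> s) (\<phi> s) $ i) has_real_derivative v $ i) (at s)" for i
      using exhaust_3[of i]
      by (auto simp: polar_def v_def intro!: derivative_eq_intros r \<theta> \<phi> simp: algebra_simps)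
    then show ?thesis
      unfolding has_vector_derivative_def has_derivative_componentwise_within[where f="\<lambda>s. polar (r s) (\<theta> s) (\<phi> s)"]
      by (auto simp: Basis_vec_def inner_axis has_field_derivative_def mult_commute_abs)
  qed
  have nx: "norm x = r s" using r(2) norm_polar unfolding x_def by simp
  have x0: "x \<noteq> 0" using nx r(2) by auto
  have s1: "(sin (\<theta> s))\<^sup>2 = 1 - (cos (\<theta> s))\<^sup>2" "(sin (\<phi> s))\<^sup>2 = 1 - (cos (\<phi> s))\<^sup>2"
    by (auto simp: sin_squared_eq)
  have xv: "x \<bullet> v = r s * r'"
  proof -
    have "x \<bullet> v - r s * r' = 0"
      unfolding x_def polar_def v_def inner_vec_def sum_3
      apply simp using s1 by algebra
    then show ?thesis by simp
  qed
  have vv: "v \<bullet> v = r'\<^sup>2 + (r s)\<^sup>2 * (\<theta>'\<^sup>2 + (sin (\<theta> s))\<^sup>2 * \<phi>'\<^sup>2)"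
    unfolding v_def inner_vec_def sum_3
    apply simp using s1 by algebra
  have "v \<bullet> (g0 f x *v v) = (x \<bullet> v)\<^sup>2 / (r s)\<^sup>2
      + f (r s) * ((v \<bullet> v - (x \<bullet> v)\<^sup>2 / (r s)\<^sup>2) / (r s)\<^sup>2)"
    using x0 r(2) by (simp add: g0_def nx inner_vec_def matrix_vector_mult_def sum_3 mat_def field_simps power2_eq_square)
  also have "\<dots> = r'\<^sup>2 + f (r s) * (\<theta>'\<^sup>2 + (sin (\<theta> s))\<^sup>2 * \<phi>'\<^sup>2)"
    unfolding xv vv using r(2) by (simp add: power_mult_distrib)
  finally show thesis using d that unfolding x_def by blast
qed

definition T_field :: spacetime where
  "T_field = axis None 1"

definition n_normal :: spacetime where
  "n_normal = axis None 1"

definition T_deriv :: "(spacetime \<Rightarrow> complex) \<Rightarrow> spacetime \<Rightarrow> complex" where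
  "T_deriv \<psi> p = frechet_derivative \<psi> (at p) T_field"

definition energy_density :: "(real \<Rightarrow> real) \<Rightarrow> (spacetime \<Rightarrow> complex) \<Rightarrow> spacetime \<Rightarrow> real" where
  "energy_density f \<psi> p = (\<Sum>\<mu>\<in>UNIV. J_current (g_metric f) T_field \<psi> \<mu> p * n_normal $ \<mu>)"

text \<open>Integral of \<open>w J\<^sup>T\<^sub>\<mu>(\<psi>) n\<^sup>\<mu>\<close> over \<open>{t = c} \<inter> S\<close> with respect to the volume form of
  the induced metric \<open>g0 f\<close>. The integrand is nonnegative for \<open>w \<ge> 0\<close>, and a divergent
  integral has value \<open>\<infinity>\<close>.\<close>

definition weighted_energy ::
    "(real \<Rightarrow> real) \<Rightarrow> (spacetime \<Rightarrow> complex) \<Rightarrow> real \<Rightarrow> (real ^ 3) set \<Rightarrow> (real ^ 3 \<Rightarrow> real) \<Rightarrow> ennreal" where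
  "weighted_energy f \<psi> c S w =
     (\<integral>\<^sup>+x\<in>S. ennreal (w x * energy_density f \<psi> (event c x) * sqrt_det (g0 f) x) \<partial>lborel)"

end

theory Submission
  imports Defs "HOL-Real_Asymp.Real_Asymp"
begin

text \<open>On the ball \<open>r \<le> 7\<pi>/8\<close> the metric \<open>g0\<close> is that of the unit three-sphere, whose equator
  \<open>r = \<pi>/2\<close> consists of trapped geodesics. The functions \<open>exp (- i \<omega> t) (sin r / r)\<^sup>l (x\<^sub>1 + i x\<^sub>2)\<^sup>l\<close> with
  \<open>\<omega>\<^sup>2 = l (l + 2)\<close> solve the wave equation there and concentrate on one such geodesic, so cutting them
  off between \<open>r = 3\<pi>/4\<close> and \<open>r = 13\<pi>/16\<close> leaves an error which is exponentially small in \<open>l\<close>. Correcting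
  the error costs, by the energy estimate, a term growing only polynomially in \<open>t\<close>. With \<open>l\<close> a multiple of
  \<open>log \<tau>\<close> the local energy at time \<open>\<tau>\<close> is still comparable to the initial one, while \<open>T\<close> acts as
  multiplication by \<open>\<omega> \<approx> log \<tau>\<close> up to a constant; this is the logarithmic loss of the statement.

  The corrector is found among the functions transforming under rotations like \<open>(x\<^sub>1 + i x\<^sub>2)\<^sup>l\<close>. On these the
  angular part of the wave operator is multiplication by a function of \<open>r\<close>, and conjugation with the
  square root of \<open>\<rho> = f / r\<^sup>2\<close> turns it into the flat wave operator plus a smooth radial potential. That equation is
  solved by iterating the retarded potential.\<close>

section \<open>Calculus of smooth functions\<close>

text \<open>The cutoff must act where the metric is still spherical, between 3\<pi>/4 and 7\<pi>/8.
  There sin^2 r is at most 1/2, while the modes have modulus near 1 on the equator; this gap is the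
  source of every exponential gain. Correcting the quasimode means solving an inhomogeneous wave
  equation on a metric whose profile is arbitrary between 7\<pi>/8 and \<pi>. Highest weight
  functions make this radial without dividing by r: two first-order equations characterise them, and
  retarded potentials preserve these because they commute with rotations. The resulting potential
  grows with the degree, but forward supports are bounded up to any time, and an exponential weight
  in time makes the iteration contract there. Existence may thus lose any constant; quantitative
  control comes only from the energy identity, with weights tuned to the length of the time
  interval. All coefficients are functions of s = r^2, so smoothness at the origin is smoothness in
  one variable. One half of the correction starts near t = -1, its mirror image near t = 1, so the
  data at t = 0 stay in a fixed ball, where 1 + r is bounded.\<close>

primrec Ck_on :: "nat \<Rightarrow> 'a set \<Rightarrow> ('a::euclidean_space \<Rightarrow> 'b::real_normed_vector) \<Rightarrow> bool" where
  "Ck_on 0 S u \<longleftrightarrow> continuous_on S u"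
| "Ck_on (Suc k) S u \<longleftrightarrow> (\<forall>x\<in>S. u differentiable at x) \<and>
     (\<forall>b\<in>Basis. Ck_on k S (\<lambda>x. frechet_derivative u (at x) b))"

text \<open>Gluing needs local smoothness: the metric coefficients are given by different formulas
  on overlapping half lines, and the retarded potential by different truncations on different time
  ranges. Derivatives are taken \<open>at x\<close>, so for open S only the values in S
  matter.\<close>

definition smooth_on :: "'a set \<Rightarrow> ('a::euclidean_space \<Rightarrow> 'b::real_normed_vector) \<Rightarrow> bool" where
  "smooth_on S u \<longleftrightarrow> (\<forall>k. Ck_on k S u)"

lemma Ck_on_UNIV: "Ck_on k UNIV u \<longleftrightarrow> Ck k u"
  by (induction k arbitrary: u) auto

lemma smooth_on_UNIV: "smooth_on UNIV u \<longleftrightarrow> smooth u"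
  by (simp add: smooth_on_def smooth_def Ck_on_UNIV)

lemma Ck_on_subset: "Ck_on k S u \<Longrightarrow> T \<subseteq> S \<Longrightarrow> Ck_on k T u"
  by (induction k arbitrary: u) (auto intro: continuous_on_subset)

lemma smooth_on_subset: "smooth_on S u \<Longrightarrow> T \<subseteq> S \<Longrightarrow> smooth_on T u"
  unfolding smooth_on_def using Ck_on_subset by blast

text \<open>\<open>frechet_derivative\<close> is a choice from the set of derivatives, and functions
  agreeing near x have the same set; hence the equality holds even where no derivative
  exists.\<close>

lemma frechet_derivative_cong_open:
  assumes "open S" "x \<in> S" "\<And>y. y \<in> S \<Longrightarrow> u y = v y"
  shows "frechet_derivative u (at x) = frechet_derivative v (at x)"
proof -
  have "(u has_derivative D) (at x) \<longleftrightarrow> (v has_derivative D) (at x)" for D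
    using has_derivative_transform_within_open[OF _ assms(1,2)] assms(3) by (metis (full_types))
  then show ?thesis unfolding frechet_derivative_def by simp
qed

lemma Ck_on_cong:
  assumes "open S" "\<And>y. y \<in> S \<Longrightarrow> u y = v y" "Ck_on k S u"
  shows "Ck_on k S v"
  using assms
proof (induction k arbitrary: u v)
  case 0
  then show ?case using continuous_on_cong by (metis Ck_on.simps(1))
next
  case (Suc k)
  have "v differentiable at x" if "x \<in> S" for x
    using Suc.prems that has_derivative_transform_within_open[OF _ Suc.prems(1) that]
    by (metis Ck_on.simps(2) differentiable_def)
  moreover have "Ck_on k S (\<lambda>x. frechet_derivative v (at x) b)" if "b \<in> Basis" for b
    by (rule Suc.IH[of "\<lambda>x. frechet_derivative u (at x) b"])
      (use Suc.prems that frechet_derivative_cong_open[of S _ u v] in auto)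
  ultimately show ?case by simp
qed

lemma Ck_on_SucI:
  assumes "open S" "\<And>x. x \<in> S \<Longrightarrow> (u has_derivative u' x) (at x)"
    "\<And>b. b \<in> Basis \<Longrightarrow> Ck_on k S (\<lambda>x. u' x b)"
  shows "Ck_on (Suc k) S u"
proof -
  have "Ck_on k S (\<lambda>x. frechet_derivative u (at x) b)" if "b \<in> Basis" for b
    by (rule Ck_on_cong[OF assms(1) _ assms(3)[OF that]])
      (use frechet_derivative_at[OF assms(2)] in auto)
  then show ?thesis using assms(2) by (auto simp: differentiable_def)
qed

lemma Ck_on_has_derivative:
  assumes "Ck_on (Suc k) S u" "x \<in> S"
  shows "(u has_derivative frechet_derivative u (at x)) (at x)"
  using assms frechet_derivative_works by auto

lemma Ck_on_Suc_imp: "Ck_on (Suc k) S u \<Longrightarrow> Ck_on k S u"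
proof (induction k arbitrary: u)
  case 0
  then show ?case
    by (auto intro!: differentiable_imp_continuous_on simp: differentiable_on_def differentiable_at_withinI)
next
  case (Suc k)
  then show ?case by (metis Ck_on.simps(2))
qed

lemma Ck_on_const: "Ck_on k S (\<lambda>x. c)"
proof (induction k arbitrary: c)
  case (Suc k)
  then show ?case by simp
qed simp

lemma Ck_on_add:
  assumes "open S" "Ck_on k S u" "Ck_on k S v"
  shows "Ck_on k S (\<lambda>x. u x + v x)"
  using assms
proof (induction k arbitrary: u v)
  case 0
  then show ?case by (auto intro: continuous_on_add)
next
  case (Suc k)
  show ?case
    by (rule Ck_on_SucI[OF Suc.prems(1),
          of _ "\<lambda>x h. frechet_derivative u (at x) h + frechet_derivative v (at x) h"])
      (use Suc Ck_on_has_derivative in \<open>auto intro!: derivative_eq_intros simp: frechet_derivative_works\<close>)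
qed

lemma Ck_on_bounded_linear:
  assumes "bounded_linear L" "open S" "Ck_on k S u"
  shows "Ck_on k S (\<lambda>x. L (u x))"
  using assms(2,3)
proof (induction k arbitrary: u)
  case 0
  then show ?case using bounded_linear.continuous_on[OF assms(1)] by auto
next
  case (Suc k)
  show ?case
    by (rule Ck_on_SucI[OF Suc.prems(1), of _ "\<lambda>x h. L (frechet_derivative u (at x) h)"])
      (use Suc Ck_on_has_derivative[OF Suc.prems(2)] in
        \<open>auto intro!: bounded_linear.has_derivative[OF assms(1)]\<close>)
qed

lemma Ck_on_bilinear:
  fixes u :: "'c::euclidean_space \<Rightarrow> _"
  assumes "bounded_bilinear bl" "open S" "Ck_on k S u" "Ck_on k S v"
  shows "Ck_on k S (\<lambda>x. bl (u x) (v x))"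
  using assms(2-)
proof (induction k arbitrary: u v)
  case 0
  then show ?case using bounded_bilinear.continuous_on[OF assms(1)] by auto
next
  case (Suc k)
  show ?case
  proof (rule Ck_on_SucI[OF Suc.prems(1)])
    fix x assume "x \<in> S"
    then show "((\<lambda>x. bl (u x) (v x)) has_derivative
       (\<lambda>h. bl (u x) (frechet_derivative v (at x) h) + bl (frechet_derivative u (at x) h) (v x))) (at x)"
      using Ck_on_has_derivative[OF Suc.prems(2)] Ck_on_has_derivative[OF Suc.prems(3)]
      by (intro bounded_bilinear.FDERIV[OF assms(1)]) auto
  next
    fix b :: 'c assume "b \<in> Basis"
    then show "Ck_on k S (\<lambda>x. bl (u x) (frechet_derivative v (at x) b) + bl (frechet_derivative u (at x) b) (v x))"
      using Suc.prems Ck_on_Suc_imp[OF Suc.prems(2)] Ck_on_Suc_imp[OF Suc.prems(3)]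
      by (intro Ck_on_add Suc.IH) auto
  qed
qed

lemma Ck_on_1D:
  fixes u :: "real \<Rightarrow> 'b::real_normed_vector"
  assumes "open S" "\<And>x. x \<in> S \<Longrightarrow> (u has_vector_derivative u' x) (at x)" "Ck_on k S u'"
  shows "Ck_on (Suc k) S u"
  by (rule Ck_on_SucI[OF assms(1), of _ "\<lambda>x h. h *\<^sub>R u' x"])
    (use assms in \<open>auto simp: has_vector_derivative_def\<close>)

text \<open>With a real inner function the derivative of g(u) is a single product of u' and g'(u),
  so the induction closes through the bilinear rule.\<close>

lemma Ck_on_compose:
  fixes g :: "real \<Rightarrow> 'b::real_normed_vector" and u :: "'a::euclidean_space \<Rightarrow> real"
  assumes "open S" "open T" "u ` S \<subseteq> T" "Ck_on k T g" "Ck_on k S u"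
  shows "Ck_on k S (\<lambda>x. g (u x))"
  using assms(4,5)
proof (induction k arbitrary: g)
  case 0
  then show ?case using continuous_on_compose2[OF _ _ assms(3)] by auto
next
  case (Suc k)
  define g' where "g' y = frechet_derivative g (at y) 1" for y
  have g: "(g has_vector_derivative g' y) (at y)" if "y \<in> T" for y
    using Ck_on_has_derivative[OF Suc.prems(1) that]
  proof -
    interpret bounded_linear "frechet_derivative g (at y)"
      by (rule has_derivative_bounded_linear[OF Ck_on_has_derivative[OF Suc.prems(1) that]])
    have "frechet_derivative g (at y) = (\<lambda>h. h *\<^sub>R g' y)"
      unfolding g'_def by (metis mult.right_neutral real_scaleR_def scaleR)
    then show ?thesis
      using Ck_on_has_derivative[OF Suc.prems(1) that] unfolding has_vector_derivative_def by simp
  qed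
  have g': "Ck_on k T g'" using Suc.prems(1) unfolding g'_def by simp
  show ?case
  proof (rule Ck_on_SucI[OF assms(1)])
    fix x assume x: "x \<in> S"
    then have "(g has_derivative (\<lambda>h. h *\<^sub>R g' (u x))) (at (u x))"
      using g assms(3) unfolding has_vector_derivative_def by blast
    from diff_chain_at[OF Ck_on_has_derivative[OF Suc.prems(2) x] this]
    show "((\<lambda>x. g (u x)) has_derivative (\<lambda>h. frechet_derivative u (at x) h *\<^sub>R g' (u x))) (at x)"
      by (simp add: o_def)
  next
    fix b :: 'a assume b: "b \<in> Basis"
    show "Ck_on k S (\<lambda>x. frechet_derivative u (at x) b *\<^sub>R g' (u x))"
      using Suc.prems(2) b
      by (intro Ck_on_bilinear[OF bounded_bilinear_scaleR assms(1)] Suc.IH g' Ck_on_Suc_imp[OF Suc.prems(2)]) auto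
  qed
qed

lemma Ck_on_Union:
  assumes "\<And>x. x \<in> S \<Longrightarrow> \<exists>U. open U \<and> x \<in> U \<and> Ck_on k U u"
  shows "Ck_on k S u"
  using assms
proof (induction k arbitrary: u)
  case 0
  then show ?case
    by (metis Ck_on.simps(1) continuous_at_imp_continuous_on continuous_on_eq_continuous_at)
next
  case (Suc k)
  then show ?case unfolding Ck_on.simps by (metis (mono_tags, lifting))
qed

lemma smooth_on_cong:
  assumes "open S" "\<And>y. y \<in> S \<Longrightarrow> u y = v y" "smooth_on S u"
  shows "smooth_on S v"
  using assms Ck_on_cong unfolding smooth_on_def by blast

lemma smooth_on_local:
  assumes "\<And>x. x \<in> S \<Longrightarrow> \<exists>U. open U \<and> x \<in> U \<and> smooth_on U u"
  shows "smooth_on S u"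
  using assms Ck_on_Union unfolding smooth_on_def by meson

lemma smooth_on_open_Un:
  assumes "open S" "open T" "smooth_on S u" "smooth_on T u"
  shows "smooth_on (S \<union> T) u"
  by (rule smooth_on_local) (use assms in blast)

lemma smooth_on_const [simp]: "smooth_on S (\<lambda>x. c)"
  by (simp add: smooth_on_def Ck_on_const)

lemma smooth_on_add: "open S \<Longrightarrow> smooth_on S u \<Longrightarrow> smooth_on S v \<Longrightarrow> smooth_on S (\<lambda>x. u x + v x)"
  by (simp add: smooth_on_def Ck_on_add)

lemma smooth_on_bounded_linear:
  "bounded_linear L \<Longrightarrow> open S \<Longrightarrow> smooth_on S u \<Longrightarrow> smooth_on S (\<lambda>x. L (u x))"
  by (simp add: smooth_on_def Ck_on_bounded_linear)

lemma smooth_on_mult: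
  fixes u v :: "'a::euclidean_space \<Rightarrow> 'b::real_normed_algebra"
  shows "open S \<Longrightarrow> smooth_on S u \<Longrightarrow> smooth_on S v \<Longrightarrow> smooth_on S (\<lambda>x. u x * v x)"
  by (simp add: smooth_on_def Ck_on_bilinear[OF bounded_bilinear_mult])

lemma smooth_on_minus: "open S \<Longrightarrow> smooth_on S u \<Longrightarrow> smooth_on S (\<lambda>x. - u x)"
  by (rule smooth_on_bounded_linear[OF bounded_linear_minus[OF bounded_linear_ident]])

lemma smooth_on_diff: "open S \<Longrightarrow> smooth_on S u \<Longrightarrow> smooth_on S v \<Longrightarrow> smooth_on S (\<lambda>x. u x - v x)"
  using smooth_on_add[of S u "\<lambda>x. - v x"] smooth_on_minus[of S v] by simp

lemma smooth_on_sum: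
  "open S \<Longrightarrow> (\<And>i. i \<in> I \<Longrightarrow> smooth_on S (u i)) \<Longrightarrow> smooth_on S (\<lambda>x. \<Sum>i\<in>I. u i x)"
  by (induction I rule: infinite_finite_induct) (auto intro: smooth_on_add)

lemma smooth_on_power:
  fixes u :: "'a::euclidean_space \<Rightarrow> 'b::real_normed_algebra_1"
  shows "open S \<Longrightarrow> smooth_on S u \<Longrightarrow> smooth_on S (\<lambda>x. u x ^ n)"
  by (induction n) (auto intro: smooth_on_mult)

lemma smooth_on_compose:
  fixes g :: "real \<Rightarrow> 'b::real_normed_vector" and u :: "'a::euclidean_space \<Rightarrow> real"
  assumes "open S" "open T" "smooth_on T g" "smooth_on S u" "u ` S \<subseteq> T"
  shows "smooth_on S (\<lambda>x. g (u x))"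
  using assms Ck_on_compose unfolding smooth_on_def by blast

lemma smooth_on_ident: "open S \<Longrightarrow> smooth_on S (\<lambda>x. x)"
proof -
  assume S: "open S"
  have "Ck_on k S (\<lambda>x. x)" for k
  proof (cases k)
    case (Suc n)
    have "Ck_on (Suc n) S (\<lambda>x. x)"
      by (rule Ck_on_SucI[OF S, of _ "\<lambda>x h. h"]) (auto simp: Ck_on_const)
    then show ?thesis using Suc by blast
  qed (simp add: continuous_on_id)
  then show ?thesis unfolding smooth_on_def by blast
qed

lemma smooth_on_has_derivative:
  assumes "smooth_on S u" "x \<in> S"
  shows "(u has_derivative frechet_derivative u (at x)) (at x)"
  using assms Ck_on_has_derivative[of 0] unfolding smooth_on_def by blast

lemma smooth_on_frechet_derivative:
  assumes "smooth_on S u" "b \<in> Basis"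
  shows "smooth_on S (\<lambda>x. frechet_derivative u (at x) b)"
  unfolding smooth_on_def
proof
  fix k
  have "Ck_on (Suc k) S u" using assms unfolding smooth_on_def by blast
  then show "Ck_on k S (\<lambda>x. frechet_derivative u (at x) b)" using assms(2) by simp
qed

lemma smooth_on_continuous_on: "smooth_on S u \<Longrightarrow> continuous_on S u"
  unfolding smooth_on_def by (metis Ck_on.simps(1))

text \<open>The derivative of the inverse is minus its own square, so the bilinear rule feeds the
  induction.\<close>

lemma smooth_on_inverse_real: "smooth_on (- {0}) (inverse :: real \<Rightarrow> real)"
  unfolding smooth_on_def
proof
  fix k show "Ck_on k (- {0}) (inverse :: real \<Rightarrow> real)"
  proof (induction k)
    case 0
    then show ?case by (auto intro!: continuous_intros)
  next
    case (Suc k)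
    show ?case
    proof (rule Ck_on_1D[of _ _ "\<lambda>x. - (inverse x * inverse x)"])
      show "(inverse has_vector_derivative - (inverse x * inverse x)) (at x)" if "x \<in> - {0}" for x :: real
        using that DERIV_inverse[of x UNIV]
        by (auto simp: has_real_derivative_iff_has_vector_derivative power2_eq_square eval_nat_numeral)
      show "Ck_on k (- {0}) (\<lambda>x::real. - (inverse x * inverse x))"
        by (intro Ck_on_bounded_linear[OF bounded_linear_minus[OF bounded_linear_ident]]
            Ck_on_bilinear[OF bounded_bilinear_mult] Suc) auto
    qed auto
  qed
qed

lemma smooth_on_sqrt: "smooth_on {0<..} sqrt"
  unfolding smooth_on_def
proof
  fix k show "Ck_on k {0<..} sqrt"
  proof (induction k)
    case 0
    then show ?case by (auto intro!: continuous_intros)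
  next
    case (Suc k)
    show ?case
    proof (rule Ck_on_1D[of _ _ "\<lambda>x. inverse (sqrt x) * (1/2)"])
      show "(sqrt has_vector_derivative inverse (sqrt x) * (1/2)) (at x)" if "x \<in> {0<..}" for x :: real
        using that DERIV_real_sqrt[of x]
        by (auto simp: has_real_derivative_iff_has_vector_derivative)
      have "Ck_on k (-{0}) (inverse :: real \<Rightarrow> real)"
        using smooth_on_inverse_real unfolding smooth_on_def by blast
      from Ck_on_compose[OF _ _ _ this Suc]
      have "Ck_on k {0<..} (\<lambda>x. inverse (sqrt x))" by fastforce
      then show "Ck_on k {0<..} (\<lambda>x. inverse (sqrt x) * (1/2))"
        by (intro Ck_on_bilinear[OF bounded_bilinear_mult] Ck_on_const) auto
    qed auto
  qed
qed

lemma smooth_on_inverse: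
  fixes u :: "'a::euclidean_space \<Rightarrow> real"
  assumes "open S" "smooth_on S u" "\<And>x. x \<in> S \<Longrightarrow> u x \<noteq> 0"
  shows "smooth_on S (\<lambda>x. inverse (u x))"
  using smooth_on_compose[OF assms(1) _ smooth_on_inverse_real assms(2)] assms(3) by fastforce

lemma smooth_on_divide:
  fixes u v :: "'a::euclidean_space \<Rightarrow> real"
  assumes "open S" "smooth_on S u" "smooth_on S v" "\<And>x. x \<in> S \<Longrightarrow> v x \<noteq> 0"
  shows "smooth_on S (\<lambda>x. u x / v x)"
  unfolding divide_inverse by (intro smooth_on_mult smooth_on_inverse assms)

text \<open>Termwise differentiation gives another everywhere convergent power series, so the
  induction runs over all coefficient sequences. The application is sin r / r as a series in
  r^2.\<close>

lemma smooth_powser: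
  fixes c :: "nat \<Rightarrow> real"
  assumes "\<And>y. summable (\<lambda>n. c n * y ^ n)"
  shows "smooth (\<lambda>x. \<Sum>n. c n * x ^ n)"
  unfolding smooth_on_UNIV[symmetric] smooth_on_def
proof
  fix k
  show "Ck_on k UNIV (\<lambda>x. \<Sum>n. c n * x ^ n)"
    using assms
  proof (induction k arbitrary: c)
    case 0
    then show ?case
      by (auto intro!: continuous_at_imp_continuous_on
          DERIV_isCont[OF termdiffs_strong_converges_everywhere])
  next
    case (Suc k)
    have "summable (\<lambda>n. diffs c n * y ^ n)" for y
      by (rule termdiff_converges_all[OF Suc.prems])
    from Suc.IH[OF this] show ?case
      by (intro Ck_on_1D[of _ _ "\<lambda>x. \<Sum>n. diffs c n * x ^ n"])
        (auto simp: has_real_derivative_iff_has_vector_derivative[symmetric]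
          intro: termdiffs_strong_converges_everywhere[OF Suc.prems])
  qed
qed

lemma smooth_exp_mult: "smooth (\<lambda>t::real. exp (of_real t * c) :: complex)"
  unfolding smooth_on_UNIV[symmetric] smooth_on_def
proof
  fix k
  show "Ck_on k UNIV (\<lambda>t::real. exp (of_real t * c) :: complex)"
  proof (induction k)
    case 0
    then show ?case by (auto intro!: continuous_intros)
  next
    case (Suc k)
    have "((\<lambda>t::real. exp (of_real t * c)) has_vector_derivative exp (of_real x * c) * c) (at x)" for x
      by (auto intro!: derivative_eq_intros has_vector_derivative_real_field has_vector_derivative_eq_rhs
          simp: exp_def[symmetric])
    then show ?case
      by (intro Ck_on_1D[of _ _ "\<lambda>t. exp (of_real t * c) * c"])
        (auto intro!: Ck_on_bilinear[OF bounded_bilinear_mult] Suc Ck_on_const)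
  qed
qed

text \<open>The family in n is treated as a whole because the derivative of member n is member n + 2
  minus n times member n + 1.\<close>

lemma smooth_exp_inverse:
  "smooth (\<lambda>x::real. if 0 < x then exp (- 1 / x) / x ^ n else 0)" (is "smooth (?e n)")
  unfolding smooth_on_UNIV[symmetric] smooth_on_def
proof
  have lim: "((\<lambda>x::real. exp (- 1 / x) / x ^ m) \<longlongrightarrow> 0) (at_right 0)" for m
    by real_asymp
  have lim0: "(?e m \<longlongrightarrow> 0) (at 0)" for m
    unfolding filterlim_at_split
  proof
    show "(?e m \<longlongrightarrow> 0) (at_left 0)"
      by (rule tendsto_eventually) (auto simp: eventually_at_filter)
    show "(?e m \<longlongrightarrow> 0) (at_right 0)"
      by (rule Lim_transform_eventually[OF lim[of m]]) (auto simp: eventually_at_filter)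
  qed
  have der: "(?e n has_vector_derivative ?e (n+2) x - of_nat n * ?e (n+1) x) (at x)" for n x
  proof -
    consider "x < 0" | "x = 0" | "x > 0" by linarith
    then show ?thesis
    proof cases
      case 1
      have "((\<lambda>x. 0) has_vector_derivative 0) (at x)" by simp
      then show ?thesis
        by (rule has_vector_derivative_transform_within_open[where S="{..<0}", THEN has_vector_derivative_eq_rhs])
          (use 1 in auto)
    next
      case 3
      have "((\<lambda>x. exp (- 1 / x) / x ^ n) has_real_derivative ?e (n+2) x - of_nat n * ?e (n+1) x) (at x)"
        using 3 by (auto intro!: derivative_eq_intros)
          (cases n; simp add: field_simps power2_eq_square)
      then have "((\<lambda>x. exp (- 1 / x) / x ^ n) has_vector_derivative ?e (n+2) x - of_nat n * ?e (n+1) x) (at x)"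
        by (simp only: has_real_derivative_iff_has_vector_derivative)
      then show ?thesis
        by (rule has_vector_derivative_transform_within_open[where S="{0<..}"]) (use 3 in auto)
    next
      case 2
      \<comment> \<open>The difference quotient at 0 is the next member of the family, which tends
        to 0.\<close>
      have "((\<lambda>h. (?e n (0 + h) - ?e n 0) / h) \<longlongrightarrow> 0) (at 0)"
        by (rule Lim_transform_eventually[OF lim0[of "Suc n"]]) (auto simp: eventually_at_filter)
      then have "(?e n has_real_derivative 0) (at 0)"
        unfolding DERIV_def by simp
      then show ?thesis using 2 by (simp add: has_real_derivative_iff_has_vector_derivative)
    qed
  qed
  fix k
  show "Ck_on k UNIV (?e n)"
  proof (induction k arbitrary: n)
    case 0
    then show ?case
      by (auto intro!: continuous_at_imp_continuous_on has_vector_derivative_continuous[OF der])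
  next
    case (Suc k)
    have "Ck_on k UNIV (\<lambda>x. ?e (n+2) x + (- of_nat n) * ?e (n+1) x)"
      by (intro Ck_on_add Ck_on_bilinear[OF bounded_bilinear_mult] Ck_on_const Suc) auto
    then have "Ck_on k UNIV (\<lambda>x. ?e (n+2) x - of_nat n * ?e (n+1) x)" by simp
    then show ?case by (rule Ck_on_1D[rotated 2]) (use der in auto)
  qed
qed

text \<open>In the quotient of e(1 + t) by e(1 + t) + e(1 - t) one of the two arguments is always
  positive, hence so is the denominator. The symmetry under t to -t is built in so that a source can
  be split exactly between future and past.\<close>

lemma smooth_step_exists:
  "\<exists>\<theta>::real \<Rightarrow> real. smooth \<theta> \<and> (\<forall>t. 0 \<le> \<theta> t \<and> \<theta> t \<le> 1) \<and> (\<forall>t\<le>-1. \<theta> t = 0) \<and> (\<forall>t\<ge>1. \<theta> t = 1)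
     \<and> (\<forall>t. \<theta> t + \<theta> (- t) = 1)"
proof -
  define e where "e x = (if 0 < x then exp (- 1 / x) / x ^ 0 else 0)" for x :: real
  have e: "smooth_on UNIV e" using smooth_exp_inverse[of 0] unfolding e_def smooth_on_UNIV by simp
  have e0: "e x \<ge> 0" for x by (simp add: e_def)
  have e1: "e x > 0" if "x > 0" for x using that by (simp add: e_def)
  have e2: "e x = 0" if "x \<le> 0" for x using that by (simp add: e_def)
  have pos: "e (1 + t) + e (1 - t) > 0" for t
    using e0[of "1+t"] e0[of "1-t"] e1[of "1+t"] e1[of "1-t"] by (cases "t \<ge> 0") auto
  have s: "smooth_on UNIV (\<lambda>t. e (1 + t))" "smooth_on UNIV (\<lambda>t. e (1 - t))"
    by (auto intro!: smooth_on_compose[OF _ _ e] smooth_on_add smooth_on_diff smooth_on_ident)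
  define \<theta> where "\<theta> t = e (1 + t) / (e (1 + t) + e (1 - t))" for t
  have "smooth_on UNIV \<theta>" unfolding \<theta>_def
    by (intro smooth_on_divide smooth_on_add s) (simp_all add: pos[THEN less_imp_neq, symmetric])
  moreover have "\<forall>t. 0 \<le> \<theta> t \<and> \<theta> t \<le> 1"
    using e0 pos by (auto simp: \<theta>_def divide_simps add_nonneg_nonneg)
  moreover have "\<forall>t\<le>-1. \<theta> t = 0" by (auto simp: \<theta>_def e2)
  moreover have "\<theta> t = 1" if "t \<ge> 1" for t
    using pos[of t] that e2[of "1 - t"] by (auto simp: \<theta>_def)
  moreover have "\<theta> t + \<theta> (- t) = 1" for t
    using pos[of t] by (simp add: \<theta>_def add_divide_distrib[symmetric] add.commute)
  ultimately show ?thesis unfolding smooth_on_UNIV[symmetric] by blast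
qed

section \<open>Coordinate partial derivatives of smooth functions\<close>

lemma smooth_continuous_on: "smooth u \<Longrightarrow> continuous_on S u"
  using smooth_on_continuous_on[of UNIV u] continuous_on_subset unfolding smooth_on_UNIV by blast

lemmas smooth_intros =
  smooth_on_const[of UNIV, unfolded smooth_on_UNIV]
  smooth_on_add[of UNIV, unfolded smooth_on_UNIV, OF open_UNIV]
  smooth_on_diff[of UNIV, unfolded smooth_on_UNIV, OF open_UNIV]
  smooth_on_minus[of UNIV, unfolded smooth_on_UNIV, OF open_UNIV]
  smooth_on_mult[of UNIV, unfolded smooth_on_UNIV, OF open_UNIV]
  smooth_on_power[of UNIV, unfolded smooth_on_UNIV, OF open_UNIV]
  smooth_on_sum[of UNIV, unfolded smooth_on_UNIV, OF open_UNIV]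
  smooth_on_ident[of UNIV, unfolded smooth_on_UNIV, OF open_UNIV]

lemma smooth_bounded_linear: "bounded_linear L \<Longrightarrow> smooth u \<Longrightarrow> smooth (\<lambda>x. L (u x))"
  using smooth_on_bounded_linear[of L UNIV u] by (simp add: smooth_on_UNIV)

lemma smooth_linear: "bounded_linear L \<Longrightarrow> smooth L"
  using smooth_bounded_linear[OF _ smooth_intros(8)] by blast

lemma smooth_compose:
  fixes g :: "real \<Rightarrow> 'b::real_normed_vector" and u :: "'a::euclidean_space \<Rightarrow> real"
  shows "smooth g \<Longrightarrow> smooth u \<Longrightarrow> smooth (\<lambda>x. g (u x))"
  using smooth_on_compose[of UNIV UNIV g u] by (simp add: smooth_on_UNIV)

lemma smooth_of_real: "smooth u \<Longrightarrow> smooth (\<lambda>x. complex_of_real (u x))"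
  by (rule smooth_bounded_linear[OF bounded_linear_of_real])

lemma smooth_cnj: "smooth u \<Longrightarrow> smooth (\<lambda>x. cnj (u x))"
  by (rule smooth_bounded_linear[OF bounded_linear_cnj])

lemma smooth_nth: "smooth (\<lambda>p::real^'n. p $ \<mu>)"
  by (rule smooth_linear[OF bounded_linear_vec_nth])

lemma smooth_pd: "smooth u \<Longrightarrow> smooth (pd \<mu> u)"
  using smooth_on_frechet_derivative[of UNIV u "axis \<mu> 1"]
  unfolding smooth_on_UNIV pd_def[abs_def] by simp

lemma pd_eqI: "(u has_derivative D) (at p) \<Longrightarrow> pd \<mu> u p = D (axis \<mu> 1)"
  unfolding pd_def by (metis frechet_derivative_at)

lemma smooth_has_derivative:
  fixes u :: "real^'n \<Rightarrow> complex"
  assumes "smooth u"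
  shows "(u has_derivative (\<lambda>h. \<Sum>\<mu>\<in>UNIV. (h $ \<mu>) *\<^sub>R pd \<mu> u p)) (at p)"
proof -
  have d: "(u has_derivative frechet_derivative u (at p)) (at p)"
    using smooth_on_has_derivative[of UNIV u] assms by (simp add: smooth_on_UNIV)
  then interpret bounded_linear "frechet_derivative u (at p)" by (rule has_derivative_bounded_linear)
  have "frechet_derivative u (at p) h = (\<Sum>\<mu>\<in>UNIV. (h $ \<mu>) *\<^sub>R pd \<mu> u p)" for h
  proof -
    have "h = (\<Sum>\<mu>\<in>UNIV. (h $ \<mu>) *\<^sub>R axis \<mu> 1)"
      by (simp add: vec_eq_iff axis_def if_distrib cong: if_cong)
    then have "frechet_derivative u (at p) h = frechet_derivative u (at p) (\<Sum>\<mu>\<in>UNIV. (h $ \<mu>) *\<^sub>R axis \<mu> 1)"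
      by simp
    then show ?thesis by (simp add: sum scaleR pd_def)
  qed
  then show ?thesis using d by (metis (no_types, lifting) ext)
qed

lemma has_derivative_chain_vec:
  fixes u :: "real^'n \<Rightarrow> complex"
  assumes "smooth u" "(\<gamma> has_vector_derivative v) (at s within S)"
  shows "((\<lambda>s. u (\<gamma> s)) has_vector_derivative (\<Sum>\<mu>\<in>UNIV. (v $ \<mu>) *\<^sub>R pd \<mu> u (\<gamma> s))) (at s within S)"
  using vector_derivative_diff_chain_within[OF assms(2) has_derivative_at_withinI[OF smooth_has_derivative[OF assms(1)]]]
  by (simp add: o_def)

lemma has_vector_derivative_axis:
  fixes u :: "real^'n \<Rightarrow> complex"
  assumes "smooth u"
  shows "((\<lambda>s. u (q + s *\<^sub>R axis \<mu> 1)) has_vector_derivative pd \<mu> u (q + s *\<^sub>R axis \<mu> 1)) (at s within S)"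
proof -
  have "((\<lambda>s. q + s *\<^sub>R axis \<mu> 1) has_vector_derivative axis \<mu> 1) (at s within S)"
    by (auto intro!: derivative_eq_intros)
  from has_derivative_chain_vec[OF assms this] show ?thesis
    by (simp add: axis_def if_distrib[of "\<lambda>c. c *\<^sub>R _"] cong: if_cong)
qed

lemma pd_axis_eqI:
  fixes u :: "real^'n \<Rightarrow> complex"
  assumes "smooth u" "((\<lambda>s. u (p + s *\<^sub>R axis \<mu> 1)) has_vector_derivative d) (at 0)"
  shows "pd \<mu> u p = d"
  using vector_derivative_unique_at[OF has_vector_derivative_axis[OF assms(1), of p \<mu> 0 UNIV] assms(2)] by simp

lemma pd_add: "smooth u \<Longrightarrow> smooth v \<Longrightarrow> pd \<mu> (\<lambda>p. u p + v p) = (\<lambda>p. pd \<mu> u p + pd \<mu> v p)"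
  by (rule ext, rule pd_eqI[THEN trans], rule has_derivative_add[OF smooth_has_derivative smooth_has_derivative])
    (auto simp: axis_def if_distrib[of "\<lambda>c. c *\<^sub>R _"] cong: if_cong)

lemma pd_diff: "smooth u \<Longrightarrow> smooth v \<Longrightarrow> pd \<mu> (\<lambda>p. u p - v p) = (\<lambda>p. pd \<mu> u p - pd \<mu> v p)"
  by (rule ext, rule pd_eqI[THEN trans], rule has_derivative_diff[OF smooth_has_derivative smooth_has_derivative])
    (auto simp: axis_def if_distrib[of "\<lambda>c. c *\<^sub>R _"] cong: if_cong)

lemma pd_mult: "smooth u \<Longrightarrow> smooth v \<Longrightarrow> pd \<mu> (\<lambda>p. u p * v p) = (\<lambda>p. pd \<mu> u p * v p + u p * pd \<mu> v p)"
  by (rule ext, rule pd_eqI[THEN trans], rule has_derivative_mult[OF smooth_has_derivative smooth_has_derivative])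
    (auto simp: axis_def if_distrib[of "\<lambda>c. c *\<^sub>R _"] cong: if_cong)

lemma pd_const: "pd \<mu> (\<lambda>p. c) = (\<lambda>p. 0)"
  by (rule ext, rule pd_eqI[THEN trans], rule has_derivative_const) simp

lemma pd_cmult: "smooth u \<Longrightarrow> pd \<mu> (\<lambda>p. c * u p) = (\<lambda>p. c * pd \<mu> u p)"
  using pd_mult[OF smooth_intros(1)[of c], of u] by (simp add: pd_const)

lemma pd_minus: "smooth u \<Longrightarrow> pd \<mu> (\<lambda>p. - u p) = (\<lambda>p. - pd \<mu> u p)"
  using pd_cmult[of u \<mu> "-1"] by simp

lemma pd_sum:
  "(\<And>i. i \<in> I \<Longrightarrow> smooth (u i)) \<Longrightarrow> pd \<mu> (\<lambda>p. \<Sum>i\<in>I. u i p) = (\<lambda>p. \<Sum>i\<in>I. pd \<mu> (u i) p)"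
  by (induction I rule: infinite_finite_induct) (auto simp: pd_const pd_add smooth_intros)

lemma pd_cnj: "smooth u \<Longrightarrow> pd \<mu> (\<lambda>p. cnj (u p)) = (\<lambda>p. cnj (pd \<mu> u p))"
  by (rule ext, rule pd_eqI[THEN trans], rule has_derivative_cnj[OF smooth_has_derivative])
    (auto simp: axis_def if_distrib[of "\<lambda>c. c *\<^sub>R _"] cong: if_cong)

lemma pd_nth: "pd \<mu> (\<lambda>p. complex_of_real (p $ \<nu>)) = (\<lambda>p. if \<mu> = \<nu> then 1 else 0)"
proof
  fix p
  have "((\<lambda>p. complex_of_real (p $ \<nu>)) has_derivative (\<lambda>h. complex_of_real (h $ \<nu>))) (at p)"
    by (intro has_derivative_of_real bounded_linear_imp_has_derivative bounded_linear_vec_nth)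
  from pd_eqI[OF this] show "pd \<mu> (\<lambda>p. complex_of_real (p $ \<nu>)) p = (if \<mu> = \<nu> then 1 else 0)"
    by (auto simp: axis_def)
qed

lemma pd_power: "smooth u \<Longrightarrow> pd \<mu> (\<lambda>p. u p ^ n) = (\<lambda>p. of_nat n * u p ^ (n - 1) * pd \<mu> u p)"
proof (induction n)
  case (Suc n)
  show ?case
    by (cases n) (use Suc in \<open>simp_all add: pd_mult smooth_intros pd_const fun_eq_iff algebra_simps\<close>)
qed (simp add: pd_const)

text \<open>Clairaut's theorem: the increment of \<open>pd \<nu> u\<close> along \<open>\<mu>\<close> is an integral of
  \<open>pd \<nu> (pd \<mu> u)\<close>, by differentiating the fundamental theorem of calculus along \<open>\<mu>\<close> in the
  direction \<open>\<nu>\<close>.\<close>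

lemma pd_commute:
  fixes u :: "real^'n \<Rightarrow> complex"
  assumes "smooth u"
  shows "pd \<mu> (pd \<nu> u) = pd \<nu> (pd \<mu> u)"
proof
  fix p
  note u = assms smooth_pd[OF assms]
  define a where "a s t = p + s *\<^sub>R axis \<mu> 1 + t *\<^sub>R (axis \<nu> 1 :: real^'n)" for s t
  have cont: "continuous_on S (\<lambda>s. w (a s t))" if "smooth w" for S t and w :: "real^'n \<Rightarrow> complex"
    unfolding a_def by (rule continuous_on_compose2[OF smooth_continuous_on[OF that, of UNIV]])
      (auto intro!: continuous_intros)
  have cont2: "continuous_on S (\<lambda>(t, s). w (a s t))" if "smooth w" for S and w :: "real^'n \<Rightarrow> complex"
    unfolding a_def case_prod_beta
    by (rule continuous_on_compose2[OF smooth_continuous_on[OF that, of UNIV]])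
      (auto intro!: continuous_intros)
  have ds: "((\<lambda>s. w (a s t)) has_vector_derivative pd \<mu> w (a s t)) (at s within S)"
    if "smooth w" for w :: "real^'n \<Rightarrow> complex" and S s t
    using has_vector_derivative_axis[OF that, of "p + t *\<^sub>R axis \<nu> 1" \<mu> s] by (simp add: a_def algebra_simps)
  have dt: "((\<lambda>t. w (a s t)) has_vector_derivative pd \<nu> w (a s t)) (at t within S)"
    if "smooth w" for w :: "real^'n \<Rightarrow> complex" and S s t
    using has_vector_derivative_axis[OF that, of "p + s *\<^sub>R axis \<mu> 1" \<nu> t] by (simp add: a_def algebra_simps)
  have key: "pd \<nu> u (a s 0) - pd \<nu> u (a 0 0) = integral {0..s} (\<lambda>\<sigma>. pd \<nu> (pd \<mu> u) (a \<sigma> 0))" if s: "0 \<le> s" for s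
  proof -
    have ftc: "integral {0..s} (\<lambda>\<sigma>. pd \<mu> u (a \<sigma> t)) = u (a s t) - u (a 0 t)" for t
      by (rule integral_unique[OF fundamental_theorem_of_calculus[OF s]]) (rule ds[OF u(1)])
    have "((\<lambda>t. integral (cbox 0 s) (\<lambda>\<sigma>. pd \<mu> u (a \<sigma> t))) has_vector_derivative
        integral (cbox 0 s) (\<lambda>\<sigma>. pd \<nu> (pd \<mu> u) (a \<sigma> 0))) (at 0 within UNIV)"
      by (rule leibniz_rule_vector_derivative[where fx="\<lambda>t \<sigma>. pd \<nu> (pd \<mu> u) (a \<sigma> t)"])
        (auto intro!: dt[OF u(2)] cont2 u smooth_pd integrable_continuous_real cont)
    then have "((\<lambda>t. u (a s t) - u (a 0 t)) has_vector_derivative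
        integral {0..s} (\<lambda>\<sigma>. pd \<nu> (pd \<mu> u) (a \<sigma> 0))) (at 0)"
      by (simp add: ftc)
    moreover have "((\<lambda>t. u (a s t) - u (a 0 t)) has_vector_derivative pd \<nu> u (a s 0) - pd \<nu> u (a 0 0)) (at 0)"
      by (intro derivative_intros dt u)
    ultimately show ?thesis by (rule vector_derivative_unique_at[rotated])
  qed
  \<comment> \<open>The integral formula \<open>key\<close> is available for s \<ge> 0 only, so the
    remaining differentiation is one-sided at 0; uniqueness of derivatives within {0..1} identifies
    the two mixed derivatives.\<close>
  have "((\<lambda>s. integral {0..s} (\<lambda>\<sigma>. pd \<nu> (pd \<mu> u) (a \<sigma> 0))) has_vector_derivative pd \<nu> (pd \<mu> u) (a 0 0)) (at 0 within {0..1})"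
    by (rule integral_has_vector_derivative) (auto intro!: cont u smooth_pd)
  then have "((\<lambda>s. pd \<nu> u (a s 0) - pd \<nu> u (a 0 0)) has_vector_derivative pd \<nu> (pd \<mu> u) (a 0 0)) (at 0 within {0..1})"
    by (rule has_vector_derivative_transform[rotated 2]) (auto simp: key)
  moreover have "((\<lambda>s. pd \<nu> u (a s 0) - pd \<nu> u (a 0 0)) has_vector_derivative pd \<mu> (pd \<nu> u) (a 0 0) - 0) (at 0 within {0..1})"
    by (intro derivative_intros ds smooth_pd u)
  ultimately have "pd \<mu> (pd \<nu> u) (a 0 0) - 0 = pd \<nu> (pd \<mu> u) (a 0 0)"
    by (intro vector_derivative_unique_within[of 0 "{0..1}"])
      (auto simp: trivial_limit_within islimpt_Icc)
  then show "pd \<mu> (pd \<nu> u) p = pd \<nu> (pd \<mu> u) p" by (simp add: a_def)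
qed

lemma sum_option: "(\<Sum>\<mu>\<in>(UNIV::'a::finite option set). f \<mu>) = f None + (\<Sum>i\<in>UNIV. f (Some i))"
proof -
  have "sum f (UNIV::'a option set) = sum f (insert None (range Some))"
    by (simp add: UNIV_option_conv)
  then show ?thesis by (simp add: sum.reindex)
qed

section \<open>Differentiation under the integral sign\<close>

lemma bounded_on_cball:
  fixes F :: "'a::euclidean_space \<Rightarrow> 'b::real_normed_vector"
  assumes "continuous_on UNIV F"
  shows "\<exists>B\<ge>0. \<forall>q. norm q \<le> r \<longrightarrow> norm (F q) \<le> B"
proof -
  have "compact (F ` cball 0 r)"
    by (intro compact_continuous_image continuous_on_subset[OF assms]) auto
  then obtain B where "\<And>z. z \<in> F ` cball 0 r \<Longrightarrow> norm z \<le> B"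
    using compact_imp_bounded bounded_iff by metis
  then have "\<forall>q. norm q \<le> r \<longrightarrow> norm (F q) \<le> max B 0" by fastforce
  then show ?thesis by (intro exI[of _ "max B 0"]) auto
qed

text \<open>The mean value inequality for F minus its linear part at q reduces the claim to uniform
  continuity of the partial derivatives on a larger ball. Uniformity in q is what later allows
  integration over shifted base points.\<close>

lemma smooth_uniform_derivative:
  fixes F :: "real^'n \<Rightarrow> complex"
  assumes "smooth F" "\<epsilon> > 0"
  shows "\<exists>\<delta>>0. \<forall>q h. norm q \<le> r \<longrightarrow> norm h < \<delta> \<longrightarrow>
    norm (F (q + h) - F q - (\<Sum>\<mu>\<in>UNIV. (h $ \<mu>) *\<^sub>R pd \<mu> F q)) \<le> norm h * \<epsilon>"
proof -
  define \<epsilon>' where "\<epsilon>' = \<epsilon> / CARD('n)"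
  have \<epsilon>': "\<epsilon>' > 0" using assms(2) by (simp add: \<epsilon>'_def)
  have "\<exists>\<delta>>0. \<forall>x q. norm x \<le> r + 1 \<longrightarrow> norm q \<le> r + 1 \<longrightarrow> dist x q < \<delta> \<longrightarrow> dist (pd \<mu> F x) (pd \<mu> F q) < \<epsilon>'" for \<mu>
  proof -
    have "uniformly_continuous_on (cball 0 (r+1)) (pd \<mu> F)"
      by (intro compact_uniformly_continuous smooth_continuous_on smooth_pd assms) auto
    then show ?thesis using \<epsilon>' unfolding uniformly_continuous_on_def
      by (metis mem_cball_0 dist_commute)
  qed
  then obtain d where d: "\<And>\<mu>. d \<mu> > 0" "\<And>\<mu> x q. norm x \<le> r + 1 \<Longrightarrow> norm q \<le> r + 1 \<Longrightarrow> dist x q < d \<mu> \<Longrightarrow>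
      dist (pd \<mu> F x) (pd \<mu> F q) < \<epsilon>'" by metis
  \<comment> \<open>The bound by 1 keeps the segment from q to q + h in the ball of radius r + 1, on
    which the moduli of continuity were taken.\<close>
  define \<delta> where "\<delta> = min 1 (Min (range d))"
  have \<delta>: "\<delta> > 0" "\<delta> \<le> 1" "\<And>\<mu>. \<delta> \<le> d \<mu>" using d(1) by (auto simp: \<delta>_def min_le_iff_disj)
  show ?thesis
  proof (intro exI conjI allI impI)
    fix q h :: "real^'n" assume q: "norm q \<le> r" and h: "norm h < \<delta>"
    let ?D = "\<lambda>x h. \<Sum>\<mu>\<in>UNIV. (h $ \<mu>) *\<^sub>R pd \<mu> F x"
    have "norm (F (q + h) - F q - ?D q (q + h - q)) \<le> norm (q + h - q) * \<epsilon>"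
    proof (rule differentiable_bound_linearization)
      show "q + t *\<^sub>R (q + h - q) \<in> ball q \<delta>" if "t \<in> {0..1}" for t
      proof -
        have "\<bar>t\<bar> * norm h \<le> 1 * norm h" using that by (intro mult_right_mono) auto
        then show ?thesis using h by (simp add: dist_norm)
      qed
      show "(F has_derivative ?D x) (at x within ball q \<delta>)" for x
        by (rule has_derivative_at_withinI[OF smooth_has_derivative[OF assms(1)]])
      show "q \<in> ball q \<delta>" using \<delta> by simp
      fix x assume x: "x \<in> ball q \<delta>"
      have nx: "norm x \<le> r + 1" using x q \<delta>(2) norm_triangle_ineq2[of x q] by (auto simp: dist_norm norm_minus_commute)
      show "onorm (?D x - ?D q) \<le> \<epsilon>"
      proof (rule onorm_le)
        fix k :: "real^'n"
        have "norm ((?D x - ?D q) k) = norm (\<Sum>\<mu>\<in>UNIV. (k $ \<mu>) *\<^sub>R (pd \<mu> F x - pd \<mu> F q))"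
          by (simp add: scaleR_diff_right sum_subtractf)
        also have "\<dots> \<le> (\<Sum>\<mu>\<in>(UNIV::'n set). norm k * \<epsilon>')"
        proof (rule sum_norm_le)
          fix \<mu> :: 'n
          have "norm (pd \<mu> F x - pd \<mu> F q) \<le> \<epsilon>'"
            using d(2)[OF nx, of q \<mu>] q \<delta>(3)[of \<mu>] x by (auto simp: dist_norm norm_minus_commute)
          then show "norm ((k $ \<mu>) *\<^sub>R (pd \<mu> F x - pd \<mu> F q)) \<le> norm k * \<epsilon>'"
            using component_le_norm_cart[of k \<mu>] by (auto intro!: mult_mono)
        qed
        also have "\<dots> = \<epsilon> * norm k" by (simp add: \<epsilon>'_def)
        finally show "norm ((?D x - ?D q) k) \<le> \<epsilon> * norm k" .
      qed
    qed
    then show "norm (F (q + h) - F q - ?D q h) \<le> norm h * \<epsilon>" by simp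
  qed (rule \<delta>(1))
qed

text \<open>Averages of translates against a merely integrable weight. The retarded potential, with
  its singular weight 1/|y|, and the integrals over time slices are both of this form, so
  differentiation under the integral is proved once. The bound on e makes only a bounded part of F
  visible from each point.\<close>

locale translation_average =
  fixes M :: "'b measure" and w :: "'b \<Rightarrow> real" and e :: "'b \<Rightarrow> real^'n" and R :: real
  assumes w: "integrable M w" and e: "e \<in> borel_measurable M"
    and bd: "\<And>y. w y \<noteq> 0 \<Longrightarrow> norm (e y) \<le> R"
begin

definition avg :: "(real^'n \<Rightarrow> complex) \<Rightarrow> real^'n \<Rightarrow> complex" where
  "avg F p = (\<integral>y. w y *\<^sub>R F (p - e y) \<partial>M)"

lemma integrable_avg:
  fixes F :: "real^'n \<Rightarrow> complex"
  assumes "continuous_on UNIV F"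
  shows "integrable M (\<lambda>y. w y *\<^sub>R F (p - e y))"
proof -
  obtain B where B: "B \<ge> 0" "\<And>q. norm q \<le> norm p + R \<Longrightarrow> norm (F q) \<le> B"
    using bounded_on_cball[OF assms] by blast
  show ?thesis
  proof (rule Bochner_Integration.integrable_bound)
    show "integrable M (\<lambda>y. B * w y)" using w by simp
    show "(\<lambda>y. w y *\<^sub>R F (p - e y)) \<in> borel_measurable M"
      using w e borel_measurable_continuous_onI[OF assms] by measurable
    show "AE y in M. norm (w y *\<^sub>R F (p - e y)) \<le> norm (B * w y)"
    proof (rule AE_I2)
      fix y
      show "norm (w y *\<^sub>R F (p - e y)) \<le> norm (B * w y)"
      proof (cases "w y = 0")
        case False
        have "norm (p - e y) \<le> norm p + R" using bd[OF False] norm_triangle_ineq4[of p "e y"] by linarith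
        from B(2)[OF this] show ?thesis using B(1) mult_right_mono[of "cmod (F (p - e y))" B "\<bar>w y\<bar>"]
          by (simp add: abs_mult mult.commute)
      qed simp
    qed
  qed
qed

text \<open>The uniform first-order expansion of F is integrated against |w|; no derivative falls on
  the weight, so its singularities are harmless.\<close>

lemma avg_has_derivative:
  assumes F: "smooth F"
  shows "(avg F has_derivative (\<lambda>h. \<Sum>\<mu>\<in>UNIV. (h $ \<mu>) *\<^sub>R avg (pd \<mu> F) p)) (at p)"
proof -
  let ?D = "\<lambda>q h. \<Sum>\<mu>\<in>UNIV. (h $ \<mu>) *\<^sub>R pd \<mu> F q"
  note int = integrable_avg[OF smooth_continuous_on[OF F]] integrable_avg[OF smooth_continuous_on[OF smooth_pd[OF F]]]
  have intD: "integrable M (\<lambda>y. w y *\<^sub>R ?D (p - e y) h)" for h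
    unfolding scaleR_sum_right scaleR_left_commute[of "w _"]
    by (intro Bochner_Integration.integrable_sum integrable_scaleR_right int)
  have eqD: "(\<Sum>\<mu>\<in>UNIV. (h $ \<mu>) *\<^sub>R avg (pd \<mu> F) p) = (\<integral>y. w y *\<^sub>R ?D (p - e y) h \<partial>M)" for h
    unfolding scaleR_sum_right scaleR_left_commute[of "w _"]
    by (subst Bochner_Integration.integral_sum) (simp_all add: avg_def int del: scaleR_scaleR)
  define W where "W = (\<integral>y. \<bar>w y\<bar> \<partial>M)"
  have W: "W \<ge> 0" by (simp add: W_def)
  show ?thesis
    unfolding has_derivative_at_alt
  proof (intro conjI allI impI)
    show "bounded_linear (\<lambda>h. \<Sum>\<mu>\<in>UNIV. (h $ \<mu>) *\<^sub>R avg (pd \<mu> F) p)"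
      by (intro bounded_linear_sum bounded_linear_scaleR_const bounded_linear_vec_nth)
    fix \<epsilon> :: real assume \<epsilon>: "\<epsilon> > 0"
    \<comment> \<open>The mass W of the weight may be 0, hence W + 1.\<close>
    then have "\<epsilon> / (W + 1) > 0" using W by simp
    from smooth_uniform_derivative[OF F this, of "norm p + R"] obtain \<delta> where \<delta>: "\<delta> > 0"
      "\<And>q h. norm q \<le> norm p + R \<Longrightarrow> norm h < \<delta> \<Longrightarrow> norm (F (q + h) - F q - ?D q h) \<le> norm h * (\<epsilon> / (W+1))"
      by blast
    show "\<exists>d>0. \<forall>y. norm (y - p) < d \<longrightarrow> norm (avg F y - avg F p - (\<Sum>\<mu>\<in>UNIV. ((y - p) $ \<mu>) *\<^sub>R avg (pd \<mu> F) p)) \<le> \<epsilon> * norm (y - p)"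
    proof (intro exI conjI allI impI)
      fix z assume z: "norm (z - p) < \<delta>"
      define h where "h = z - p"
      have "avg F z - avg F p - (\<Sum>\<mu>\<in>UNIV. (h $ \<mu>) *\<^sub>R avg (pd \<mu> F) p)
          = (\<integral>y. w y *\<^sub>R F (z - e y) - w y *\<^sub>R F (p - e y) - w y *\<^sub>R ?D (p - e y) h \<partial>M)"
        unfolding eqD using int(1) intD[of h] by (simp add: avg_def)
      also have "norm \<dots> \<le> (\<integral>y. \<bar>w y\<bar> * (norm h * (\<epsilon> / (W+1))) \<partial>M)"
      proof (rule order_trans[OF integral_norm_bound integral_mono])
        show "integrable M (\<lambda>y. norm (w y *\<^sub>R F (z - e y) - w y *\<^sub>R F (p - e y) - w y *\<^sub>R ?D (p - e y) h))"
          using int(1) intD[of h] by auto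
        show "integrable M (\<lambda>y. \<bar>w y\<bar> * (norm h * (\<epsilon> / (W+1))))" using w by simp
        fix y
        show "norm (w y *\<^sub>R F (z - e y) - w y *\<^sub>R F (p - e y) - w y *\<^sub>R ?D (p - e y) h) \<le> \<bar>w y\<bar> * (norm h * (\<epsilon> / (W+1)))"
        proof (cases "w y = 0")
          case False
          have "norm (p - e y) \<le> norm p + R" using bd[OF False] norm_triangle_ineq4[of p "e y"] by linarith
          from \<delta>(2)[OF this z] have *: "norm (F (z - e y) - F (p - e y) - ?D (p - e y) h) \<le> norm h * (\<epsilon> / (W+1))"
            by (simp add: h_def algebra_simps)
          have "norm (w y *\<^sub>R F (z - e y) - w y *\<^sub>R F (p - e y) - w y *\<^sub>R ?D (p - e y) h)
             = \<bar>w y\<bar> * norm (F (z - e y) - F (p - e y) - ?D (p - e y) h)"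
            by (simp add: scaleR_diff_right[symmetric])
          also have "\<dots> \<le> \<bar>w y\<bar> * (norm h * (\<epsilon> / (W+1)))" by (intro mult_left_mono *) auto
          finally show ?thesis .
        qed simp
      qed
      also have "\<dots> = W * (norm h * (\<epsilon> / (W+1)))" using w by (simp add: W_def)
      also have "\<dots> \<le> (W + 1) * (norm h * (\<epsilon> / (W+1)))" using \<epsilon> W by (intro mult_right_mono) auto
      also have "\<dots> = \<epsilon> * norm h" using W by (simp add: field_simps)
      finally show "norm (avg F z - avg F p - (\<Sum>\<mu>\<in>UNIV. ((z - p) $ \<mu>) *\<^sub>R avg (pd \<mu> F) p)) \<le> \<epsilon> * norm (z - p)"
        by (simp add: h_def)
    qed (rule \<delta>(1))
  qed
qed

lemma pd_avg: "smooth F \<Longrightarrow> pd \<mu> (avg F) p = avg (pd \<mu> F) p"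
  by (subst pd_eqI[OF avg_has_derivative])
    (auto simp: axis_def if_distrib[of "\<lambda>c. c *\<^sub>R _"] cong: if_cong)

lemma smooth_avg: "smooth F \<Longrightarrow> smooth (avg F)"
proof -
  have "Ck_on k UNIV (avg F)" if "smooth F" for k F
    using that
  proof (induction k arbitrary: F)
    case 0
    then show ?case
      by (auto intro!: continuous_at_imp_continuous_on has_derivative_continuous[OF avg_has_derivative])
  next
    case (Suc k)
    show ?case
    proof (rule Ck_on_SucI[OF _ avg_has_derivative[OF Suc.prems]])
      fix b :: "real^'n" assume "b \<in> Basis"
      then obtain \<mu> where b: "b = axis \<mu> 1" by (auto simp: Basis_vec_def)
      show "Ck_on k UNIV (\<lambda>x. \<Sum>\<mu>\<in>UNIV. (b $ \<mu>) *\<^sub>R avg (pd \<mu> F) x)"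
        using Suc.IH[OF smooth_pd[OF Suc.prems, of \<mu>]] unfolding b
        by (simp add: axis_def if_distrib[of "\<lambda>c. c *\<^sub>R _"] eta_contract_eq cong: if_cong)
    qed simp
  qed
  then show "smooth F \<Longrightarrow> smooth (avg F)" by (simp add: smooth_on_UNIV[symmetric] smooth_on_def)
qed

end

section \<open>Integration by parts on \<open>real ^ 3\<close>\<close>

lemma integrable_indicator_cball: "integrable lborel (\<lambda>y::real^3. c * indicator (cball 0 r) y :: real)"
  by (intro integrable_mult_right integrable_real_indicator) (auto intro: emeasure_lborel_cball_finite[simplified])

text \<open>On the dyadic shell r/2^(j+1) < |y| \<le> r/2^j the function is at most 4^(j+1)/r^2, and
  the surrounding ball has volume proportional to r^3/8^j, so the sum is geometric with ratio
  1/2.\<close>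

lemma integrable_inverse_norm_square:
  "integrable lborel (\<lambda>y::real^3. indicator (cball 0 r) y / (norm y)\<^sup>2)"
proof (cases "r > 0")
  case False
  have "(\<lambda>y::real^3. indicator (cball 0 r) y / (norm y)\<^sup>2) = (\<lambda>y. 0 :: real)"
    using False by (auto simp: fun_eq_iff indicator_def) (metis norm_ge_zero norm_le_zero_iff order_trans not_less)
  then show ?thesis by simp
next
  case r: True
  define V where "V = measure lborel (cball (0::real^3) 1)"
  have V: "V \<ge> 0" by (simp add: V_def)
  have ballV: "emeasure lborel (cball (0::real^3) s) = ennreal (V * s ^ 3)" if "s \<ge> 0" for s
  proof -
    have "measure lborel (cball (0::real^3) s) = s ^ DIM(real^3) * V"
      using content_cball[OF that, of "0::real^3"] content_cball[of 1 "0::real^3"] by (simp add: V_def)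
    then show ?thesis
      using emeasure_lborel_cball_finite[of "0::real^3" s]
      by (subst emeasure_eq_ennreal_measure) (auto simp: mult.commute)
  qed
  have "(\<integral>\<^sup>+y. ennreal (indicator (cball 0 r) y / (norm (y::real^3))\<^sup>2) \<partial>lborel)
      \<le> (\<integral>\<^sup>+y. (\<Sum>k. ennreal (4 ^ (k+1) / r\<^sup>2) * indicator (cball 0 (r / 2 ^ k)) (y::real^3)) \<partial>lborel)"
  proof (rule nn_integral_mono)
    fix y :: "real^3"
    show "ennreal (indicator (cball 0 r) y / (norm y)\<^sup>2) \<le> (\<Sum>k. ennreal (4 ^ (k+1) / r\<^sup>2) * indicator (cball 0 (r / 2 ^ k)) y)"
    proof (cases "y \<noteq> 0 \<and> norm y \<le> r")
      case True
      have "\<exists>n. (1/2) ^ n < norm y / r" using True r by (intro real_arch_pow_inv) auto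
      then obtain n where n: "r / 2 ^ n < norm y" using r by (auto simp: field_simps power_divide)
      define k where "k = (LEAST n. r / 2 ^ n < norm y)"
      have k: "r / 2 ^ k < norm y" unfolding k_def using n by (rule LeastI)
      have "k \<noteq> 0" using k True by (intro notI) auto
      then obtain j where j: "k = Suc j" using not0_implies_Suc by blast
      have "\<not> r / 2 ^ j < norm y" using not_less_Least[of j "\<lambda>n. r / 2 ^ n < norm y"] j unfolding k_def by simp
      then have in_j: "y \<in> cball 0 (r / 2 ^ j)" by simp
      have "r\<^sup>2 \<le> 4 ^ (j+1) * (norm y)\<^sup>2"
      proof -
        have "r \<le> 2 ^ (j+1) * norm y" using k j by (simp add: field_simps)
        then have "r\<^sup>2 \<le> (2 ^ (j+1) * norm y)\<^sup>2" using r by (intro power_mono) auto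
        also have "\<dots> = 4 ^ (j+1) * (norm y)\<^sup>2"
          by (simp add: power_mult_distrib power_mult[symmetric] mult.commute[of _ 2] power_add) (simp add: power_mult)
        finally show ?thesis .
      qed
      then have "indicator (cball 0 r) y / (norm y)\<^sup>2 \<le> 4 ^ (j+1) / r\<^sup>2"
        using True r by (simp add: field_simps)
      then have "ennreal (indicator (cball 0 r) y / (norm y)\<^sup>2) \<le> ennreal (4 ^ (j+1) / r\<^sup>2) * indicator (cball 0 (r / 2 ^ j)) y"
        using in_j by (simp add: ennreal_leI)
      also have "\<dots> \<le> (\<Sum>k. ennreal (4 ^ (k+1) / r\<^sup>2) * indicator (cball 0 (r / 2 ^ k)) y)"
        using sum_le_suminf[OF summableI, of "{j}" "\<lambda>k. ennreal (4 ^ (k+1) / r\<^sup>2) * indicator (cball 0 (r / 2 ^ k)) y"]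
        by (simp only: sum.insert finite.intros sum.empty empty_iff not_False_eq_True add_0_right zero_le simp_thms)
      finally show ?thesis .
    qed auto
  qed
  also have "\<dots> = (\<Sum>k. ennreal (4 ^ (k+1) / r\<^sup>2) * emeasure lborel (cball (0::real^3) (r / 2 ^ k)))"
    by (subst nn_integral_suminf) (auto simp: nn_integral_cmult_indicator
        intro!: borel_measurable_times_ennreal borel_measurable_indicator)
  also have "\<dots> = (\<Sum>k. ennreal (4 * V * r * (1/2) ^ k))"
  proof (rule suminf_cong)
    fix k
    have "(8::real) ^ k = 4 ^ k * 2 ^ k" "(4::real) ^ k = 2 ^ k * 2 ^ k" by (simp_all add: power_mult_distrib[symmetric])
    then have "4 ^ (k+1) / r\<^sup>2 * (V * (r / 2 ^ k) ^ 3) = 4 * V * r * (1/2) ^ k"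
      using r by (simp add: field_simps power2_eq_square power3_eq_cube power_mult[symmetric] power_divide)
    then show "ennreal (4 ^ (k+1) / r\<^sup>2) * emeasure lborel (cball (0::real^3) (r / 2 ^ k)) = ennreal (4 * V * r * (1/2) ^ k)"
      using r by (subst ballV) (auto simp: ennreal_mult'[symmetric] simp del: power_Suc)
  qed
  also have "\<dots> < \<infinity>"
  proof -
    have "summable (\<lambda>k. 4 * V * r * (1/2) ^ k)" by (intro summable_mult summable_geometric) auto
    then show ?thesis using V r by (subst suminf_ennreal2) auto
  qed
  finally have "(\<integral>\<^sup>+y. ennreal (indicator (cball 0 r) y / (norm (y::real^3))\<^sup>2) \<partial>lborel) < \<infinity>" .
  then show ?thesis
    by (intro integrableI_nonneg) (auto intro!: borel_measurable_divide borel_measurable_indicator borel_measurable_power borel_measurable_norm)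
qed

lemma integrable_inverse_norm:
  "integrable lborel (\<lambda>y::real^3. indicator (cball 0 r) y / norm y)"
proof (rule Bochner_Integration.integrable_bound)
  show "integrable lborel (\<lambda>y::real^3. \<bar>r\<bar> * (indicator (cball 0 r) y / (norm y)\<^sup>2))"
    by (intro integrable_mult_right integrable_inverse_norm_square)
  show "AE y::real^3 in lborel. norm (indicator (cball 0 r) y / norm y :: real) \<le> norm (\<bar>r\<bar> * (indicator (cball 0 r) y / (norm y)\<^sup>2))"
  proof (rule AE_I2)
    fix y :: "real^3"
    show "norm (indicator (cball 0 r) y / norm y :: real) \<le> norm (\<bar>r\<bar> * (indicator (cball 0 r) y / (norm y)\<^sup>2))"
      by (cases "y = 0") (auto simp: indicator_def field_simps power2_eq_square intro!: mult_right_mono order_trans[OF _ abs_ge_self])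
  qed
qed (auto intro!: borel_measurable_divide borel_measurable_indicator borel_measurable_norm)

lemma lborel_integral_translate:
  fixes Y :: "'a::euclidean_space \<Rightarrow> 'b::{banach, second_countable_topology}"
  assumes "Y \<in> borel_measurable borel"
  shows "(\<integral>y. Y (y + c) \<partial>lborel) = (\<integral>y. Y y \<partial>lborel)"
    and "integrable lborel Y \<Longrightarrow> integrable lborel (\<lambda>y. Y (y + c))"
proof -
  have *: "lborel = distr lborel borel ((+) c)" by (simp add: lborel_distr_plus)
  show "(\<integral>y. Y (y + c) \<partial>lborel) = (\<integral>y. Y y \<partial>lborel)"
    by (subst (2) *, subst integral_distr) (use assms in \<open>auto simp: add.commute\<close>)
  show "integrable lborel (\<lambda>y. Y (y + c))" if "integrable lborel Y"
    using that assms by (subst (asm) *, subst (asm) integrable_distr_eq) (auto simp: add.commute)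
qed

text \<open>Translation invariance makes the integral of every difference quotient vanish, so neither
  Fubini nor a divergence theorem is needed.\<close>

lemma integral_directional_derivative_zero:
  fixes Y Y' :: "'a::euclidean_space \<Rightarrow> complex"
  assumes der: "\<And>y. ((\<lambda>s. Y (y + s *\<^sub>R b)) has_vector_derivative Y' y) (at 0)"
    and meas: "Y \<in> borel_measurable borel" and int: "integrable lborel Y"
    and bound: "\<And>y. norm (Y' y) \<le> B"
    and supp: "\<And>y. norm y > R \<Longrightarrow> Y y = 0"
  shows "(\<integral>y. Y' y \<partial>lborel) = 0"
proof -
  define Q where "Q n y = real (Suc n) *\<^sub>R (Y (y + (1 / real (Suc n)) *\<^sub>R b) - Y y)" for n y
  have lim: "(\<lambda>n. Q n y) \<longlonglongrightarrow> Y' y" for y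
  proof -
    have "((\<lambda>h. inverse h *\<^sub>R (Y (y + h *\<^sub>R b) - Y y)) \<longlongrightarrow> Y' y) (at 0)"
    proof (rule LIM_zero_cancel, rule tendsto_norm_zero_cancel, rule Lim_transform_eventually)
      show "((\<lambda>h. norm (Y (y + h *\<^sub>R b) - Y y - h *\<^sub>R Y' y) / norm h) \<longlongrightarrow> 0) (at 0)"
        using der[of y] unfolding has_vector_derivative_def has_derivative_at by simp
      have "inverse h *\<^sub>R D - Y' y = inverse h *\<^sub>R (D - h *\<^sub>R Y' y)" if "h \<noteq> 0" for h D
        using that by (simp add: scaleR_diff_right)
      then have "norm (D - h *\<^sub>R Y' y) / norm h = norm (inverse h *\<^sub>R D - Y' y)" if "h \<noteq> 0" for h D
        using that by (simp add: norm_inverse divide_inverse mult.commute)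
      then show "\<forall>\<^sub>F h in at 0. norm (Y (y + h *\<^sub>R b) - Y y - h *\<^sub>R Y' y) / norm h
          = norm (inverse h *\<^sub>R (Y (y + h *\<^sub>R b) - Y y) - Y' y)"
        by (auto simp: eventually_at_filter)
    qed
    moreover have "filterlim (\<lambda>n. 1 / real (Suc n)) (at 0) sequentially"
      unfolding filterlim_at using lim_1_over_n LIMSEQ_Suc[OF lim_1_over_n] by auto
    ultimately have "(\<lambda>n. inverse (1 / real (Suc n)) *\<^sub>R (Y (y + (1 / real (Suc n)) *\<^sub>R b) - Y y)) \<longlonglongrightarrow> Y' y"
      by (rule filterlim_compose)
    then show ?thesis unfolding Q_def by simp
  qed
  have der': "((\<lambda>s. Y (y + s *\<^sub>R b)) has_vector_derivative Y' (y + s *\<^sub>R b)) (at s within S)" for y s S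
  proof -
    have "((\<lambda>\<sigma>. Y (y + s *\<^sub>R b + \<sigma> *\<^sub>R b)) \<circ> (\<lambda>\<sigma>. \<sigma> - s) has_vector_derivative 1 *\<^sub>R Y' (y + s *\<^sub>R b)) (at s)"
      by (rule vector_diff_chain_at) (use der in \<open>auto intro!: derivative_eq_intros\<close>)
    then show ?thesis by (simp add: o_def algebra_simps has_vector_derivative_at_within)
  qed
  \<comment> \<open>The bound on the directional derivative makes all difference quotients at most
    B, and steps of length at most |b| keep them supported in one fixed ball; together this is the
    dominating function.\<close>
  have lip: "norm (Y (y + h *\<^sub>R b) - Y y) \<le> B * h" if "h \<ge> 0" for y h
  proof -
    have "norm (Y (y + h *\<^sub>R b) - Y (y + 0 *\<^sub>R b)) \<le> B * norm (h - 0)"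
    proof (rule differentiable_bound[of "{0..h}" "\<lambda>s. Y (y + s *\<^sub>R b)" "\<lambda>s x. x *\<^sub>R Y' (y + s *\<^sub>R b)"])
      show "((\<lambda>s. Y (y + s *\<^sub>R b)) has_derivative (\<lambda>x. x *\<^sub>R Y' (y + s *\<^sub>R b))) (at s within {0..h})" for s
        using der' unfolding has_vector_derivative_def by blast
      show "onorm (\<lambda>x. x *\<^sub>R Y' (y + s *\<^sub>R b)) \<le> B" for s
        by (rule onorm_le) (use mult_left_mono[OF bound[of "y + s *\<^sub>R b"]] in \<open>auto simp: mult.commute[of B]\<close>)
    qed (use that in auto)
    then show ?thesis using that by simp
  qed
  have B: "B \<ge> 0" using bound[of 0] norm_ge_zero order_trans by blast
  have "(\<lambda>n. \<integral>y. Q n y \<partial>lborel) \<longlonglongrightarrow> (\<integral>y. Y' y \<partial>lborel)"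
  proof (rule integral_dominated_convergence[where w="\<lambda>y. B * indicator (cball 0 (R + norm b)) y"])
    show Qm: "Q n \<in> borel_measurable lborel" for n
      using meas unfolding Q_def[abs_def] by measurable
    show "Y' \<in> borel_measurable lborel"
      by (rule borel_measurable_LIMSEQ_metric[OF Qm]) (rule lim)
    show "integrable lborel (\<lambda>y. B * indicator (cball 0 (R + norm b)) y)"
      by (intro integrable_mult_right integrable_real_indicator) (auto intro: emeasure_lborel_cball_finite[simplified])
    show "AE y in lborel. (\<lambda>n. Q n y) \<longlonglongrightarrow> Y' y" using lim by simp
    show "AE y in lborel. norm (Q n y) \<le> B * indicator (cball 0 (R + norm b)) y" for n
    proof (rule AE_I2)
      fix y
      show "norm (Q n y) \<le> B * indicator (cball 0 (R + norm b)) y"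
      proof (cases "norm y \<le> R + norm b")
        case True
        have "norm (Q n y) = real (Suc n) * norm (Y (y + (1 / real (Suc n)) *\<^sub>R b) - Y y)" by (simp add: Q_def)
        also have "\<dots> \<le> real (Suc n) * (B * (1 / real (Suc n)))" by (intro mult_left_mono lip) auto
        finally show ?thesis using True by simp
      next
        case False
        have "norm ((1 / real (Suc n)) *\<^sub>R b) \<le> norm b" by (auto simp: field_simps mult_left_le_one_le)
        then have "norm (y + (1 / real (Suc n)) *\<^sub>R b) > R"
          using False norm_diff_ineq[of y "(1 / real (Suc n)) *\<^sub>R b"] by linarith
        moreover have "norm y > R" using False norm_ge_zero[of b] by linarith
        ultimately show ?thesis using False by (simp add: Q_def supp)
      qed
    qed
  qed
  moreover have "(\<integral>y. Q n y \<partial>lborel) = 0" for n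
    using lborel_integral_translate[OF meas, of "(1 / real (Suc n)) *\<^sub>R b"] int by (simp add: Q_def)
  ultimately show ?thesis by (simp add: LIMSEQ_const_iff)
qed

lemma has_vector_derivative_zeroI:
  fixes \<phi> :: "real \<Rightarrow> 'b::real_normed_vector"
  assumes "\<And>s. norm (\<phi> s) \<le> K * s\<^sup>2"
  shows "(\<phi> has_vector_derivative 0) (at 0)"
proof -
  have "\<phi> 0 = 0" using assms[of 0] by simp
  moreover have "((\<lambda>h. norm (\<phi> h) / norm h) \<longlongrightarrow> 0) (at 0)"
  proof (rule Lim_null_comparison)
    show "\<forall>\<^sub>F h in at 0. norm (norm (\<phi> h) / norm h) \<le> K * \<bar>h\<bar>"
      using assms by (auto simp: eventually_at_filter field_simps power2_eq_square)
    show "((\<lambda>h. K * \<bar>h\<bar>) \<longlongrightarrow> 0) (at 0)" by (auto intro!: tendsto_eq_intros)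
  qed
  ultimately show ?thesis by (simp add: has_vector_derivative_def has_derivative_at)
qed

text \<open>The cutoff \<open>\<eta>\<close> vanishes to fourth order at the origin, so its product
  with Z has a bounded directional derivative everywhere and integrates to zero. As n grows, the
  extra term with \<open>\<eta>'\<close> stays below a multiple of |y|^(-2), which is locally
  integrable in three dimensions, and tends to 0 pointwise.\<close>

lemma integral_by_parts_singular:
  fixes Z Z' :: "real^3 \<Rightarrow> complex"
  assumes der: "\<And>y. y \<noteq> 0 \<Longrightarrow> ((\<lambda>s. Z (y + s *\<^sub>R b)) has_vector_derivative Z' y) (at 0)"
    and meas: "Z \<in> borel_measurable borel" "Z' \<in> borel_measurable borel"
    and bound: "\<And>y. y \<noteq> 0 \<Longrightarrow> norm (Z y) \<le> C / norm y" "\<And>y. y \<noteq> 0 \<Longrightarrow> norm (Z' y) \<le> C / (norm y)\<^sup>2"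
    and supp: "\<And>y. norm y > R \<Longrightarrow> Z y = 0" "\<And>y. norm y > R \<Longrightarrow> Z' y = 0"
  shows "integrable lborel Z'" and "(\<integral>y. Z' y \<partial>lborel) = 0"
proof -
  have C: "C \<ge> 0"
  proof -
    have "0 \<le> C / norm (axis 1 1 :: real^3)" using bound(1)[of "axis 1 1"] norm_ge_zero order_trans
      by (metis axis_eq_0_iff zero_neq_one)
    then show ?thesis by simp
  qed
  have ae0: "AE y in lborel. (y::real^3) \<noteq> 0" by (rule AE_lborel_singleton)
  have dom: "integrable lborel (\<lambda>y::real^3. K * (indicator (cball 0 R) y / (norm y)\<^sup>2))" for K :: real
    by (intro integrable_mult_right integrable_inverse_norm_square)
  show "integrable lborel Z'"
  proof (rule Bochner_Integration.integrable_bound[OF dom[of C]])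
    show "AE y in lborel. norm (Z' y) \<le> norm (C * (indicator (cball 0 R) y / (norm y)\<^sup>2))"
      using ae0 by eventually_elim (use bound(2) supp(2) C in \<open>auto simp: indicator_def\<close>)
  qed (use meas in auto)
  define \<epsilon> where "\<epsilon> n = 1 / real (Suc n)" for n
  have \<epsilon>: "\<epsilon> n > 0" for n by (simp add: \<epsilon>_def)
  define \<eta> where "\<eta> n y = ((norm y)\<^sup>2 / ((norm y)\<^sup>2 + (\<epsilon> n)\<^sup>2))\<^sup>2" for n and y :: "real^3"
  define \<eta>' where "\<eta>' n y = 4 * (y \<bullet> b) * (norm y)\<^sup>2 * (\<epsilon> n)\<^sup>2 / ((norm y)\<^sup>2 + (\<epsilon> n)\<^sup>2) ^ 3" for n and y :: "real^3"
  define Y' where "Y' n y = (if y = 0 then 0 else \<eta> n y *\<^sub>R Z' y + \<eta>' n y *\<^sub>R Z y)" for n y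
  have sp: "(norm y)\<^sup>2 + (\<epsilon> n)\<^sup>2 > 0" for y :: "real^3" and n using \<epsilon>[of n] by (simp add: add_nonneg_pos)
  have \<eta>1: "0 \<le> \<eta> n y" "\<eta> n y \<le> 1" for n y
    using sp[of y n] by (auto simp: \<eta>_def power_le_one_iff divide_le_eq_1)
  \<comment> \<open>This bound and \<open>\<eta>3\<close> degenerate as n grows; they supply
    boundedness for each fixed n.\<close>
  have \<eta>2: "\<eta> n y \<le> (norm y) ^ 4 / (\<epsilon> n) ^ 4" for n y
  proof -
    have "(norm y)\<^sup>2 / ((norm y)\<^sup>2 + (\<epsilon> n)\<^sup>2) \<le> (norm y)\<^sup>2 / (\<epsilon> n)\<^sup>2"
      using \<epsilon>[of n] sp[of y n] by (intro divide_left_mono) auto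
    then have "\<eta> n y \<le> ((norm y)\<^sup>2 / (\<epsilon> n)\<^sup>2)\<^sup>2" unfolding \<eta>_def using sp[of y n] by (intro power_mono) auto
    then show ?thesis by (simp add: power_divide power_mult[symmetric])
  qed
  have yb: "\<bar>y \<bullet> b\<bar> \<le> norm y * norm b" for y by (rule Cauchy_Schwarz_ineq2)
  have \<eta>3: "\<bar>\<eta>' n y\<bar> \<le> 4 * norm b * (norm y) ^ 3 / (\<epsilon> n) ^ 4" for n y
  proof -
    have "\<bar>\<eta>' n y\<bar> = 4 * \<bar>y \<bullet> b\<bar> * (norm y)\<^sup>2 * (\<epsilon> n)\<^sup>2 / ((norm y)\<^sup>2 + (\<epsilon> n)\<^sup>2) ^ 3"
      using sp[of y n] by (simp add: \<eta>'_def abs_mult)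
    also have "\<dots> \<le> 4 * \<bar>y \<bullet> b\<bar> * (norm y)\<^sup>2 * (\<epsilon> n)\<^sup>2 / ((\<epsilon> n)\<^sup>2) ^ 3"
      using \<epsilon>[of n] sp[of y n] by (intro divide_left_mono power_mono) auto
    also have "\<dots> = 4 * \<bar>y \<bullet> b\<bar> * (norm y)\<^sup>2 / (\<epsilon> n) ^ 4"
      using \<epsilon>[of n] by (simp add: field_simps power_mult[symmetric] eval_nat_numeral)
    also have "\<dots> \<le> 4 * (norm y * norm b) * (norm y)\<^sup>2 / (\<epsilon> n) ^ 4"
      using \<epsilon>[of n] yb[of y] by (intro divide_right_mono mult_right_mono) auto
    finally show ?thesis by (simp add: power3_eq_cube power2_eq_square mult_ac)
  qed
  \<comment> \<open>Uniform in n, hence fit for dominated convergence: with s = |y|^2 the product s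
    * s * e is at most (s + e)^3.\<close>
  have \<eta>4: "\<bar>\<eta>' n y\<bar> \<le> 4 * norm b / norm y" if "y \<noteq> 0" for n y
  proof -
    let ?s = "(norm y)\<^sup>2" and ?e = "(\<epsilon> n)\<^sup>2"
    have s: "?s > 0" using that by simp
    have "\<bar>\<eta>' n y\<bar> = 4 * \<bar>y \<bullet> b\<bar> * (?s * ?e / (?s + ?e) ^ 3)"
      using sp[of y n] by (simp add: \<eta>'_def abs_mult)
    also have "\<dots> \<le> 4 * (norm y * norm b) * (1 / ?s)"
    proof (intro mult_mono)
      have "?s * (?s * ?e) \<le> (?s + ?e) * ((?s + ?e) * (?s + ?e))"
        using s by (intro mult_mono) auto
      then show "?s * ?e / (?s + ?e) ^ 3 \<le> 1 / ?s"
        using s sp[of y n] by (simp add: divide_simps power3_eq_cube mult_ac)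
    qed (use yb[of y] in auto)
    also have "\<dots> = 4 * norm b / norm y" using that by (simp add: power2_eq_square)
    finally show ?thesis .
  qed
  have Zm: "(\<lambda>y. \<eta> n y *\<^sub>R Z y) \<in> borel_measurable borel" "Y' n \<in> borel_measurable borel" for n
    using meas unfolding \<eta>_def Y'_def[abs_def] \<eta>'_def by measurable
  have zero: "(\<integral>y. Y' n y \<partial>lborel) = 0" for n
  proof (rule integral_directional_derivative_zero[where Y="\<lambda>y. \<eta> n y *\<^sub>R Z y" and b=b and R=R
        and B="\<bar>R\<bar>\<^sup>2 * C / (\<epsilon> n) ^ 4 + 4 * norm b * \<bar>R\<bar>\<^sup>2 * C / (\<epsilon> n) ^ 4"])
    show "(\<lambda>y. \<eta> n y *\<^sub>R Z y) \<in> borel_measurable borel" by (rule Zm)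
    show "\<eta> n y *\<^sub>R Z y = 0" if "norm y > R" for y using supp that by simp
    show "integrable lborel (\<lambda>y. \<eta> n y *\<^sub>R Z y)"
    proof (rule Bochner_Integration.integrable_bound)
      show "integrable lborel (\<lambda>y::real^3. C * (indicator (cball 0 R) y / norm y))"
        by (intro integrable_mult_right integrable_inverse_norm)
      show "AE y in lborel. norm (\<eta> n y *\<^sub>R Z y) \<le> norm (C * (indicator (cball 0 R) y / norm y))"
        using ae0
      proof eventually_elim
        case (elim y)
        have "\<eta> n y * norm (Z y) \<le> 1 * norm (Z y)" using \<eta>1 by (intro mult_right_mono) auto
        then show ?case using bound(1)[OF elim] supp(1)[of y] C \<eta>1[of n y] by (auto simp: indicator_def)
      qed
    qed (use Zm in auto)
    show "((\<lambda>s. \<eta> n (y + s *\<^sub>R b) *\<^sub>R Z (y + s *\<^sub>R b)) has_vector_derivative Y' n y) (at 0)" for y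
    proof (cases "y = 0")
      case True
      have "((\<lambda>s. \<eta> n (s *\<^sub>R b) *\<^sub>R Z (s *\<^sub>R b)) has_vector_derivative 0) (at 0)"
      proof (rule has_vector_derivative_zeroI[where K="\<bar>R\<bar> * C * (norm b)\<^sup>2 / (\<epsilon> n) ^ 4"])
        fix s
        show "norm (\<eta> n (s *\<^sub>R b) *\<^sub>R Z (s *\<^sub>R b)) \<le> \<bar>R\<bar> * C * (norm b)\<^sup>2 / (\<epsilon> n) ^ 4 * s\<^sup>2"
        proof (cases "s *\<^sub>R b = 0 \<or> norm (s *\<^sub>R b) > R")
          case True
          then show ?thesis using C by (auto simp: \<eta>_def supp)
        next
          case False
          let ?y = "s *\<^sub>R b"
          have y: "norm ?y > 0" "norm ?y \<le> R" using False by auto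
          have "norm (\<eta> n ?y *\<^sub>R Z ?y) \<le> (norm ?y) ^ 4 / (\<epsilon> n) ^ 4 * (C / norm ?y)"
            unfolding norm_scaleR[of "\<eta> n ?y"] abs_of_nonneg[OF \<eta>1(1)]
            by (rule mult_mono[OF \<eta>2 bound(1)]) (use False \<epsilon>[of n] in auto)
          also have "\<dots> = norm ?y * (C * (norm ?y)\<^sup>2) / (\<epsilon> n) ^ 4"
            using y by (simp add: field_simps eval_nat_numeral)
          also have "\<dots> \<le> R * (C * (norm ?y)\<^sup>2) / (\<epsilon> n) ^ 4"
            using y C \<epsilon>[of n] by (intro divide_right_mono mult_right_mono) auto
          finally show ?thesis using y by (simp add: power_mult_distrib mult_ac)
        qed
      qed
      then show ?thesis using True by (simp add: Y'_def)
    next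
      case False
      have ns: "((\<lambda>s. (norm (y + s *\<^sub>R b))\<^sup>2) has_real_derivative 2 * (y \<bullet> b)) (at 0)"
      proof -
        have "(norm (y + s *\<^sub>R b))\<^sup>2 = y \<bullet> y + 2 * s * (y \<bullet> b) + s\<^sup>2 * (b \<bullet> b)" for s
          unfolding power2_norm_eq_inner by (simp add: inner_add inner_commute power2_eq_square algebra_simps)
        then show ?thesis by (auto intro!: derivative_eq_intros)
      qed
      have "((\<lambda>s. \<eta> n (y + s *\<^sub>R b)) has_real_derivative \<eta>' n y) (at 0)"
      proof -
        have "((\<lambda>s. (N s / (N s + e))\<^sup>2) has_real_derivative 2 * d * N 0 * e / (N 0 + e) ^ 3) (at 0)"
          if "(N has_real_derivative d) (at 0)" "N 0 + e > 0" for N :: "real \<Rightarrow> real" and d e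
        proof -
          have "((\<lambda>s. (N s / (N s + e))\<^sup>2) has_real_derivative
              2 * (N 0 / (N 0 + e)) * ((d * (N 0 + e) - N 0 * d) / ((N 0 + e) * (N 0 + e)))) (at 0)"
            using that by (auto intro!: derivative_eq_intros simp: mult_ac)
          moreover have "2 * (N 0 / (N 0 + e)) * ((d * (N 0 + e) - N 0 * d) / ((N 0 + e) * (N 0 + e)))
              = 2 * d * N 0 * e / (N 0 + e) ^ 3"
            by (simp add: power3_eq_cube algebra_simps)
          ultimately show ?thesis by simp
        qed
        from this[OF ns, of "(\<epsilon> n)\<^sup>2"] show ?thesis
          unfolding \<eta>_def \<eta>'_def using sp[of y n] by simp
      qed
      from has_vector_derivative_scaleR[OF this der[OF False]]
      show ?thesis using False by (simp add: Y'_def)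
    qed
    show "norm (Y' n y) \<le> \<bar>R\<bar>\<^sup>2 * C / (\<epsilon> n) ^ 4 + 4 * norm b * \<bar>R\<bar>\<^sup>2 * C / (\<epsilon> n) ^ 4" for y
    proof (cases "y = 0 \<or> norm y > R")
      case True
      then show ?thesis using C by (auto simp: Y'_def supp)
    next
      case False
      then have y: "norm y > 0" "norm y \<le> R" "y \<noteq> 0" by auto
      have y2: "(norm y)\<^sup>2 \<le> \<bar>R\<bar>\<^sup>2" using y by (intro power_mono) auto
      have "norm (\<eta> n y *\<^sub>R Z' y) \<le> (norm y) ^ 4 / (\<epsilon> n) ^ 4 * (C / (norm y)\<^sup>2)"
        unfolding norm_scaleR[of "\<eta> n y"] abs_of_nonneg[OF \<eta>1(1)]
        by (rule mult_mono[OF \<eta>2 bound(2)]) (use y \<epsilon>[of n] in auto)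
      also have "\<dots> = (norm y)\<^sup>2 * C / (\<epsilon> n) ^ 4" using y by (simp add: field_simps eval_nat_numeral)
      also have "\<dots> \<le> \<bar>R\<bar>\<^sup>2 * C / (\<epsilon> n) ^ 4"
        using y2 C \<epsilon>[of n] by (intro divide_right_mono mult_right_mono) auto
      finally have 1: "norm (\<eta> n y *\<^sub>R Z' y) \<le> \<bar>R\<bar>\<^sup>2 * C / (\<epsilon> n) ^ 4" .
      have "norm (\<eta>' n y *\<^sub>R Z y) \<le> 4 * norm b * (norm y) ^ 3 / (\<epsilon> n) ^ 4 * (C / norm y)"
        unfolding norm_scaleR
        by (rule mult_mono[OF \<eta>3 bound(1)]) (use y \<epsilon>[of n] in auto)
      also have "\<dots> = 4 * norm b * (norm y)\<^sup>2 * C / (\<epsilon> n) ^ 4" using y by (simp add: field_simps eval_nat_numeral)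
      also have "\<dots> \<le> 4 * norm b * \<bar>R\<bar>\<^sup>2 * C / (\<epsilon> n) ^ 4"
        using y2 C \<epsilon>[of n] by (intro divide_right_mono mult_right_mono mult_left_mono) auto
      finally have 2: "norm (\<eta>' n y *\<^sub>R Z y) \<le> 4 * norm b * \<bar>R\<bar>\<^sup>2 * C / (\<epsilon> n) ^ 4" .
      show ?thesis using norm_triangle_mono[OF 1 2] y by (simp add: Y'_def)
    qed
  qed
  have "(\<lambda>n. \<integral>y. Y' n y \<partial>lborel) \<longlonglongrightarrow> (\<integral>y. Z' y \<partial>lborel)"
  proof (rule integral_dominated_convergence)
    show "integrable lborel (\<lambda>y::real^3. (C + 4 * norm b * C) * (indicator (cball 0 R) y / (norm y)\<^sup>2))"
      by (rule dom)
    have \<epsilon>0: "(\<lambda>n. (\<epsilon> n)\<^sup>2) \<longlonglongrightarrow> 0"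
      unfolding \<epsilon>_def by real_asymp
    show "AE y in lborel. (\<lambda>n. Y' n y) \<longlonglongrightarrow> Z' y"
      using ae0
    proof eventually_elim
      case (elim y)
      have "(\<lambda>n. \<eta> n y) \<longlonglongrightarrow> ((norm y)\<^sup>2 / ((norm y)\<^sup>2 + 0))\<^sup>2"
        unfolding \<eta>_def by (intro tendsto_intros \<epsilon>0) (use elim in auto)
      moreover have "(\<lambda>n. \<eta>' n y) \<longlonglongrightarrow> 4 * (y \<bullet> b) * (norm y)\<^sup>2 * 0 / ((norm y)\<^sup>2 + 0) ^ 3"
        unfolding \<eta>'_def by (intro tendsto_intros \<epsilon>0) (use elim in auto)
      ultimately have "(\<lambda>n. \<eta> n y *\<^sub>R Z' y + \<eta>' n y *\<^sub>R Z y) \<longlonglongrightarrow> 1 *\<^sub>R Z' y + 0 *\<^sub>R Z y"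
        using elim by (intro tendsto_intros) auto
      then show ?case using elim by (simp add: Y'_def)
    qed
    show "AE y in lborel. norm (Y' n y) \<le> (C + 4 * norm b * C) * (indicator (cball 0 R) y / (norm y)\<^sup>2)" for n
      using ae0
    proof eventually_elim
      case (elim y)
      show ?case
      proof (cases "norm y > R")
        case False
        have 1: "norm (\<eta> n y *\<^sub>R Z' y) \<le> 1 * (C / (norm y)\<^sup>2)"
          unfolding norm_scaleR using \<eta>1[of n y] bound(2)[OF elim] by (intro mult_mono) auto
        have "norm (\<eta>' n y *\<^sub>R Z y) \<le> (4 * norm b / norm y) * (C / norm y)"
          unfolding norm_scaleR using \<eta>4[OF elim, of n] bound(1)[OF elim] by (intro mult_mono) auto
        also have "\<dots> = 4 * norm b * C / (norm y)\<^sup>2" by (simp add: power2_eq_square)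
        finally show ?thesis using norm_triangle_mono[OF 1] elim False by (simp add: Y'_def add_divide_distrib)
      qed (simp add: Y'_def supp elim)
    qed
  qed (use meas Zm in auto)
  then show "(\<integral>y. Z' y \<partial>lborel) = 0" by (simp add: zero LIMSEQ_const_iff)
qed

section \<open>The retarded potential\<close>

definition coord :: "3 \<Rightarrow> spacetime \<Rightarrow> complex" where
  "coord i p = complex_of_real (p $ Some i)"

definition rot :: "3 \<Rightarrow> 3 \<Rightarrow> (spacetime \<Rightarrow> complex) \<Rightarrow> spacetime \<Rightarrow> complex" where
  "rot i j u p = coord i p * pd (Some j) u p - coord j p * pd (Some i) u p"

definition flat_box :: "(spacetime \<Rightarrow> complex) \<Rightarrow> spacetime \<Rightarrow> complex" where
  "flat_box u p = pd None (pd None u) p - (\<Sum>i\<in>UNIV. pd (Some i) (pd (Some i) u) p)"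

text \<open>Support in the flat causal future of the ball of radius R at time -1, the time at which
  the sources are switched on.\<close>

definition forward_supported :: "real \<Rightarrow> (spacetime \<Rightarrow> complex) \<Rightarrow> bool" where
  "forward_supported R u \<longleftrightarrow>
     (\<forall>p. p $ None < -1 \<or> norm (space_part p) > R + p $ None + 1 \<longrightarrow> u p = 0)"

text \<open>The future null vector over y, so that \<open>p - retard y\<close> runs through the past
  light cone of p.\<close>

definition retard :: "real^3 \<Rightarrow> spacetime" where
  "retard y = event (norm y) y"

text \<open>Equals the area \<open>4 \<pi>\<close> of the unit sphere; only positivity matters.\<close>

definition green_const :: real where
  "green_const = (\<integral>y. 4 * max 0 (1 - (norm y)\<^sup>2) / norm (y::real^3) \<partial>lborel)"

text \<open>Kirchhoff's solution of the flat wave equation in three space dimensions without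
  incoming data: the source is sampled on the past light cone with weight 1/|y|.\<close>

definition potential :: "(spacetime \<Rightarrow> complex) \<Rightarrow> spacetime \<Rightarrow> complex" where
  "potential F p = (\<integral>y. (1 / norm y) *\<^sub>R F (p - retard y) \<partial>lborel) / green_const"

text \<open>For a forward supported source nothing on the past cone of an event at time t lies
  beyond |y| = t + 1. Truncating there makes the kernel integrable without changing the
  potential.\<close>

definition ball_weight :: "real \<Rightarrow> real^3 \<Rightarrow> real" where
  "ball_weight R y = indicator (cball 0 R) y / norm y"

section \<open>Spacetime coordinates and propagation of supports\<close>

lemma event_None [simp]: "event t x $ None = t" by (simp add: event_def)
lemma event_Some [simp]: "event t x $ Some i = x $ i" by (simp add: event_def)
lemma space_part_nth [simp]: "space_part p $ i = p $ Some i" by (simp add: space_part_def)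
lemma space_part_event [simp]: "space_part (event t x) = x" by (simp add: vec_eq_iff)
lemma event_space_part [simp]: "event (p $ None) (space_part p) = p"
  by (simp add: vec_eq_iff event_def split: option.split)
lemma space_part_diff: "space_part (p - q) = space_part p - space_part q" by (simp add: vec_eq_iff)
lemma bounded_linear_space_part: "bounded_linear space_part"
proof -
  have "linear space_part"
    by (rule linearI) (auto simp: vec_eq_iff)
  then show ?thesis by (simp add: linear_conv_bounded_linear)
qed

lemma continuous_event: "continuous_on S (\<lambda>y. event (g y) (h y))"
  if "continuous_on S g" "continuous_on S h"
  unfolding event_def
  by (rule continuous_on_vec_lambda, case_tac i) (use that in \<open>auto intro!: continuous_intros\<close>)

lemma continuous_retard: "continuous_on S retard"
  unfolding retard_def by (intro continuous_event continuous_intros)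

lemma norm_event: "norm (event t x) \<le> \<bar>t\<bar> + norm x"
proof -
  have "(norm (event t x))\<^sup>2 = t\<^sup>2 + (norm x)\<^sup>2"
    by (simp only: power2_norm_eq_inner inner_vec_def sum_option) (simp add: power2_eq_square)
  also have "\<dots> \<le> (\<bar>t\<bar> + norm x)\<^sup>2" by (simp add: power2_sum)
  finally show ?thesis by (rule power2_le_imp_le) simp
qed

lemma norm_retard: "norm (retard y) \<le> 2 * norm y"
  using norm_event[of "norm y" y] by (simp add: retard_def)

lemma smooth_coord: "smooth (coord i)"
  unfolding coord_def[abs_def] by (rule smooth_of_real[OF smooth_nth])

lemma pd_coord: "pd \<mu> (coord i) = (\<lambda>p. if \<mu> = Some i then 1 else 0)"
  unfolding coord_def[abs_def] pd_nth by auto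

lemma smooth_rot: "smooth u \<Longrightarrow> smooth (rot i j u)"
  unfolding rot_def[abs_def] by (intro smooth_intros smooth_coord smooth_pd)

lemma smooth_flat_box: "smooth u \<Longrightarrow> smooth (flat_box u)"
  unfolding flat_box_def[abs_def] by (intro smooth_intros smooth_pd)

lemma pd_cong_open:
  assumes "open S" "p \<in> S" "\<And>q. q \<in> S \<Longrightarrow> u q = v q"
  shows "pd \<mu> u p = pd \<mu> v p"
  unfolding pd_def using frechet_derivative_cong_open[OF assms] by simp

lemma forward_supportedD:
  assumes "forward_supported R u" "p $ None < -1 \<or> norm (space_part p) > R + p $ None + 1"
  shows "u p = 0"
  using assms unfolding forward_supported_def by blast

lemma forward_supported_pd:
  assumes "forward_supported R u"
  shows "forward_supported R (pd \<mu> u)"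
  unfolding forward_supported_def
proof (intro allI impI)
  fix p :: spacetime
  assume p: "p $ None < -1 \<or> norm (space_part p) > R + p $ None + 1"
  let ?S = "{p::spacetime. p $ None < -1} \<union> {p. norm (space_part p) > R + p $ None + 1}"
  have "open ?S"
    by (intro open_Un open_Collect_less continuous_intros linear_continuous_on bounded_linear_space_part)
  from pd_cong_open[OF this, of p u "\<lambda>_. 0" \<mu>] p assms
  show "pd \<mu> u p = 0" by (auto simp: pd_const forward_supported_def)
qed

lemma forward_supported_rot: "forward_supported R u \<Longrightarrow> forward_supported R (rot i j u)"
  using forward_supported_pd[of R u] unfolding forward_supported_def rot_def by simp

lemma forward_supported_mult: "forward_supported R u \<Longrightarrow> forward_supported R (\<lambda>p. w p * u p)"
  unfolding forward_supported_def by simp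

lemma translation_average_retard: "translation_average lborel (ball_weight R) retard (2 * R)"
proof
  show "integrable lborel (ball_weight R)"
    unfolding ball_weight_def[abs_def] by (rule integrable_inverse_norm)
  show "retard \<in> borel_measurable lborel"
    using borel_measurable_continuous_onI[OF continuous_retard] by simp
  show "norm (retard y) \<le> 2 * R" if "ball_weight R y \<noteq> 0" for y
    using that norm_retard[of y] by (auto simp: ball_weight_def indicator_def split: if_splits)
qed

lemma potential_eq_avg:
  assumes "forward_supported R0 F" "p $ None + 1 \<le> R"
  shows "potential F p = translation_average.avg lborel (ball_weight R) retard F p / green_const"
proof -
  have "(\<lambda>y. (1 / norm y) *\<^sub>R F (p - retard y)) = (\<lambda>y. ball_weight R y *\<^sub>R F (p - retard y))"
  proof
    fix y
    show "(1 / norm y) *\<^sub>R F (p - retard y) = ball_weight R y *\<^sub>R F (p - retard y)"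
    proof (cases "norm y \<le> R")
      case False
      then have "F (p - retard y) = 0"
        using assms(2) by (intro forward_supportedD[OF assms(1)]) (simp add: retard_def)
      then show ?thesis by simp
    qed (simp add: ball_weight_def)
  qed
  then show ?thesis
    by (simp add: potential_def translation_average.avg_def[OF translation_average_retard])
qed

lemma integrable_potential:
  assumes "forward_supported R0 F" "smooth F"
  shows "integrable lborel (\<lambda>y. (1 / norm y) *\<^sub>R F (p - retard y))"
proof -
  have "(\<lambda>y. (1 / norm y) *\<^sub>R F (p - retard y)) = (\<lambda>y. ball_weight (p $ None + 1) y *\<^sub>R F (p - retard y))"
  proof
    fix y
    show "(1 / norm y) *\<^sub>R F (p - retard y) = ball_weight (p $ None + 1) y *\<^sub>R F (p - retard y)"
    proof (cases "norm y \<le> p $ None + 1")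
      case False
      then have "F (p - retard y) = 0"
        by (intro forward_supportedD[OF assms(1)]) (simp add: retard_def)
      then show ?thesis by simp
    qed (simp add: ball_weight_def)
  qed
  then show ?thesis
    using translation_average.integrable_avg[OF translation_average_retard smooth_continuous_on[OF assms(2)]]
    by simp
qed

lemma open_past: "open {q::spacetime. q $ None < T}"
  by (intro open_Collect_less continuous_intros)

text \<open>Near an event at time t one truncation serves all points: times below t + 1 need only
  radius t + 2. There the potential is a translation average, whose smoothness and derivatives are
  known.\<close>

lemma smooth_potential:
  assumes "forward_supported R0 F" "smooth F"
  shows "smooth (potential F)" and "pd \<mu> (potential F) = potential (pd \<mu> F)"
proof -
  define a where "a R = translation_average.avg lborel (ball_weight R) retard F" for R
  have sm: "smooth (\<lambda>q. a R q / green_const)" for R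
    using translation_average.smooth_avg[OF translation_average_retard assms(2)]
    unfolding divide_inverse a_def of_real_inverse[symmetric] by (intro smooth_intros)
  have "smooth_on UNIV (potential F)"
  proof (rule smooth_on_local)
    fix p :: spacetime
    let ?U = "{q::spacetime. q $ None < p $ None + 1}"
    have "smooth_on ?U (potential F)"
    proof (rule smooth_on_cong[OF open_past])
      show "smooth_on ?U (\<lambda>q. a (p $ None + 2) q / green_const)"
        using smooth_on_subset[of UNIV _ ?U] sm unfolding smooth_on_UNIV by blast
    qed (auto simp: a_def intro!: potential_eq_avg[OF assms(1), symmetric])
    then show "\<exists>U. open U \<and> p \<in> U \<and> smooth_on U (potential F)"
      by (intro exI[of _ ?U]) (auto simp: open_past)
  qed
  then show "smooth (potential F)" by (simp add: smooth_on_UNIV)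
  show "pd \<mu> (potential F) = potential (pd \<mu> F)"
  proof
    fix p :: spacetime
    have "pd \<mu> (potential F) p = pd \<mu> (\<lambda>q. a (p $ None + 2) q / green_const) p"
      by (rule pd_cong_open[OF open_past, of _ "p $ None + 1"])
        (auto simp: a_def intro!: potential_eq_avg[OF assms(1)])
    also have "\<dots> = pd \<mu> (a (p $ None + 2)) p / green_const"
      using pd_cmult[of "a (p $ None + 2)" \<mu> "1 / green_const"]
        translation_average.smooth_avg[OF translation_average_retard assms(2)] by (simp add: a_def)
    also have "\<dots> = potential (pd \<mu> F) p"
      unfolding a_def translation_average.pd_avg[OF translation_average_retard assms(2)]
      by (rule potential_eq_avg[OF forward_supported_pd[OF assms(1)], symmetric]) simp
    finally show "pd \<mu> (potential F) p = potential (pd \<mu> F) p" .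
  qed
qed

text \<open>Passing from p to \<open>p - retard y\<close> lowers the time by |y| and the distance
  from the origin by at most |y|, so the forbidden region is mapped into itself.\<close>

lemma forward_supported_potential:
  assumes "forward_supported R F"
  shows "forward_supported R (potential F)"
  unfolding forward_supported_def
proof (intro allI impI)
  fix p :: spacetime assume p: "p $ None < -1 \<or> norm (space_part p) > R + p $ None + 1"
  have "F (p - retard y) = 0" for y
  proof (rule forward_supportedD[OF assms])
    have "norm (space_part p) \<le> norm (space_part (p - retard y)) + norm y"
      using norm_triangle_ineq2[of "space_part p" y] by (simp add: space_part_diff retard_def)
    then show "(p - retard y) $ None < -1 \<or> norm (space_part (p - retard y)) > R + (p - retard y) $ None + 1"
      using p by (simp add: retard_def) (smt (verit) norm_ge_zero)
  qed
  then show "potential F p = 0" by (simp add: potential_def)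
qed

lemma potential_add:
  assumes "forward_supported R F" "smooth F" "forward_supported R' G" "smooth G"
  shows "potential (\<lambda>q. F q + G q) p = potential F p + potential G p"
  using integrable_potential[OF assms(1,2), of p] integrable_potential[OF assms(3,4), of p]
  by (simp add: potential_def scaleR_right_distrib add_divide_distrib)

lemma potential_cmult: "potential (\<lambda>q. c * F q) p = c * potential F p"
  by (simp add: potential_def mult_scaleR_right[symmetric] del: mult_scaleR_right)

section \<open>Derivatives of functions sampled on the past light cone\<close>

lemma smooth_lipschitz:
  fixes F :: "real^'n \<Rightarrow> complex"
  assumes "smooth F"
  shows "\<exists>L\<ge>0. \<forall>x y. norm x \<le> r \<longrightarrow> norm y \<le> r \<longrightarrow> norm (F x - F y) \<le> L * norm (x - y)"
proof -
  have "\<exists>B\<ge>0. \<forall>q. norm q \<le> r \<longrightarrow> norm (pd \<mu> F q) \<le> B" for \<mu>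
    by (rule bounded_on_cball[OF smooth_continuous_on[OF smooth_pd[OF assms]]])
  then obtain B where B: "\<And>\<mu>. B \<mu> \<ge> 0" "\<And>\<mu> q. norm q \<le> r \<Longrightarrow> norm (pd \<mu> F q) \<le> B \<mu>" by metis
  define L where "L = (\<Sum>\<mu>\<in>UNIV. B \<mu>)"
  have "norm (F x - F y) \<le> L * norm (x - y)" if "norm x \<le> r" "norm y \<le> r" for x y
  proof (rule differentiable_bound[of "cball 0 r"])
    show "(F has_derivative (\<lambda>h. \<Sum>\<mu>\<in>UNIV. (h $ \<mu>) *\<^sub>R pd \<mu> F q)) (at q within cball 0 r)" for q
      by (rule has_derivative_at_withinI[OF smooth_has_derivative[OF assms]])
    fix q :: "real^'n" assume q: "q \<in> cball 0 r"
    show "onorm (\<lambda>h. \<Sum>\<mu>\<in>UNIV. (h $ \<mu>) *\<^sub>R pd \<mu> F q) \<le> L"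
    proof (rule onorm_le)
      fix h :: "real^'n"
      have "norm (\<Sum>\<mu>\<in>UNIV. (h $ \<mu>) *\<^sub>R pd \<mu> F q) \<le> (\<Sum>\<mu>\<in>UNIV. norm h * B \<mu>)"
      proof (rule sum_norm_le)
        fix \<mu>
        show "norm ((h $ \<mu>) *\<^sub>R pd \<mu> F q) \<le> norm h * B \<mu>"
          unfolding norm_scaleR real_norm_def[symmetric]
          by (rule mult_mono) (use B(2)[of q \<mu>] q component_le_norm_cart[of h \<mu>] in auto)
      qed
      then show "norm (\<Sum>\<mu>\<in>UNIV. (h $ \<mu>) *\<^sub>R pd \<mu> F q) \<le> L * norm h"
        by (simp add: L_def sum_distrib_left mult.commute)
    qed
  qed (use that in auto)
  then show ?thesis by (intro exI[of _ L]) (auto simp: L_def B sum_nonneg)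
qed

context
  fixes p :: spacetime and y :: "real^3"
  assumes y: "y \<noteq> 0"
begin

lemma has_real_derivative_norm_axis:
  "((\<lambda>s. norm (y + s *\<^sub>R axis i 1)) has_real_derivative y $ i / norm y) (at 0)"
proof -
  have n: "(norm has_derivative (\<lambda>h. h \<bullet> sgn y)) (at (y + 0 *\<^sub>R axis i 1))"
    using has_derivative_norm[OF y] by simp
  have "((\<lambda>s. y + s *\<^sub>R axis i 1) has_vector_derivative axis i 1) (at 0)"
    by (auto intro!: derivative_eq_intros)
  from vector_derivative_diff_chain_within[OF this has_derivative_at_withinI[OF n]]
  have "(norm \<circ> (\<lambda>s. y + s *\<^sub>R axis i 1) has_vector_derivative axis i 1 \<bullet> sgn y) (at 0)" .
  then show ?thesis
    by (simp add: o_def has_real_derivative_iff_has_vector_derivative sgn_div_norm inner_axis' divide_inverse mult.commute)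
qed

lemma has_vector_derivative_retarded:
  assumes "smooth u"
  shows "((\<lambda>s. u (p - retard (y + s *\<^sub>R axis i 1))) has_vector_derivative
    - (of_real (y $ i) * of_real (1 / norm y) * pd None u (p - retard y) + pd (Some i) u (p - retard y))) (at 0)"
proof -
  define v :: spacetime where "v = - (axis None (y $ i / norm y) + axis (Some i) 1)"
  have "((\<lambda>s. p - retard (y + s *\<^sub>R axis i 1)) has_vector_derivative v) (at 0)"
  proof -
    have "((\<lambda>s. (p - retard (y + s *\<^sub>R axis i 1)) $ \<mu>) has_real_derivative v $ \<mu>) (at 0)" for \<mu>
    proof (cases \<mu>)
      case None
      then show ?thesis
        using DERIV_diff[OF DERIV_const has_real_derivative_norm_axis[of i], of "p $ None"]
        by (simp add: retard_def v_def axis_def)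
    next
      case (Some j)
      have "((\<lambda>s. p $ Some j - (y $ j + s * axis i 1 $ j)) has_real_derivative - axis i 1 $ j) (at 0)"
        by (auto intro!: derivative_eq_intros)
      then show ?thesis using Some by (auto simp: retard_def v_def axis_def)
    qed
    then show ?thesis
      unfolding has_vector_derivative_def has_derivative_componentwise_within[where f="\<lambda>s. p - retard (y + s *\<^sub>R axis i 1)"]
      by (auto simp: Basis_vec_def inner_axis has_field_derivative_def mult_commute_abs)
  qed
  have vN: "v $ None = - (y $ i / norm y)" by (simp add: v_def axis_def)
  have vS: "v $ Some j = (if j = i then -1 else 0)" for j by (simp add: v_def axis_def)
  have "(\<Sum>\<mu>\<in>UNIV. (v $ \<mu>) *\<^sub>R w \<mu>) = - (of_real (y $ i) * of_real (1 / norm y) * w None + w (Some i))" for w :: "_ \<Rightarrow> complex"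
    unfolding sum_option vN vS if_distrib[of "\<lambda>c. c *\<^sub>R _"]
    by (simp add: scaleR_conv_of_real cong: if_cong)
  with has_derivative_chain_vec[OF assms \<open>(_ has_vector_derivative v) _\<close>] show ?thesis by simp
qed

lemma has_vector_derivative_inverse_norm:
  "((\<lambda>s. complex_of_real (1 / norm (y + s *\<^sub>R axis i 1))) has_vector_derivative
     - (of_real (y $ i) * of_real (1 / norm y) ^ 3)) (at 0)"
proof -
  have "((\<lambda>s. 1 / norm (y + s *\<^sub>R axis i 1)) has_real_derivative - (y $ i * (1 / norm y) ^ 3)) (at 0)"
    using y by (auto intro!: derivative_eq_intros has_real_derivative_norm_axis
        simp: power3_eq_cube field_simps)
  then show ?thesis
    by (rule has_vector_derivative_eq_rhs[OF has_vector_derivative_of_real]) simp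
qed

lemma has_vector_derivative_component:
  "((\<lambda>s. complex_of_real ((y + s *\<^sub>R axis i 1) $ j)) has_vector_derivative (if i = j then 1 else 0)) (at 0)"
proof -
  have "((\<lambda>s. (y + s *\<^sub>R axis i 1) $ j) has_real_derivative (if i = j then 1 else 0)) (at 0)"
    by (auto intro!: derivative_eq_intros simp: axis_def)
  then show ?thesis
    by (rule has_vector_derivative_eq_rhs[OF has_vector_derivative_of_real]) simp
qed

end

text \<open>This and \<open>inv_norm\<close> are 0 at the origin, by division by zero; the
  differentiation rules exclude that point, and it has measure zero.\<close>

definition unit_comp :: "3 \<Rightarrow> real^3 \<Rightarrow> complex" where
  "unit_comp i y = of_real (y $ i) * of_real (1 / norm y)"

definition inv_norm :: "real^3 \<Rightarrow> complex" where
  "inv_norm y = of_real (1 / norm y)"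

text \<open>Equal to 1 at the origin and of class C^1 with bounded support, which suffices because
  it is differentiated once. Its gradient -4 max 0 (1 - |y|^2) y produces the integrand of
  \<open>green_const\<close>.\<close>

definition bump :: "real^3 \<Rightarrow> real" where
  "bump y = (max 0 (1 - (norm y)\<^sup>2))\<^sup>2"

lemma norm_mult_bound: "norm a \<le> \<alpha> \<Longrightarrow> norm b \<le> \<beta> \<Longrightarrow> norm (a * b :: complex) \<le> \<alpha> * \<beta>"
  unfolding norm_mult by (rule mult_mono) (auto intro: order_trans[OF norm_ge_zero])

lemma norm_diff_bound: "norm a \<le> \<alpha> \<Longrightarrow> norm b \<le> \<beta> \<Longrightarrow> norm (a - b :: complex) \<le> \<alpha> + \<beta>"
  using norm_triangle_ineq4[of a b] by linarith

lemma norm_minus_bound: "norm a \<le> \<alpha> \<Longrightarrow> norm (- a :: complex) \<le> \<alpha>"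
  by simp

lemmas norm_bounds = norm_triangle_mono norm_diff_bound norm_minus_bound norm_mult_bound

lemma norm_unit_comp: "norm (unit_comp i y) \<le> 1"
  using component_le_norm_cart[of y i]
  by (cases "y = 0") (auto simp: unit_comp_def norm_mult norm_divide divide_simps)

lemma norm_inv_norm: "norm (inv_norm y) = 1 / norm y"
  by (simp add: inv_norm_def norm_divide)

lemma sum_unit_comp_square: "y \<noteq> 0 \<Longrightarrow> (\<Sum>i\<in>UNIV. unit_comp i y * unit_comp i y) = 1"
proof -
  assume y: "y \<noteq> 0"
  have "(\<Sum>i\<in>UNIV. unit_comp i y * unit_comp i y) = of_real ((\<Sum>i\<in>UNIV. y $ i * y $ i) / (norm y * norm y))"
    by (simp add: unit_comp_def sum_divide_distrib)
  also have "(\<Sum>i\<in>UNIV. y $ i * y $ i) = norm y * norm y"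
    using power2_norm_eq_inner[of y] by (simp add: inner_vec_def power2_eq_square)
  finally show ?thesis using y by simp
qed

lemma borel_measurable_unit_comp [measurable]: "unit_comp i \<in> borel_measurable borel"
proof -
  have "(\<lambda>y::real^3. y $ i) \<in> borel_measurable borel"
    by (intro borel_measurable_continuous_onI continuous_intros)
  then show ?thesis unfolding unit_comp_def[abs_def] by measurable
qed

lemma borel_measurable_inv_norm [measurable]: "inv_norm \<in> borel_measurable borel"
  unfolding inv_norm_def[abs_def] by measurable

lemma borel_measurable_retarded:
  "smooth u \<Longrightarrow> (\<lambda>y. u (p - retard y)) \<in> borel_measurable borel"
  by (intro borel_measurable_continuous_onI continuous_on_compose2[OF smooth_continuous_on[of u UNIV]]
      continuous_intros continuous_retard) auto

lemma borel_measurable_bump [measurable]: "bump \<in> borel_measurable borel"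
  unfolding bump_def[abs_def] by measurable

lemma bump_le: "\<bar>1 - bump y\<bar> \<le> 2 * norm y"
proof (cases "norm y \<le> 1")
  case True
  define s where "s = (norm y)\<^sup>2"
  have s: "0 \<le> s" "s \<le> norm y" "s \<le> 1"
    using True mult_left_le[of "norm y" "norm y"] by (auto simp: s_def power2_eq_square power_le_one mult_le_one)
  then have "max 0 (1 - s) = 1 - s" by simp
  then have "1 - bump y = 2 * s - s\<^sup>2" unfolding bump_def s_def[symmetric] by (simp add: power2_diff)
  moreover have "s\<^sup>2 \<le> s" using s mult_left_le[of s s] by (simp add: power2_eq_square)
  ultimately have "1 - bump y \<ge> 0" "1 - bump y \<le> 2 * norm y"
    using s zero_le_power2[of s] by linarith+
  then show ?thesis by simp
next
  case False
  then have "(norm y)\<^sup>2 > 1" by (intro one_less_power) auto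
  then have "bump y = 0" by (simp add: bump_def max_def)
  then show ?thesis using False by simp
qed

context
  fixes y :: "real^3"
  assumes y: "y \<noteq> 0"
begin

lemma has_vector_derivative_inv_norm:
  "((\<lambda>s. inv_norm (y + s *\<^sub>R axis i 1)) has_vector_derivative - (unit_comp i y * inv_norm y * inv_norm y)) (at 0)"
  using has_vector_derivative_inverse_norm[OF y, of i]
  by (simp add: inv_norm_def unit_comp_def power3_eq_cube mult.assoc)

lemma has_vector_derivative_unit_comp:
  "((\<lambda>s. unit_comp j (y + s *\<^sub>R axis i 1)) has_vector_derivative
     (if i = j then inv_norm y else 0) - unit_comp j y * unit_comp i y * inv_norm y) (at 0)"
  unfolding unit_comp_def
  by (rule has_vector_derivative_eq_rhs[OF has_vector_derivative_mult[OF
        has_vector_derivative_component[OF y] has_vector_derivative_inverse_norm[OF y]]])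
    (simp add: inv_norm_def power3_eq_cube)

lemma has_vector_derivative_retarded':
  "smooth u \<Longrightarrow> ((\<lambda>s. u (p - retard (y + s *\<^sub>R axis i 1))) has_vector_derivative
    - (unit_comp i y * pd None u (p - retard y) + pd (Some i) u (p - retard y))) (at 0)"
  using has_vector_derivative_retarded[OF y] by (simp add: unit_comp_def)

lemma has_vector_derivative_bump:
  "((\<lambda>s. complex_of_real (bump (y + s *\<^sub>R axis i 1))) has_vector_derivative
     - (4 * of_real (max 0 (1 - (norm y)\<^sup>2)) * of_real (y $ i))) (at 0)"
proof -
  have m: "((\<lambda>v. (max 0 v)\<^sup>2) has_real_derivative 2 * max 0 v) (at v)" for v :: real
  proof -
    consider "v < 0" | "v = 0" | "v > 0" by linarith
    then show ?thesis
    proof cases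
      case 1
      have "((\<lambda>v. 0) has_real_derivative 2 * max 0 v) (at v)" using 1 by simp
      then show ?thesis
        by (rule has_field_derivative_transform_within_open[where S="{..<0}"]) (use 1 in auto)
    next
      case 3
      have "((\<lambda>v. v\<^sup>2) has_real_derivative 2 * max 0 v) (at v)"
        using 3 by (auto intro!: derivative_eq_intros)
      then show ?thesis
        by (rule has_field_derivative_transform_within_open[where S="{0<..}"]) (use 3 in auto)
    next
      case 2
      have "((\<lambda>v::real. (max 0 v)\<^sup>2) has_vector_derivative 0) (at 0)"
        by (rule has_vector_derivative_zeroI[of _ 1]) (auto simp: max_def)
      then show ?thesis using 2 by (simp add: has_real_derivative_iff_has_vector_derivative)
    qed
  qed
  have ns: "((\<lambda>s. 1 - (norm (y + s *\<^sub>R axis i 1))\<^sup>2) has_real_derivative - 2 * y $ i) (at 0)"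
    using y by (auto intro!: derivative_eq_intros has_real_derivative_norm_axis[OF y])
  have "((\<lambda>s. bump (y + s *\<^sub>R axis i 1)) has_real_derivative
     - 4 * max 0 (1 - (norm y)\<^sup>2) * y $ i) (at 0)"
    using DERIV_chain2[OF m ns] unfolding bump_def by (simp add: mult_ac)
  then show ?thesis
    by (rule has_vector_derivative_eq_rhs[OF has_vector_derivative_of_real]) simp
qed

end

lemma potential_inv_norm: "potential F p = (\<integral>y. inv_norm y * F (p - retard y) \<partial>lborel) / green_const"
  by (simp add: potential_def inv_norm_def scaleR_conv_of_real)

lemma integrable_potential':
  assumes "forward_supported R0 F" "smooth F"
  shows "integrable lborel (\<lambda>y. inv_norm y * F (p - retard y))"
  using integrable_potential[OF assms, of p] by (simp add: inv_norm_def scaleR_conv_of_real)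

text \<open>The integrand is at most 4/|y| on the unit ball, vanishes outside, and is at least 1 on
  the punctured ball of radius 1/2.\<close>

lemma green_const_pos: "integrable lborel (\<lambda>y::real^3. 4 * max 0 (1 - (norm y)\<^sup>2) / norm y)" "green_const > 0"
proof -
  show int: "integrable lborel (\<lambda>y::real^3. 4 * max 0 (1 - (norm y)\<^sup>2) / norm y)"
  proof (rule Bochner_Integration.integrable_bound)
    show "integrable lborel (\<lambda>y::real^3. 4 * (indicator (cball 0 1) y / norm y))"
      by (intro integrable_mult_right integrable_inverse_norm)
    show "AE y::real^3 in lborel. norm (4 * max 0 (1 - (norm y)\<^sup>2) / norm y) \<le> norm (4 * (indicator (cball 0 1) y / norm y :: real))"
    proof (rule AE_I2)
      fix y :: "real^3"
      show "norm (4 * max 0 (1 - (norm y)\<^sup>2) / norm y) \<le> norm (4 * (indicator (cball 0 1) y / norm y :: real))"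
      proof (cases "norm y \<le> 1")
        case False
        then have "(norm y)\<^sup>2 > 1" by (intro one_less_power) auto
        then show ?thesis by (simp add: max_def)
      next
        case True
        then have "(norm y)\<^sup>2 \<le> 1" by (simp add: power_le_one)
        then show ?thesis using True by (auto simp: max_def intro!: divide_right_mono)
      qed
    qed
  qed measurable
  have "(\<integral>y. indicator (ball (0::real^3) (1/2)) y \<partial>lborel) \<le> green_const"
    unfolding green_const_def
  proof (rule integral_mono_AE[OF _ int])
    show "integrable lborel (indicator (ball (0::real^3) (1/2)) :: _ \<Rightarrow> real)"
      by (intro integrable_real_indicator) (auto intro: emeasure_lborel_ball_finite[simplified])
    have *: "indicator (ball 0 (1/2)) y \<le> 4 * max 0 (1 - (norm y)\<^sup>2) / norm y" if y0: "y \<noteq> 0" for y :: "real^3"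
    proof (cases "norm y < 1/2")
      case True
      have "(norm y)\<^sup>2 \<le> (1/2)\<^sup>2" using True by (intro power_mono) auto
      then have h: "1 - (norm y)\<^sup>2 \<ge> 1/2" by (simp add: power2_eq_square)
      have "1 \<le> 4 * (1/2) / norm y" using y0 True by (simp add: divide_simps)
      also have "\<dots> \<le> 4 * max 0 (1 - (norm y)\<^sup>2) / norm y"
        using h by (intro divide_right_mono mult_left_mono) auto
      finally have "1 \<le> 4 * max 0 (1 - (norm y)\<^sup>2) / norm y" .
      moreover have "indicator (ball 0 (1/2)) y = (1::real)" using True by simp
      ultimately show ?thesis by (simp only:)
    qed simp
    show "AE y::real^3 in lborel. indicator (ball 0 (1/2)) y \<le> 4 * max 0 (1 - (norm y)\<^sup>2) / norm y"
      using AE_lborel_singleton[of "0::real^3"] by eventually_elim (rule *)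
  qed
  moreover have "(\<integral>y. indicator (ball (0::real^3) (1/2)) y \<partial>lborel) > (0::real)"
    by (simp add: content_ball_pos)
  ultimately show "green_const > 0" by linarith
qed

text \<open>The kernel is rotation invariant. Infinitesimally, a coordinate of p is that of
  \<open>p - retard y\<close> plus that of y; the second part leaves the integral of n_i F_j - n_j
  F_i with n = y/|y|, an antisymmetrised derivative of n F, which integrates to zero.\<close>

lemma rot_potential:
  assumes F: "forward_supported R0 F" "smooth F"
  shows "rot i j (potential F) = potential (rot i j F)"
proof (cases "i = j")
  case True
  then show ?thesis by (simp add: rot_def[abs_def] potential_def fun_eq_iff)
next
  case ij: False
  show ?thesis
  proof
    fix p :: spacetime
    define R where "R = max 1 (p $ None + 1)"
    have R: "R \<ge> 1" "p $ None + 1 \<le> R" by (auto simp: R_def le_max_iff_disj)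
    have zero: "u (p - retard y) = 0" if "forward_supported R0 u" "norm y > R" for u y
      by (rule forward_supportedD[OF that(1)]) (use that(2) R in \<open>auto simp: retard_def\<close>)
    note sm = F(2) smooth_pd[OF F(2)]
    define r where "r = norm p + 2 * R"
    obtain B0 where B0: "B0 \<ge> 0" "\<And>q. norm q \<le> r \<Longrightarrow> norm (F q) \<le> B0"
      using bounded_on_cball[OF smooth_continuous_on[OF F(2)]] by blast
    obtain B1 where B1: "\<And>\<mu>. B1 \<mu> \<ge> 0" "\<And>\<mu> q. norm q \<le> r \<Longrightarrow> norm (pd \<mu> F q) \<le> B1 \<mu>"
      using bounded_on_cball[OF smooth_continuous_on[OF sm(2)]] by metis
    define B where "B = B0 + (\<Sum>\<mu>\<in>UNIV. B1 \<mu>)"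
    have B: "B \<ge> 0" "\<And>q. norm q \<le> r \<Longrightarrow> norm (F q) \<le> B" "\<And>\<mu> q. norm q \<le> r \<Longrightarrow> norm (pd \<mu> F q) \<le> B"
    proof -
      have "B1 \<mu> \<le> (\<Sum>\<mu>\<in>UNIV. B1 \<mu>)" for \<mu> by (rule member_le_sum) (auto simp: B1)
      then show "B \<ge> 0" "\<And>q. norm q \<le> r \<Longrightarrow> norm (F q) \<le> B" "\<And>\<mu> q. norm q \<le> r \<Longrightarrow> norm (pd \<mu> F q) \<le> B"
        unfolding B_def using B0 B1 by (force simp: sum_nonneg intro: order_trans add_increasing add_increasing2)+
    qed
    define G where "G u y = u (p - retard y)" for u :: "spacetime \<Rightarrow> complex" and y
    have GB: "norm (G F y) \<le> B" "norm (G (pd \<mu> F) y) \<le> B" if "norm y \<le> R" for y \<mu>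
    proof -
      have "norm (p - retard y) \<le> r"
        using norm_triangle_ineq4[of p "retard y"] norm_retard[of y] that by (simp add: r_def)
      then show "norm (G F y) \<le> B" "norm (G (pd \<mu> F) y) \<le> B" using B by (auto simp: G_def)
    qed
    have G0: "G F y = 0" "G (pd \<mu> F) y = 0" if "norm y > R" for y \<mu>
      using zero[OF _ that] F forward_supported_pd[OF F(1)] by (auto simp: G_def)
    have Gm: "G F \<in> borel_measurable borel" "G (pd \<mu> F) \<in> borel_measurable borel" for \<mu>
      unfolding G_def[abs_def] by (intro borel_measurable_retarded sm)+
    define Z' where "Z' a b y = unit_comp a y * - (unit_comp b y * G (pd None F) y + G (pd (Some b) F) y)
        + - (unit_comp a y * unit_comp b y * inv_norm y) * G F y" for a b y
    have parts: "integrable lborel (Z' a b)" "integral\<^sup>L lborel (Z' a b) = 0" if ab: "a \<noteq> b" for a b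
    proof -
      have 1: "((\<lambda>s. unit_comp a (y + s *\<^sub>R axis b 1) * G F (y + s *\<^sub>R axis b 1)) has_vector_derivative Z' a b y) (at 0)"
        if "y \<noteq> 0" for y
        unfolding G_def Z'_def
        by (rule has_vector_derivative_eq_rhs[OF has_vector_derivative_mult[OF
            has_vector_derivative_unit_comp[OF that] has_vector_derivative_retarded'[OF that F(2)]]])
          (use ab in simp)
      have 2: "(\<lambda>y. unit_comp a y * G F y) \<in> borel_measurable borel" "Z' a b \<in> borel_measurable borel"
        using Gm unfolding Z'_def[abs_def] by measurable
      have 3: "norm (unit_comp a y * G F y) \<le> 3 * B * R\<^sup>2 / norm y" if "y \<noteq> 0" for y
      proof (cases "norm y > R")
        case False
        have "norm (unit_comp a y * G F y) \<le> 1 * B"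
          by (intro norm_mult_bound norm_unit_comp GB) (use False in simp)
        also have "\<dots> \<le> 3 * B * R\<^sup>2 / norm y"
        proof -
          have "norm y * 1 \<le> R * R" using False R by (intro mult_mono) auto
          then have "B * norm y \<le> B * R\<^sup>2" using B by (intro mult_left_mono) (auto simp: power2_eq_square)
          moreover have "B * R\<^sup>2 \<ge> 0" using B by simp
          ultimately have "B * norm y \<le> 3 * B * R\<^sup>2" by linarith
          then show ?thesis using that by (simp add: field_simps)
        qed
        finally show ?thesis .
      qed (use B in \<open>simp add: G0\<close>)
      have 4: "norm (Z' a b y) \<le> 3 * B * R\<^sup>2 / (norm y)\<^sup>2" if "y \<noteq> 0" for y
      proof (cases "norm y > R")
        case False
        have "norm (Z' a b y) \<le> 1 * (1 * B + B) + 1 * 1 * (1 / norm y) * B"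
          unfolding Z'_def
          by (intro norm_bounds norm_unit_comp GB norm_inv_norm[THEN eq_refl]) (use False in auto)
        also have "\<dots> \<le> 3 * B * R\<^sup>2 / (norm y)\<^sup>2"
        proof -
          have "norm y * norm y \<le> R * R" "norm y * 1 \<le> R * R" using False R by (intro mult_mono; auto)+
          then have "B * (norm y * norm y) \<le> B * (R * R)" "B * norm y \<le> B * (R * R)"
            using B by (auto intro!: mult_left_mono)
          then have "(2 * (B * (norm y * norm y)) + B * norm y) / (norm y)\<^sup>2 \<le> 3 * B * R\<^sup>2 / (norm y)\<^sup>2"
            by (intro divide_right_mono) (auto simp: power2_eq_square)
          then show ?thesis using that by (simp add: add_divide_distrib power2_eq_square)
        qed
        finally show ?thesis .
      qed (use B in \<open>simp add: G0 Z'_def\<close>)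
      show "integrable lborel (Z' a b)" "integral\<^sup>L lborel (Z' a b) = 0"
        by (rule integral_by_parts_singular[OF 1 2 3 4, of R]; simp add: G0 Z'_def)+
    qed
    have "(\<integral>y. Z' j i y - Z' i j y \<partial>lborel) = 0"
      using parts[of i j] parts[of j i] ij by simp
    \<comment> \<open>The term with the time derivative and the one from differentiating n are
      symmetric in i and j, hence cancel.\<close>
    moreover have "Z' j i y - Z' i j y = unit_comp i y * G (pd (Some j) F) y - unit_comp j y * G (pd (Some i) F) y" for y
      by (simp add: Z'_def algebra_simps)
    ultimately have key: "(\<integral>y. unit_comp i y * G (pd (Some j) F) y - unit_comp j y * G (pd (Some i) F) y \<partial>lborel) = 0"
      by simp
    have intG: "integrable lborel (\<lambda>y. inv_norm y * G (rot i j F) y)"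
      unfolding G_def by (rule integrable_potential'[OF forward_supported_rot[OF F(1)] smooth_rot[OF F(2)]])
    have intk: "integrable lborel (\<lambda>y. inv_norm y * G (pd (Some k) F) y)" for k
      unfolding G_def by (rule integrable_potential'[OF forward_supported_pd[OF F(1)] smooth_pd[OF F(2)]])
    have "rot i j (potential F) p = (coord i p * (\<integral>y. inv_norm y * G (pd (Some j) F) y \<partial>lborel)
        - coord j p * (\<integral>y. inv_norm y * G (pd (Some i) F) y \<partial>lborel)) / green_const"
      by (simp add: rot_def smooth_potential[OF F] potential_inv_norm G_def diff_divide_distrib)
    also have "\<dots> = (\<integral>y. coord i p * (inv_norm y * G (pd (Some j) F) y)
        - coord j p * (inv_norm y * G (pd (Some i) F) y) \<partial>lborel) / green_const"
      using intk by simp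
    also have "(\<lambda>y. coord i p * (inv_norm y * G (pd (Some j) F) y)
        - coord j p * (inv_norm y * G (pd (Some i) F) y)) =
        (\<lambda>y. inv_norm y * G (rot i j F) y + (unit_comp i y * G (pd (Some j) F) y - unit_comp j y * G (pd (Some i) F) y))"
      by (simp add: fun_eq_iff G_def rot_def coord_def inv_norm_def unit_comp_def retard_def algebra_simps add_divide_distrib diff_divide_distrib)
    also have "(\<integral>y. inv_norm y * G (rot i j F) y + (unit_comp i y * G (pd (Some j) F) y - unit_comp j y * G (pd (Some i) F) y) \<partial>lborel)
        = (\<integral>y. inv_norm y * G (rot i j F) y \<partial>lborel) + 0"
    proof (subst Bochner_Integration.integral_add[OF intG])
      have "integrable lborel (\<lambda>y. Z' j i y - Z' i j y)" using parts[of i j] parts[of j i] ij by auto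
      then show "integrable lborel (\<lambda>y. unit_comp i y * G (pd (Some j) F) y - unit_comp j y * G (pd (Some i) F) y)"
        by (simp add: Z'_def algebra_simps)
    qed (simp add: key)
    finally show "rot i j (potential F) p = potential (rot i j F) p"
      unfolding potential_inv_norm[of "rot i j F"] by (simp add: G_def)
  qed
qed

text \<open>With \<open>n\<close> the unit vector of \<open>y\<close>, the vector field
  \<open>(\<nabla>F - n F\<^sub>t) / |y| - n (F - F(p) bump) / |y|\<^sup>2\<close>, evaluated at the retarded point, has divergence
  \<open>\<box>F / |y| - 4 F(p) max 0 (1 - |y|\<^sup>2) / |y|\<close>. Subtracting \<open>F(p) bump\<close> makes it weakly singular.\<close>

lemma flat_box_potential:
  assumes F: "forward_supported R0 F" "smooth F"
  shows "flat_box (potential F) p = F p"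
proof -
  define R where "R = max 1 (p $ None + 1)"
  have R: "R \<ge> 1" "p $ None + 1 \<le> R" by (auto simp: R_def le_max_iff_disj)
  have zero: "u (p - retard y) = 0" if "forward_supported R0 u" "norm y > R" for u y
    by (rule forward_supportedD[OF that(1)]) (use that(2) R in \<open>auto simp: retard_def\<close>)
  note sm = F(2) smooth_pd[OF F(2)] smooth_pd[OF smooth_pd[OF F(2)]]
  note fs = F(1) forward_supported_pd[OF F(1)] forward_supported_pd[OF forward_supported_pd[OF F(1)]]
  define r where "r = norm p + 2 * R"
  obtain B0 where B0: "B0 \<ge> 0" "\<And>q. norm q \<le> r \<Longrightarrow> norm (F q) \<le> B0"
    using bounded_on_cball[OF smooth_continuous_on[OF F(2)]] by blast
  obtain B1 where B1: "\<And>\<mu>. B1 \<mu> \<ge> 0" "\<And>\<mu> q. norm q \<le> r \<Longrightarrow> norm (pd \<mu> F q) \<le> B1 \<mu>"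
    using bounded_on_cball[OF smooth_continuous_on[OF sm(2)]] by metis
  obtain B2 where B2: "\<And>\<mu> \<nu>. B2 \<mu> \<nu> \<ge> 0" "\<And>\<mu> \<nu> q. norm q \<le> r \<Longrightarrow> norm (pd \<mu> (pd \<nu> F) q) \<le> B2 \<mu> \<nu>"
    using bounded_on_cball[OF smooth_continuous_on[OF sm(3)]] by metis
  obtain L0 where L0: "L0 \<ge> 0" "\<And>x y. norm x \<le> r \<Longrightarrow> norm y \<le> r \<Longrightarrow> norm (F x - F y) \<le> L0 * norm (x - y)"
    using smooth_lipschitz[OF F(2), of r] by blast
  define B where "B = B0 + (\<Sum>\<mu>\<in>UNIV. B1 \<mu>) + (\<Sum>\<mu>\<in>UNIV. \<Sum>\<nu>\<in>UNIV. B2 \<mu> \<nu>)"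
  have sB: "(\<Sum>\<mu>\<in>UNIV. B1 \<mu>) \<ge> 0" "(\<Sum>\<mu>\<in>UNIV. \<Sum>\<nu>\<in>UNIV. B2 \<mu> \<nu>) \<ge> 0"
    by (intro sum_nonneg B1 B2)+
  have mB: "B1 \<mu> \<le> (\<Sum>\<mu>\<in>UNIV. B1 \<mu>)" "B2 \<mu> \<nu> \<le> (\<Sum>\<mu>\<in>UNIV. \<Sum>\<nu>\<in>UNIV. B2 \<mu> \<nu>)" for \<mu> \<nu>
  proof -
    show "B1 \<mu> \<le> (\<Sum>\<mu>\<in>UNIV. B1 \<mu>)" by (rule member_le_sum) (auto simp: B1)
    have "B2 \<mu> \<nu> \<le> (\<Sum>\<nu>\<in>UNIV. B2 \<mu> \<nu>)" by (rule member_le_sum) (auto simp: B2)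
    also have "\<dots> \<le> (\<Sum>\<mu>\<in>UNIV. \<Sum>\<nu>\<in>UNIV. B2 \<mu> \<nu>)"
      by (rule member_le_sum[of \<mu> UNIV "\<lambda>\<mu>. \<Sum>\<nu>\<in>UNIV. B2 \<mu> \<nu>"]) (auto simp: B2 sum_nonneg)
    finally show "B2 \<mu> \<nu> \<le> (\<Sum>\<mu>\<in>UNIV. \<Sum>\<nu>\<in>UNIV. B2 \<mu> \<nu>)" .
  qed
  have B: "B \<ge> 0" "norm q \<le> r \<Longrightarrow> norm (F q) \<le> B" "norm q \<le> r \<Longrightarrow> norm (pd \<mu> F q) \<le> B"
    "norm q \<le> r \<Longrightarrow> norm (pd \<mu> (pd \<nu> F) q) \<le> B" for \<mu> \<nu> q
    unfolding B_def using B0(1) B0(2)[of q] B1(2)[of q \<mu>] B2(2)[of q \<mu> \<nu>] sB mB(1)[of \<mu>] mB(2)[of \<mu> \<nu>] by linarith+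
  \<comment> \<open>Two contributions to |H| \<le> L |y|: the retarded displacement has length at
    most 2|y|, and 1 - bump is at most 2|y|.\<close>
  define L where "L = 2 * L0 + 2 * B"
  have L: "L \<ge> 0" using L0(1) B(1) by (simp add: L_def)
  define G where "G u y = u (p - retard y)" for u :: "spacetime \<Rightarrow> complex" and y
  have nr: "norm (p - retard y) \<le> r" if "norm y \<le> R" for y
    using norm_triangle_ineq4[of p "retard y"] norm_retard[of y] that by (simp add: r_def)
  have pr: "norm p \<le> r" using R by (simp add: r_def)
  have GB: "norm (G F y) \<le> B" "norm (G (pd \<mu> F) y) \<le> B" "norm (G (pd \<mu> (pd \<nu> F)) y) \<le> B" if "norm y \<le> R" for y \<mu> \<nu>
    using B nr[OF that] by (auto simp: G_def)
  have G0: "G F y = 0" "G (pd \<mu> F) y = 0" "G (pd \<mu> (pd \<nu> F)) y = 0" if "norm y > R" for y \<mu> \<nu>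
    using zero[OF _ that] fs by (auto simp: G_def)
  have Gm: "G F \<in> borel_measurable borel" "G (pd \<mu> F) \<in> borel_measurable borel"
    "G (pd \<mu> (pd \<nu> F)) \<in> borel_measurable borel" for \<mu> \<nu>
    unfolding G_def[abs_def] by (intro borel_measurable_retarded sm)+
  define H where "H y = G F y - F p * of_real (bump y)" for y
  define M where "M y = complex_of_real (max 0 (1 - (norm y)\<^sup>2))" for y :: "real^3"
  define Y where "Y i y = complex_of_real (y $ i)" for i and y :: "real^3"
  have HB: "norm (inv_norm y * H y) \<le> L" if "norm y \<le> R" "y \<noteq> 0" for y
  proof -
    have "H y = (F (p - retard y) - F p) + F p * of_real (1 - bump y)"
      by (simp add: H_def G_def algebra_simps)
    also have "norm \<dots> \<le> L0 * norm (p - retard y - p) + B * (2 * norm y)"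
    proof (rule norm_triangle_mono[OF L0(2)[OF nr[OF that(1)] pr]])
      show "norm (F p * of_real (1 - bump y)) \<le> B * (2 * norm y)"
        by (rule norm_mult_bound[OF B(2)[OF pr]]) (use bump_le[of y] in \<open>simp only: norm_of_real\<close>)
    qed
    also have "\<dots> \<le> L0 * (2 * norm y) + B * (2 * norm y)"
      using norm_retard[of y] L0(1) by (intro add_right_mono mult_left_mono) auto
    also have "\<dots> = L * norm y" by (simp add: L_def algebra_simps)
    finally have "norm (H y) \<le> L * norm y" .
    then show ?thesis using that by (simp add: norm_mult norm_inv_norm field_simps)
  qed
  have b0: "bump y = 0" "M y = 0" if "norm y > R" for y
  proof -
    have "(norm y)\<^sup>2 > 1" using that R by (intro one_less_power) auto
    then show "bump y = 0" "M y = 0" by (simp_all add: bump_def M_def max_def)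
  qed
  have H0: "H y = 0" if "norm y > R" for y using that by (simp add: H_def G0 b0)
  have MB: "norm (M y) \<le> 1" "norm (Y i y) \<le> norm y" for y i
    using component_le_norm_cart[of y i] by (auto simp: M_def Y_def)
  have Hm: "H \<in> borel_measurable borel" "M \<in> borel_measurable borel" "Y i \<in> borel_measurable borel" for i
  proof -
    show "H \<in> borel_measurable borel" "M \<in> borel_measurable borel"
      using Gm(1) unfolding H_def[abs_def] M_def[abs_def] by measurable
    have "(\<lambda>y::real^3. y $ i) \<in> borel_measurable borel"
      by (intro borel_measurable_continuous_onI continuous_intros)
    then show "Y i \<in> borel_measurable borel" unfolding Y_def[abs_def] by measurable
  qed
  define n where "n = unit_comp"
  define A where "A = inv_norm"
  have nA: "norm (n i y) \<le> 1" "norm (A y) \<le> 1 / norm y" for i y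
    by (simp_all add: n_def A_def norm_unit_comp norm_inv_norm)
  have nAm: "n i \<in> borel_measurable borel" "A \<in> borel_measurable borel" for i
    by (simp_all add: n_def A_def)
  define Z where "Z i y = G (pd (Some i) F) y * A y - n i y * (A y * G (pd None F) y) - n i y * (A y * (A y * H y))" for i y
  define H' where "H' i y = - (n i y * G (pd None F) y + G (pd (Some i) F) y) + F p * (4 * M y * Y i y)" for i y
  define A' where "A' i y = - (n i y * A y * A y)" for i y
  define n' where "n' i y = A y - n i y * n i y * A y" for i y
  define Gi where "Gi i u y = - (n i y * G (pd None u) y + G (pd (Some i) u) y)" for i u y
  define Z' where "Z' i y = (G (pd (Some i) F) y * A' i y + Gi i (pd (Some i) F) y * A y)
     - (n i y * (A y * Gi i (pd None F) y + A' i y * G (pd None F) y) + n' i y * (A y * G (pd None F) y))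
     - (n i y * (A y * (A y * H' i y + A' i y * H y) + A' i y * (A y * H y)) + n' i y * (A y * (A y * H y)))" for i y
  have parts: "integrable lborel (Z' i)" "integral\<^sup>L lborel (Z' i) = 0" for i
  proof -
    have 1: "((\<lambda>s. Z i (y + s *\<^sub>R axis i 1)) has_vector_derivative Z' i y) (at 0)" if y: "y \<noteq> 0" for y
    proof -
      have dA: "((\<lambda>s. A (y + s *\<^sub>R axis i 1)) has_vector_derivative A' i y) (at 0)"
        using has_vector_derivative_inv_norm[OF y, of i] by (simp add: A_def A'_def n_def)
      have dn: "((\<lambda>s. n i (y + s *\<^sub>R axis i 1)) has_vector_derivative n' i y) (at 0)"
        using has_vector_derivative_unit_comp[OF y, of i i] by (simp add: A_def n'_def n_def)
      have dG: "((\<lambda>s. G u (y + s *\<^sub>R axis i 1)) has_vector_derivative Gi i u y) (at 0)" if "smooth u" for u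
        using has_vector_derivative_retarded'[OF y that, of p i] by (simp add: G_def Gi_def n_def)
      have dH: "((\<lambda>s. H (y + s *\<^sub>R axis i 1)) has_vector_derivative H' i y) (at 0)"
        unfolding H_def
        by (rule has_vector_derivative_eq_rhs[OF has_vector_derivative_diff[OF dG[OF F(2)]
             has_vector_derivative_mult_right[OF has_vector_derivative_bump[OF y]]]])
          (simp add: H'_def Gi_def M_def Y_def)
      note m = has_vector_derivative_mult[where x=0 and s=UNIV, simplified add_0 scaleR_zero_left add_0_right]
      show ?thesis
        unfolding Z_def
        by (rule has_vector_derivative_eq_rhs[OF has_vector_derivative_diff[OF has_vector_derivative_diff[OF
              has_vector_derivative_mult[OF dG[OF sm(2)] dA]
              has_vector_derivative_mult[OF dn has_vector_derivative_mult[OF dA dG[OF sm(2)]]]]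
              has_vector_derivative_mult[OF dn has_vector_derivative_mult[OF dA has_vector_derivative_mult[OF dA dH]]]]])
          (simp add: Z'_def)
    qed
    have 2: "Z i \<in> borel_measurable borel" "Z' i \<in> borel_measurable borel"
      using Gm Hm nAm unfolding Z_def[abs_def] Z'_def[abs_def] H'_def A'_def n'_def Gi_def by measurable
    have H'B: "norm (H' i y) \<le> 2 * B + 4 * B * R" if "norm y \<le> R" for y
    proof -
      have "norm (H' i y) \<le> 1 * B + B + B * (4 * 1 * R)"
        unfolding H'_def
        by (intro norm_bounds nA GB MB B(2)[OF pr] that order_trans[OF MB(2)]) simp
      then show ?thesis by (simp add: algebra_simps)
    qed
    define C where "C = (2 * B + L) * R + 6 * B * R + 10 * B + 8 * L + 4 * B * R"
    have C0: "C \<ge> 0" using B(1) L R by (simp add: C_def)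
    have 3: "norm (Z i y) \<le> C / norm y" if y: "y \<noteq> 0" for y
    proof (cases "norm y > R")
      case False
      then have yR: "norm y \<le> R" by simp
      have AH: "norm (A y * H y) \<le> L" using HB[OF yR y] by (simp add: A_def)
      have "norm (Z i y) \<le> B * (1 / norm y) + 1 * ((1 / norm y) * B) + 1 * ((1 / norm y) * L)"
        unfolding Z_def by (intro norm_triangle_mono norm_diff_bound norm_mult_bound[OF nA(1)] norm_mult_bound[OF nA(2)]
            norm_mult_bound AH GB nA yR)
      also have "\<dots> = (2 * B + L) / norm y" by (simp add: add_divide_distrib)
      also have "\<dots> \<le> C / norm y"
      proof (rule divide_right_mono)
        have "(2 * B + L) * 1 \<le> (2 * B + L) * R" using B(1) L R by (intro mult_left_mono) auto
        then show "2 * B + L \<le> C" using B(1) L R by (simp add: C_def add_increasing2)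
      qed simp
      finally show ?thesis .
    qed (use C0 in \<open>simp add: Z_def G0 H0\<close>)
    have 4: "norm (Z' i y) \<le> C / (norm y)\<^sup>2" if y: "y \<noteq> 0" for y
    proof (cases "norm y > R")
      case False
      then have yR: "norm y \<le> R" by simp
      define a where "a = 1 / norm y"
      have a: "a > 0" using y by (simp add: a_def)
      have aR: "a \<le> R * (a * a)"
      proof -
        have "a * norm y = 1" using y by (simp add: a_def)
        then have "1 \<le> a * R" using yR a mult_left_mono[of "norm y" R a] by simp
        then show ?thesis using a mult_left_mono[of 1 "a * R" a] by (simp add: mult_ac)
      qed
      have A: "norm (A y) \<le> a" using nA(2) by (simp add: a_def)
      have AH: "norm (A y * H y) \<le> L" using HB[OF yR y] by (simp add: A_def)
      have A': "norm (A' i y) \<le> a * a"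
        using norm_bounds(4)[OF norm_bounds(4)[OF nA(1) A] A] by (simp add: A'_def)
      have n': "norm (n' i y) \<le> 2 * a"
        using norm_diff_bound[OF A norm_mult_bound[OF norm_mult_bound[OF nA(1) nA(1)] A]] by (simp add: n'_def)
      have Gi: "norm (Gi i (pd \<mu> F) y) \<le> 2 * B" for \<mu>
        unfolding Gi_def
        by (rule order_trans[OF norm_minus_bound[OF norm_triangle_mono[OF norm_mult_bound[OF nA(1) GB(3)[OF yR]] GB(3)[OF yR]]]]) simp
      have A'H: "norm (A' i y * H y) \<le> a * L"
      proof -
        have "A' i y * H y = - (n i y * A y * (A y * H y))" by (simp add: A'_def)
        then show ?thesis using norm_mult_bound[OF norm_mult_bound[OF nA(1) A] AH, of i] by simp
      qed
      have "norm (Z' i y) \<le> (B * (a * a) + 2 * B * a)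
         + (1 * (a * (2 * B) + a * a * B) + 2 * a * (a * B))
         + (1 * (a * (a * (2 * B + 4 * B * R) + a * L) + a * a * L) + 2 * a * (a * L))"
        unfolding Z'_def
        by (intro norm_triangle_mono norm_diff_bound A'H norm_mult_bound[OF nA(1)] norm_mult_bound[OF A]
            norm_mult_bound A AH GB Gi H'B A' n' nA yR)
      also have "\<dots> = 4 * B * a + (6 * B + 4 * B * R + 4 * L) * (a * a)"
        by (simp add: algebra_simps)
      also have "4 * B * a \<le> 4 * B * (R * (a * a))" using aR B(1) by (intro mult_left_mono) auto
      also have "4 * B * (R * (a * a)) + (6 * B + 4 * B * R + 4 * L) * (a * a) \<le> C * (a * a)"
      proof -
        have "4 * B * R + (6 * B + 4 * B * R + 4 * L) \<le> C" using B(1) L R by (simp add: C_def algebra_simps)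
        from mult_right_mono[OF this, of "a * a"] a show ?thesis by (simp add: algebra_simps)
      qed
      finally show ?thesis by (simp add: a_def power2_eq_square)
    qed (use C0 in \<open>simp add: Z'_def Gi_def H'_def G0 H0 b0\<close>)
    show "integrable lborel (Z' i)" "integral\<^sup>L lborel (Z' i) = 0"
      by (rule integral_by_parts_singular[OF 1 2 3 4, of R]; simp add: G0 H0 b0 Z_def Z'_def Gi_def H'_def)+
  qed
  have sumZ: "(\<Sum>i\<in>UNIV. Z' i y) = A y * G (flat_box F) y - F p * (4 * M y * A y)" if y: "y \<noteq> 0" for y
  proof -
    have n1: "n 1 y * n 1 y + n 2 y * n 2 y + n 3 y * n 3 y = 1"
      using sum_unit_comp_square[OF y] by (simp add: n_def sum_3)
    have YA: "A y * Y i y = n i y" for i by (simp add: A_def Y_def n_def unit_comp_def inv_norm_def)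
    \<comment> \<open>The mixed derivatives come once from the gradient term and once from n F_t,
      with opposite signs.\<close>
    have comm: "G (pd None (pd (Some i) F)) y = G (pd (Some i) (pd None F)) y" for i
      unfolding G_def by (subst pd_commute[OF F(2)]) simp
    have box: "G (flat_box F) y = G (pd None (pd None F)) y - (G (pd (Some 1) (pd (Some 1) F)) y
      + G (pd (Some 2) (pd (Some 2) F)) y + G (pd (Some 3) (pd (Some 3) F)) y)"
      by (simp add: G_def flat_box_def sum_3)
    \<comment> \<open>Summed over i, the factor 1 - 3 n_i^2 gives 3 - 3 = 0, which removes both the
      |y|^(-3) term in H and the |y|^(-2) term in F_t; in the other terms the n_i^2 add up to
      1.\<close>
    have Z'_eq: "Z' i y = - A y * G (pd (Some i) (pd (Some i) F)) y + n i y * n i y * A y * G (pd None (pd None F)) y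
        - (1 - 3 * (n i y * n i y)) * (A y * A y * A y) * H y
        - 4 * F p * M y * A y * (n i y * n i y)
        - (1 - 3 * (n i y * n i y)) * A y * A y * G (pd None F) y" for i
    proof -
      have "Z' i y + A y * G (pd (Some i) (pd (Some i) F)) y - n i y * n i y * A y * G (pd None (pd None F)) y
        + (1 - 3 * (n i y * n i y)) * (A y * A y * A y) * H y
        + (1 - 3 * (n i y * n i y)) * A y * A y * G (pd None F) y
        = - 4 * F p * M y * A y * n i y * (A y * Y i y)"
        unfolding Z'_def Gi_def A'_def n'_def H'_def comm by (simp add: algebra_simps)
      then show ?thesis unfolding YA by (simp add: algebra_simps)
    qed
    show ?thesis
      unfolding sum_3 Z'_eq box using n1 by algebra
  qed
  have "(\<integral>y. (\<Sum>i\<in>UNIV. Z' i y) \<partial>lborel) = 0" using parts by (simp add: Bochner_Integration.integral_sum)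
  moreover have "(\<integral>y. (\<Sum>i\<in>UNIV. Z' i y) \<partial>lborel) = (\<integral>y. A y * G (flat_box F) y - F p * (4 * M y * A y) \<partial>lborel)"
  proof (rule integral_cong_AE)
    show "AE y in lborel. (\<Sum>i\<in>UNIV. Z' i y) = A y * G (flat_box F) y - F p * (4 * M y * A y)"
      using AE_lborel_singleton[of 0] by eventually_elim (rule sumZ)
    show "(\<lambda>y. \<Sum>i\<in>UNIV. Z' i y) \<in> borel_measurable lborel"
      using parts(1) by (intro borel_measurable_sum) auto
    show "(\<lambda>y. A y * G (flat_box F) y - F p * (4 * M y * A y)) \<in> borel_measurable lborel"
      using Hm nAm borel_measurable_retarded[OF smooth_flat_box[OF F(2)]] unfolding G_def by measurable
  qed
  moreover have fsb: "forward_supported R0 (flat_box F)"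
    using fs(3) unfolding forward_supported_def flat_box_def by simp
  have i1: "integrable lborel (\<lambda>y. A y * G (flat_box F) y)"
    unfolding A_def G_def by (rule integrable_potential'[OF fsb smooth_flat_box[OF F(2)]])
  have MA: "4 * M y * A y = complex_of_real (4 * max 0 (1 - (norm y)\<^sup>2) / norm y)" for y
    by (simp add: M_def A_def inv_norm_def)
  have i2: "integrable lborel (\<lambda>y. 4 * M y * A y)" "(\<integral>y. 4 * M y * A y \<partial>lborel) = green_const"
  proof -
    show "integrable lborel (\<lambda>y. 4 * M y * A y)"
      unfolding MA using green_const_pos(1) by (rule integrable_of_real)
    show "(\<integral>y. 4 * M y * A y \<partial>lborel) = green_const"
      unfolding MA green_const_def by (rule integral_of_real[OF green_const_pos(1)])
  qed
  ultimately have "(\<integral>y. A y * G (flat_box F) y \<partial>lborel) = F p * green_const"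
    using i1 i2 by simp
  then have "potential (flat_box F) p = F p"
    using green_const_pos(2) by (simp add: potential_inv_norm A_def G_def)
  moreover have "flat_box (potential F) p = potential (flat_box F) p"
  proof -
    have pp: "pd \<mu> (pd \<mu> (potential F)) = potential (pd \<mu> (pd \<mu> F))" for \<mu>
      using smooth_potential[OF F] smooth_potential[OF fs(2) sm(2)] by simp
    have ii: "integrable lborel (\<lambda>y. inv_norm y * pd \<mu> (pd \<mu> F) (p - retard y))" for \<mu>
      by (rule integrable_potential'[OF fs(3) sm(3)])
    show ?thesis
      using ii by (simp add: flat_box_def pp potential_inv_norm right_diff_distrib sum_distrib_left
          diff_divide_distrib sum_divide_distrib Bochner_Integration.integral_sum)
  qed
  ultimately show ?thesis by simp
qed

section \<open>Waves with a smooth potential\<close>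

primrec iter_pd :: "'n list \<Rightarrow> (real^'n \<Rightarrow> complex) \<Rightarrow> real^'n \<Rightarrow> complex" where
  "iter_pd [] u = u"
| "iter_pd (\<mu> # ms) u = iter_pd ms (pd \<mu> u)"

lemma smooth_iter_pd: "smooth u \<Longrightarrow> smooth (iter_pd ms u)"
  by (induction ms arbitrary: u) (auto simp: smooth_pd)

lemma iter_pd_add: "smooth u \<Longrightarrow> smooth v \<Longrightarrow> iter_pd ms (\<lambda>p. u p + v p) = (\<lambda>p. iter_pd ms u p + iter_pd ms v p)"
  by (induction ms arbitrary: u v) (auto simp: pd_add smooth_pd)

lemma forward_supported_iter_pd: "forward_supported R u \<Longrightarrow> forward_supported R (iter_pd ms u)"
  by (induction ms arbitrary: u) (auto simp: forward_supported_pd)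

lemma iter_pd_potential:
  "forward_supported R u \<Longrightarrow> smooth u \<Longrightarrow> iter_pd ms (potential u) = potential (iter_pd ms u)"
  by (induction ms arbitrary: u) (auto simp: smooth_potential forward_supported_pd smooth_pd)

text \<open>Leibniz rule by induction on the order. The constant does not depend on u and the
  estimate is pointwise in p, so bounds on u that vary with time pass through unchanged.\<close>

lemma iter_pd_mult_bound:
  fixes W :: "real^'n \<Rightarrow> complex"
  assumes "smooth W"
  shows "\<exists>C\<ge>0. \<forall>u p m. smooth u \<longrightarrow> norm p \<le> r \<longrightarrow> (\<forall>ms. length ms \<le> k \<longrightarrow> norm (iter_pd ms u p) \<le> m) \<longrightarrow>
    (\<forall>ms. length ms \<le> k \<longrightarrow> norm (iter_pd ms (\<lambda>q. W q * u q) p) \<le> C * m)"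
  using assms
proof (induction k arbitrary: W)
  case 0
  from bounded_on_cball[OF smooth_continuous_on[OF 0], of r] obtain B where
    B: "B \<ge> 0" "\<And>q. norm q \<le> r \<Longrightarrow> norm (W q) \<le> B" by blast
  show ?case
    by (rule exI[of _ B]) (use B in \<open>auto intro!: norm_mult_bound\<close>)
next
  case (Suc k)
  from bounded_on_cball[OF smooth_continuous_on[OF Suc.prems], of r] obtain B where
    B: "B \<ge> 0" "\<And>q. norm q \<le> r \<Longrightarrow> norm (W q) \<le> B" by blast
  from Suc.IH[OF Suc.prems] obtain C0 where C0: "C0 \<ge> 0"
    "\<And>u p m ms. smooth u \<Longrightarrow> norm p \<le> r \<Longrightarrow> (\<forall>ms. length ms \<le> k \<longrightarrow> norm (iter_pd ms u p) \<le> m) \<Longrightarrow>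
      length ms \<le> k \<Longrightarrow> norm (iter_pd ms (\<lambda>q. W q * u q) p) \<le> C0 * m" by blast
  have "\<exists>C\<ge>0. \<forall>u p m. smooth u \<longrightarrow> norm p \<le> r \<longrightarrow> (\<forall>ms. length ms \<le> k \<longrightarrow> norm (iter_pd ms u p) \<le> m) \<longrightarrow>
      (\<forall>ms. length ms \<le> k \<longrightarrow> norm (iter_pd ms (\<lambda>q. pd \<mu> W q * u q) p) \<le> C * m)" for \<mu>
    by (rule Suc.IH[OF smooth_pd[OF Suc.prems]])
  then obtain C1 where C1: "\<And>\<mu>. C1 \<mu> \<ge> 0"
    "\<And>\<mu> u p m ms. smooth u \<Longrightarrow> norm p \<le> r \<Longrightarrow> (\<forall>ms. length ms \<le> k \<longrightarrow> norm (iter_pd ms u p) \<le> m) \<Longrightarrow>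
      length ms \<le> k \<Longrightarrow> norm (iter_pd ms (\<lambda>q. pd \<mu> W q * u q) p) \<le> C1 \<mu> * m" by metis
  define C where "C = B + C0 + (\<Sum>\<mu>\<in>UNIV. C1 \<mu>)"
  have C1s: "C1 \<mu> \<le> (\<Sum>\<mu>\<in>UNIV. C1 \<mu>)" "0 \<le> (\<Sum>\<mu>\<in>UNIV. C1 \<mu>)" for \<mu>
    by (auto intro!: member_le_sum sum_nonneg C1)
  show ?case
  proof (intro exI[of _ C] conjI allI impI)
    show "C \<ge> 0" using B C0 C1s by (simp add: C_def)
    fix u :: "real^'n \<Rightarrow> complex" and p m ms
    assume u: "smooth u" and p: "norm p \<le> r" and m: "\<forall>ms. length ms \<le> Suc k \<longrightarrow> norm (iter_pd ms u p) \<le> m"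
      and ms: "length (ms::'n list) \<le> Suc k"
    have "norm (u p) \<le> m" using m[rule_format, of "[]"] by simp
    then have m0: "m \<ge> 0" by (rule order_trans[OF norm_ge_zero])
    show "norm (iter_pd ms (\<lambda>q. W q * u q) p) \<le> C * m"
    proof (cases ms)
      case Nil
      have "norm (W p * u p) \<le> B * m"
        by (rule norm_mult_bound[OF B(2)[OF p]]) (use m[rule_format, of "[]"] in simp)
      also have "\<dots> \<le> C * m" using m0 C0 C1s by (intro mult_right_mono) (auto simp: C_def)
      finally show ?thesis using Nil by simp
    next
      case (Cons \<mu> ms')
      have "iter_pd ms (\<lambda>q. W q * u q) p = iter_pd ms' (\<lambda>q. pd \<mu> W q * u q) p + iter_pd ms' (\<lambda>q. W q * pd \<mu> u q) p"
        using Cons u Suc.prems by (simp add: pd_mult iter_pd_add smooth_intros smooth_pd)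
      also have "norm \<dots> \<le> C1 \<mu> * m + C0 * m"
      proof (rule norm_triangle_mono)
        show "norm (iter_pd ms' (\<lambda>q. pd \<mu> W q * u q) p) \<le> C1 \<mu> * m"
          by (rule C1(2)[OF u p]) (use m ms Cons in auto)
        show "norm (iter_pd ms' (\<lambda>q. W q * pd \<mu> u q) p) \<le> C0 * m"
        proof (rule C0(2)[OF smooth_pd[OF u] p])
          show "\<forall>ms. length ms \<le> k \<longrightarrow> norm (iter_pd ms (pd \<mu> u) p) \<le> m"
            using m[rule_format, of "\<mu> # _"] by simp
        qed (use ms Cons in auto)
      qed
      also have "\<dots> = (C1 \<mu> + C0) * m" by (simp add: algebra_simps)
      also have "\<dots> \<le> C * m" using m0 B C1s(1)[of \<mu>] by (intro mult_right_mono) (auto simp: C_def)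
      finally show ?thesis .
    qed
  qed
qed

text \<open>The majorant hypothesis is inherited by every partial derivative of the series, so
  termwise differentiation can be iterated.\<close>

lemma smooth_series:
  fixes u :: "nat \<Rightarrow> real^'n \<Rightarrow> complex"
  assumes sm: "\<And>n. smooth (u n)"
    and bd: "\<And>ms r. \<exists>M. summable M \<and> (\<forall>n p. norm p \<le> r \<longrightarrow> norm (iter_pd ms (u n) p) \<le> M n)"
  shows "smooth (\<lambda>p. \<Sum>n. u n p)" and "pd \<mu> (\<lambda>p. \<Sum>n. u n p) = (\<lambda>p. \<Sum>n. pd \<mu> (u n) p)"
    and "summable (\<lambda>n. u n p)"
proof -
  have summ: "summable (\<lambda>n. u n p)"
    if *: "\<And>ms r. \<exists>M. summable M \<and> (\<forall>n p. norm p \<le> r \<longrightarrow> norm (iter_pd ms (u n) p) \<le> M n)"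
    for u :: "nat \<Rightarrow> real^'n \<Rightarrow> complex" and p
  proof -
    obtain M where M: "summable M" "\<And>n q. norm q \<le> norm p \<Longrightarrow> norm (u n q) \<le> M n"
      using *[of "norm p" "[]"] by auto
    show ?thesis by (rule summable_comparison_test'[OF M(1), of 0]) (auto intro: M(2))
  qed
  show "summable (\<lambda>n. u n p)" by (rule summ[OF bd])
  have der: "((\<lambda>p. \<Sum>n. u n p) has_derivative (\<lambda>h. \<Sum>\<mu>\<in>UNIV. (h $ \<mu>) *\<^sub>R (\<Sum>n. pd \<mu> (u n) p))) (at p)"
    if sm: "\<And>n. smooth (u n)"
      and bd: "\<And>ms r. \<exists>M. summable M \<and> (\<forall>n p. norm p \<le> r \<longrightarrow> norm (iter_pd ms (u n) p) \<le> M n)"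
    for u :: "nat \<Rightarrow> real^'n \<Rightarrow> complex" and p
  proof -
    define r where "r = norm p + 1"
    let ?S = "ball (0::real^'n) r"
    let ?f' = "\<lambda>n x h. \<Sum>\<mu>\<in>UNIV. (h $ \<mu>) *\<^sub>R pd \<mu> (u n) x"
    let ?g' = "\<lambda>x h. \<Sum>\<mu>\<in>UNIV. (h $ \<mu>) *\<^sub>R (\<Sum>n. pd \<mu> (u n) x)"
    have pS: "p \<in> ?S" by (simp add: r_def)
    have unif: "uniform_limit ?S (\<lambda>n x. \<Sum>i<n. pd \<mu> (u i) x) (\<lambda>x. \<Sum>i. pd \<mu> (u i) x) sequentially" for \<mu>
    proof -
      obtain M where "summable M" "\<And>n q. norm q \<le> r \<Longrightarrow> norm (pd \<mu> (u n) q) \<le> M n"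
        using bd[of r "[\<mu>]"] by auto
      then show ?thesis by (intro Weierstrass_m_test) auto
    qed
    have "\<exists>g. \<forall>x\<in>?S. (\<lambda>n. u n x) sums (g x) \<and> (g has_derivative ?g' x) (at x within ?S)"
    proof (rule has_derivative_series[where f'="?f'" and x=p and l="\<Sum>n. u n p"])
      show "(u n has_derivative ?f' n x) (at x within ?S)" for n x
        by (rule has_derivative_at_withinI[OF smooth_has_derivative[OF sm]])
      show "(\<lambda>n. u n p) sums (\<Sum>n. u n p)" by (rule summable_sums[OF summ[OF bd]])
      fix e :: real assume e: "e > 0"
      define e' where "e' = e / CARD('n)"
      have e': "e' > 0" using e by (simp add: e'_def)
      have "\<forall>\<^sub>F n in sequentially. \<forall>\<mu>. \<forall>x\<in>?S. dist (\<Sum>i<n. pd \<mu> (u i) x) (\<Sum>i. pd \<mu> (u i) x) < e'"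
        by (intro eventually_all_finite) (use unif e' in \<open>auto simp: uniform_limit_iff\<close>)
      then show "\<forall>\<^sub>F n in sequentially. \<forall>x\<in>?S. \<forall>h. norm ((\<Sum>i<n. ?f' i x h) - ?g' x h) \<le> e * norm h"
      proof eventually_elim
        case (elim n)
        show ?case
        proof (intro ballI allI)
          fix x h assume x: "x \<in> ?S"
          have "(\<Sum>i<n. ?f' i x h) - ?g' x h = (\<Sum>\<mu>\<in>UNIV. (h $ \<mu>) *\<^sub>R ((\<Sum>i<n. pd \<mu> (u i) x) - (\<Sum>i. pd \<mu> (u i) x)))"
            by (subst sum.swap) (simp add: scaleR_sum_right scaleR_diff_right sum_subtractf)
          also have "norm \<dots> \<le> (\<Sum>\<mu>\<in>(UNIV::'n set). norm h * e')"
          proof (rule sum_norm_le)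
            fix \<mu>
            have "norm ((\<Sum>i<n. pd \<mu> (u i) x) - (\<Sum>i. pd \<mu> (u i) x)) \<le> e'"
              using elim x by (auto simp: dist_norm intro: less_imp_le)
            then show "norm ((h $ \<mu>) *\<^sub>R ((\<Sum>i<n. pd \<mu> (u i) x) - (\<Sum>i. pd \<mu> (u i) x))) \<le> norm h * e'"
              unfolding norm_scaleR real_norm_def[symmetric]
              by (intro mult_mono) (use component_le_norm_cart[of h \<mu>] in auto)
          qed
          also have "\<dots> = e * norm h" by (simp add: e'_def)
          finally show "norm ((\<Sum>i<n. ?f' i x h) - ?g' x h) \<le> e * norm h" .
        qed
      qed
    qed (use pS in auto)
    then obtain g where g: "\<And>x. x \<in> ?S \<Longrightarrow> (\<lambda>n. u n x) sums (g x)" "\<And>x. x \<in> ?S \<Longrightarrow> (g has_derivative ?g' x) (at x within ?S)"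
      by blast
    have "(g has_derivative ?g' p) (at p)"
      using g(2)[OF pS] pS by (simp add: at_within_open[OF _ open_ball])
    then show ?thesis
      by (rule has_derivative_transform_within_open[OF _ open_ball pS]) (use sums_unique[OF g(1)] in auto)
  qed
  show "pd \<mu> (\<lambda>p. \<Sum>n. u n p) = (\<lambda>p. \<Sum>n. pd \<mu> (u n) p)"
    by (rule ext, subst pd_eqI[OF der[OF sm bd]])
      (auto simp: axis_def if_distrib[of "\<lambda>c. c *\<^sub>R _"] cong: if_cong)
  have "Ck_on k UNIV (\<lambda>p. \<Sum>n. u n p)" for k
    using sm bd
  proof (induction k arbitrary: u)
    case 0
    then show ?case
      by (auto intro!: continuous_at_imp_continuous_on has_derivative_continuous[OF der])
  next
    case (Suc k)
    show ?case
    proof (rule Ck_on_SucI[OF _ der[OF Suc.prems]])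
      fix b :: "real^'n" assume "b \<in> Basis"
      then obtain \<mu> where b: "b = axis \<mu> 1" by (auto simp: Basis_vec_def)
      have "Ck_on k UNIV (\<lambda>x. \<Sum>n. pd \<mu> (u n) x)"
      proof (rule Suc.IH)
        show "\<exists>M. summable M \<and> (\<forall>n p. norm p \<le> r \<longrightarrow> norm (iter_pd ms (pd \<mu> (u n)) p) \<le> M n)" for ms r
          using Suc.prems(2)[of r "\<mu> # ms"] by simp
      qed (intro smooth_pd Suc.prems)
      then show "Ck_on k UNIV (\<lambda>x. \<Sum>\<mu>\<in>UNIV. (b $ \<mu>) *\<^sub>R (\<Sum>n. pd \<mu> (u n) x))"
        unfolding b by (simp add: axis_def if_distrib[of "\<lambda>c. c *\<^sub>R _"] cong: if_cong)
    qed auto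
  qed
  then show "smooth (\<lambda>p. \<Sum>n. u n p)" by (simp add: smooth_on_UNIV[symmetric] smooth_on_def)
qed

text \<open>Along the past cone the weight exp(\<kappa> t) drops by exp(-\<kappa> |y|). This factor
  is kept inside the kernel integral, which becomes small for large \<kappa>.\<close>

lemma potential_bound:
  assumes F: "forward_supported R0 F" "smooth F" and \<kappa>: "\<kappa> \<ge> 0"
    and M: "\<And>q. q $ None \<le> T \<Longrightarrow> norm (F q) \<le> M * exp (\<kappa> * (q $ None))"
    and p: "p $ None \<le> T"
  shows "norm (potential F p) \<le> M * exp (\<kappa> * (p $ None)) *
    ((\<integral>y. ball_weight (T + 1) y * exp (- \<kappa> * norm y) \<partial>lborel) / green_const)"
proof -
  have w: "integrable lborel (ball_weight (T + 1))"
    using translation_average.w[OF translation_average_retard] .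
  have w0: "ball_weight (T + 1) y \<ge> 0" for y by (simp add: ball_weight_def)
  have int: "integrable lborel (\<lambda>y. ball_weight (T + 1) y * exp (- \<kappa> * norm y))"
  proof (rule Bochner_Integration.integrable_bound[OF w])
    show "AE y in lborel. norm (ball_weight (T + 1) y * exp (- \<kappa> * norm y)) \<le> norm (ball_weight (T + 1) y)"
      using \<kappa> by (auto simp: abs_mult intro!: AE_I2 mult_left_le)
  qed (use borel_measurable_integrable[OF w] in measurable)
  have "potential F p = (\<integral>y. ball_weight (T + 1) y *\<^sub>R F (p - retard y) \<partial>lborel) / green_const"
    using potential_eq_avg[OF F(1), of p "T + 1"] p
    by (simp add: translation_average.avg_def[OF translation_average_retard])
  also have "norm \<dots> = norm (\<integral>y. ball_weight (T + 1) y *\<^sub>R F (p - retard y) \<partial>lborel) / green_const"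
    using green_const_pos(2) by (simp add: norm_divide)
  also have "\<dots> \<le> (\<integral>y. M * exp (\<kappa> * (p $ None)) * (ball_weight (T + 1) y * exp (- \<kappa> * norm y)) \<partial>lborel) / green_const"
  proof (intro divide_right_mono order_trans[OF integral_norm_bound] integral_mono)
    show "integrable lborel (\<lambda>y. norm (ball_weight (T + 1) y *\<^sub>R F (p - retard y)))"
      by (intro integrable_norm translation_average.integrable_avg[OF translation_average_retard] smooth_continuous_on F)
    show "integrable lborel (\<lambda>y. M * exp (\<kappa> * (p $ None)) * (ball_weight (T + 1) y * exp (- \<kappa> * norm y)))"
      by (intro integrable_mult_right int)
    show "norm (ball_weight (T + 1) y *\<^sub>R F (p - retard y)) \<le> M * exp (\<kappa> * (p $ None)) * (ball_weight (T + 1) y * exp (- \<kappa> * norm y))" for y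
    proof -
      have "(p - retard y) $ None = p $ None - norm y" by (simp add: retard_def)
      moreover have "norm (F (p - retard y)) \<le> M * exp (\<kappa> * ((p - retard y) $ None))"
      proof (rule M)
        show "(p - retard y) $ None \<le> T"
          unfolding \<open>(p - retard y) $ None = _\<close> using p norm_ge_zero[of y] by linarith
      qed
      ultimately have "norm (F (p - retard y)) \<le> M * exp (\<kappa> * (p $ None)) * exp (- \<kappa> * norm y)"
        by (simp add: exp_add[symmetric] algebra_simps)
      from mult_left_mono[OF this w0[of y]] show ?thesis using w0[of y] by (simp add: mult_ac)
    qed
    show "green_const \<ge> 0" using green_const_pos(2) by simp
  qed
  also have "\<dots> = M * exp (\<kappa> * (p $ None)) * ((\<integral>y. ball_weight (T + 1) y * exp (- \<kappa> * norm y) \<partial>lborel) / green_const)"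
    by (subst integral_mult_right_zero) simp
  finally show ?thesis .
qed

text \<open>The undamped weight dominates, and the damping kills the integrand at every point off
  the origin.\<close>

lemma damped_weight_tendsto_0:
  "(\<lambda>n. \<integral>y. ball_weight R y * exp (- real n * norm y) \<partial>lborel) \<longlonglongrightarrow> 0"
proof -
  have w: "integrable lborel (ball_weight R)"
    using translation_average.w[OF translation_average_retard] .
  have m: "ball_weight R \<in> borel_measurable borel" using borel_measurable_integrable[OF w] by simp
  have "(\<lambda>n. \<integral>y. ball_weight R y * exp (- real n * norm y) \<partial>lborel) \<longlonglongrightarrow> (\<integral>y. 0 \<partial>(lborel :: (real^3) measure))"
  proof (rule integral_dominated_convergence[OF _ _ w])
    show "(\<lambda>y. ball_weight R y * exp (- real n * norm y)) \<in> borel_measurable lborel" for n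
      using m by measurable
    show "AE y in lborel. (\<lambda>n. ball_weight R y * exp (- real n * norm y)) \<longlonglongrightarrow> 0"
      using AE_lborel_singleton[of "0::real^3"]
    proof eventually_elim
      case (elim y)
      then have "norm y > 0" by simp
      then have "(\<lambda>n. exp (- real n * norm y)) \<longlonglongrightarrow> 0" by real_asymp
      then show ?case using tendsto_mult_right_zero by blast
    qed
    show "AE y in lborel. norm (ball_weight R y * exp (- real n * norm y)) \<le> ball_weight R y" for n
      by (auto simp: ball_weight_def abs_mult intro!: AE_I2 mult_left_le divide_right_mono)
  qed simp
  then show ?thesis by simp
qed

text \<open>The functions \<open>(x\<^sub>1 + i x\<^sub>2)\<^sup>l b(t, |x|)\<close>, characterised by first-order equations, which commute
  with the retarded potential.\<close>

definition highest_weight :: "nat \<Rightarrow> (spacetime \<Rightarrow> complex) \<Rightarrow> bool" where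
  "highest_weight l u \<longleftrightarrow> (\<forall>p. rot 1 2 u p = \<i> * of_nat l * u p) \<and> (\<forall>p. rot 1 3 u p + \<i> * rot 2 3 u p = 0)"

lemma rot_mult:
  "smooth u \<Longrightarrow> smooth v \<Longrightarrow> rot i j (\<lambda>p. u p * v p) p = rot i j u p * v p + u p * rot i j v p"
  by (simp add: rot_def pd_mult algebra_simps)

lemma highest_weight_mult:
  assumes "smooth W" "smooth u" "\<And>i j p. rot i j W p = 0" "highest_weight l u"
  shows "highest_weight l (\<lambda>p. W p * u p)"
proof -
  have r: "rot i j (\<lambda>p. W p * u p) p = W p * rot i j u p" for i j p
    using assms by (simp add: rot_mult)
  have "W p * rot 1 3 u p + \<i> * (W p * rot 2 3 u p) = W p * (rot 1 3 u p + \<i> * rot 2 3 u p)" for p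
    by (simp add: algebra_simps)
  then show ?thesis
    using assms(4) unfolding highest_weight_def r by simp
qed

text \<open>The potential is linear and commutes with \<open>rot\<close>, and the defining equations
  are linear in rotations.\<close>

lemma highest_weight_potential:
  assumes F: "forward_supported R F" "smooth F" and hw: "highest_weight l F"
  shows "highest_weight l (potential F)"
proof -
  note fr = forward_supported_rot[OF F(1)] smooth_rot[OF F(2)]
  have "rot 1 2 (potential F) p = \<i> * of_nat l * potential F p" for p
  proof -
    have "rot 1 2 F = (\<lambda>q. (\<i> * of_nat l) * F q)" using hw unfolding highest_weight_def by (simp add: fun_eq_iff)
    then show ?thesis unfolding rot_potential[OF F] using potential_cmult[of "\<i> * of_nat l" F p] by simp
  qed
  moreover have "rot 1 3 (potential F) p + \<i> * rot 2 3 (potential F) p = 0" for p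
  proof -
    have s: "smooth (\<lambda>q. \<i> * rot 2 3 F q)" by (intro smooth_intros fr)
    have "rot 1 3 (potential F) p + \<i> * rot 2 3 (potential F) p = potential (\<lambda>q. rot 1 3 F q + \<i> * rot 2 3 F q) p"
      unfolding rot_potential[OF F]
      by (subst potential_add[OF fr forward_supported_mult[OF fr(1)] s]) (simp add: potential_cmult)
    also have "\<dots> = 0" using hw unfolding highest_weight_def by (simp add: potential_def)
    finally show ?thesis .
  qed
  ultimately show ?thesis unfolding highest_weight_def by blast
qed

text \<open>Terms of the Born series of \<open>flat_box\<close> \<phi> + W \<phi> = F: each is the
  retarded response to minus W times its predecessor.\<close>

primrec born :: "(spacetime \<Rightarrow> complex) \<Rightarrow> (spacetime \<Rightarrow> complex) \<Rightarrow> nat \<Rightarrow> spacetime \<Rightarrow> complex" where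
  "born W F 0 = potential F"
| "born W F (Suc n) = potential (\<lambda>p. (- W p) * born W F n p)"

context
  fixes W F :: "spacetime \<Rightarrow> complex" and R :: real
  assumes W: "smooth W" and F: "forward_supported R F" "smooth F" and R: "R \<ge> 0"
begin

lemma born_smooth: "smooth (born W F n)" "forward_supported R (born W F n)"
proof -
  have "smooth (born W F n) \<and> forward_supported R (born W F n)"
  proof (induction n)
    case 0
    then show ?case using smooth_potential(1)[OF F] forward_supported_potential[OF F(1)] by simp
  next
    case (Suc n)
    then have "smooth (\<lambda>p. (- W p) * born W F n p)" "forward_supported R (\<lambda>p. (- W p) * born W F n p)"
      by (intro smooth_intros forward_supported_mult; use W in blast)+
    then show ?case using smooth_potential(1) forward_supported_potential by (simp only: born.simps)
  qed
  then show "smooth (born W F n)" "forward_supported R (born W F n)" by auto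
qed

lemma born_source: "smooth (\<lambda>p. (- W p) * born W F n p)" "forward_supported R (\<lambda>p. (- W p) * born W F n p)"
  by (intro smooth_intros forward_supported_mult W born_smooth)+

text \<open>Geometric decay in a norm with weight \<open>exp (\<kappa> t)\<close>: the potential gains a factor tending to
  zero as \<open>\<kappa> \<rightarrow> \<infinity>\<close>.\<close>

lemma born_bound:
  "\<exists>M. \<forall>n ms p. length ms \<le> k \<longrightarrow> p $ None \<le> T \<longrightarrow> norm (iter_pd ms (born W F n) p) \<le> M * (1/2) ^ n"
proof -
  define T' where "T' = max T 0"
  have T'0: "T' \<ge> 0" by (simp add: T'_def)
  \<comment> \<open>Up to time T' a forward supported function lives where |t| \<le> T' + 1 and |x|
    \<le> R + T' + 1; r is the sum of these bounds.\<close>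
  define r where "r = R + 2 * T' + 2"
  have inside: "norm p \<le> r" if "p $ None \<le> T'" "forward_supported R u" "u p \<noteq> 0" for p u
  proof -
    have "\<not> (p $ None < -1 \<or> norm (space_part p) > R + p $ None + 1)"
      using forward_supportedD[OF that(2)] that(3) by blast
    then show ?thesis
      using norm_event[of "p $ None" "space_part p"] that(1) R T'0 unfolding r_def event_space_part by linarith
  qed
  from iter_pd_mult_bound[OF smooth_intros(4)[OF W], of r k] obtain C where C: "C \<ge> 0"
    "\<And>u p m ms. smooth u \<Longrightarrow> norm p \<le> r \<Longrightarrow> (\<forall>ms. length ms \<le> k \<longrightarrow> norm (iter_pd ms u p) \<le> m) \<Longrightarrow>
      length ms \<le> k \<Longrightarrow> norm (iter_pd ms (\<lambda>q. (- W q) * u q) p) \<le> C * m" by blast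
  define I where "I n = (\<integral>y. ball_weight (T' + 1) y * exp (- real n * norm y) \<partial>lborel) / green_const" for n
  have "I \<longlonglongrightarrow> 0 / green_const"
    unfolding I_def by (intro tendsto_divide damped_weight_tendsto_0 tendsto_const) (use green_const_pos in auto)
  then have "(\<lambda>n. C * I n) \<longlonglongrightarrow> 0" using tendsto_mult_right_zero by force
  then have "\<forall>\<^sub>F n in sequentially. C * I n < 1/2" by (rule order_tendstoD) simp
  \<comment> \<open>The exponent of the weight is fixed after the Leibniz constant C, so that one
    iteration halves the bound on all derivatives of order at most k simultaneously.\<close>
  then obtain N where N: "C * I N < 1/2" by (auto simp: eventually_sequentially)
  have "\<exists>B\<ge>0. \<forall>q. norm q \<le> r \<longrightarrow> norm (iter_pd ms (born W F 0) q) \<le> B" for ms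
    by (rule bounded_on_cball[OF smooth_continuous_on[OF smooth_iter_pd[OF born_smooth(1)]]])
  then obtain B where B: "\<And>ms. B ms \<ge> 0" "\<And>ms q. norm q \<le> r \<Longrightarrow> norm (iter_pd ms (born W F 0) q) \<le> B ms" by metis
  define fin where "fin = {ms::3 option list. length ms \<le> k}"
  have fin: "finite fin" unfolding fin_def using finite_lists_length_le[of "UNIV :: 3 option set" k] by simp
  \<comment> \<open>Times as early as -1 occur; the factor exp N makes the weighted bound on the
    first term hold there.\<close>
  define M where "M = (\<Sum>ms\<in>fin. B ms) * exp (real N)"
  have M0: "M \<ge> 0" by (simp add: M_def B sum_nonneg)
  have main: "norm (iter_pd ms (born W F n) p) \<le> M * (1/2) ^ n * exp (real N * (p $ None))"
    if "length ms \<le> k" "p $ None \<le> T'" for n ms p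
    using that
  proof (induction n arbitrary: ms p)
    case 0
    show ?case
    proof (cases "iter_pd ms (born W F 0) p = 0")
      case False
      have fs: "forward_supported R (iter_pd ms (born W F 0))"
        by (intro forward_supported_iter_pd born_smooth)
      have "p $ None \<ge> -1" using forward_supportedD[OF fs, of p] False by force
      then have "exp (- real N) \<le> exp (real N * (p $ None))"
        using mult_left_mono[of "-1" "p $ None" "real N"] by simp
      then have e1: "1 \<le> exp (real N) * exp (real N * (p $ None))"
        by (simp add: exp_minus field_simps)
      have "norm (iter_pd ms (born W F 0) p) \<le> B ms" by (rule B(2)[OF inside[OF 0(2) fs False]])
      also have "\<dots> \<le> (\<Sum>ms\<in>fin. B ms)" by (rule member_le_sum) (use 0 fin B in \<open>auto simp: fin_def\<close>)
      also have "\<dots> * 1 \<le> (\<Sum>ms\<in>fin. B ms) * (exp (real N) * exp (real N * (p $ None)))"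
        by (intro mult_left_mono e1 sum_nonneg B)
      finally show ?thesis by (simp add: M_def mult_ac)
    qed (use M0 in simp)
  next
    case (Suc n)
    define G where "G = iter_pd ms (\<lambda>p. (- W p) * born W F n p)"
    have G: "forward_supported R G" "smooth G"
      unfolding G_def by (intro forward_supported_iter_pd smooth_iter_pd born_source)+
    have eq: "iter_pd ms (born W F (Suc n)) p = potential G p"
      unfolding born.simps G_def by (subst iter_pd_potential[OF born_source(2) born_source(1)]) simp
    have "norm (potential G p) \<le> (C * (M * (1/2) ^ n)) * exp (real N * (p $ None)) *
      ((\<integral>y. ball_weight (T' + 1) y * exp (- real N * norm y) \<partial>lborel) / green_const)"
    proof (rule potential_bound[OF G _ _ Suc.prems(2)])
      fix q :: spacetime assume q: "q $ None \<le> T'"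
      show "norm (G q) \<le> C * (M * (1/2) ^ n) * exp (real N * (q $ None))"
      proof (cases "G q = 0")
        case False
        have "norm (G q) \<le> C * (M * (1/2) ^ n * exp (real N * (q $ None)))"
          unfolding G_def
          by (rule C(2)[OF born_smooth(1) inside[OF q G(1) False] _ Suc.prems(1)]) (use Suc.IH q in blast)
        then show ?thesis by (simp add: mult_ac)
      qed (use C M0 in simp)
    qed simp
    also have "\<dots> = (C * I N) * (M * (1/2) ^ n * exp (real N * (p $ None)))" by (simp add: I_def mult_ac)
    also have "\<dots> \<le> 1/2 * (M * (1/2) ^ n * exp (real N * (p $ None)))"
      using N M0 by (intro mult_right_mono) auto
    finally show ?case unfolding eq by (simp add: mult_ac)
  qed
  show ?thesis
  proof (intro exI[of _ "M * exp (real N * T')"] allI impI)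
    fix n and ms :: "3 option list" and p :: spacetime assume ms: "length ms \<le> k" and p: "p $ None \<le> T"
    have p': "p $ None \<le> T'" using p by (simp add: T'_def)
    have "norm (iter_pd ms (born W F n) p) \<le> M * (1/2) ^ n * exp (real N * (p $ None))"
      by (rule main[OF ms p'])
    also have "\<dots> \<le> M * (1/2) ^ n * exp (real N * T')"
      using M0 p' by (intro mult_left_mono) (auto intro: mult_left_mono)
    finally show "norm (iter_pd ms (born W F n) p) \<le> M * exp (real N * T') * (1/2) ^ n" by (simp add: mult_ac)
  qed
qed

lemma born_majorant: "\<exists>M. summable M \<and> (\<forall>n p. norm p \<le> r \<longrightarrow> norm (iter_pd ms (born W F n) p) \<le> M n)"
proof -
  obtain M where M: "\<And>n p. p $ None \<le> r \<Longrightarrow> norm (iter_pd ms (born W F n) p) \<le> M * (1/2) ^ n"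
    using born_bound[of "length ms" r] by blast
  show ?thesis
  proof (intro exI[of _ "\<lambda>n. M * (1/2) ^ n"] conjI allI impI)
    show "summable (\<lambda>n. M * (1/2) ^ n)" by (intro summable_mult summable_geometric) simp
    fix n and p :: spacetime assume "norm p \<le> r"
    then have "p $ None \<le> r" using component_le_norm_cart[of p None] by linarith
    then show "norm (iter_pd ms (born W F n) p) \<le> M * (1/2) ^ n" by (rule M)
  qed
qed

text \<open>Applied termwise, \<open>flat_box\<close> shifts the series by one index and leaves F
  minus W times the sum. A radial W keeps every term in the same weight space.\<close>

lemma flat_wave_potential_exists:
  "\<exists>\<phi>. smooth \<phi> \<and> forward_supported R \<phi> \<and> (\<forall>p. flat_box \<phi> p + W p * \<phi> p = F p) \<and>
     (\<forall>l. (\<forall>i j p. rot i j W p = 0) \<longrightarrow> highest_weight l F \<longrightarrow> highest_weight l \<phi>)"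
proof -
  define \<phi> where "\<phi> p = (\<Sum>n. born W F n p)" for p
  note s0 = smooth_series[where u="born W F", OF born_smooth(1) born_majorant, folded \<phi>_def]
  have maj1: "\<exists>M. summable M \<and> (\<forall>n p. norm p \<le> r \<longrightarrow> norm (iter_pd ms (pd \<mu> (born W F n)) p) \<le> M n)" for ms r \<mu>
    using born_majorant[of r "\<mu> # ms"] by simp
  have maj2: "\<exists>M. summable M \<and> (\<forall>n p. norm p \<le> r \<longrightarrow> norm (iter_pd ms (pd \<nu> (pd \<mu> (born W F n))) p) \<le> M n)" for ms r \<mu> \<nu>
    using born_majorant[of r "\<mu> # \<nu> # ms"] by simp
  have p1: "pd \<mu> \<phi> = (\<lambda>p. \<Sum>n. pd \<mu> (born W F n) p)" for \<mu>
    using s0(2)[of \<mu>] by (simp add: \<phi>_def[abs_def])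
  note s1 = smooth_series[where u="\<lambda>n. pd _ (born W F n)", OF smooth_pd[OF born_smooth(1)] maj1]
  have p2: "pd \<nu> (pd \<mu> \<phi>) = (\<lambda>p. \<Sum>n. pd \<nu> (pd \<mu> (born W F n)) p)" for \<mu> \<nu>
    unfolding p1 by (rule s1(2))
  note s2 = smooth_series(3)[where u="\<lambda>n. pd _ (pd _ (born W F n))", OF smooth_pd[OF smooth_pd[OF born_smooth(1)]] maj2]
  have sm: "smooth \<phi>" using s0(1) by (simp add: \<phi>_def[abs_def])
  moreover have "forward_supported R \<phi>"
    using born_smooth(2) unfolding forward_supported_def \<phi>_def by simp
  moreover have "flat_box \<phi> p + W p * \<phi> p = F p" for p
  proof -
    have sb: "summable (\<lambda>n. flat_box (born W F n) p)"
      unfolding flat_box_def by (intro summable_diff summable_sum s2)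
    have "flat_box \<phi> p = (\<Sum>n. flat_box (born W F n) p)"
      unfolding flat_box_def p2 by (subst suminf_sum[symmetric, OF s2], subst suminf_diff[OF s2 summable_sum[OF s2]]) simp
    also have "\<dots> = flat_box (born W F 0) p + (\<Sum>n. flat_box (born W F (Suc n)) p)"
      using suminf_split_head[OF sb] by simp
    also have "(\<Sum>n. flat_box (born W F (Suc n)) p) = (\<Sum>n. (- W p) * born W F n p)"
      unfolding born.simps using flat_box_potential[OF born_source(2) born_source(1)] by simp
    also have "\<dots> = (- W p) * \<phi> p"
      unfolding \<phi>_def by (rule suminf_mult[OF s0(3)])
    finally show ?thesis by (simp add: flat_box_potential[OF F])
  qed
  moreover have "highest_weight l \<phi>" if radial: "\<And>i j p. rot i j W p = 0" and hF: "highest_weight l F" for l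
  proof -
    have hb: "highest_weight l (born W F n)" for n
    proof (induction n)
      case 0
      then show ?case using highest_weight_potential[OF F hF] by simp
    next
      case (Suc n)
      have "rot i j (\<lambda>p. - W p) p = 0" for i j p
        using radial[of i j p] W by (simp add: rot_def pd_minus)
      from highest_weight_mult[OF smooth_intros(4)[OF W] born_smooth(1) this Suc]
      show ?case unfolding born.simps by (rule highest_weight_potential[OF born_source(2) born_source(1)])
    qed
    have sr: "summable (\<lambda>n. rot i j (born W F n) p)" for i j p
      unfolding rot_def by (intro summable_diff summable_mult s1(3))
    have r: "rot i j \<phi> p = (\<Sum>n. rot i j (born W F n) p)" for i j p
      unfolding rot_def p1
      by (subst suminf_mult[symmetric, OF s1(3)], subst suminf_mult[symmetric, OF s1(3)],
          subst suminf_diff[OF summable_mult[OF s1(3)] summable_mult[OF s1(3)]]) simp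
    have "rot 1 2 \<phi> p = \<i> * of_nat l * \<phi> p" for p
    proof -
      have "rot 1 2 \<phi> p = (\<Sum>n. \<i> * of_nat l * born W F n p)"
        unfolding r using hb unfolding highest_weight_def by simp
      then show ?thesis unfolding \<phi>_def using suminf_mult[OF s0(3), of "\<i> * of_nat l" p] by simp
    qed
    moreover have "rot 1 3 \<phi> p + \<i> * rot 2 3 \<phi> p = 0" for p
    proof -
      have "rot 1 3 \<phi> p + \<i> * rot 2 3 \<phi> p = (\<Sum>n. rot 1 3 (born W F n) p + \<i> * rot 2 3 (born W F n) p)"
        unfolding r by (subst suminf_mult[symmetric, OF sr], subst suminf_add[OF sr summable_mult[OF sr]]) simp
      also have "\<dots> = 0" using hb unfolding highest_weight_def by simp
      finally show ?thesis .
    qed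
    ultimately show ?thesis unfolding highest_weight_def by blast
  qed
  ultimately show ?thesis by blast
qed

end

section \<open>Radial coefficients\<close>

definition sq :: "spacetime \<Rightarrow> real" where
  "sq p = (\<Sum>i\<in>UNIV. (p $ Some i)\<^sup>2)"

text \<open>Profiles are functions of s = r^2 rather than of r: a smooth profile then gives a
  function smooth across the origin.\<close>

definition radial :: "(real \<Rightarrow> real) \<Rightarrow> spacetime \<Rightarrow> complex" where
  "radial b p = complex_of_real (b (sq p))"

text \<open>The field r d/dr, which unlike d/dr has smooth coefficients.\<close>

definition euler :: "(spacetime \<Rightarrow> complex) \<Rightarrow> spacetime \<Rightarrow> complex" where
  "euler u p = (\<Sum>i\<in>UNIV. coord i p * pd (Some i) u p)"

definition laplacian :: "(spacetime \<Rightarrow> complex) \<Rightarrow> spacetime \<Rightarrow> complex" where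
  "laplacian u p = (\<Sum>i\<in>UNIV. pd (Some i) (pd (Some i) u) p)"

text \<open>The operator \<open>\<partial>\<^sub>i ((\<delta>\<^sub>i\<^sub>j + \<beta> x\<^sub>i x\<^sub>j) \<partial>\<^sub>j u)\<close>, whose coefficients are \<open>sqrt (det g0)\<close> times the inverse of \<open>g0\<close>.\<close>

definition elliptic :: "(real \<Rightarrow> real) \<Rightarrow> (spacetime \<Rightarrow> complex) \<Rightarrow> spacetime \<Rightarrow> complex" where
  "elliptic \<beta> u p = laplacian u p + (\<Sum>i\<in>UNIV. pd (Some i) (\<lambda>q. radial \<beta> q * coord i q * euler u q) p)"

lemma sq_eq: "sq p = (norm (space_part p))\<^sup>2"
  unfolding sq_def power2_norm_eq_inner inner_vec_def by (simp add: power2_eq_square)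

lemma sq_event [simp]: "sq (event t x) = (norm x)\<^sup>2"
  by (simp add: sq_eq)

lemma smooth_sq: "smooth sq"
  unfolding sq_def[abs_def] by (intro smooth_intros smooth_nth)

lemma smooth_radial: "smooth b \<Longrightarrow> smooth (radial b)"
  unfolding radial_def[abs_def] by (rule smooth_of_real[OF smooth_compose[OF _ smooth_sq]])

lemma smooth_euler: "smooth u \<Longrightarrow> smooth (euler u)"
  unfolding euler_def[abs_def] by (intro smooth_intros smooth_pd smooth_coord)

lemma smooth_laplacian: "smooth u \<Longrightarrow> smooth (laplacian u)"
  unfolding laplacian_def[abs_def] by (intro smooth_intros smooth_pd)

lemma smooth_elliptic: "smooth \<beta> \<Longrightarrow> smooth u \<Longrightarrow> smooth (elliptic \<beta> u)"
  unfolding elliptic_def[abs_def]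
  by (intro smooth_intros smooth_pd smooth_laplacian smooth_radial smooth_coord smooth_euler)

section \<open>Calculus of radial profiles\<close>

lemma smooth_real_deriv:
  fixes b :: "real \<Rightarrow> real"
  assumes "smooth b"
  shows "(b has_real_derivative deriv b s) (at s)" and "smooth (deriv b)"
proof -
  have d: "(b has_derivative frechet_derivative b (at s)) (at s)" for s
    using smooth_on_has_derivative[of UNIV b] assms by (simp add: smooth_on_UNIV)
  have *: "(b has_real_derivative frechet_derivative b (at s) 1) (at s)" for s
  proof -
    interpret bounded_linear "frechet_derivative b (at s)" by (rule has_derivative_bounded_linear[OF d])
    have "frechet_derivative b (at s) = (*) (frechet_derivative b (at s) 1)"
    proof
      fix h show "frechet_derivative b (at s) h = frechet_derivative b (at s) 1 * h"
        using scaleR[of h 1] by simp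
    qed
    then show ?thesis using d[of s] unfolding has_field_derivative_def by simp
  qed
  then have eq: "deriv b = (\<lambda>s. frechet_derivative b (at s) 1)"
    by (auto intro!: DERIV_imp_deriv)
  show "(b has_real_derivative deriv b s) (at s)" unfolding eq by (rule *)
  show "smooth (deriv b)"
    unfolding eq using smooth_on_frechet_derivative[of UNIV b 1] assms by (simp add: smooth_on_UNIV)
qed

lemma deriv_locally_constant:
  fixes g :: "real \<Rightarrow> real"
  assumes "open T" "t \<in> T" "\<And>s. s \<in> T \<Longrightarrow> g s = c"
  shows "deriv g t = 0"
proof -
  have "((\<lambda>s. c) has_real_derivative 0) (at t)" by simp
  then have "(g has_real_derivative 0) (at t)"
    by (rule has_field_derivative_transform_within_open[OF _ assms(1,2)]) (simp add: assms(3))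
  then show ?thesis by (rule DERIV_imp_deriv)
qed

lemma pd_radial:
  assumes "smooth b"
  shows "pd None (radial b) = (\<lambda>p. 0)" and "pd (Some i) (radial b) = (\<lambda>p. 2 * coord i p * radial (deriv b) p)"
proof -
  have ds: "(sq has_derivative (\<lambda>h. \<Sum>i\<in>UNIV. 2 * (p $ Some i) * (h $ Some i))) (at p)" for p
    unfolding sq_def[abs_def]
    by (auto intro!: derivative_eq_intros bounded_linear.has_derivative[OF bounded_linear_vec_nth] sum.cong simp: mult_ac)
  have db: "(b has_derivative (\<lambda>h. deriv b (sq p) * h)) (at (sq p))" for p
    using smooth_real_deriv(1)[OF assms] unfolding has_field_derivative_def .
  have "(radial b has_derivative (\<lambda>h. of_real (deriv b (sq p) * (\<Sum>i\<in>UNIV. 2 * (p $ Some i) * (h $ Some i))))) (at p)" for p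
    unfolding radial_def[abs_def]
    using has_derivative_of_real[OF diff_chain_at[OF ds db]] by (simp add: o_def)
  from pd_eqI[OF this] show "pd None (radial b) = (\<lambda>p. 0)" "pd (Some i) (radial b) = (\<lambda>p. 2 * coord i p * radial (deriv b) p)"
    by (auto simp: axis_def radial_def coord_def if_distrib cong: if_cong)
qed

lemma rot_radial: "smooth b \<Longrightarrow> rot i j (radial b) p = 0"
  by (simp add: rot_def pd_radial)

lemma sum_coord_square: "(\<Sum>i\<in>UNIV. coord i p * coord i p) = of_real (sq p)"
  by (simp add: coord_def sq_def power2_eq_square)

lemma euler_radial: "smooth b \<Longrightarrow> euler (radial b) = radial (\<lambda>s. 2 * s * deriv b s)"
proof
  fix p assume b: "smooth b"
  have "euler (radial b) p = 2 * (\<Sum>i\<in>UNIV. coord i p * coord i p) * radial (deriv b) p"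
    by (simp add: euler_def pd_radial[OF b] sum_distrib_left sum_distrib_right mult_ac)
  then show "euler (radial b) p = radial (\<lambda>s. 2 * s * deriv b s) p"
    by (simp add: sum_coord_square radial_def)
qed

lemma euler_mult: "smooth u \<Longrightarrow> smooth v \<Longrightarrow> euler (\<lambda>p. u p * v p) = (\<lambda>p. euler u p * v p + u p * euler v p)"
  by (simp add: euler_def pd_mult fun_eq_iff sum.distrib[symmetric] sum_distrib_left sum_distrib_right algebra_simps)

lemma euler_diff: "smooth u \<Longrightarrow> smooth v \<Longrightarrow> euler (\<lambda>p. u p - v p) = (\<lambda>p. euler u p - euler v p)"
  by (simp add: euler_def pd_diff fun_eq_iff sum_subtractf[symmetric] algebra_simps)

lemma euler_add: "smooth u \<Longrightarrow> smooth v \<Longrightarrow> euler (\<lambda>p. u p + v p) = (\<lambda>p. euler u p + euler v p)"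
  by (simp add: euler_def pd_add fun_eq_iff sum.distrib[symmetric] algebra_simps)

lemma euler_cmult: "smooth u \<Longrightarrow> euler (\<lambda>p. c * u p) = (\<lambda>p. c * euler u p)"
  by (simp add: euler_def pd_cmult fun_eq_iff sum_distrib_left algebra_simps)

text \<open>The constant 3 is the divergence of the position field.\<close>

lemma elliptic_eq:
  assumes "smooth \<beta>" "smooth u"
  shows "elliptic \<beta> u p = laplacian u p + (3 * radial \<beta> p + euler (radial \<beta>) p) * euler u p + radial \<beta> p * euler (euler u) p"
proof -
  have "pd (Some i) (\<lambda>q. radial \<beta> q * coord i q * euler u q) p
    = (coord i p * pd (Some i) (radial \<beta>) p) * euler u p + radial \<beta> p * euler u p
      + radial \<beta> p * (coord i p * pd (Some i) (euler u) p)" for i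
    using assms by (simp add: pd_mult smooth_intros smooth_radial smooth_coord smooth_euler pd_coord algebra_simps)
  then show ?thesis
    unfolding elliptic_def
    by (simp add: sum_3 euler_def[of "radial \<beta>" p] euler_def[of "euler u" p] algebra_simps)
qed

text \<open>Identities proved after multiplication by r^2 are first obtained off the origin; by
  continuity it suffices to approach a point through points off finitely many spheres.\<close>

lemma continuous_eq_off_spheres:
  assumes "smooth u" "smooth v" "finite E" "\<And>p. sq p \<notin> E \<Longrightarrow> u p = (v p :: complex)"
  shows "u p = v p"
proof -
  define q where "q n = p + (1 / real (Suc n)) *\<^sub>R axis (Some 1) 1" for n
  have lim: "q \<longlonglongrightarrow> p + 0 *\<^sub>R axis (Some 1) 1"
    unfolding q_def by (intro tendsto_intros LIMSEQ_Suc[OF lim_1_over_n])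
  \<comment> \<open>Along the x_1 direction r^2 is a quadratic polynomial in the step, so a
    prescribed value is avoided for all sufficiently small nonzero steps.\<close>
  have sqq: "sq (q n) = sq p + 2 * (p $ Some 1) * (1 / real (Suc n)) + (1 / real (Suc n))\<^sup>2" for n
  proof -
    have "(q n $ Some i)\<^sup>2 = (p $ Some i)\<^sup>2 + (if i = 1 then 2 * (p $ Some 1) * (1 / real (Suc n)) + (1 / real (Suc n))\<^sup>2 else 0)" for i
      by (auto simp: q_def axis_def power2_sum)
    then show ?thesis by (simp add: sq_def sum.distrib)
  qed
  have ev: "\<forall>\<^sub>F n in sequentially. sq (q n) \<noteq> c" for c
  proof -
    have "\<forall>\<^sub>F n in sequentially. sq p - c + 2 * (p $ Some 1) * (1 / real (Suc n)) + (1 / real (Suc n))\<^sup>2 \<noteq> 0"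
    proof (cases "sq p = c")
      case False
      have "(\<lambda>n. sq p - c + 2 * (p $ Some 1) * (1 / real (Suc n)) + (1 / real (Suc n))\<^sup>2) \<longlonglongrightarrow> sq p - c + 2 * (p $ Some 1) * 0 + 0\<^sup>2"
        by (intro tendsto_intros LIMSEQ_Suc[OF lim_1_over_n])
      then show ?thesis using False by (intro tendsto_imp_eventually_ne) auto
    next
      case True
      have "\<forall>\<^sub>F n in sequentially. 2 * (p $ Some 1) + 1 / real (Suc n) \<noteq> 0"
      proof (cases "p $ Some 1 = 0")
        case False
        have "(\<lambda>n. 2 * (p $ Some 1) + 1 / real (Suc n)) \<longlonglongrightarrow> 2 * (p $ Some 1) + 0"
          by (intro tendsto_intros LIMSEQ_Suc[OF lim_1_over_n])
        from tendsto_imp_eventually_ne[OF this, of 0] False show ?thesis by simp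
      qed simp
      then show ?thesis
      proof eventually_elim
        case (elim n)
        have "sq p - c + 2 * (p $ Some 1) * (1 / real (Suc n)) + (1 / real (Suc n))\<^sup>2
          = (1 / real (Suc n)) * (2 * (p $ Some 1) + 1 / real (Suc n))"
          using True by (simp add: power2_eq_square algebra_simps)
        then show ?case using elim by simp
      qed
    qed
    then show ?thesis by eventually_elim (auto simp: sqq algebra_simps)
  qed
  have "\<forall>\<^sub>F n in sequentially. \<forall>c\<in>E. sq (q n) \<noteq> c"
    using assms(3) ev by (simp add: eventually_ball_finite_distrib)
  then have "\<forall>\<^sub>F n in sequentially. u (q n) = v (q n)"
    by eventually_elim (auto intro: assms(4))
  moreover have lim': "(\<lambda>n. w (q n)) \<longlonglongrightarrow> w p" if "smooth w" for w :: "spacetime \<Rightarrow> complex"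
    using continuous_on_tendsto_compose[OF smooth_continuous_on[OF that, of UNIV] lim] by simp
  ultimately have "(\<lambda>n. v (q n)) \<longlonglongrightarrow> u p"
    using assms(1) by (auto intro: Lim_transform_eventually)
  then show ?thesis using lim' assms(2) LIMSEQ_unique by blast
qed

text \<open>The first-order equations determine the gradient: with z = x_1 + i x_2 and D = r u_r - l
  u they give r^2 u_3 = x_3 D and r^2 (u_1 + i u_2) = z D. Applying d_3 to the first and d_1 - i d_2
  to the second produces r^2 times the Laplacian, with angular eigenvalue l (l + 1).\<close>

lemma highest_weight_laplacian:
  assumes hw: "highest_weight l u" and u: "smooth u"
  shows "of_real (sq p) * laplacian u p = euler (euler u) p + euler u p - of_nat l * (of_nat l + 1) * u p"
proof -
  let ?d = "\<lambda>i. pd (Some i)"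
  note sm = u smooth_pd[OF u] smooth_pd[OF smooth_pd[OF u]]
  define z where "z p = coord 1 p + \<i> * coord 2 p" for p
  define D where "D p = euler u p - of_nat l * u p" for p
  define ss where "ss p = coord 1 p * coord 1 p + coord 2 p * coord 2 p + coord 3 p * coord 3 p" for p
  have ss: "ss p = of_real (sq p)" for p using sum_coord_square[of p] by (simp add: ss_def sum_3)
  have eu: "euler w p = coord 1 p * ?d 1 w p + coord 2 p * ?d 2 w p + coord 3 p * ?d 3 w p" for w p
    by (simp add: euler_def sum_3)
  have h1: "coord 1 p * ?d 2 u p - coord 2 p * ?d 1 u p = \<i> * of_nat l * u p" for p
    using hw by (simp add: highest_weight_def rot_def)
  have h2: "coord 1 p * ?d 3 u p - coord 3 p * ?d 1 u p + \<i> * (coord 2 p * ?d 3 u p - coord 3 p * ?d 2 u p) = 0" for p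
    using hw by (simp add: highest_weight_def rot_def)
  have h2': "z p * ?d 3 u p = coord 3 p * (?d 1 u p + \<i> * ?d 2 u p)" for p
    using h2[of p] by (simp add: z_def algebra_simps)
  have ii: "\<i> * \<i> = -1" by simp
  have zb: "(coord 1 p - \<i> * coord 2 p) * (?d 1 u p + \<i> * ?d 2 u p) = D p - coord 3 p * ?d 3 u p" for p
    unfolding D_def eu using h1[of p] ii by algebra
  have zz: "ss p = z p * (coord 1 p - \<i> * coord 2 p) + coord 3 p * coord 3 p" for p
    unfolding ss_def z_def using ii by algebra
  have i1: "(\<lambda>p. ss p * ?d 3 u p) = (\<lambda>p. coord 3 p * D p)"
  proof
    fix p show "ss p * ?d 3 u p = coord 3 p * D p"
      unfolding zz using h2'[of p] zb[of p] by algebra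
  qed
  have i2: "(\<lambda>p. ss p * (?d 1 u p + \<i> * ?d 2 u p)) = (\<lambda>p. z p * D p)"
  proof
    fix p show "ss p * (?d 1 u p + \<i> * ?d 2 u p) = z p * D p"
      unfolding zz using h2'[of p] zb[of p] by algebra
  qed
  have smz: "smooth z" "smooth ss" "smooth D"
    unfolding z_def[abs_def] ss_def[abs_def] D_def[abs_def]
    by (intro smooth_intros smooth_coord smooth_euler u)+
  have pss: "pd (Some i) ss p = 2 * coord i p" for i p
    using exhaust_3[of i] unfolding ss_def[abs_def]
    by (auto simp: pd_add pd_mult pd_coord smooth_intros smooth_coord)
  have pz: "pd (Some i) z p = (if i = 1 then 1 else if i = 2 then \<i> else 0)" for i p
    unfolding z_def[abs_def] by (simp add: pd_add pd_cmult pd_coord smooth_intros smooth_coord)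
  have e1: "2 * coord 3 p * ?d 3 u p + ss p * ?d 3 (?d 3 u) p = D p + coord 3 p * ?d 3 D p"
    using fun_cong[OF arg_cong[OF i1, of "pd (Some 3)"], of p]
    by (simp add: pd_mult smooth_coord smz sm pss pd_coord)
  have p2: "pd (Some i) (\<lambda>p. ?d 1 u p + \<i> * ?d 2 u p) p = ?d i (?d 1 u) p + \<i> * ?d i (?d 2 u) p" for i
    by (simp add: pd_add pd_cmult smooth_intros sm)
  have s2: "smooth (\<lambda>p. ?d 1 u p + \<i> * ?d 2 u p)" by (intro smooth_intros sm)
  have e2: "2 * coord i p * (?d 1 u p + \<i> * ?d 2 u p) + ss p * (?d i (?d 1 u) p + \<i> * ?d i (?d 2 u) p)
      = (if i = 1 then 1 else if i = 2 then \<i> else 0) * D p + z p * ?d i D p" for i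
    using fun_cong[OF arg_cong[OF i2, of "pd (Some i)"], of p]
    by (simp only: pd_mult[OF smz(2) s2] pd_mult[OF smz(1,3)] pss pz p2)
  have c12: "?d 1 (?d 2 u) p = ?d 2 (?d 1 u) p" for p by (subst pd_commute[OF u]) simp
  have pD: "?d i D p = ?d i (euler u) p - of_nat l * ?d i u p" for i p
    unfolding D_def[abs_def] by (simp add: pd_diff pd_cmult smooth_intros smooth_euler u)
  have pe: "?d i (euler u) p = ?d i u p + (coord 1 p * ?d 1 (?d i u) p + coord 2 p * ?d 2 (?d i u) p + coord 3 p * ?d 3 (?d i u) p)" for i p
  proof -
    have "?d i (euler u) p = (if i = 1 then ?d 1 u p else 0) + (if i = 2 then ?d 2 u p else 0) + (if i = 3 then ?d 3 u p else 0)
      + (coord 1 p * ?d i (?d 1 u) p + coord 2 p * ?d i (?d 2 u) p + coord 3 p * ?d i (?d 3 u) p)"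
      unfolding euler_def[abs_def] sum_3
      by (simp add: pd_add pd_mult smooth_intros smooth_coord sm pd_coord)
    also have "\<dots> = ?d i u p + (coord 1 p * ?d i (?d 1 u) p + coord 2 p * ?d i (?d 2 u) p + coord 3 p * ?d i (?d 3 u) p)"
      using exhaust_3[of i] by auto
    finally show ?thesis
      by (simp add: pd_commute[OF u, of "Some i" "Some 1"] pd_commute[OF u, of "Some i" "Some 2"] pd_commute[OF u, of "Some i" "Some 3"])
  qed
  have h1d: "?d i (\<lambda>p. coord 1 p * ?d 2 u p - coord 2 p * ?d 1 u p) p = \<i> * of_nat l * ?d i u p" for i p
  proof -
    have "(\<lambda>p. coord 1 p * ?d 2 u p - coord 2 p * ?d 1 u p) = (\<lambda>p. (\<i> * of_nat l) * u p)" using h1 by auto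
    then show ?thesis by (simp add: pd_cmult[OF u])
  qed
  have h1d': "(if i = 1 then ?d 2 u p else 0) - (if i = 2 then ?d 1 u p else 0) +
     (coord 1 p * ?d i (?d 2 u) p - coord 2 p * ?d i (?d 1 u) p) = \<i> * of_nat l * ?d i u p" for i p
    using h1d[of i p] by (auto simp: pd_diff pd_mult smooth_intros smooth_coord sm pd_coord algebra_simps split: if_splits)
  \<comment> \<open>The Euler field commutes with rotations, so \<open>euler u\<close>, and hence D,
    satisfies the same equation under \<open>rot 1 2\<close>.\<close>
  have h1e: "coord 1 p * ?d 2 (euler u) p - coord 2 p * ?d 1 (euler u) p = \<i> * of_nat l * euler u p" for p
  proof -
    have "coord 1 p * ?d 2 (euler u) p - coord 2 p * ?d 1 (euler u) p
      = coord 1 p * (?d 2 u p + (coord 1 p * ?d 1 (?d 2 u) p - coord 2 p * ?d 1 (?d 1 u) p))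
      + coord 2 p * (- ?d 1 u p + (coord 1 p * ?d 2 (?d 2 u) p - coord 2 p * ?d 2 (?d 1 u) p))
      + coord 3 p * (coord 1 p * ?d 3 (?d 2 u) p - coord 2 p * ?d 3 (?d 1 u) p)"
      unfolding pe by (simp add: algebra_simps)
    also have "\<dots> = coord 1 p * (\<i> * of_nat l * ?d 1 u p) + coord 2 p * (\<i> * of_nat l * ?d 2 u p)
      + coord 3 p * (\<i> * of_nat l * ?d 3 u p)"
      using h1d'[of 1 p] h1d'[of 2 p] h1d'[of 3 p] by simp
    finally show ?thesis unfolding eu by (simp add: algebra_simps)
  qed
  have hD: "coord 1 p * ?d 2 D p - coord 2 p * ?d 1 D p = \<i> * of_nat l * D p"
    unfolding pD D_def using h1e[of p] h1[of p] by algebra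
  have e2': "2 * coord 1 p * (?d 1 u p + \<i> * ?d 2 u p) + ss p * (?d 1 (?d 1 u) p + \<i> * ?d 1 (?d 2 u) p) = D p + z p * ?d 1 D p"
    "2 * coord 2 p * (?d 1 u p + \<i> * ?d 2 u p) + ss p * (?d 2 (?d 1 u) p + \<i> * ?d 2 (?d 2 u) p) = \<i> * D p + z p * ?d 2 D p"
    using e2[of 1] e2[of 2] by simp_all
  have eD: "euler D p = euler (euler u) p - of_nat l * euler u p"
    unfolding D_def[abs_def] by (simp add: euler_diff euler_cmult smooth_intros smooth_euler u)
  have "ss p * (?d 1 (?d 1 u) p + ?d 2 (?d 2 u) p + ?d 3 (?d 3 u) p) = D p + euler D p + of_nat l * D p"
  proof -
    \<comment> \<open>The first part of \<open>e2'\<close> minus \<i> times the second; the mixed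
      second derivatives cancel.\<close>
    have s1: "2 * ((coord 1 p - \<i> * coord 2 p) * (?d 1 u p + \<i> * ?d 2 u p)) + ss p * (?d 1 (?d 1 u) p + ?d 2 (?d 2 u) p)
      = 2 * D p + z p * (?d 1 D p - \<i> * ?d 2 D p)"
      using e2' c12[of p] ii by algebra
    have s2: "z p * (?d 1 D p - \<i> * ?d 2 D p) = coord 1 p * ?d 1 D p + coord 2 p * ?d 2 D p + of_nat l * D p"
      unfolding z_def using hD ii by algebra
    show ?thesis unfolding eu[of D] using e1 s1[unfolded zb s2] by algebra
  qed
  then show ?thesis
    unfolding eD D_def ss laplacian_def sum_3 by (simp add: algebra_simps)
qed

text \<open>Since s \<beta> = \<rho> - 1, multiplication by r^2 turns \<beta> into \<rho> - 1, and
  the flat terms complete this to \<rho>.\<close>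

lemma highest_weight_elliptic:
  assumes hw: "highest_weight l u" and u: "smooth u"
    and \<rho>: "smooth \<rho>" and \<beta>: "smooth \<beta>" and rel: "\<And>s. s * \<beta> s = \<rho> s - 1"
  shows "of_real (sq p) * elliptic \<beta> u p = radial \<rho> p * (euler (euler u) p + euler u p)
     + euler (radial \<rho>) p * euler u p - of_nat l * (of_nat l + 1) * u p"
proof -
  have r1: "of_real (sq p) * radial \<beta> p = radial \<rho> p - 1"
    using rel[of "sq p"] by (simp add: radial_def flip: of_real_mult)
  have r2: "of_real (sq p) * euler (radial \<beta>) p = euler (radial \<rho>) p - 2 * (radial \<rho> p - 1)"
  proof -
    have "\<rho> = (\<lambda>s. s * \<beta> s + 1)" using rel by (simp add: fun_eq_iff)
    then have "(\<rho> has_real_derivative \<beta> s + s * deriv \<beta> s) (at s)" for s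
      by (auto intro!: derivative_eq_intros smooth_real_deriv(1)[OF \<beta>])
    then have "deriv \<rho> s = \<beta> s + s * deriv \<beta> s" for s by (rule DERIV_imp_deriv)
    then have "euler (radial \<rho>) p = of_real (2 * sq p * (\<beta> (sq p) + sq p * deriv \<beta> (sq p)))"
      unfolding euler_radial[OF \<rho>] by (simp add: radial_def)
    moreover have "of_real (sq p) * euler (radial \<beta>) p = of_real (sq p * (2 * sq p * deriv \<beta> (sq p)))"
      unfolding euler_radial[OF \<beta>] by (simp add: radial_def)
    moreover have "radial \<rho> p - 1 = of_real (sq p * \<beta> (sq p))" using rel by (simp add: radial_def)
    ultimately show ?thesis by (simp add: algebra_simps)
  qed
  have "of_real (sq p) * elliptic \<beta> u p = of_real (sq p) * laplacian u p
     + (3 * (of_real (sq p) * radial \<beta> p) + of_real (sq p) * euler (radial \<beta>) p) * euler u p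
     + (of_real (sq p) * radial \<beta> p) * euler (euler u) p"
    unfolding elliptic_eq[OF \<beta> u] by (simp add: algebra_simps)
  then show ?thesis
    unfolding r1 r2 highest_weight_laplacian[OF hw u] by (simp add: algebra_simps)
qed

section \<open>Conjugation to flat principal part and solvability\<close>

lemma deriv_euler_profile:
  fixes b :: "real \<Rightarrow> real"
  assumes "smooth b"
  shows "deriv (\<lambda>s. 2 * s * deriv b s) = (\<lambda>s. 2 * deriv b s + 2 * s * deriv (deriv b) s)"
  by (rule ext, rule DERIV_imp_deriv)
    (auto intro!: derivative_eq_intros smooth_real_deriv(1)[OF smooth_real_deriv(2)[OF assms]])

lemma smooth_euler_profile: "smooth b \<Longrightarrow> smooth (\<lambda>s::real. 2 * s * deriv b s)"
  by (intro smooth_intros smooth_real_deriv(2))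

text \<open>Here \<rho>(r^2) = f(r)/r^2 will be the volume density of \<open>g0\<close>, and the
  matrix 1 + \<beta> x x^T is \<rho> times its inverse. Positivity on the whole line, negative s
  included, makes sqrt \<rho> a smooth function of one variable.\<close>

locale warped =
  fixes \<rho> \<beta> :: "real \<Rightarrow> real"
  assumes smooth_\<rho>: "smooth \<rho>" and smooth_\<beta>: "smooth \<beta>"
    and \<rho>_pos: "\<rho> s > 0" and \<beta>_eq: "s * \<beta> s = \<rho> s - 1"
begin

text \<open>Minus \<rho> times the geometric wave operator, which clears all denominators.\<close>

definition wave :: "(spacetime \<Rightarrow> complex) \<Rightarrow> spacetime \<Rightarrow> complex" where
  "wave u p = radial \<rho> p * pd None (pd None u) p - elliptic \<beta> u p"

definition sroot :: "real \<Rightarrow> real" where "sroot s = sqrt (\<rho> s)"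
definition isroot :: "real \<Rightarrow> real" where "isroot s = inverse (sqrt (\<rho> s))"

text \<open>The potential produced by conjugating \<open>wave\<close> with \<open>sqrt \<rho>\<close> on the functions of weight \<open>l\<close>.\<close>

definition mode_potential :: "nat \<Rightarrow> real \<Rightarrow> real" where
  "mode_potential l s = (4 * s * deriv (deriv sroot) s + 6 * deriv sroot s) * isroot s
     - real l * (real l + 1) * \<beta> s * (isroot s * isroot s)"

lemma smooth_sroot: "smooth sroot" "smooth isroot"
proof -
  have r: "smooth_on UNIV (\<lambda>s. sqrt (\<rho> s))"
    by (rule smooth_on_compose[OF _ _ smooth_on_sqrt]) (use smooth_\<rho> \<rho>_pos in \<open>auto simp: smooth_on_UNIV\<close>)
  then show "smooth sroot" unfolding sroot_def[abs_def] smooth_on_UNIV .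
  show "smooth isroot"
    unfolding isroot_def[abs_def] smooth_on_UNIV[symmetric]
  proof (rule smooth_on_inverse[OF _ r])
    show "sqrt (\<rho> s) \<noteq> 0" for s using \<rho>_pos[of s] by simp
  qed simp
qed

lemma sroot_isroot: "sroot s * isroot s = 1" "sroot s * sroot s = \<rho> s" "isroot s > 0"
  using \<rho>_pos[of s] by (auto simp: sroot_def isroot_def)

lemma smooth_mode_potential: "smooth (mode_potential l)"
  unfolding mode_potential_def[abs_def]
  by (intro smooth_intros smooth_sroot smooth_real_deriv(2) smooth_\<beta>)

text \<open>Dividing by sqrt \<rho> removes the first-order radial term. Besides
  \<open>flat_box\<close> there remain the Laplacian of sqrt \<rho> divided by sqrt \<rho>, and the
  difference of the warped and the flat angular terms, -l (l + 1) (\<rho> - 1)/(s \<rho>), which is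
  smooth because (\<rho> - 1)/s is \<beta>.\<close>

lemma wave_conjugation:
  assumes hw: "highest_weight l \<phi>" and \<phi>: "smooth \<phi>"
  shows "wave (\<lambda>p. radial isroot p * \<phi> p) p
    = radial sroot p * (flat_box \<phi> p + radial (mode_potential l) p * \<phi> p)"
proof (rule continuous_eq_off_spheres[where E="{0}"])
  note sm = smooth_radial[OF smooth_sroot(1)] smooth_radial[OF smooth_sroot(2)] smooth_radial[OF smooth_\<rho>]
  have sc: "smooth (\<lambda>p. radial isroot p * \<phi> p)" by (intro smooth_intros sm \<phi>)
  show "smooth (wave (\<lambda>p. radial isroot p * \<phi> p))"
    unfolding wave_def[abs_def] by (intro smooth_intros sm smooth_pd smooth_elliptic smooth_\<beta> \<phi>)
  show "smooth (\<lambda>p. radial sroot p * (flat_box \<phi> p + radial (mode_potential l) p * \<phi> p))"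
    by (intro smooth_intros sm smooth_flat_box smooth_radial smooth_mode_potential \<phi>)
  fix p assume p: "sq p \<notin> {0}"
  have hwc: "highest_weight l (\<lambda>p. radial isroot p * \<phi> p)"
    by (rule highest_weight_mult[OF sm(2) \<phi> rot_radial[OF smooth_sroot(2)] hw])
  have E1: "euler (\<lambda>p. radial isroot p * \<phi> p) = (\<lambda>p. euler (radial isroot) p * \<phi> p + radial isroot p * euler \<phi> p)"
    by (rule euler_mult[OF sm(2) \<phi>])
  have E2: "euler (euler (\<lambda>p. radial isroot p * \<phi> p)) p = euler (euler (radial isroot)) p * \<phi> p
     + 2 * (euler (radial isroot) p * euler \<phi> p) + radial isroot p * euler (euler \<phi>) p"
    unfolding E1 by (simp add: euler_add euler_mult smooth_intros smooth_euler sm \<phi>)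
  have A1: "radial isroot q * radial sroot q = 1" for q
    using sroot_isroot(1)[of "sq q"] by (simp add: radial_def mult.commute flip: of_real_mult)
  have R: "radial \<rho> = (\<lambda>q. radial sroot q * radial sroot q)"
    using sroot_isroot(2) by (simp add: radial_def fun_eq_iff flip: of_real_mult)
  have one: "euler (\<lambda>q. 1) = (\<lambda>q. 0)" by (simp add: euler_def fun_eq_iff pd_const)
  \<comment> \<open>Differentiating \<open>isroot * sroot = 1\<close> once and twice gives
    \<open>A2\<close> and \<open>A3\<close>, which eliminate the derivatives of
    \<open>isroot\<close>.\<close>
  have "euler (\<lambda>q. radial isroot q * radial sroot q) = (\<lambda>q. 0)" unfolding A1 by (rule one)
  then have A2': "(\<lambda>q. euler (radial isroot) q * radial sroot q + radial isroot q * euler (radial sroot) q) = (\<lambda>q. 0)"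
    using euler_mult[OF sm(2) sm(1)] by simp
  then have A2: "euler (radial isroot) p * radial sroot p + radial isroot p * euler (radial sroot) p = 0"
    by (rule fun_cong)
  have zero: "euler (\<lambda>q. 0) p = 0" by (simp add: euler_def pd_const)
  have A3: "euler (euler (radial isroot)) p * radial sroot p + 2 * (euler (radial isroot) p * euler (radial sroot) p)
      + radial isroot p * euler (euler (radial sroot)) p = 0"
    using arg_cong[OF A2', of "\<lambda>u. euler u p"]
    by (simp add: zero euler_add euler_mult smooth_intros smooth_euler sm add_ac)
  have A4: "euler (radial \<rho>) p = 2 * (radial sroot p * euler (radial sroot) p)"
    unfolding R by (simp add: euler_mult sm)
  have tt: "pd None (pd None (\<lambda>p. radial isroot p * \<phi> p)) p = radial isroot p * pd None (pd None \<phi>) p"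
    by (simp add: pd_mult pd_add pd_radial[OF smooth_sroot(2)] smooth_intros smooth_pd sm \<phi> pd_const)
  have W: "of_real (sq p) * radial (mode_potential l) p
    = radial isroot p * (euler (euler (radial sroot)) p + euler (radial sroot) p)
      - of_nat l * (of_nat l + 1) * (radial \<rho> p - 1) * (radial isroot p * radial isroot p)"
  proof -
    have "euler (euler (radial sroot)) p + euler (radial sroot) p
       = of_real (2 * sq p * (2 * deriv sroot (sq p) + 2 * sq p * deriv (deriv sroot) (sq p)) + 2 * sq p * deriv sroot (sq p))"
      by (simp add: euler_radial smooth_sroot smooth_euler_profile deriv_euler_profile radial_def)
    moreover have "radial \<rho> p - 1 = of_real (sq p * \<beta> (sq p))" using \<beta>_eq by (simp add: radial_def)
    ultimately show ?thesis
      unfolding mode_potential_def[abs_def] by (simp add: radial_def algebra_simps)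
  qed
  have L: "of_real (sq p) * flat_box \<phi> p = of_real (sq p) * pd None (pd None \<phi>) p
      - (euler (euler \<phi>) p + euler \<phi> p - of_nat l * (of_nat l + 1) * \<phi> p)"
    using highest_weight_laplacian[OF hw \<phi>, of p] by (simp add: flat_box_def laplacian_def right_diff_distrib)
  have Rp: "radial \<rho> p = radial sroot p * radial sroot p" using R by (simp add: fun_eq_iff)
  define a h ea eea eh eeh f ft fe fee s LL where
    "a = radial isroot p" and "h = radial sroot p" and "ea = euler (radial isroot) p"
    and "eea = euler (euler (radial isroot)) p" and "eh = euler (radial sroot) p"
    and "eeh = euler (euler (radial sroot)) p" and "f = \<phi> p" and "ft = pd None (pd None \<phi>) p"
    and "fe = euler \<phi> p" and "fee = euler (euler \<phi>) p" and "s = complex_of_real (sq p)"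
    and "LL = complex_of_nat l * (of_nat l + 1)"
  note defs = a_def[symmetric] h_def[symmetric] ea_def[symmetric] eea_def[symmetric] eh_def[symmetric]
    eeh_def[symmetric] f_def[symmetric] ft_def[symmetric] fe_def[symmetric] fee_def[symmetric] s_def[symmetric] LL_def[symmetric]
  have "s * wave (\<lambda>p. radial isroot p * \<phi> p) p = h * h * (a * ft) * s
      - (h * h * (eea * f + 2 * (ea * fe) + a * fee + (ea * f + a * fe)) + 2 * (h * eh) * (ea * f + a * fe) - LL * (a * f))"
    unfolding wave_def right_diff_distrib s_def highest_weight_elliptic[OF hwc sc smooth_\<rho> smooth_\<beta> \<beta>_eq] tt E2 A4 Rp
    unfolding E1 defs by (simp add: mult_ac)
  also have "\<dots> = h * (s * ft - (fee + fe - LL * f) + (a * (eeh + eh) - LL * (h * h - 1) * (a * a)) * f)"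
    using A1[of p] A2 A3 unfolding defs by algebra
  also have "\<dots> = s * (radial sroot p * (flat_box \<phi> p + radial (mode_potential l) p * \<phi> p))"
  proof -
    have "s * (x * (y + w * f)) = x * (s * y + (s * w) * f)" for x y w by (simp add: algebra_simps)
    then have "s * (radial sroot p * (flat_box \<phi> p + radial (mode_potential l) p * \<phi> p))
      = h * (s * flat_box \<phi> p + (s * radial (mode_potential l) p) * f)" unfolding h_def f_def .
    also have "s * flat_box \<phi> p = s * ft - (fee + fe - LL * f)" using L unfolding defs .
    also have "s * radial (mode_potential l) p = a * (eeh + eh) - LL * (h * h - 1) * (a * a)"
      using W unfolding Rp unfolding defs .
    finally show ?thesis by (rule sym)
  qed
  finally show "wave (\<lambda>p. radial isroot p * \<phi> p) p
    = radial sroot p * (flat_box \<phi> p + radial (mode_potential l) p * \<phi> p)"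
    using p by (simp add: s_def)
qed simp

text \<open>The source of the conjugated equation and the solution recovered from \<phi> both carry
  a factor \<open>isroot\<close>; \<open>wave_conjugation\<close> multiplies the former by
  \<open>sroot\<close> again.\<close>

theorem wave_exists:
  assumes G: "smooth G" "forward_supported R G" "highest_weight l G" and R: "R \<ge> 0"
  shows "\<exists>c. smooth c \<and> forward_supported R c \<and> (\<forall>p. wave c p = G p)"
proof -
  define F where "F p = radial isroot p * G p" for p
  have F: "smooth F" "forward_supported R F" "highest_weight l F"
    unfolding F_def[abs_def]
    by (intro smooth_intros smooth_radial smooth_sroot G forward_supported_mult
        highest_weight_mult rot_radial)+
  have W: "smooth (radial (mode_potential l))" by (intro smooth_radial smooth_mode_potential)
  obtain \<phi> where \<phi>: "smooth \<phi>" "forward_supported R \<phi>"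
      "\<And>p. flat_box \<phi> p + radial (mode_potential l) p * \<phi> p = F p" "highest_weight l \<phi>"
    using flat_wave_potential_exists[OF W F(2,1) R] rot_radial[OF smooth_mode_potential] F(3) by blast
  have "radial sroot p * F p = G p" for p
    using sroot_isroot(1)[of "sq p"] unfolding F_def
    by (simp add: radial_def mult.assoc[symmetric] flip: of_real_mult)
  then show ?thesis
    using \<phi> wave_conjugation[OF \<phi>(4,1)]
    by (intro exI[of _ "\<lambda>p. radial isroot p * \<phi> p"])
      (auto intro!: smooth_intros smooth_radial smooth_sroot forward_supported_mult)
qed

end

section \<open>Energy estimates\<close>

lemma continuous_slice: "continuous_on UNIV w \<Longrightarrow> continuous_on S (\<lambda>x. w (event t x))"
  by (rule continuous_on_compose2[of UNIV]) (auto intro!: continuous_event continuous_intros)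

lemma integrable_slice:
  fixes w :: "spacetime \<Rightarrow> 'b::{banach, second_countable_topology}"
  assumes "continuous_on UNIV w" "\<And>x. norm x > R \<Longrightarrow> w (event t x) = 0"
  shows "integrable lborel (\<lambda>x. w (event t x))"
proof -
  have "integrable lborel (\<lambda>x. indicator (cball 0 R) x *\<^sub>R w (event t x))"
    by (intro borel_integrable_compact continuous_slice assms) simp
  also have "(\<lambda>x. indicator (cball 0 R) x *\<^sub>R w (event t x)) = (\<lambda>x. w (event t x))"
    using assms(2) by (auto simp: fun_eq_iff indicator_def)
  finally show ?thesis .
qed

lemma event_axis: "event t (x + s *\<^sub>R axis i 1) = event t x + s *\<^sub>R axis (Some i) 1"
  by (auto simp: vec_eq_iff event_def axis_def split: option.split)

lemma event_time: "event (t + s) x = event t x + s *\<^sub>R axis None 1"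
  by (auto simp: vec_eq_iff event_def axis_def split: option.split)

lemma pd_space_eq_0:
  fixes w :: "spacetime \<Rightarrow> complex" and y :: "real^3" and i :: 3
  assumes w: "smooth w" and z: "\<And>x. norm x > R \<Longrightarrow> w (event t x) = 0" and y: "norm y > R"
  shows "pd (Some i) w (event t y) = 0"
proof (rule pd_axis_eqI[OF w])
  have "continuous_on UNIV (\<lambda>s::real. norm (y + s *\<^sub>R axis i 1))" by (intro continuous_intros)
  then have o: "open {s::real. norm (y + s *\<^sub>R axis i 1) > R}"
    by (intro open_Collect_less continuous_on_const)
  have "((\<lambda>s. 0) has_vector_derivative (0::complex)) (at (0::real))" by simp
  then show "((\<lambda>s. w (event t y + s *\<^sub>R axis (Some i) 1)) has_vector_derivative 0) (at 0)"
    by (rule has_vector_derivative_transform_within_open[OF _ o]) (use z y in \<open>auto simp: event_axis[symmetric]\<close>)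
qed

lemma integral_pd_space:
  assumes w: "smooth w" and z: "\<And>x. norm x > R \<Longrightarrow> w (event t x) = 0"
  shows "(\<integral>x. pd (Some i) w (event t x) \<partial>lborel) = 0"
proof -
  have c: "continuous_on UNIV (\<lambda>x. pd (Some i) w (event t x))"
    by (intro continuous_slice smooth_continuous_on smooth_pd w)
  from bounded_on_cball[OF c, of R] obtain B where
    B: "B \<ge> 0" "\<And>x. norm x \<le> R \<Longrightarrow> norm (pd (Some i) w (event t x)) \<le> B" by blast
  show ?thesis
  proof (rule integral_directional_derivative_zero[where Y="\<lambda>x. w (event t x)" and b="axis i 1" and R=R and B=B])
    show "((\<lambda>s. w (event t (x + s *\<^sub>R axis i 1))) has_vector_derivative pd (Some i) w (event t x)) (at 0)" for x
      using has_vector_derivative_axis[OF w, of "event t x" "Some i" 0] by (simp add: event_axis)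
    show "(\<lambda>x. w (event t x)) \<in> borel_measurable borel"
      by (intro borel_measurable_continuous_onI continuous_slice smooth_continuous_on w)
    show "integrable lborel (\<lambda>x. w (event t x))" by (intro integrable_slice smooth_continuous_on w z)
    show "norm (pd (Some i) w (event t x)) \<le> B" for x
      using B pd_space_eq_0[OF w z, where y=x and i=i] by (cases "norm x \<le> R") auto
  qed (rule z)
qed

text \<open>The integral over the slice at time s is the translation average at the event (s, 0)
  with shifts (0, -x); the ball of radius R + t + 2 contains the support for all s < t + 1.\<close>

lemma integral_slice_has_derivative:
  assumes w: "smooth w" and fs: "forward_supported R w"
  shows "((\<lambda>t. \<integral>x. w (event t x) \<partial>lborel) has_vector_derivative (\<integral>x. pd None w (event t x) \<partial>lborel)) (at t)"
proof -
  define R' where "R' = R + t + 2"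
  define ind :: "real^3 \<Rightarrow> real" where "ind = indicator (cball 0 R')"
  define e :: "real^3 \<Rightarrow> spacetime" where "e x = event 0 (- x)" for x
  have ta: "translation_average lborel ind e R'"
  proof
    show "integrable lborel ind" unfolding ind_def
      by (intro integrable_real_indicator) (auto intro: emeasure_lborel_cball_finite[simplified])
    show "e \<in> borel_measurable lborel" unfolding e_def
      by (auto intro!: borel_measurable_continuous_onI continuous_event continuous_intros)
    show "norm (e x) \<le> R'" if "ind x \<noteq> 0" for x
      using that norm_event[of 0 "-x"] by (auto simp: ind_def e_def indicator_def split: if_splits)
  qed
  have ev: "event s 0 - e x = event s x" for s x
    by (auto simp: vec_eq_iff e_def event_def split: option.split)
  have eq: "translation_average.avg lborel ind e v (event s 0) = (\<integral>x. v (event s x) \<partial>lborel)"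
    if "forward_supported R v" "s < t + 1" for v s
    unfolding translation_average.avg_def[OF ta] ev
  proof (rule Bochner_Integration.integral_cong[OF refl])
    fix x
    show "ind x *\<^sub>R v (event s x) = v (event s x)"
    proof (cases "norm x \<le> R'")
      case False
      then have "v (event s x) = 0"
        by (intro forward_supportedD[OF that(1)]) (use that(2) in \<open>auto simp: R'_def\<close>)
      then show ?thesis by simp
    qed (simp add: ind_def)
  qed
  have "((\<lambda>s. translation_average.avg lborel ind e w (event 0 0 + s *\<^sub>R axis None 1)) has_vector_derivative
      pd None (translation_average.avg lborel ind e w) (event 0 0 + t *\<^sub>R axis None 1)) (at t)"
    by (rule has_vector_derivative_axis[OF translation_average.smooth_avg[OF ta w]])
  then have "((\<lambda>s. translation_average.avg lborel ind e w (event s 0)) has_vector_derivative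
      pd None (translation_average.avg lborel ind e w) (event t 0)) (at t)"
    by (simp flip: event_time)
  then have "((\<lambda>s. \<integral>x. w (event s x) \<partial>lborel) has_vector_derivative
      pd None (translation_average.avg lborel ind e w) (event t 0)) (at t)"
    by (rule has_vector_derivative_transform_within_open[where S="{..<t+1}"]) (use eq[OF fs] in auto)
  then show ?thesis
    unfolding translation_average.pd_avg[OF ta w] by (simp add: eq[OF forward_supported_pd[OF fs]])
qed

section \<open>The energy density, its conservation law and the energy estimate\<close>

context warped
begin

text \<open>Twice the energy density times the volume density, written without inverse
  matrices.\<close>

definition wave_density :: "(spacetime \<Rightarrow> complex) \<Rightarrow> spacetime \<Rightarrow> real" where
  "wave_density u p = \<rho> (sq p) * (norm (pd None u p))\<^sup>2 + (\<Sum>i\<in>UNIV. (norm (pd (Some i) u p))\<^sup>2)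
     + \<beta> (sq p) * (norm (euler u p))\<^sup>2"

definition energy :: "(spacetime \<Rightarrow> complex) \<Rightarrow> real \<Rightarrow> real" where
  "energy u t = (\<integral>x. wave_density u (event t x) \<partial>lborel)"

definition flux :: "(spacetime \<Rightarrow> complex) \<Rightarrow> 3 \<Rightarrow> spacetime \<Rightarrow> complex" where
  "flux u i p = pd (Some i) u p + radial \<beta> p * coord i p * euler u p"

lemma smooth_flux: "smooth u \<Longrightarrow> smooth (flux u i)"
  unfolding flux_def[abs_def] by (intro smooth_intros smooth_pd smooth_radial smooth_\<beta> smooth_coord smooth_euler)

lemma elliptic_flux: "smooth u \<Longrightarrow> elliptic \<beta> u p = (\<Sum>i\<in>UNIV. pd (Some i) (flux u i) p)"
  unfolding elliptic_def laplacian_def flux_def[abs_def]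
  by (simp add: pd_add smooth_intros smooth_pd smooth_radial smooth_\<beta> smooth_coord smooth_euler sum.distrib)

text \<open>Here and below \<open>s * \<beta> s = \<rho> s - 1 > -1\<close> and the Cauchy-Schwarz inequality give coercivity.\<close>

lemma gradient_nonneg:
  "(\<Sum>i\<in>UNIV. (norm (pd (Some i) u p))\<^sup>2) + \<beta> (sq p) * (norm (euler u p))\<^sup>2 \<ge> 0"
proof -
  define N where "N = (\<Sum>i\<in>UNIV. (norm (pd (Some i) u p))\<^sup>2)"
  have N: "N \<ge> 0" by (simp add: N_def sum_nonneg)
  have "norm (euler u p) \<le> (\<Sum>i\<in>UNIV. \<bar>p $ Some i\<bar> * \<bar>norm (pd (Some i) u p)\<bar>)"
    unfolding euler_def by (rule order_trans[OF norm_sum]) (simp add: norm_mult coord_def)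
  also have "\<dots> \<le> L2_set (\<lambda>i. p $ Some i) UNIV * L2_set (\<lambda>i. norm (pd (Some i) u p)) UNIV"
    by (rule L2_set_mult_ineq)
  also have "\<dots> = sqrt (sq p * N)" by (simp add: L2_set_def sq_def N_def real_sqrt_mult)
  finally have "(norm (euler u p))\<^sup>2 \<le> (sqrt (sq p * N))\<^sup>2" by (intro power_mono) auto
  moreover have "sq p \<ge> 0" by (simp add: sq_eq)
  ultimately have cs: "(norm (euler u p))\<^sup>2 \<le> sq p * N" using N by simp
  show ?thesis
  proof (cases "\<beta> (sq p) \<ge> 0")
    case True
    then show ?thesis using N by (simp add: N_def[symmetric])
  next
    case False
    have "\<beta> (sq p) * (norm (euler u p))\<^sup>2 \<ge> \<beta> (sq p) * (sq p * N)"
      using cs False by (intro mult_left_mono_neg) auto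
    moreover have "\<beta> (sq p) * (sq p * N) = (\<rho> (sq p) - 1) * N"
      using \<beta>_eq[of "sq p"] by (metis mult.assoc mult.commute)
    moreover have "(\<rho> (sq p) - 1) * N \<ge> - N"
      using mult_nonneg_nonneg[OF less_imp_le[OF \<rho>_pos[of "sq p"]] N] by (simp add: algebra_simps)
    ultimately show ?thesis by (simp add: N_def[symmetric])
  qed
qed

lemma density_ge: "wave_density u p \<ge> \<rho> (sq p) * (norm (pd None u p))\<^sup>2"
  using gradient_nonneg[where u=u and p=p] by (simp add: wave_density_def)

lemma density_nonneg: "wave_density u p \<ge> 0"
  using density_ge[of p u] \<rho>_pos[of "sq p"] by (meson less_imp_le mult_nonneg_nonneg order_trans zero_le_power2)

text \<open>The density as a complex function: \<open>pd\<close> differentiates complex functions,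
  and products with conjugates are manifestly smooth.\<close>

definition cdensity :: "(spacetime \<Rightarrow> complex) \<Rightarrow> spacetime \<Rightarrow> complex" where
  "cdensity u p = radial \<rho> p * (pd None u p * cnj (pd None u p))
     + (\<Sum>i\<in>UNIV. pd (Some i) u p * cnj (pd (Some i) u p)) + radial \<beta> p * (euler u p * cnj (euler u p))"

lemma cdensity_eq: "cdensity u p = of_real (wave_density u p)"
  by (simp add: cdensity_def wave_density_def radial_def complex_norm_square[symmetric])

lemma smooth_cdensity: "smooth u \<Longrightarrow> smooth (cdensity u)"
  unfolding cdensity_def[abs_def]
  by (intro smooth_intros smooth_pd smooth_radial smooth_\<rho> smooth_\<beta> smooth_euler smooth_cnj)

lemma density_Re: "wave_density u = (\<lambda>p. Re (cdensity u p))"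
  by (simp add: cdensity_eq)

lemma continuous_density: "smooth u \<Longrightarrow> continuous_on S (wave_density u)"
  unfolding density_Re by (intro continuous_intros smooth_continuous_on smooth_cdensity)

lemma forward_supported_euler: "forward_supported R u \<Longrightarrow> forward_supported R (euler u)"
  using forward_supported_pd[of R u] unfolding forward_supported_def euler_def by simp

lemma forward_supported_cdensity: "forward_supported R u \<Longrightarrow> forward_supported R (cdensity u)"
  using forward_supported_pd[of R u] forward_supported_euler[of R u] unfolding forward_supported_def cdensity_def by simp

lemma pd_None_euler: "smooth u \<Longrightarrow> pd None (euler u) = euler (pd None u)"
proof -
  assume u: "smooth u"
  have "pd None (\<lambda>p. \<Sum>i\<in>UNIV. coord i p * pd (Some i) u p) = (\<lambda>p. \<Sum>i\<in>UNIV. coord i p * pd None (pd (Some i) u) p)"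
    by (subst pd_sum) (auto intro!: smooth_intros smooth_coord smooth_pd u simp: pd_mult pd_coord smooth_coord smooth_pd u)
  then show ?thesis
    unfolding euler_def[abs_def] pd_commute[OF u, of None] .
qed

text \<open>Local energy identity for the multiplier T. The products of the gradient with the time
  derivative assemble into the divergence of the flux because the coefficients are real, symmetric
  and independent of t.\<close>

lemma pd_None_cdensity:
  assumes u: "smooth u"
  defines "v \<equiv> pd None u"
  shows "pd None (cdensity u) p = wave u p * cnj (v p) + cnj (wave u p) * v p
    + (\<Sum>i\<in>UNIV. pd (Some i) (\<lambda>q. flux u i q * cnj (v q) + cnj (flux u i q) * v q) p)"
proof -
  have v: "smooth v" unfolding v_def by (intro smooth_pd u)
  note sm = u v smooth_pd[OF u] smooth_pd[OF v] smooth_euler[OF u] smooth_euler[OF v] smooth_flux[OF u]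
    smooth_radial[OF smooth_\<rho>] smooth_radial[OF smooth_\<beta>]
  have c: "pd None (pd (Some i) u) = pd (Some i) v" for i unfolding v_def by (rule pd_commute[OF u])
  have m: "pd None (\<lambda>p. w p * cnj (w p)) p = pd None w p * cnj (w p) + w p * cnj (pd None w p)" if "smooth w" for w
    using that by (simp add: pd_mult smooth_cnj pd_cnj)
  have lhs: "pd None (cdensity u) p = radial \<rho> p * (pd None v p * cnj (v p) + v p * cnj (pd None v p))
    + (\<Sum>i\<in>UNIV. pd (Some i) v p * cnj (pd (Some i) u p) + pd (Some i) u p * cnj (pd (Some i) v p))
    + radial \<beta> p * (euler v p * cnj (euler u p) + euler u p * cnj (euler v p))"
    unfolding cdensity_def[abs_def] v_def[symmetric]
    by (simp add: pd_add pd_mult pd_sum smooth_intros sm smooth_cnj pd_cnj pd_radial[OF smooth_\<rho>] pd_radial[OF smooth_\<beta>]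
        c pd_None_euler[OF u, folded v_def])
  have rhs: "pd (Some i) (\<lambda>q. flux u i q * cnj (v q) + cnj (flux u i q) * v q) p
    = pd (Some i) (flux u i) p * cnj (v p) + flux u i p * cnj (pd (Some i) v p)
     + cnj (pd (Some i) (flux u i) p) * v p + cnj (flux u i p) * pd (Some i) v p" for i
    by (simp add: pd_add pd_mult smooth_intros sm smooth_cnj pd_cnj)
  have fl: "(\<Sum>i\<in>UNIV. flux u i p * a i) = (\<Sum>i\<in>UNIV. pd (Some i) u p * a i) + radial \<beta> p * euler u p * (\<Sum>i\<in>UNIV. coord i p * a i)" for a
    by (simp add: flux_def sum_distrib_left sum.distrib[symmetric] algebra_simps)
  have cc: "cnj (coord i p) = coord i p" "cnj (radial b p) = radial b p" for i b
    by (simp_all add: coord_def radial_def)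
  have f1: "(\<Sum>i\<in>UNIV. flux u i p * cnj (pd (Some i) v p)) = (\<Sum>i\<in>UNIV. pd (Some i) u p * cnj (pd (Some i) v p)) + radial \<beta> p * euler u p * cnj (euler v p)"
    unfolding fl by (simp add: euler_def[of v] cc)
  have f2: "(\<Sum>i\<in>UNIV. cnj (flux u i p) * pd (Some i) v p) = (\<Sum>i\<in>UNIV. pd (Some i) v p * cnj (pd (Some i) u p)) + radial \<beta> p * (euler v p * cnj (euler u p))"
    using arg_cong[OF f1, of cnj] by (simp add: cc mult_ac)
  have e: "(\<Sum>i\<in>UNIV. pd (Some i) (flux u i) p * a) = elliptic \<beta> u p * a" "(\<Sum>i\<in>UNIV. cnj (pd (Some i) (flux u i) p) * a) = cnj (elliptic \<beta> u p) * a" for a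
    by (simp_all add: elliptic_flux[OF u] sum_distrib_right)
  show ?thesis
    unfolding lhs rhs sum.distrib f1 f2 e wave_def v_def[symmetric]
    by (simp add: cc algebra_simps sum.distrib)
qed

text \<open>The derivative of the energy is the pairing of the source with u_t, split by 2 a b \<le>
  \<rho> a^2/T + T b^2/\<rho>. With T the length of the time interval the Gronwall factor stays at
  e, and the growth is only quadratic.\<close>

lemma energy_estimate:
  assumes u: "smooth u" "forward_supported R u"
    and m: "\<And>t. (\<integral>x. (norm (wave u (event t x)))\<^sup>2 / \<rho> ((norm x)\<^sup>2) \<partial>lborel) \<le> m"
    and t1: "t1 \<ge> -1"
  shows "energy u t1 \<le> exp 1 * (t1 + 2)\<^sup>2 * m"
proof -
  \<comment> \<open>The interval runs to t1 from -2, where the energy vanishes because the support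
    starts at -1.\<close>
  define T where "T = t1 + 2"
  have T: "T > 0" using t1 by (simp add: T_def)
  define v where "v = pd None u"
  have v: "smooth v" "forward_supported R v" unfolding v_def by (intro smooth_pd forward_supported_pd u)+
  have zero: "w (event t x) = 0" if "forward_supported R w" "norm x > R + t + 1" for w t x
    by (rule forward_supportedD[OF that(1)]) (use that(2) in simp)
  have fw: "forward_supported R (wave u)"
  proof -
    have 1: "forward_supported R (pd (Some i) (\<lambda>q. radial \<beta> q * coord i q * euler u q))" for i
      by (intro forward_supported_pd forward_supported_mult forward_supported_euler u)
    have 2: "forward_supported R (pd \<mu> (pd \<mu> u))" for \<mu> by (intro forward_supported_pd u)
    show ?thesis
      unfolding forward_supported_def
    proof (intro allI impI)
      fix p assume "p $ None < - 1 \<or> R + p $ None + 1 < norm (space_part p)"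
      then show "wave u p = 0"
        using forward_supportedD[OF 1, of p] forward_supportedD[OF 2, of p]
        by (simp add: wave_def elliptic_def laplacian_def)
    qed
  qed
  have sw: "smooth (wave u)"
    unfolding wave_def[abs_def] by (intro smooth_intros smooth_pd smooth_radial smooth_\<rho> smooth_elliptic smooth_\<beta> u)
  have ff: "forward_supported R (\<lambda>q. flux u i q * cnj (v q) + cnj (flux u i q) * v q)" for i
    using v(2) unfolding forward_supported_def by simp
  define S where "S p = wave u p * cnj (v p) + cnj (wave u p) * v p" for p
  have S: "smooth S" "forward_supported R S"
    unfolding S_def[abs_def] using v(2)
    by (auto intro!: smooth_intros smooth_cnj sw v(1) simp: forward_supported_def)
  define e' where "e' t = Re (\<integral>x. S (event t x) \<partial>lborel)" for t
  have e_Re: "energy u t = Re (\<integral>x. cdensity u (event t x) \<partial>lborel)" for t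
  proof -
    have "integrable lborel (\<lambda>x. cdensity u (event t x))"
      by (intro integrable_slice[where R="R + t + 1"] smooth_continuous_on smooth_cdensity u zero forward_supported_cdensity)
    then show ?thesis unfolding energy_def density_Re by (rule integral_Re)
  qed
  have der: "(energy u has_real_derivative e' t) (at t)" for t
  proof -
    have "(\<integral>x. pd None (cdensity u) (event t x) \<partial>lborel)
      = (\<integral>x. S (event t x) + (\<Sum>i\<in>UNIV. pd (Some i) (\<lambda>q. flux u i q * cnj (v q) + cnj (flux u i q) * v q) (event t x)) \<partial>lborel)"
      unfolding pd_None_cdensity[OF u(1)] S_def v_def ..
    also have "\<dots> = (\<integral>x. S (event t x) \<partial>lborel) + (\<Sum>i\<in>UNIV. \<integral>x. pd (Some i) (\<lambda>q. flux u i q * cnj (v q) + cnj (flux u i q) * v q) (event t x) \<partial>lborel)"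
    proof -
      have i1: "integrable lborel (\<lambda>x. S (event t x))"
        by (intro integrable_slice[where R="R + t + 1"] smooth_continuous_on S zero)
      have i2: "integrable lborel (\<lambda>x. pd (Some i) (\<lambda>q. flux u i q * cnj (v q) + cnj (flux u i q) * v q) (event t x))" for i
        by (intro integrable_slice[where R="R + t + 1"] smooth_continuous_on smooth_pd smooth_intros smooth_cnj smooth_flux u v
            zero[OF forward_supported_pd[OF ff]])
      show ?thesis
        using i1 i2 by (simp add: Bochner_Integration.integral_sum)
    qed
    also have "\<dots> = (\<integral>x. S (event t x) \<partial>lborel)"
    proof -
      have "(\<integral>x. pd (Some i) (\<lambda>q. flux u i q * cnj (v q) + cnj (flux u i q) * v q) (event t x) \<partial>lborel) = 0" for i
        by (rule integral_pd_space[where R="R + t + 1"]) (auto intro!: smooth_intros smooth_cnj smooth_flux u v zero[OF ff])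
      then show ?thesis by simp
    qed
    finally have "(\<integral>x. pd None (cdensity u) (event t x) \<partial>lborel) = (\<integral>x. S (event t x) \<partial>lborel)" .
    then have "((\<lambda>t. \<integral>x. cdensity u (event t x) \<partial>lborel) has_vector_derivative (\<integral>x. S (event t x) \<partial>lborel)) (at t)"
      using integral_slice_has_derivative[OF smooth_cdensity[OF u(1)] forward_supported_cdensity[OF u(2)], of t] by simp
    from bounded_linear.has_vector_derivative[OF bounded_linear_Re this]
    have "((\<lambda>t. Re (\<integral>x. cdensity u (event t x) \<partial>lborel)) has_real_derivative e' t) (at t)"
      by (simp add: e'_def has_real_derivative_iff_has_vector_derivative)
    then show ?thesis using e_Re by (metis (no_types, lifting) ext)
  qed
  have e'_le: "e' t \<le> energy u t / T + T * m" for t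
  proof -
    have iS: "integrable lborel (\<lambda>x. S (event t x))"
      by (intro integrable_slice[where R="R + t + 1"] smooth_continuous_on S zero)
    have iD: "integrable lborel (\<lambda>x. wave_density u (event t x))"
    proof (rule integrable_slice[where R="R + t + 1"])
      show "wave_density u (event t x) = 0" if "norm x > R + t + 1" for x
        using zero[OF forward_supported_cdensity[OF u(2)] that] by (simp add: cdensity_eq)
    qed (rule continuous_density[OF u(1)])
    have cr: "continuous_on UNIV (\<lambda>x::spacetime. \<rho> (sq x))"
      by (rule continuous_on_compose2[OF smooth_continuous_on[OF smooth_\<rho>, of UNIV] smooth_continuous_on[OF smooth_sq]]) auto
    have iW: "integrable lborel (\<lambda>x. (norm (wave u (event t x)))\<^sup>2 / \<rho> ((norm x)\<^sup>2))"
    proof -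
      have "integrable lborel (\<lambda>x. (\<lambda>p. (norm (wave u p))\<^sup>2 / \<rho> (sq p)) (event t x))"
      proof (rule integrable_slice[where R="R + t + 1"])
        have "\<rho> s \<noteq> 0" for s using \<rho>_pos[of s] by simp
        then show "continuous_on UNIV (\<lambda>p. (norm (wave u p))\<^sup>2 / \<rho> (sq p))"
          by (intro continuous_on_divide continuous_on_power continuous_on_norm smooth_continuous_on sw cr) simp
      qed (simp add: zero[OF fw])
      then show ?thesis by simp
    qed
    have iB: "integrable lborel (\<lambda>x. wave_density u (event t x) / T)" using iD by (intro integrable_divide)
    have iC: "integrable lborel (\<lambda>x. T * ((norm (wave u (event t x)))\<^sup>2 / \<rho> ((norm x)\<^sup>2)))"
      using iW by (intro integrable_mult_right)
    have "e' t = (\<integral>x. Re (S (event t x)) \<partial>lborel)" unfolding e'_def by (rule integral_Re[OF iS, symmetric])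
    also have "\<dots> \<le> (\<integral>x. wave_density u (event t x) / T + T * ((norm (wave u (event t x)))\<^sup>2 / \<rho> ((norm x)\<^sup>2)) \<partial>lborel)"
    proof (rule integral_mono)
      show "integrable lborel (\<lambda>x. Re (S (event t x)))" using iS by simp
      show "integrable lborel (\<lambda>x. wave_density u (event t x) / T + T * ((norm (wave u (event t x)))\<^sup>2 / \<rho> ((norm x)\<^sup>2)))"
        by (rule Bochner_Integration.integrable_add[OF iB iC])
      fix x
      define a b r where "a = norm (v (event t x))" and "b = norm (wave u (event t x))" and "r = \<rho> ((norm x)\<^sup>2)"
      have r: "r > 0" by (simp add: r_def \<rho>_pos)
      have "Re (S (event t x)) \<le> norm (S (event t x))" by (rule complex_Re_le_cmod)
      also have "\<dots> \<le> b * a + b * a"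
        unfolding S_def by (rule norm_triangle_mono) (simp_all add: norm_mult a_def b_def)
      also have "\<dots> \<le> r * a\<^sup>2 / T + T * (b\<^sup>2 / r)"
      proof -
        have "0 \<le> (r * a - T * b)\<^sup>2 / (r * T)" using r T by simp
        also have "(r * a - T * b)\<^sup>2 / (r * T) = r * a\<^sup>2 / T + T * (b\<^sup>2 / r) - (b * a + b * a)"
          using r T by (simp add: power2_diff power_mult_distrib field_simps power2_eq_square)
        finally show ?thesis by simp
      qed
      also have "\<dots> \<le> wave_density u (event t x) / T + T * (b\<^sup>2 / r)"
        using density_ge[of "event t x" u] T unfolding r_def a_def v_def by (simp add: divide_right_mono)
      finally show "Re (S (event t x)) \<le> wave_density u (event t x) / T + T * ((norm (wave u (event t x)))\<^sup>2 / \<rho> ((norm x)\<^sup>2))"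
        by (simp add: b_def r_def)
    qed
    also have "\<dots> = energy u t / T + T * (\<integral>x. (norm (wave u (event t x)))\<^sup>2 / \<rho> ((norm x)\<^sup>2) \<partial>lborel)"
      unfolding energy_def Bochner_Integration.integral_add[OF iB iC]
      by (simp only: integral_divide_zero integral_mult_right_zero)
    also have "\<dots> \<le> energy u t / T + T * m" using m[of t] T by (intro add_left_mono mult_left_mono) auto
    finally show ?thesis .
  qed
  have m0: "m \<ge> 0"
    by (rule order_trans[OF _ m[of 0]]) (auto intro!: integral_nonneg_AE divide_nonneg_nonneg less_imp_le[OF \<rho>_pos])
  define \<psi> where "\<psi> t = exp (- (t + 2) / T) * energy u t - T * m * (t + 2)" for t
  have "\<psi> t1 \<le> \<psi> (-2)"
  proof (rule DERIV_nonpos_imp_nonincreasing[of "-2" t1 \<psi>])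
    show "-2 \<le> t1" using t1 by simp
    fix t assume t: "-2 \<le> t" "t \<le> t1"
    have "(\<psi> has_real_derivative exp (- (t + 2) / T) * (- 1 / T) * energy u t + e' t * exp (- (t + 2) / T) - T * m) (at t)"
      unfolding \<psi>_def using T by (auto intro!: derivative_eq_intros der)
    moreover have "exp (- (t + 2) / T) * (- 1 / T) * energy u t + e' t * exp (- (t + 2) / T) - T * m \<le> 0"
    proof -
      have "- (t + 2) / T \<le> 0" using t T by (intro divide_nonpos_pos) auto
      then have E: "exp (- (t + 2) / T) \<le> 1" by simp
      have "exp (- (t + 2) / T) * e' t \<le> exp (- (t + 2) / T) * (energy u t / T + T * m)"
        by (intro mult_left_mono e'_le) simp
      moreover have "exp (- (t + 2) / T) * (T * m) \<le> 1 * (T * m)"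
        using E T m0 by (intro mult_right_mono) auto
      ultimately show ?thesis by (simp add: algebra_simps)
    qed
    ultimately show "\<exists>y. DERIV \<psi> t :> y \<and> y \<le> 0" by blast
  qed
  also have "\<psi> (-2) = 0"
  proof -
    have "wave_density u (event (-2) x) = 0" for x
      using forward_supportedD[OF forward_supported_cdensity[OF u(2)], of "event (-2) x"] by (simp add: cdensity_eq)
    then show ?thesis by (simp add: \<psi>_def energy_def)
  qed
  finally have "exp (-1) * energy u t1 \<le> T\<^sup>2 * m"
    using T by (simp add: \<psi>_def T_def[symmetric] power2_eq_square mult_ac)
  from mult_left_mono[OF this, of "exp 1"] show ?thesis
    by (simp add: T_def mult.assoc[symmetric] exp_add[symmetric])
qed

end

section \<open>Coordinate expressions of the metric\<close>

lemma matrix_inv_eqI: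
  fixes A B :: "real^'n^'n"
  assumes "A ** B = mat 1" "B ** A = mat 1"
  shows "matrix_inv A = B"
proof -
  have "\<exists>A'. A ** A' = mat 1 \<and> A' ** A = mat 1" using assms by blast
  then have "matrix_inv A ** A = mat 1" unfolding matrix_inv_def by (rule someI2_ex) blast
  then have "matrix_inv A = matrix_inv A ** (A ** B)" by (simp add: assms)
  also have "\<dots> = B" using \<open>matrix_inv A ** A = mat 1\<close> by (simp add: matrix_mul_assoc)
  finally show ?thesis .
qed

lemma det_block:
  fixes A :: "real^(3 option)^(3 option)" and B :: "real^3^3"
  assumes "\<And>i j. A $ Some i $ Some j = B $ i $ j" "\<And>i. A $ None $ Some i = 0"
  shows "det A = A $ None $ None * det B"
proof -
  have U: "(UNIV :: 3 option set) = {None, Some 1, Some 2, Some 3}"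
    by (auto simp: UNIV_option_conv UNIV_3)
  have f1: "finite {Some (1::3), Some 2, Some 3}" "None \<notin> {Some (1::3), Some 2, Some 3}" by auto
  have f2: "finite {Some (2::3), Some 3}" "Some 1 \<notin> {Some (2::3), Some 3}" by auto
  have f3: "finite {Some (3::3)}" "Some 2 \<notin> {Some (3::3)}" by auto
  show ?thesis
    unfolding det_3
    unfolding det_def U
    unfolding sum_over_permutations_insert[OF f1]
    unfolding sum_over_permutations_insert[OF f2]
    unfolding sum_over_permutations_insert[OF f3]
    unfolding permutes_sing
    by (simp add: sign_swap_id permutation_swap_id permutation_compose sign_compose sign_id swap_id_eq assms algebra_simps)
qed

locale warped_metric = warped +
  fixes f :: "real \<Rightarrow> real"
  assumes f_eq: "r > 0 \<Longrightarrow> f r = r\<^sup>2 * \<rho> (r\<^sup>2)"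
begin

definition g0_inv :: "real^3 \<Rightarrow> real^3^3" where
  "g0_inv x = (\<chi> i j. ((if i = j then 1 else 0) + \<beta> ((norm x)\<^sup>2) * x $ i * x $ j) / \<rho> ((norm x)\<^sup>2))"

definition g_inv :: "spacetime \<Rightarrow> real^(3 option)^(3 option)" where
  "g_inv p = (\<chi> \<mu> \<nu>. case (\<mu>, \<nu>) of (None, None) \<Rightarrow> -1
     | (Some i, Some j) \<Rightarrow> g0_inv (space_part p) $ i $ j | _ \<Rightarrow> 0)"

text \<open>The tangential eigenvalue is f/r^2 = \<rho> and the radial one is \<rho> - s \<beta> =
  1. This removes the case distinction at the origin and explains the determinant \<rho>^2.\<close>

lemma g0_eq: "g0 f x $ i $ j = (if i = j then \<rho> ((norm x)\<^sup>2) else 0) - \<beta> ((norm x)\<^sup>2) * x $ i * x $ j"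
proof (cases "x = 0")
  case True
  then show ?thesis using \<beta>_eq[of 0] by (simp add: g0_def mat_def)
next
  case False
  define s where "s = (norm x)\<^sup>2"
  have s: "s > 0" using False by (simp add: s_def)
  have b: "\<beta> s = (\<rho> s - 1) / s" using \<beta>_eq[of s] s by (simp add: field_simps)
  have "f (norm x) = s * \<rho> s" using f_eq[of "norm x"] False by (simp add: s_def)
  then show ?thesis
    unfolding g0_def s_def[symmetric] b using False s by (simp add: mat_def field_simps)
qed

lemma norm_sq_3: "(norm (x::real^3))\<^sup>2 = x $ 1 * x $ 1 + x $ 2 * x $ 2 + x $ 3 * x $ 3"
  by (simp only: power2_norm_eq_inner inner_vec_def sum_3) simp

lemma det_g0: "det (g0 f x) = (\<rho> ((norm x)\<^sup>2))\<^sup>2"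
proof -
  define r b where "r = \<rho> ((norm x)\<^sup>2)" and "b = \<beta> ((norm x)\<^sup>2)"
  have rb: "(x $ 1 * x $ 1 + x $ 2 * x $ 2 + x $ 3 * x $ 3) * b = r - 1"
    using \<beta>_eq[of "(norm x)\<^sup>2"] by (simp add: norm_sq_3[symmetric] r_def b_def)
  have "det (g0 f x) = r * r"
    unfolding det_3 g0_eq r_def[symmetric] b_def[symmetric]
    apply simp
    using rb by algebra
  then show ?thesis by (simp add: r_def power2_eq_square)
qed

lemma sqrt_det_g0: "sqrt_det (g0 f) x = \<rho> ((norm x)\<^sup>2)"
  using \<rho>_pos[of "(norm x)\<^sup>2"] by (simp add: sqrt_det_def det_g0)

lemma sqrt_det_g: "sqrt_det (g_metric f) p = \<rho> (sq p)"
proof -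
  have "det (g_metric f p) = g_metric f p $ None $ None * det (g0 f (space_part p))"
    by (rule det_block) (simp_all add: g_metric_def)
  then have "det (g_metric f p) = - (\<rho> (sq p))\<^sup>2" by (simp add: g_metric_def det_g0 sq_eq)
  then show ?thesis using \<rho>_pos[of "sq p"] by (simp add: sqrt_det_def)
qed

lemma g0_mult: "g0 f x ** g0_inv x = mat 1" "g0_inv x ** g0 f x = mat 1"
proof -
  define r b where "r = \<rho> ((norm x)\<^sup>2)" and "b = \<beta> ((norm x)\<^sup>2)"
  have r: "r > 0" by (simp add: r_def \<rho>_pos)
  have rb: "(x $ 1 * x $ 1 + x $ 2 * x $ 2 + x $ 3 * x $ 3) * b = r - 1"
    using \<beta>_eq[of "(norm x)\<^sup>2"] by (simp add: norm_sq_3[symmetric] r_def b_def)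
  define d where "d i j = (if i = j then 1 else 0 :: real)" for i j :: 3
  have g: "g0 f x $ i $ j = r * d i j - b * x $ i * x $ j" "g0_inv x $ i $ j = (d i j + b * x $ i * x $ j) / r" for i j
    by (auto simp: g0_eq g0_inv_def r_def b_def d_def)
  have sd: "(\<Sum>k\<in>UNIV. d i k * a k) = a i" "(\<Sum>k\<in>UNIV. a k * d k i) = a i" for i and a :: "3 \<Rightarrow> real"
    by (simp_all add: d_def if_distrib[of "\<lambda>c. c * _"] if_distrib[of "\<lambda>c. _ * c"] cong: if_cong)
  have sx: "(\<Sum>k\<in>UNIV. x $ k * x $ k) * b = r - 1" using rb by (simp add: sum_3)
  have key: "(\<Sum>k\<in>UNIV. (r * d i k - b * x $ i * x $ k) * (d k j + b * x $ k * x $ j)) = r * d i j" for i j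
  proof -
    have "(\<Sum>k\<in>UNIV. (r * d i k - b * x $ i * x $ k) * (d k j + b * x $ k * x $ j))
      = r * (\<Sum>k\<in>UNIV. d i k * (d k j + b * x $ k * x $ j)) - b * x $ i * (\<Sum>k\<in>UNIV. x $ k * d k j)
        - b * x $ i * x $ j * ((\<Sum>k\<in>UNIV. x $ k * x $ k) * b)"
      by (simp add: sum_distrib_left sum_distrib_right sum_subtractf[symmetric] algebra_simps)
    then show ?thesis unfolding sd sx by (simp add: algebra_simps)
  qed
  have dsym: "d i j = d j i" for i j by (simp add: d_def)
  have "(g0 f x ** g0_inv x) $ i $ j = d i j" for i j
  proof -
    have "(g0 f x ** g0_inv x) $ i $ j = (\<Sum>k\<in>UNIV. (r * d i k - b * x $ i * x $ k) * (d k j + b * x $ k * x $ j)) / r"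
      by (simp add: matrix_matrix_mult_def g sum_divide_distrib)
    then show ?thesis unfolding key using r by simp
  qed
  then show "g0 f x ** g0_inv x = mat 1" by (simp add: vec_eq_iff mat_def d_def)
  have "(g0_inv x ** g0 f x) $ i $ j = d i j" for i j
  proof -
    have "(g0_inv x ** g0 f x) $ i $ j = (\<Sum>k\<in>UNIV. (r * d j k - b * x $ j * x $ k) * (d k i + b * x $ k * x $ i)) / r"
      by (simp add: matrix_matrix_mult_def g sum_divide_distrib dsym mult_ac)
    then show ?thesis unfolding key using r dsym by simp
  qed
  then show "g0_inv x ** g0 f x = mat 1" by (simp add: vec_eq_iff mat_def d_def)
qed

lemma matrix_inv_g: "matrix_inv (g_metric f p) = g_inv p"
proof -
  have m: "(\<Sum>k\<in>UNIV. g0 f x $ i $ k * g0_inv x $ k $ j) = (if i = j then 1 else 0)"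
    "(\<Sum>k\<in>UNIV. g0_inv x $ i $ k * g0 f x $ k $ j) = (if i = j then 1 else 0)" for x i j
    using arg_cong[OF g0_mult(1)[of x], of "\<lambda>A. A $ i $ j"] arg_cong[OF g0_mult(2)[of x], of "\<lambda>A. A $ i $ j"]
    by (simp_all add: matrix_matrix_mult_def mat_def)
  show ?thesis
    by (rule matrix_inv_eqI)
      (auto simp: vec_eq_iff matrix_matrix_mult_def mat_def g_metric_def g_inv_def sum_option m split: option.split)
qed

lemma sum_g0_inv:
  "of_real (\<rho> (sq p)) * (\<Sum>j\<in>UNIV. of_real (g0_inv (space_part p) $ i $ j) * pd (Some j) u p) = flux u i p"
proof -
  have r: "\<rho> (sq p) \<noteq> 0" using \<rho>_pos[of "sq p"] by simp
  have "of_real (\<rho> (sq p)) * (of_real (g0_inv (space_part p) $ i $ j) * pd (Some j) u p)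
     = (if i = j then pd (Some j) u p else 0) + radial \<beta> p * coord i p * (coord j p * pd (Some j) u p)" for j
    using r by (simp add: g0_inv_def sq_eq[symmetric] radial_def coord_def field_simps)
  then show ?thesis
    by (simp add: sum_distrib_left flux_def euler_def sum.distrib)
qed

text \<open>The volume density \<rho> cancels the denominator of the inverse metric, so the spatial
  components of the divergence form are those of \<open>flux\<close>.\<close>

lemma wave_op_eq:
  assumes u: "smooth u"
  shows "wave_op (g_metric f) u p = - wave u p / of_real (\<rho> (sq p))"
proof -
  define F where "F \<mu> q = of_real (sqrt_det (g_metric f) q) * (\<Sum>\<nu>\<in>UNIV. of_real (matrix_inv (g_metric f q) $ \<mu> $ \<nu>) * pd \<nu> u q)" for \<mu> q
  have N: "F None = (\<lambda>q. - (radial \<rho> q * pd None u q))"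
    by (simp add: F_def[abs_def] sqrt_det_g matrix_inv_g g_inv_def sum_option radial_def)
  have S: "F (Some i) = flux u i" for i
    using sum_g0_inv[of _ i u] by (simp add: F_def sqrt_det_g matrix_inv_g g_inv_def sum_option fun_eq_iff)
  have W: "wave_op (g_metric f) u p = (\<Sum>\<mu>\<in>UNIV. pd \<mu> (F \<mu>) p) / of_real (sqrt_det (g_metric f) p)"
    by (simp add: wave_op_def F_def[abs_def])
  have "pd None (\<lambda>q. - (radial \<rho> q * pd None u q)) p = - (radial \<rho> p * pd None (pd None u) p)"
    using u by (simp add: pd_minus pd_mult pd_radial smooth_\<rho> smooth_radial smooth_pd smooth_intros)
  then show ?thesis
    unfolding W sum_option N S
    by (simp add: sqrt_det_g wave_def elliptic_flux[OF u])
qed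

lemma T_deriv_eq: "T_deriv u = pd None u"
  by (simp add: T_deriv_def pd_def T_field_def fun_eq_iff)

text \<open>As g_00 = -1, the trace term turns Q_00 into half the sum of |u_t|^2 and the squared
  spatial gradient; the factor \<rho> of the volume form then cancels the denominator of
  \<open>g0_inv\<close>.\<close>

lemma energy_density_eq:
  assumes u: "smooth u"
  shows "energy_density f u (event c x) * sqrt_det (g0 f) x = wave_density u (event c x) / 2"
proof -
  define p where "p = event c x"
  have r: "\<rho> (sq p) > 0" by (rule \<rho>_pos)
  have c: "pd \<mu> (\<lambda>q. cnj (u q)) p = cnj (pd \<mu> u p)" for \<mu> using pd_cnj[OF u] by simp
  have Z: "(\<Sum>a\<in>UNIV. \<Sum>b\<in>UNIV. of_real (matrix_inv (g_metric f p) $ a $ b) * pd b u p * cnj (pd a u p))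
    = - (pd None u p * cnj (pd None u p)) + (\<Sum>i\<in>UNIV. (\<Sum>j\<in>UNIV. of_real (g0_inv (space_part p) $ i $ j) * pd (Some j) u p) * cnj (pd (Some i) u p))"
    by (simp add: sum_option matrix_inv_g g_inv_def sum_distrib_right)
  have "energy_density f u p = Re ((pd None u p * cnj (pd None u p) + cnj (pd None u p) * pd None u p) / 2
     + (\<Sum>a\<in>UNIV. \<Sum>b\<in>UNIV. of_real (matrix_inv (g_metric f p) $ a $ b) * pd b u p * cnj (pd a u p)) / 2)"
  proof -
    have "energy_density f u p = Q_tensor (g_metric f) u None None p"
      by (simp add: energy_density_def J_current_def sum_option T_field_def n_normal_def axis_def)
    moreover have "g_metric f p $ None $ None = -1" by (simp add: g_metric_def)
    ultimately show ?thesis by (simp add: Q_tensor_def Let_def c)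
  qed
  also have "\<dots> = Re ((pd None u p * cnj (pd None u p)) / 2
     + (\<Sum>i\<in>UNIV. (\<Sum>j\<in>UNIV. of_real (g0_inv (space_part p) $ i $ j) * pd (Some j) u p) * cnj (pd (Some i) u p)) / 2)"
    unfolding Z by (simp add: field_simps)
  finally have ed: "energy_density f u p = Re ((pd None u p * cnj (pd None u p)) / 2
     + (\<Sum>i\<in>UNIV. (\<Sum>j\<in>UNIV. of_real (g0_inv (space_part p) $ i $ j) * pd (Some j) u p) * cnj (pd (Some i) u p)) / 2)" .
  have "energy_density f u p * \<rho> (sq p) = Re ((radial \<rho> p * (pd None u p * cnj (pd None u p))) / 2
     + (\<Sum>i\<in>UNIV. (of_real (\<rho> (sq p)) * (\<Sum>j\<in>UNIV. of_real (g0_inv (space_part p) $ i $ j) * pd (Some j) u p)) * cnj (pd (Some i) u p)) / 2)"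
  proof -
    have "Re (A / 2 + B / 2) * \<rho> (sq p) = Re (radial \<rho> p * A / 2 + of_real (\<rho> (sq p)) * B / 2)" for A B
      by (simp add: radial_def algebra_simps)
    moreover have "of_real (\<rho> (sq p)) * (\<Sum>i\<in>UNIV. a i * b i) = (\<Sum>i\<in>UNIV. (of_real (\<rho> (sq p)) * a i) * b i)"
      for a b :: "3 \<Rightarrow> complex" by (simp add: sum_distrib_left mult.assoc)
    ultimately show ?thesis unfolding ed by (simp only:)
  qed
  also have "(\<Sum>i\<in>UNIV. (of_real (\<rho> (sq p)) * (\<Sum>j\<in>UNIV. of_real (g0_inv (space_part p) $ i $ j) * pd (Some j) u p)) * cnj (pd (Some i) u p))
    = (\<Sum>i\<in>UNIV. pd (Some i) u p * cnj (pd (Some i) u p)) + radial \<beta> p * (euler u p * cnj (euler u p))"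
  proof -
    have "(\<Sum>i\<in>UNIV. (pd (Some i) u p + radial \<beta> p * coord i p * E) * a i)
      = (\<Sum>i\<in>UNIV. pd (Some i) u p * a i) + radial \<beta> p * (E * (\<Sum>i\<in>UNIV. coord i p * a i))" for E a
      by (simp add: sum_distrib_left sum.distrib[symmetric] algebra_simps)
    moreover have "(\<Sum>i\<in>UNIV. coord i p * cnj (pd (Some i) u p)) = cnj (euler u p)"
      by (simp add: euler_def coord_def)
    ultimately show ?thesis unfolding sum_g0_inv flux_def by (simp only:)
  qed
  finally have "energy_density f u p * \<rho> (sq p) = Re (cdensity u p) / 2"
    by (simp add: cdensity_def add.assoc)
  then show ?thesis
    by (simp add: sqrt_det_g0 p_def cdensity_eq)
qed

lemma weighted_energy_eq:
  assumes u: "smooth u"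
  shows "weighted_energy f u c S w = (\<integral>\<^sup>+x\<in>S. ennreal (w x * wave_density u (event c x) / 2) \<partial>lborel)"
  unfolding weighted_energy_def mult.assoc energy_density_eq[OF u] by simp

end

section \<open>The trapping profile and the quasimodes\<close>

text \<open>S is sin r / r as a smooth function of s = r^2; for r < 7\<pi>/8 the profile is that of
  the round three-sphere.\<close>

locale trapped = warped_metric +
  fixes S :: "real \<Rightarrow> real"
  assumes smooth_S: "smooth S" and S_sin: "s > 0 \<Longrightarrow> S s = sin (sqrt s) / sqrt s"
    and \<rho>_S: "s < (7 * pi / 8)\<^sup>2 \<Longrightarrow> \<rho> s = (S s)\<^sup>2"

definition sinc_coeff :: "nat \<Rightarrow> real" where
  "sinc_coeff n = (- 1) ^ n / fact (2 * n + 1)"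

lemma summable_sinc: "summable (\<lambda>n. sinc_coeff n * y ^ n)"
proof (rule summable_comparison_test'[of "\<lambda>n. inverse (fact n) * \<bar>y\<bar> ^ n" 0])
  show "summable (\<lambda>n. inverse (fact n) * \<bar>y\<bar> ^ n)" by (rule summable_exp)
  fix n :: nat
  have "(fact n :: real) \<le> fact (2 * n + 1)" by (rule fact_mono) simp
  then have "1 / fact (2 * n + 1) \<le> (1 / fact n :: real)" by (intro divide_left_mono) auto
  then have "\<bar>y\<bar> ^ n * (1 / fact (2 * n + 1)) \<le> \<bar>y\<bar> ^ n * (1 / fact n)" by (intro mult_left_mono) auto
  then show "norm (sinc_coeff n * y ^ n) \<le> inverse (fact n) * \<bar>y\<bar> ^ n"
    by (simp add: sinc_coeff_def abs_mult power_abs field_simps)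
qed

text \<open>For r < 7\<pi>/8 the coefficients come from the power series of sin r / r, away from the
  origin from a smooth extension of f. The descriptions agree on the overlap, and the two open half
  lines cover the real line.\<close>

lemma trapped_exists:
  fixes f :: "real \<Rightarrow> real"
  assumes f_smooth: "smooth_on_closed {0..} f"
    and f_sin: "\<And>r. 0 \<le> r \<Longrightarrow> r \<le> 7 * pi / 8 \<Longrightarrow> f r = (sin r)\<^sup>2"
    and f_pos: "\<And>r. r > 7 * pi / 8 \<Longrightarrow> f r > 0"
  shows "\<exists>\<rho> \<beta> S. trapped \<rho> \<beta> f S"
proof -
  define S where "S y = (\<Sum>n. sinc_coeff n * y ^ n)" for y
  define S2 where "S2 y = (\<Sum>n. sinc_coeff (Suc n) * y ^ n)" for y
  define c where "c = (7 * pi / 8)\<^sup>2"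
  have c: "c > 0" by (simp add: c_def)
  have sm: "smooth S" unfolding S_def[abs_def] by (rule smooth_powser[OF summable_sinc])
  have summ2: "summable (\<lambda>n. sinc_coeff (Suc n) * y ^ n)" for y
    by (rule powser_split_head(3)[OF summable_sinc])
  have sm2: "smooth S2" unfolding S2_def[abs_def] by (rule smooth_powser[OF summ2])
  \<comment> \<open>Splitting off the constant term gives S^2 - 1 = y S2 (2 + y S2), hence \<beta>
    near the origin without division by s.\<close>
  have split: "S y = 1 + y * S2 y" for y
  proof -
    have "S y = sinc_coeff 0 * y ^ 0 + (\<Sum>n. sinc_coeff (Suc n) * y ^ Suc n)"
      unfolding S_def using suminf_split_head[OF summable_sinc[of y]] by simp
    also have "(\<Sum>n. sinc_coeff (Suc n) * y ^ Suc n) = y * S2 y"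
      unfolding S2_def by (subst suminf_mult[OF summ2, symmetric]) (simp add: mult_ac)
    finally show ?thesis by (simp add: sinc_coeff_def)
  qed
  have S_sin: "S s = sin (sqrt s) / sqrt s" if "s > 0" for s
  proof -
    have "(\<lambda>n. (- 1) ^ n / fact (2 * n + 1) * sqrt s ^ (2 * n + 1)) sums sin (sqrt s)" by (rule sin_paired)
    moreover have "(- 1) ^ n / fact (2 * n + 1) * sqrt s ^ (2 * n + 1) = sqrt s * (sinc_coeff n * s ^ n)" for n
      using that by (simp add: sinc_coeff_def power_mult)
    ultimately have "(\<lambda>n. sqrt s * (sinc_coeff n * s ^ n)) sums sin (sqrt s)" by simp
    moreover have "(\<lambda>n. sqrt s * (sinc_coeff n * s ^ n)) sums (sqrt s * S s)"
      unfolding S_def by (intro sums_mult summable_sums summable_sinc)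
    ultimately have "sqrt s * S s = sin (sqrt s)" by (rule sums_unique2[symmetric])
    then show ?thesis using that by (simp add: field_simps)
  qed
  have S_pos: "S s > 0" if "s < c" for s
  proof (cases "s \<le> 0")
    case True
    \<comment> \<open>For s \<le> 0 the alternating signs cancel and all terms are nonnegative, so
      the series is at least its first term 1.\<close>
    have "sum (\<lambda>n. sinc_coeff n * s ^ n) {0} \<le> S s"
      unfolding S_def
    proof (rule sum_le_suminf[OF summable_sinc])
      fix n :: nat
      have "(- 1) ^ n * s ^ n = (- s) ^ n" by (simp add: power_mult_distrib[symmetric])
      then have "sinc_coeff n * s ^ n = (- s) ^ n / fact (2 * n + 1)" by (simp add: sinc_coeff_def)
      then show "0 \<le> sinc_coeff n * s ^ n" using True by simp
    qed simp
    then show ?thesis by (simp add: sinc_coeff_def)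
  next
    case False
    have "sqrt s < sqrt c" using that by simp
    also have "sqrt c = 7 * pi / 8" by (simp add: c_def)
    finally have "sqrt s < pi" using pi_gt_zero by linarith
    then have "sin (sqrt s) > 0" using False by (intro sin_gt_zero) auto
    then show ?thesis using False by (simp add: S_sin)
  qed
  obtain U where U: "smooth U" "\<And>x. x \<ge> 0 \<Longrightarrow> U x = f x" using f_smooth unfolding smooth_on_closed_def by auto
  define \<rho> where "\<rho> s = (if s < c then (S s)\<^sup>2 else U (sqrt s) / s)" for s
  define \<beta> where "\<beta> s = (if s < c then S2 s * (2 + s * S2 s) else (U (sqrt s) / s - 1) / s)" for s
  have outer: "(S s)\<^sup>2 = U (sqrt s) / s" if "0 < s" "s < c" for s
  proof -
    have "sqrt s < sqrt c" using that by simp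
    also have "sqrt c = 7 * pi / 8" by (simp add: c_def)
    finally have "U (sqrt s) = (sin (sqrt s))\<^sup>2" using that U(2)[of "sqrt s"] f_sin[of "sqrt s"] by simp
    then show ?thesis using that by (simp add: S_sin power_divide)
  qed
  have \<rho>_outer: "\<rho> s = U (sqrt s) / s" if "0 < s" for s using outer that by (simp add: \<rho>_def)
  have sq_split: "s * (S2 s * (2 + s * S2 s)) = (S s)\<^sup>2 - 1" for s
    by (simp add: split power2_eq_square algebra_simps)
  have \<beta>_eq: "s * \<beta> s = \<rho> s - 1" for s
    using sq_split[of s] c by (auto simp: \<beta>_def \<rho>_def)
  have \<beta>_outer: "\<beta> s = (U (sqrt s) / s - 1) / s" if "0 < s" for s
    using \<beta>_eq[of s] \<rho>_outer[OF that] that by (simp add: field_simps)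
  have smU: "smooth_on {0<..} (\<lambda>s. U (sqrt s) / s)"
    using U(1) by (intro smooth_on_divide smooth_on_compose[of _ UNIV U, OF _ _ _ smooth_on_sqrt] smooth_on_ident)
      (auto simp: smooth_on_UNIV)
  have cover: "{..<c} \<union> {0<..} = UNIV" using c by auto
  have sm_in: "smooth_on {..<c} u" if "smooth u" for u :: "real \<Rightarrow> real"
    using that smooth_on_subset[of UNIV u "{..<c}"] by (simp add: smooth_on_UNIV)
  have "smooth_on ({..<c} \<union> {0<..}) \<rho>"
  proof (rule smooth_on_open_Un)
    show "smooth_on {..<c} \<rho>"
      by (rule smooth_on_cong[of _ "\<lambda>s. (S s)\<^sup>2"]) (auto simp: \<rho>_def intro!: sm_in smooth_intros sm)
    show "smooth_on {0<..} \<rho>"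
      by (rule smooth_on_cong[OF _ _ smU]) (auto simp: \<rho>_outer)
  qed auto
  then have sm\<rho>: "smooth \<rho>" by (simp add: cover smooth_on_UNIV)
  have "smooth_on ({..<c} \<union> {0<..}) \<beta>"
  proof (rule smooth_on_open_Un)
    show "smooth_on {..<c} \<beta>"
      by (rule smooth_on_cong[of _ "\<lambda>s. S2 s * (2 + s * S2 s)"]) (auto simp: \<beta>_def intro!: sm_in smooth_intros sm2)
    show "smooth_on {0<..} \<beta>"
      by (rule smooth_on_cong[of _ "\<lambda>s. (U (sqrt s) / s - 1) / s"])
        (auto simp: \<beta>_outer intro!: smooth_on_divide smooth_on_diff smU smooth_on_ident)
  qed auto
  then have sm\<beta>: "smooth \<beta>" by (simp add: cover smooth_on_UNIV)
  have \<rho>_pos: "\<rho> s > 0" for s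
  proof (cases "s < c")
    case True
    then show ?thesis using S_pos[OF True] by (simp add: \<rho>_def)
  next
    case False
    then have s: "s > 0" "s \<ge> c" using c by auto
    have "f (sqrt s) > 0"
    proof (cases "s = c")
      case True
      have "sin (7 * pi / 8) > 0" using pi_gt_zero by (intro sin_gt_zero) (auto simp: field_simps)
      moreover have "sqrt s = 7 * pi / 8" using True by (simp add: c_def)
      ultimately show ?thesis using f_sin[of "7 * pi / 8"] by (simp only:) simp
    next
      case False
      then have "sqrt c < sqrt s" using s by simp
      moreover have "sqrt c = 7 * pi / 8" by (simp add: c_def)
      ultimately show ?thesis by (intro f_pos) simp
    qed
    then show ?thesis using s U(2)[of "sqrt s"] \<rho>_outer[of s] by simp
  qed
  have f_eq: "f r = r\<^sup>2 * \<rho> (r\<^sup>2)" if "r > 0" for r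
    using that \<rho>_outer[of "r\<^sup>2"] U(2)[of r] by simp
  have "trapped \<rho> \<beta> f S"
    by unfold_locales (use sm\<rho> sm\<beta> \<rho>_pos \<beta>_eq f_eq sm S_sin in \<open>auto simp: \<rho>_def c_def\<close>)
  then show ?thesis by blast
qed

section \<open>The cut off modes and their approximate eigenvalue equation\<close>

lemma plateau_exists:
  fixes a b :: real
  assumes "a < b"
  shows "\<exists>X::real \<Rightarrow> real. smooth X \<and> (\<forall>s. 0 \<le> X s \<and> X s \<le> 1) \<and> (\<forall>s\<le>a. X s = 1) \<and> (\<forall>s\<ge>b. X s = 0)"
proof -
  obtain \<theta> :: "real \<Rightarrow> real" where \<theta>: "smooth \<theta>" "\<And>t. 0 \<le> \<theta> t \<and> \<theta> t \<le> 1" "\<And>t. t \<le> -1 \<Longrightarrow> \<theta> t = 0" "\<And>t. t \<ge> 1 \<Longrightarrow> \<theta> t = 1"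
    using smooth_step_exists by blast
  define X where "X s = 1 - \<theta> ((1 / (b - a)) * (2 * s - (a + b)))" for s
  have "smooth X"
    unfolding X_def[abs_def] by (intro smooth_intros smooth_compose[OF \<theta>(1)])
  moreover have "\<forall>s\<le>a. X s = 1"
  proof (intro allI impI)
    fix s assume "s \<le> a"
    then have "(1 / (b - a)) * (2 * s - (a + b)) \<le> -1" using assms by (simp add: divide_le_eq)
    then show "X s = 1" by (simp add: X_def \<theta>)
  qed
  moreover have "\<forall>s\<ge>b. X s = 0"
  proof (intro allI impI)
    fix s assume "s \<ge> b"
    then have "(1 / (b - a)) * (2 * s - (a + b)) \<ge> 1" using assms by (simp add: le_divide_eq)
    then show "X s = 0" by (simp add: X_def \<theta>)
  qed
  moreover have "\<forall>s. 0 \<le> X s \<and> X s \<le> 1" using \<theta>(2) by (auto simp: X_def)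
  ultimately show ?thesis by blast
qed

text \<open>Its l-th power is the harmonic polynomial of highest weight l.\<close>

definition zeta :: "spacetime \<Rightarrow> complex" where
  "zeta p = coord 1 p + \<i> * coord 2 p"

lemma smooth_zeta: "smooth zeta"
  unfolding zeta_def[abs_def] by (intro smooth_intros smooth_coord)

lemma pd_zeta: "pd None zeta = (\<lambda>p. 0)" "pd (Some i) zeta = (\<lambda>p. if i = 1 then 1 else if i = 2 then \<i> else 0)"
  unfolding zeta_def[abs_def] by (auto simp: pd_add pd_cmult pd_coord smooth_intros smooth_coord fun_eq_iff)

lemma euler_zeta_power: "euler (\<lambda>p. zeta p ^ l) = (\<lambda>p. of_nat l * zeta p ^ l)"
proof
  fix p
  have "euler (\<lambda>p. zeta p ^ l) p = of_nat l * (zeta p ^ (l - 1) * zeta p)"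
    by (simp add: euler_def sum_3 pd_power[OF smooth_zeta] pd_zeta) (simp add: zeta_def algebra_simps)
  then show "euler (\<lambda>p. zeta p ^ l) p = of_nat l * zeta p ^ l" by (cases l) auto
qed

lemma highest_weight_zeta_power: "highest_weight l (\<lambda>p. zeta p ^ l)"
  unfolding highest_weight_def
proof (intro conjI allI)
  fix p
  have "rot 1 2 (\<lambda>p. zeta p ^ l) p = \<i> * of_nat l * (zeta p ^ (l - 1) * zeta p)"
    by (simp add: rot_def pd_power[OF smooth_zeta] pd_zeta) (simp add: zeta_def algebra_simps)
  then show "rot 1 2 (\<lambda>p. zeta p ^ l) p = \<i> * of_nat l * zeta p ^ l" by (cases l) auto
  show "rot 1 3 (\<lambda>p. zeta p ^ l) p + \<i> * rot 2 3 (\<lambda>p. zeta p ^ l) p = 0"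
    by (simp add: rot_def pd_power[OF smooth_zeta] pd_zeta algebra_simps)
qed

lemma norm_zeta: "(norm (zeta p))\<^sup>2 \<le> sq p"
proof -
  have "(norm (zeta p))\<^sup>2 = (p $ Some 1)\<^sup>2 + (p $ Some 2)\<^sup>2"
    by (simp add: zeta_def coord_def cmod_power2)
  then show ?thesis by (simp add: sq_def sum_3)
qed

text \<open>The cutoff acts between 3\<pi>/4 and 13\<pi>/16: outside the ball whose energy is
  measured, and strictly inside r = 7\<pi>/8.\<close>

definition in_radius :: real where "in_radius = 3 * pi / 4"
definition out_radius :: real where "out_radius = 13 * pi / 16"

locale quasimode = trapped +
  fixes X :: "real \<Rightarrow> real"
  assumes smooth_X: "smooth X" and X_range: "0 \<le> X s" "X s \<le> 1"
    and X_in: "s \<le> in_radius\<^sup>2 \<Longrightarrow> X s = 1" and X_out: "s \<ge> out_radius\<^sup>2 \<Longrightarrow> X s = 0"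
begin

definition mode_profile :: "nat \<Rightarrow> real \<Rightarrow> real" where
  "mode_profile l s = X s * S s ^ l"

text \<open>Without the cutoff this is (sin r sin \<theta> exp(i \<phi>))^l, the restriction to the
  three-sphere of a harmonic polynomial of degree l in four variables, whence the eigenvalue l (l +
  2).\<close>

definition mode :: "nat \<Rightarrow> spacetime \<Rightarrow> complex" where
  "mode l p = radial (mode_profile l) p * zeta p ^ l"

text \<open>The commutator of the elliptic operator with the cutoff, divided by \<open>zeta ^ l\<close>.\<close>

definition error_profile :: "nat \<Rightarrow> real \<Rightarrow> real" where
  "error_profile l s = 2 * (\<rho> s * ((2 * real l + 3) * deriv X s * S s ^ l
      + 4 * s * deriv X s * (real l * S s ^ (l - 1) * deriv S s) + 2 * s * deriv (deriv X) s * S s ^ l)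
     + 2 * s * deriv \<rho> s * deriv X s * S s ^ l)"

lemma smooth_profiles: "smooth (mode_profile l)" "smooth (error_profile l)"
  unfolding mode_profile_def[abs_def] error_profile_def[abs_def]
  by (intro smooth_intros smooth_X smooth_S smooth_\<rho> smooth_real_deriv(2))+

lemma smooth_mode: "smooth (mode l)"
  unfolding mode_def[abs_def] by (intro smooth_intros smooth_radial smooth_profiles smooth_zeta)

lemma highest_weight_radial_zeta: "smooth b \<Longrightarrow> highest_weight l (\<lambda>p. radial b p * zeta p ^ l)"
  by (intro highest_weight_mult smooth_radial smooth_intros smooth_zeta rot_radial highest_weight_zeta_power)

lemma euler_radial_zeta:
  assumes "smooth b"
  shows "euler (\<lambda>p. radial b p * zeta p ^ l) = (\<lambda>p. radial (\<lambda>s. real l * b s + 2 * s * deriv b s) p * zeta p ^ l)"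
  using assms
  by (simp add: euler_mult smooth_radial smooth_intros smooth_zeta euler_radial euler_zeta_power)
    (simp add: radial_def algebra_simps)

lemma radii: "0 < in_radius" "in_radius < out_radius" "out_radius < 7 * pi / 8"
  using pi_gt_zero by (auto simp: in_radius_def out_radius_def)

lemma deriv_X_zero: "s < in_radius\<^sup>2 \<or> s > out_radius\<^sup>2 \<Longrightarrow> deriv X s = 0 \<and> deriv (deriv X) s = 0"
proof -
  have 1: "deriv X y = 0" if "y < in_radius\<^sup>2" for y
    by (rule deriv_locally_constant[of "{..<in_radius\<^sup>2}" _ _ 1]) (use that X_in in auto)
  have 2: "deriv X y = 0" if "y > out_radius\<^sup>2" for y
    by (rule deriv_locally_constant[of "{out_radius\<^sup>2<..}" _ _ 0]) (use that X_out in auto)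
  assume "s < in_radius\<^sup>2 \<or> s > out_radius\<^sup>2"
  then show ?thesis
  proof
    assume s: "s < in_radius\<^sup>2"
    have "deriv (deriv X) s = 0" by (rule deriv_locally_constant[of "{..<in_radius\<^sup>2}" _ _ 0]) (use s 1 in auto)
    then show ?thesis using 1[OF s] by blast
  next
    assume s: "s > out_radius\<^sup>2"
    have "deriv (deriv X) s = 0" by (rule deriv_locally_constant[of "{out_radius\<^sup>2<..}" _ _ 0]) (use s 2 in auto)
    then show ?thesis using 2[OF s] by blast
  qed
qed

lemma error_profile_zero: "s < in_radius\<^sup>2 \<or> s > out_radius\<^sup>2 \<Longrightarrow> error_profile l s = 0"
  using deriv_X_zero[of s] by (simp add: error_profile_def)

text \<open>Both are facts on sin r = r S(r^2): its derivative in r is cos r, and the squares of the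
  two sum to 1.\<close>

lemma S_ode:
  assumes "s > 0"
  shows "S s + 2 * s * deriv S s = cos (sqrt s)" and "s * (S s)\<^sup>2 + (cos (sqrt s))\<^sup>2 = 1"
proof -
  have "((\<lambda>s. sin (sqrt s) / sqrt s) has_real_derivative
      (cos (sqrt s) * (inverse (sqrt s) / 2) * sqrt s - sin (sqrt s) * (inverse (sqrt s) / 2)) / (sqrt s * sqrt s)) (at s)"
    using assms by (auto intro!: derivative_eq_intros)
  then have "(S has_real_derivative
      (cos (sqrt s) * (inverse (sqrt s) / 2) * sqrt s - sin (sqrt s) * (inverse (sqrt s) / 2)) / (sqrt s * sqrt s)) (at s)"
    by (rule has_field_derivative_transform_within_open[where S="{0<..}"]) (use assms S_sin in auto)
  then have d: "deriv S s = (cos (sqrt s) * (inverse (sqrt s) / 2) * sqrt s - sin (sqrt s) * (inverse (sqrt s) / 2)) / (sqrt s * sqrt s)"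
    by (rule DERIV_imp_deriv)
  show "S s + 2 * s * deriv S s = cos (sqrt s)"
    unfolding d S_sin[OF assms] using assms by (simp add: field_simps)
  show "s * (S s)\<^sup>2 + (cos (sqrt s))\<^sup>2 = 1"
    unfolding S_sin[OF assms] using assms by (simp add: power_divide)
qed

text \<open>Inside the spherical region this is the eigenvalue equation of the sphere for X S^l, all
  terms with derivatives of X being collected in \<open>error_profile\<close>. Beyond the cutoff
  both sides vanish, so \<rho> = S^2 may be used in the rest.\<close>

lemma mode_profile_ode:
  assumes l: "l \<ge> 2" and s: "s > 0"
  defines "B \<equiv> \<lambda>s. real l * mode_profile l s + 2 * s * deriv (mode_profile l) s"
  shows "\<rho> s * (real l * B s + 2 * s * deriv B s + B s) + 2 * s * deriv \<rho> s * B s - real l * (real l + 1) * mode_profile l s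
    = - (real l * (real l + 2)) * s * \<rho> s * mode_profile l s + s * error_profile l s"
proof (cases "s > out_radius\<^sup>2")
  case True
  have o: "open {out_radius\<^sup>2<..}" by simp
  have z: "mode_profile l y = 0" if "y > out_radius\<^sup>2" for y using X_out[of y] that by (simp add: mode_profile_def)
  have d0: "deriv g y = 0" if "y > out_radius\<^sup>2" "\<And>y. y > out_radius\<^sup>2 \<Longrightarrow> g y = 0" for g :: "real \<Rightarrow> real" and y
    by (rule deriv_locally_constant[OF o, of _ _ 0]) (use that in auto)
  have zB: "B y = 0" if "y > out_radius\<^sup>2" for y
    using z d0[OF _ z] that by (simp add: B_def)
  show ?thesis using z[OF True] zB[OF True] d0[OF True zB] error_profile_zero[of s l] True by simp
next
  case False
  have "out_radius\<^sup>2 < (7 * pi / 8)\<^sup>2" using radii by (intro power_strict_mono) auto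
  then have sc: "s < (7 * pi / 8)\<^sup>2" using False by simp
  \<comment> \<open>B contains S^(l - 1), whose derivative involves S^(l - 2); writing l = m + 2
    turns the truncated subtractions into honest powers.\<close>
  obtain m where m: "l = m + 2" using l by (metis add.commute le_Suc_ex)
  note dX = smooth_real_deriv(1)[OF smooth_X] smooth_real_deriv(1)[OF smooth_real_deriv(2)[OF smooth_X]]
  note dS = smooth_real_deriv(1)[OF smooth_S]
  have d\<rho>: "deriv \<rho> s = 2 * S s * deriv S s"
  proof (rule DERIV_imp_deriv)
    have "((\<lambda>s. (S s)\<^sup>2) has_real_derivative 2 * S s * deriv S s) (at s)"
      by (auto intro!: derivative_eq_intros dS)
    then show "(\<rho> has_real_derivative 2 * S s * deriv S s) (at s)"
      by (rule has_field_derivative_transform_within_open[where S="{..<(7 * pi / 8)\<^sup>2}"]) (use sc \<rho>_S in auto)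
  qed
  have dp: "deriv (mode_profile l) y = deriv X y * S y ^ l + X y * (real l * S y ^ (l - 1) * deriv S y)" for y
    unfolding mode_profile_def[abs_def]
    by (rule DERIV_imp_deriv) (auto intro!: derivative_eq_intros dX dS)
  have B_eq: "B y = X y * (real l * S y ^ (l - 1) * cos (sqrt y)) + 2 * y * deriv X y * S y ^ l" if "y > 0" for y
  proof -
    have "S y ^ l = S y ^ (l - 1) * S y" using m by simp
    then have "B y = X y * (real l * S y ^ (l - 1) * (S y + 2 * y * deriv S y)) + 2 * y * deriv X y * S y ^ l"
      unfolding B_def dp mode_profile_def by (simp add: algebra_simps)
    then show ?thesis unfolding S_ode(1)[OF that] .
  qed
  define Q where "Q = S s ^ m"
  have P: "S s ^ l = S s * S s * Q" "S s ^ (l - 1) = S s * Q" "S s ^ (l - 2) = Q"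
    by (simp_all add: m Q_def)
  have dB: "deriv B s = deriv X s * (real l * S s ^ (l - 1) * cos (sqrt s))
     + X s * (real l * (real (l - 1) * S s ^ (l - 2) * deriv S s) * cos (sqrt s) - real l * S s ^ (l - 1) * (S s / 2))
     + 2 * deriv X s * S s ^ l + 2 * s * deriv (deriv X) s * S s ^ l
     + 2 * s * deriv X s * (real l * S s ^ (l - 1) * deriv S s)"
  proof (rule DERIV_imp_deriv)
    have c: "((\<lambda>y. cos (sqrt y)) has_real_derivative - (S s / 2)) (at s)"
      using s by (auto intro!: derivative_eq_intros simp: S_sin field_simps)
    have pw: "((\<lambda>y. S y ^ (l - 1)) has_real_derivative (real (l - 1) * S s ^ (l - 2) * deriv S s)) (at s)"
      by (auto intro!: derivative_eq_intros dS simp: numeral_2_eq_2)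
    have pw': "((\<lambda>y. S y ^ l) has_real_derivative (real l * S s ^ (l - 1) * deriv S s)) (at s)"
      by (auto intro!: derivative_eq_intros dS)
    have "((\<lambda>y. X y * (real l * S y ^ (l - 1) * cos (sqrt y)) + 2 * y * deriv X y * S y ^ l) has_real_derivative
      deriv X s * (real l * S s ^ (l - 1) * cos (sqrt s))
     + X s * (real l * (real (l - 1) * S s ^ (l - 2) * deriv S s) * cos (sqrt s) - real l * S s ^ (l - 1) * (S s / 2))
     + 2 * deriv X s * S s ^ l + 2 * s * deriv (deriv X) s * S s ^ l
     + 2 * s * deriv X s * (real l * S s ^ (l - 1) * deriv S s)) (at s)"
      by (rule derivative_eq_intros c pw pw' dX refl)+ (simp add: algebra_simps)
    then show "(B has_real_derivative
      deriv X s * (real l * S s ^ (l - 1) * cos (sqrt s))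
     + X s * (real l * (real (l - 1) * S s ^ (l - 2) * deriv S s) * cos (sqrt s) - real l * S s ^ (l - 1) * (S s / 2))
     + 2 * deriv X s * S s ^ l + 2 * s * deriv (deriv X) s * S s ^ l
     + 2 * s * deriv X s * (real l * S s ^ (l - 1) * deriv S s)) (at s)"
      by (rule has_field_derivative_transform_within_open[where S="{0<..}"]) (use s B_eq in auto)
  qed
  have l1: "real (l - 1) = real l - 1" using l by simp
  define C L x x1 x2 \<sigma> \<sigma>1 where "C = cos (sqrt s)" and "L = real l" and "x = X s" and "x1 = deriv X s"
    and "x2 = deriv (deriv X) s" and "\<sigma> = S s" and "\<sigma>1 = deriv S s"
  note defs = C_def[symmetric] L_def[symmetric] x_def[symmetric] x1_def[symmetric] x2_def[symmetric] \<sigma>_def[symmetric] \<sigma>1_def[symmetric]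
  have o1: "\<sigma> + 2 * s * \<sigma>1 = C" and o2: "s * (\<sigma> * \<sigma>) + C * C = 1"
    using S_ode[OF s] unfolding defs by (simp_all add: power2_eq_square)
  have \<rho>s: "\<rho> s = \<sigma> * \<sigma>" using \<rho>_S[OF sc] by (simp add: \<sigma>_def power2_eq_square)
  \<comment> \<open>Here u stands for 2 s \<sigma>1. The difference of the two sides is a multiple
    of s \<sigma>^2 + C^2 - 1, which vanishes by Pythagoras.\<close>
  have identity: "\<sigma> * \<sigma> * (L * (x * K + 2 * s * x1 * P) + (2 * s * x1 * K + x * (L * (L - 1) * Q * u * C - L * \<sigma> * Q * s * \<sigma>)
        + 4 * s * x1 * P + 4 * s * s * x2 * P + 2 * s * x1 * (L * \<sigma> * Q) * u) + (x * K + 2 * s * x1 * P))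
      + 2 * \<sigma> * u * (x * K + 2 * s * x1 * P) - L * (L + 1) * (x * P)
     = - (L * (L + 2)) * s * (\<sigma> * \<sigma>) * (x * P)
      + 2 * s * (\<sigma> * \<sigma> * ((2 * L + 3) * x1 * P + 2 * u * x1 * (L * \<sigma> * Q) + 2 * s * x2 * P) + 2 * \<sigma> * u * x1 * P)"
    if "K = L * \<sigma> * Q * C" "P = \<sigma> * \<sigma> * Q" "C = u + \<sigma>" for u K P
  proof -
    have "\<sigma> * \<sigma> * (L * (x * K + 2 * s * x1 * P) + (2 * s * x1 * K + x * (L * (L - 1) * Q * u * C - L * \<sigma> * Q * s * \<sigma>)
        + 4 * s * x1 * P + 4 * s * s * x2 * P + 2 * s * x1 * (L * \<sigma> * Q) * u) + (x * K + 2 * s * x1 * P))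
      + 2 * \<sigma> * u * (x * K + 2 * s * x1 * P) - L * (L + 1) * (x * P)
     - (- (L * (L + 2)) * s * (\<sigma> * \<sigma>) * (x * P)
      + 2 * s * (\<sigma> * \<sigma> * ((2 * L + 3) * x1 * P + 2 * u * x1 * (L * \<sigma> * Q) + 2 * s * x2 * P) + 2 * \<sigma> * u * x1 * P))
      = x * \<sigma> * \<sigma> * Q * L * (L + 1) * (s * (\<sigma> * \<sigma>) + (u + \<sigma>) * (u + \<sigma>) - 1)"
      unfolding that by (simp add: algebra_simps)
    also have "\<dots> = 0" using o2 unfolding that(3) by simp
    finally show ?thesis by simp
  qed
  show ?thesis
    unfolding dB B_eq[OF s] error_profile_def mode_profile_def d\<rho> \<rho>s l1 P
    unfolding defs
    using identity[OF refl refl o1[symmetric, unfolded add.commute[of \<sigma>]]] by (simp add: algebra_simps)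
qed

text \<open>The profile equation gives the claim multiplied by r^2; division is legitimate off the
  origin, and continuity supplies the rest.\<close>

lemma elliptic_mode:
  assumes l: "l \<ge> 2"
  shows "elliptic \<beta> (mode l) p = - (of_nat l * (of_nat l + 2)) * radial \<rho> p * mode l p
     + radial (error_profile l) p * zeta p ^ l"
proof (rule continuous_eq_off_spheres[where E="{0}"])
  show "smooth (elliptic \<beta> (mode l))" by (intro smooth_elliptic smooth_\<beta> smooth_mode)
  show "smooth (\<lambda>p. - (of_nat l * (of_nat l + 2)) * radial \<rho> p * mode l p + radial (error_profile l) p * zeta p ^ l)"
    by (intro smooth_intros smooth_radial smooth_\<rho> smooth_mode smooth_profiles smooth_zeta)
  fix p assume "sq p \<notin> {0}"
  then have s: "sq p > 0" using sq_eq[of p] by (simp add: less_le)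
  define b where "b = mode_profile l"
  define B where "B s = real l * b s + 2 * s * deriv b s" for s
  have b: "smooth b" "smooth B"
    unfolding B_def[abs_def] b_def by (intro smooth_intros smooth_profiles smooth_real_deriv(2))+
  have m: "mode l = (\<lambda>p. radial b p * zeta p ^ l)" by (simp add: mode_def[abs_def] b_def)
  have e1: "euler (mode l) = (\<lambda>p. radial B p * zeta p ^ l)"
    unfolding m euler_radial_zeta[OF b(1)] B_def[abs_def] ..
  have e2: "euler (euler (mode l)) = (\<lambda>p. radial (\<lambda>s. real l * B s + 2 * s * deriv B s) p * zeta p ^ l)"
    unfolding e1 by (rule euler_radial_zeta[OF b(2)])
  have "of_real (sq p) * elliptic \<beta> (mode l) p = radial \<rho> p * (euler (euler (mode l)) p + euler (mode l) p)
     + euler (radial \<rho>) p * euler (mode l) p - of_nat l * (of_nat l + 1) * mode l p"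
    by (rule highest_weight_elliptic[OF _ smooth_mode smooth_\<rho> smooth_\<beta> \<beta>_eq])
      (unfold m, rule highest_weight_radial_zeta[OF b(1)])
  also have "\<dots> = of_real (\<rho> (sq p) * (real l * B (sq p) + 2 * sq p * deriv B (sq p) + B (sq p)) + 2 * sq p * deriv \<rho> (sq p) * B (sq p)
      - real l * (real l + 1) * b (sq p)) * zeta p ^ l"
    unfolding e2 unfolding e1 unfolding euler_radial[OF smooth_\<rho>] m by (simp add: radial_def algebra_simps)
  also have "\<rho> (sq p) * (real l * B (sq p) + 2 * sq p * deriv B (sq p) + B (sq p)) + 2 * sq p * deriv \<rho> (sq p) * B (sq p)
      - real l * (real l + 1) * b (sq p) = - (real l * (real l + 2)) * sq p * \<rho> (sq p) * b (sq p) + sq p * error_profile l (sq p)"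
    using mode_profile_ode[OF l s] unfolding B_def[abs_def] b_def .
  also have "of_real (- (real l * (real l + 2)) * sq p * \<rho> (sq p) * b (sq p) + sq p * error_profile l (sq p)) * zeta p ^ l
     = of_real (sq p) * (- (of_nat l * (of_nat l + 2)) * radial \<rho> p * mode l p + radial (error_profile l) p * zeta p ^ l)"
    unfolding m by (simp add: radial_def algebra_simps)
  finally show "elliptic \<beta> (mode l) p = - (of_nat l * (of_nat l + 2)) * radial \<rho> p * mode l p
     + radial (error_profile l) p * zeta p ^ l"
    using s by simp
qed simp

end

section \<open>Masses of the mode, of its trapped part and of its error\<close>

context quasimode
begin

definition mode_error :: "nat \<Rightarrow> spacetime \<Rightarrow> complex" where
  "mode_error l p = radial (error_profile l) p * zeta p ^ l"

definition mode_mass :: "nat \<Rightarrow> real" where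
  "mode_mass l = (\<integral>x. \<rho> ((norm x)\<^sup>2) * (norm (mode l (event 0 x)))\<^sup>2 \<partial>lborel)"

definition trapped_mass :: "nat \<Rightarrow> real" where
  "trapped_mass l = (\<integral>x. indicator (cball 0 in_radius) x * (\<rho> ((norm x)\<^sup>2) * (norm (mode l (event 0 x)))\<^sup>2) \<partial>lborel)"

text \<open>The weight 1/\<rho> is dual to the weight \<rho> of |u_t|^2 in the energy, as the energy
  estimate requires.\<close>

definition error_mass :: "nat \<Rightarrow> real" where
  "error_mass l = (\<integral>x. (norm (mode_error l (event 0 x)))\<^sup>2 / \<rho> ((norm x)\<^sup>2) \<partial>lborel)"

lemma smooth_mode_error: "smooth (mode_error l)"
  unfolding mode_error_def[abs_def] by (intro smooth_intros smooth_radial smooth_profiles smooth_zeta)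

lemma zeta_event: "zeta (event t x) = zeta (event 0 x)"
  by (simp add: zeta_def coord_def)

lemma mode_event: "mode l (event t x) = mode l (event 0 x)" "mode_error l (event t x) = mode_error l (event 0 x)"
  by (simp_all add: mode_def mode_error_def radial_def zeta_event[of t])

lemma mode_outside: "norm x > out_radius \<Longrightarrow> mode l (event t x) = 0" "norm x > out_radius \<Longrightarrow> mode_error l (event t x) = 0"
proof -
  assume "norm x > out_radius"
  then have "(norm x)\<^sup>2 > out_radius\<^sup>2" using radii by (intro power_strict_mono) auto
  then show "mode l (event t x) = 0" "mode_error l (event t x) = 0"
    using X_out[of "(norm x)\<^sup>2"] error_profile_zero[of "(norm x)\<^sup>2"]
    by (simp_all add: mode_def mode_error_def radial_def mode_profile_def)
qed

lemma mode_error_inside: "norm x < in_radius \<Longrightarrow> mode_error l (event t x) = 0"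
proof -
  assume "norm x < in_radius"
  then have "(norm x)\<^sup>2 < in_radius\<^sup>2" by (intro power_strict_mono) auto
  then show ?thesis using error_profile_zero[of "(norm x)\<^sup>2"] by (simp add: mode_error_def radial_def)
qed

lemma continuous_\<rho>_norm: "continuous_on A (\<lambda>x::real^3. \<rho> ((norm x)\<^sup>2))"
  by (rule continuous_on_compose2[OF smooth_continuous_on[OF smooth_\<rho>, of UNIV]]) (auto intro!: continuous_intros)

lemma continuous_\<rho>_sq: "continuous_on A (\<lambda>p::spacetime. \<rho> (sq p))"
  by (rule continuous_on_compose2[OF smooth_continuous_on[OF smooth_\<rho>, of UNIV] smooth_continuous_on[OF smooth_sq]]) auto

lemma \<rho>_nonzero: "\<rho> s \<noteq> 0"
  using \<rho>_pos[of s] by simp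

lemma integrable_masses:
  "integrable lborel (\<lambda>x. \<rho> ((norm x)\<^sup>2) * (norm (mode l (event 0 x)))\<^sup>2)"
  "integrable lborel (\<lambda>x. (norm (mode_error l (event 0 x)))\<^sup>2 / \<rho> ((norm x)\<^sup>2))"
proof -
  have "integrable lborel (\<lambda>x. (\<lambda>p. \<rho> (sq p) * (norm (mode l p))\<^sup>2) (event 0 x))"
  proof (rule integrable_slice[where R=out_radius])
    show "continuous_on UNIV (\<lambda>p. \<rho> (sq p) * (norm (mode l p))\<^sup>2)"
      by (intro continuous_on_mult continuous_on_power continuous_on_norm continuous_\<rho>_sq smooth_continuous_on[OF smooth_mode])
  qed (simp add: mode_outside)
  then show "integrable lborel (\<lambda>x. \<rho> ((norm x)\<^sup>2) * (norm (mode l (event 0 x)))\<^sup>2)" by simp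
  have "integrable lborel (\<lambda>x. (\<lambda>p. (norm (mode_error l p))\<^sup>2 / \<rho> (sq p)) (event 0 x))"
  proof (rule integrable_slice[where R=out_radius])
    show "continuous_on UNIV (\<lambda>p. (norm (mode_error l p))\<^sup>2 / \<rho> (sq p))"
      by (intro continuous_on_divide continuous_on_power continuous_on_norm continuous_\<rho>_sq smooth_continuous_on[OF smooth_mode_error])
        (simp add: \<rho>_nonzero)
  qed (simp add: mode_outside)
  then show "integrable lborel (\<lambda>x. (norm (mode_error l (event 0 x)))\<^sup>2 / \<rho> ((norm x)\<^sup>2))" by simp
qed

text \<open>On the annulus \<pi> - r \<le> \<pi>/4, so s S^2 = sin^2 r is at most 1/2. This is where
  all powers of 1/2 come from.\<close>

lemma annulus_bound:
  assumes "in_radius\<^sup>2 \<le> s" "s \<le> out_radius\<^sup>2"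
  shows "s * (S s)\<^sup>2 \<le> 1/2" and "S s > 0"
proof -
  have s: "s > 0" using assms(1) radii by (smt (verit) zero_less_power)
  define r where "r = sqrt s"
  have r: "in_radius \<le> r" "r \<le> out_radius"
    using assms radii unfolding r_def by (auto simp: real_le_rsqrt real_le_lsqrt)
  have "sin r = sin (pi - r)" by simp
  also have "\<dots> \<le> sin (pi / 4)"
    by (rule sin_monotone_2pi_le) (use r pi_gt_zero in \<open>auto simp: in_radius_def out_radius_def\<close>)
  finally have u: "sin r \<le> sqrt 2 / 2" by (simp add: sin_45)
  have p: "sin r > 0"
  proof (rule sin_gt_zero)
    show "0 < r" using r radii by linarith
    show "r < pi" using r pi_gt_zero unfolding out_radius_def by linarith
  qed
  have "(sin r)\<^sup>2 \<le> (sqrt 2 / 2)\<^sup>2" using u p by (intro power_mono) auto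
  then have "(sin r)\<^sup>2 \<le> 1/2" by (simp add: power_divide)
  moreover have "s * (S s)\<^sup>2 = (sin r)\<^sup>2" using s by (simp add: S_sin r_def power_divide)
  ultimately show "s * (S s)\<^sup>2 \<le> 1/2" by simp
  show "S s > 0" using p s by (simp add: S_sin r_def)
qed

lemma zeta_S_bound:
  assumes "in_radius\<^sup>2 \<le> sq p" "sq p \<le> out_radius\<^sup>2"
  shows "(norm (zeta p) * S (sq p)) ^ l * (norm (zeta p) * S (sq p)) ^ l \<le> (1/2) ^ l"
proof -
  have "(norm (zeta p) * S (sq p))\<^sup>2 \<le> sq p * (S (sq p))\<^sup>2"
    using norm_zeta[of p] by (simp add: power_mult_distrib mult_right_mono)
  also have "\<dots> \<le> 1/2" by (rule annulus_bound(1)[OF assms])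
  finally have "((norm (zeta p) * S (sq p))\<^sup>2) ^ l \<le> (1/2) ^ l" by (intro power_mono) auto
  then show ?thesis by (simp add: power2_eq_square power_mult_distrib)
qed

text \<open>The error lives in the annulus, where |zeta S|^(2l) is at most 2^(-l); differentiating
  S^l costs one factor of order l, which is squared in the mass.\<close>

lemma error_mass_bound: "\<exists>C>0. \<forall>l\<ge>2. error_mass l \<le> C * (real l + 1)\<^sup>2 * (1/2) ^ l"
proof -
  let ?I = "{in_radius\<^sup>2..out_radius\<^sup>2}"
  \<comment> \<open>Bounds \<open>error_profile\<close> divided by (l + 1) S^l uniformly in l; it is
    continuous because S is positive on the annulus.\<close>
  define K where "K s = 2 * (\<rho> s * (3 * \<bar>deriv X s\<bar> + 4 * s * \<bar>deriv X s\<bar> * (\<bar>deriv S s\<bar> / S s) + 2 * s * \<bar>deriv (deriv X) s\<bar>)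
     + 2 * s * \<bar>deriv \<rho> s\<bar> * \<bar>deriv X s\<bar>)" for s
  have pos: "s \<in> ?I \<Longrightarrow> s \<ge> 0" for s using radii by (auto intro: order_trans[rotated])
  have "continuous_on ?I (\<lambda>s. (K s)\<^sup>2 / \<rho> s)"
    unfolding K_def
    by (intro continuous_intros smooth_continuous_on smooth_\<rho> smooth_X smooth_S smooth_real_deriv(2))
      (use annulus_bound(2) \<rho>_nonzero in force)+
  then have "bounded ((\<lambda>s. (K s)\<^sup>2 / \<rho> s) ` ?I)"
    by (rule compact_imp_bounded[OF compact_continuous_image]) simp
  then obtain B where "\<forall>y\<in>(\<lambda>s. (K s)\<^sup>2 / \<rho> s) ` ?I. norm y \<le> B"
    unfolding bounded_iff by (rule exE)
  then have B: "\<bar>(K s)\<^sup>2 / \<rho> s\<bar> \<le> B" if "s \<in> ?I" for s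
    using that by (simp only: ball_simps real_norm_def)
  define C where "C = \<bar>B\<bar> * measure lborel (cball (0::real^3) out_radius) + 1"
  have "error_mass l \<le> C * (real l + 1)\<^sup>2 * (1/2) ^ l" if l: "l \<ge> 2" for l
  proof -
    have pt: "(norm (mode_error l (event 0 x)))\<^sup>2 / \<rho> ((norm x)\<^sup>2) \<le> (\<bar>B\<bar> * (real l + 1)\<^sup>2 * (1/2) ^ l) * indicator (cball 0 out_radius) x" for x
    proof (cases "in_radius \<le> norm x \<and> norm x \<le> out_radius")
      case False
      then have "mode_error l (event 0 x) = 0" using mode_error_inside mode_outside(2) by force
      then show ?thesis by simp
    next
      case True
      define s where "s = (norm x)\<^sup>2"
      have s: "s \<in> ?I" using True radii unfolding s_def by (auto intro!: power_mono)
      have S0: "S s > 0" using annulus_bound(2)[of s] s by auto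
      have s0: "s \<ge> 0" by (simp add: s_def)
      have r0: "\<rho> s > 0" by (rule \<rho>_pos)
      have Sl: "S s ^ (l - 1) = S s ^ l / S s"
        using l S0 by (cases l) auto
      have e: "error_profile l s = S s ^ l * (2 * (\<rho> s * ((2 * real l + 3) * deriv X s
          + 4 * s * deriv X s * (real l * (deriv S s / S s)) + 2 * s * deriv (deriv X) s) + 2 * s * deriv \<rho> s * deriv X s))"
        unfolding error_profile_def Sl by (simp add: algebra_simps)
      have "\<bar>2 * (\<rho> s * ((2 * real l + 3) * deriv X s
          + 4 * s * deriv X s * (real l * (deriv S s / S s)) + 2 * s * deriv (deriv X) s) + 2 * s * deriv \<rho> s * deriv X s)\<bar>
        \<le> (real l + 1) * K s"
      proof -
        have a1: "\<bar>(2 * real l + 3) * deriv X s\<bar> \<le> (real l + 1) * (3 * \<bar>deriv X s\<bar>)"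
        proof -
          have "\<bar>(2 * real l + 3) * deriv X s\<bar> = (2 * real l + 3) * \<bar>deriv X s\<bar>" by (simp add: abs_mult)
          also have "\<dots> \<le> ((real l + 1) * 3) * \<bar>deriv X s\<bar>" by (intro mult_right_mono) auto
          finally show ?thesis by (simp only: mult.assoc)
        qed
        have a2: "\<bar>4 * s * deriv X s * (real l * (deriv S s / S s))\<bar> \<le> (real l + 1) * (4 * s * \<bar>deriv X s\<bar> * (\<bar>deriv S s\<bar> / S s))"
        proof -
          have "\<bar>4 * s * deriv X s * (real l * (deriv S s / S s))\<bar> = real l * (4 * s * \<bar>deriv X s\<bar> * (\<bar>deriv S s\<bar> / S s))"
            using s0 S0 by (simp add: abs_mult)
          also have "\<dots> \<le> (real l + 1) * (4 * s * \<bar>deriv X s\<bar> * (\<bar>deriv S s\<bar> / S s))"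
            using s0 S0 by (intro mult_right_mono) auto
          finally show ?thesis .
        qed
        have one: "1 \<le> real l + 1" by simp
        have a3: "\<bar>2 * s * deriv (deriv X) s\<bar> \<le> (real l + 1) * (2 * s * \<bar>deriv (deriv X) s\<bar>)"
          using mult_right_mono[OF one, of "2 * s * \<bar>deriv (deriv X) s\<bar>"] s0 by (simp add: abs_mult)
        have a4: "\<bar>2 * s * deriv \<rho> s * deriv X s\<bar> \<le> (real l + 1) * (2 * s * \<bar>deriv \<rho> s\<bar> * \<bar>deriv X s\<bar>)"
          using mult_right_mono[OF one, of "2 * s * \<bar>deriv \<rho> s\<bar> * \<bar>deriv X s\<bar>"] s0 by (simp add: abs_mult)
        have a5: "\<bar>\<rho> s * ((2 * real l + 3) * deriv X s
          + 4 * s * deriv X s * (real l * (deriv S s / S s)) + 2 * s * deriv (deriv X) s)\<bar>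
          \<le> \<rho> s * ((real l + 1) * (3 * \<bar>deriv X s\<bar>) + (real l + 1) * (4 * s * \<bar>deriv X s\<bar> * (\<bar>deriv S s\<bar> / S s)) + (real l + 1) * (2 * s * \<bar>deriv (deriv X) s\<bar>))"
        proof -
          have "\<bar>(2 * real l + 3) * deriv X s + 4 * s * deriv X s * (real l * (deriv S s / S s)) + 2 * s * deriv (deriv X) s\<bar>
            \<le> (real l + 1) * (3 * \<bar>deriv X s\<bar>) + (real l + 1) * (4 * s * \<bar>deriv X s\<bar> * (\<bar>deriv S s\<bar> / S s)) + (real l + 1) * (2 * s * \<bar>deriv (deriv X) s\<bar>)"
            by (rule order_trans[OF abs_triangle_ineq add_mono[OF order_trans[OF abs_triangle_ineq add_mono[OF a1 a2]] a3]])
          from mult_left_mono[OF this less_imp_le[OF r0]] show ?thesis unfolding abs_mult[of "\<rho> s"] abs_of_pos[OF r0] .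
        qed
        have "(real l + 1) * K s = 2 * (\<rho> s * ((real l + 1) * (3 * \<bar>deriv X s\<bar>) + (real l + 1) * (4 * s * \<bar>deriv X s\<bar> * (\<bar>deriv S s\<bar> / S s)) + (real l + 1) * (2 * s * \<bar>deriv (deriv X) s\<bar>))
          + (real l + 1) * (2 * s * \<bar>deriv \<rho> s\<bar> * \<bar>deriv X s\<bar>))"
          unfolding K_def by (simp add: algebra_simps)
        moreover have "\<bar>2 * (a + b)\<bar> \<le> 2 * (c + d)" if "\<bar>a\<bar> \<le> c" "\<bar>b\<bar> \<le> d" for a b c d :: real
          using abs_triangle_ineq[of a b] that by (simp add: abs_mult)
        ultimately show ?thesis using a4 a5 by (simp only:)
      qed
      then have "\<bar>error_profile l s\<bar> \<le> S s ^ l * ((real l + 1) * K s)"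
        unfolding e abs_mult[of "S s ^ l"] using S0 by (intro mult_mono) auto
      then have "norm (mode_error l (event 0 x)) \<le> S s ^ l * ((real l + 1) * K s) * norm (zeta (event 0 x)) ^ l"
        by (simp add: mode_error_def radial_def norm_mult norm_power s_def[symmetric] mult_right_mono)
      also have "\<dots> = (real l + 1) * K s * (norm (zeta (event 0 x)) * S s) ^ l" by (simp add: power_mult_distrib mult_ac)
      finally have "(norm (mode_error l (event 0 x)))\<^sup>2 \<le> ((real l + 1) * K s * (norm (zeta (event 0 x)) * S s) ^ l)\<^sup>2"
        by (intro power_mono) auto
      also have "\<dots> = (real l + 1)\<^sup>2 * (K s)\<^sup>2 * ((norm (zeta (event 0 x)) * S s) ^ l * (norm (zeta (event 0 x)) * S s) ^ l)"
        by (simp add: power2_eq_square mult_ac)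
      also have "\<dots> \<le> (real l + 1)\<^sup>2 * (K s)\<^sup>2 * (1/2) ^ l"
        using zeta_S_bound[of "event 0 x" l] s by (intro mult_left_mono) (auto simp: s_def)
      finally have "(norm (mode_error l (event 0 x)))\<^sup>2 / \<rho> s \<le> (real l + 1)\<^sup>2 * (K s)\<^sup>2 * (1/2) ^ l / \<rho> s"
        using r0 by (intro divide_right_mono) auto
      also have "\<dots> = ((K s)\<^sup>2 / \<rho> s) * ((real l + 1)\<^sup>2 * (1/2) ^ l)" by simp
      also have "\<dots> \<le> \<bar>B\<bar> * ((real l + 1)\<^sup>2 * (1/2) ^ l)"
        using order_trans[OF abs_ge_self B[OF s]] by (intro mult_right_mono order_trans[OF _ abs_ge_self]) simp_all
      finally show ?thesis using True by (simp add: s_def mult_ac)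
    qed
    have "error_mass l \<le> (\<integral>x. (\<bar>B\<bar> * (real l + 1)\<^sup>2 * (1/2) ^ l) * indicator (cball 0 out_radius) (x::real^3) \<partial>lborel)"
      unfolding error_mass_def by (rule integral_mono[OF integrable_masses(2) integrable_indicator_cball pt])
    also have "\<dots> = \<bar>B\<bar> * (real l + 1)\<^sup>2 * (1/2) ^ l * measure lborel (cball (0::real^3) out_radius)" by simp
    also have "\<dots> \<le> C * (real l + 1)\<^sup>2 * (1/2) ^ l" by (simp add: C_def algebra_simps)
    finally show ?thesis .
  qed
  moreover have "C > 0" by (simp add: C_def add_nonneg_pos)
  ultimately show ?thesis by blast
qed

text \<open>Outside the inner ball the cut off mode lives in the annulus, where its square is at
  most 2^(-l).\<close>

lemma mode_mass_bound: "\<exists>C>0. \<forall>l. mode_mass l \<le> trapped_mass l + C * (1/2) ^ l"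
proof -
  have "bounded ((\<lambda>x::real^3. \<rho> ((norm x)\<^sup>2)) ` cball 0 out_radius)"
    by (rule compact_imp_bounded[OF compact_continuous_image[OF continuous_\<rho>_norm]]) simp
  then obtain B where "\<forall>y\<in>(\<lambda>x::real^3. \<rho> ((norm x)\<^sup>2)) ` cball 0 out_radius. norm y \<le> B"
    unfolding bounded_iff by (rule exE)
  then have B: "\<bar>\<rho> ((norm x)\<^sup>2)\<bar> \<le> B" if "norm x \<le> out_radius" for x :: "real^3"
    using that by simp
  define C where "C = \<bar>B\<bar> * measure lborel (cball (0::real^3) out_radius) + 1"
  have "mode_mass l \<le> trapped_mass l + C * (1/2) ^ l" for l
  proof -
    let ?m = "\<lambda>x. \<rho> ((norm x)\<^sup>2) * (norm (mode l (event 0 x)))\<^sup>2"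
    have i1: "integrable lborel (\<lambda>x. indicator (cball 0 in_radius) x * ?m x)"
      using integrable_mult_indicator[OF _ integrable_masses(1)[of l], of "cball 0 in_radius"] by simp
    have pt: "?m x \<le> indicator (cball 0 in_radius) x * ?m x + (\<bar>B\<bar> * (1/2) ^ l) * indicator (cball 0 out_radius) x" for x
    proof (cases "norm x \<le> in_radius \<or> norm x > out_radius")
      case True
      then show ?thesis using mode_outside(1)[of x l 0] by (auto simp: indicator_def)
    next
      case False
      define s where "s = (norm x)\<^sup>2"
      have s: "in_radius\<^sup>2 \<le> s" "s \<le> out_radius\<^sup>2" using False radii unfolding s_def by (auto intro!: power_mono)
      have S0: "S s > 0" using annulus_bound(2) s by auto
      have "norm (mode l (event 0 x)) = X s * (norm (zeta (event 0 x)) * S s) ^ l"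
        using X_range(1)[of s] S0 by (simp add: mode_def radial_def mode_profile_def norm_mult norm_power s_def[symmetric] power_mult_distrib)
      also have "\<dots> \<le> 1 * (norm (zeta (event 0 x)) * S s) ^ l"
        using X_range(2)[of s] S0 by (intro mult_right_mono) auto
      finally have "(norm (mode l (event 0 x)))\<^sup>2 \<le> ((norm (zeta (event 0 x)) * S s) ^ l)\<^sup>2" by (intro power_mono) auto
      also have "\<dots> \<le> (1/2) ^ l" using zeta_S_bound[of "event 0 x" l] s by (simp add: s_def power2_eq_square)
      finally have "\<rho> s * (norm (mode l (event 0 x)))\<^sup>2 \<le> \<bar>B\<bar> * (1/2) ^ l"
        using B[of x] False \<rho>_pos[of s] by (intro mult_mono) (auto simp: s_def)
      then show ?thesis using False by (simp add: s_def)
    qed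
    have "mode_mass l \<le> (\<integral>x. indicator (cball 0 in_radius) x * ?m x + (\<bar>B\<bar> * (1/2) ^ l) * indicator (cball 0 out_radius) x \<partial>lborel)"
      unfolding mode_mass_def
      by (rule integral_mono[OF integrable_masses(1) Bochner_Integration.integrable_add[OF i1 integrable_indicator_cball] pt])
    also have "\<dots> = trapped_mass l + \<bar>B\<bar> * (1/2) ^ l * measure lborel (cball (0::real^3) out_radius)"
      unfolding Bochner_Integration.integral_add[OF i1 integrable_indicator_cball] trapped_mass_def by simp
    also have "\<dots> \<le> trapped_mass l + C * (1/2) ^ l" by (simp add: C_def algebra_simps)
    finally show ?thesis .
  qed
  moreover have "C > 0" by (simp add: C_def add_nonneg_pos)
  ultimately show ?thesis by blast
qed

text \<open>The modes have modulus close to one near the equatorial geodesic \<open>r = \<pi> / 2\<close>, \<open>x\<^sub>3 = 0\<close>.\<close>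

lemma trapped_mass_bound: "\<exists>c>0. \<forall>l. c * (81/100) ^ l \<le> trapped_mass l"
proof -
  define g where "g x = (norm (zeta (event 0 x)) * S ((norm x)\<^sup>2))\<^sup>2" for x :: "real^3"
  define x0 where "x0 = (pi / 2) *\<^sub>R (axis 1 1 :: real^3)"
  have cS: "continuous_on UNIV (\<lambda>x::real^3. S ((norm x)\<^sup>2))"
    by (rule continuous_on_compose2[OF smooth_continuous_on[OF smooth_S, of UNIV]]) (auto intro!: continuous_intros)
  have cg: "continuous_on UNIV g"
    unfolding g_def by (intro continuous_on_power continuous_on_mult continuous_on_norm cS continuous_slice smooth_continuous_on smooth_zeta)
  have nx0: "norm x0 = pi / 2" by (simp add: x0_def)
  have z0: "norm (zeta (event 0 x0)) = pi / 2"
    by (simp add: zeta_def coord_def x0_def axis_def)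
  have "S ((pi/2)\<^sup>2) = 1 / (pi / 2)" using S_sin[of "(pi/2)\<^sup>2"] by simp
  then have g0: "g x0 = 1" by (simp add: g_def z0 nx0)
  \<comment> \<open>At x0, on the geodesic, g = 1. The threshold 81/100 is far enough above the
    bound 1/2 on the annulus: the ratio 50/81 is below exp(-1/3).\<close>
  have "open {x. g x > 81/100 \<and> norm x < in_radius}"
    by (intro open_Collect_conj open_Collect_less cg continuous_intros)
  moreover have "x0 \<in> {x. g x > 81/100 \<and> norm x < in_radius}"
  proof -
    have "norm x0 < in_radius" unfolding nx0 in_radius_def using pi_gt_zero by linarith
    then show ?thesis using g0 by simp
  qed
  ultimately obtain d where d: "d > 0" "\<And>x. x \<in> ball x0 d \<Longrightarrow> g x > 81/100 \<and> norm x < in_radius"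
    using open_contains_ball by (metis (mono_tags, lifting) mem_Collect_eq subset_iff)
  have "\<exists>x\<in>cball (0::real^3) in_radius. \<forall>y\<in>cball (0::real^3) in_radius. \<rho> ((norm x)\<^sup>2) \<le> \<rho> ((norm y)\<^sup>2)"
    by (rule continuous_attains_inf) (use radii continuous_\<rho>_norm in auto)
  then obtain x1 :: "real^3" where x1: "\<And>y::real^3. norm y \<le> in_radius \<Longrightarrow> \<rho> ((norm x1)\<^sup>2) \<le> \<rho> ((norm y)\<^sup>2)"
    unfolding Ball_def mem_cball_0 by blast
  define c where "c = \<rho> ((norm x1)\<^sup>2) * measure lborel (ball x0 d)"
  have "c * (81/100) ^ l \<le> trapped_mass l" for l
  proof -
    have i0: "integrable lborel (\<lambda>x. (\<rho> ((norm x1)\<^sup>2) * (81/100) ^ l) * indicator (ball x0 d) x)"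
      by (intro integrable_mult_right integrable_real_indicator) (auto intro: emeasure_lborel_ball_finite[simplified])
    have i1: "integrable lborel (\<lambda>x. indicator (cball 0 in_radius) x * (\<rho> ((norm x)\<^sup>2) * (norm (mode l (event 0 x)))\<^sup>2))"
      using integrable_mult_indicator[OF _ integrable_masses(1)[of l], of "cball 0 in_radius"] by simp
    have "(\<integral>x. (\<rho> ((norm x1)\<^sup>2) * (81/100) ^ l) * indicator (ball x0 d) x \<partial>lborel) \<le> trapped_mass l"
      unfolding trapped_mass_def
    proof (rule integral_mono[OF i0 i1])
      fix x
      show "(\<rho> ((norm x1)\<^sup>2) * (81/100) ^ l) * indicator (ball x0 d) x \<le> indicator (cball 0 in_radius) x * (\<rho> ((norm x)\<^sup>2) * (norm (mode l (event 0 x)))\<^sup>2)"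
      proof (cases "x \<in> ball x0 d")
        case True
        then have x: "g x > 81/100" "norm x < in_radius" using d by auto
        have "(norm x)\<^sup>2 \<le> in_radius\<^sup>2" using x by (intro power_mono) auto
        then have "(norm (mode l (event 0 x)))\<^sup>2 = g x ^ l"
          by (simp add: mode_def radial_def mode_profile_def X_in g_def norm_mult norm_power power_mult_distrib
              power_mult[symmetric] mult.commute[of l] power_even_abs)
        moreover have "(81/100) ^ l \<le> g x ^ l" using x by (intro power_mono) auto
        ultimately have "\<rho> ((norm x1)\<^sup>2) * (81/100) ^ l \<le> \<rho> ((norm x)\<^sup>2) * (norm (mode l (event 0 x)))\<^sup>2"
          using x1[of x] x \<rho>_pos[of "(norm x)\<^sup>2"] by (intro mult_mono) auto
        then show ?thesis using True x by simp
      qed (use \<rho>_pos[of "(norm x)\<^sup>2"] in simp)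
    qed
    then show ?thesis by (simp add: c_def mult_ac)
  qed
  moreover have "c > 0" using \<rho>_pos d(1) by (simp add: c_def content_ball_pos)
  ultimately show ?thesis by blast
qed

end

section \<open>Time reflection and products with functions of time\<close>

text \<open>Turns the forward solver into a backward one; the wave operator is invariant because it
  contains only second time derivatives, with coefficients independent of t.\<close>

definition reflect :: "spacetime \<Rightarrow> spacetime" where
  "reflect p = event (- (p $ None)) (space_part p)"

lemma reflect_event [simp]: "reflect (event t x) = event (- t) x"
  by (simp add: reflect_def)

lemma reflect_nth [simp]: "reflect p $ None = - (p $ None)" "reflect p $ Some i = p $ Some i"
  by (simp_all add: reflect_def)

lemma linear_reflect: "bounded_linear reflect"
proof -
  have "linear reflect"
    by (rule linearI) (auto simp: vec_eq_iff reflect_def event_def split: option.split)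
  then show ?thesis by (simp add: linear_conv_bounded_linear)
qed

lemma reflect_has_derivative:
  assumes "smooth u"
  shows "((\<lambda>p. u (reflect p)) has_derivative
    (\<lambda>h. \<Sum>\<mu>\<in>UNIV. (reflect h $ \<mu>) *\<^sub>R pd \<mu> u (reflect p))) (at p)"
  using diff_chain_at[OF bounded_linear_imp_has_derivative[OF linear_reflect] smooth_has_derivative[OF assms, of "reflect p"]]
  by (simp add: o_def)

lemma pd_reflect:
  assumes "smooth u"
  shows "pd None (\<lambda>p. u (reflect p)) = (\<lambda>p. - pd None u (reflect p))"
    and "pd (Some i) (\<lambda>p. u (reflect p)) = (\<lambda>p. pd (Some i) u (reflect p))"
  by (rule ext, subst pd_eqI[OF reflect_has_derivative[OF assms]],
      simp add: sum_option axis_def if_distrib[of "\<lambda>c. c *\<^sub>R _"] cong: if_cong)+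

lemma smooth_reflect:
  fixes u :: "spacetime \<Rightarrow> complex"
  shows "smooth u \<Longrightarrow> smooth (\<lambda>p. u (reflect p))"
proof -
  have "Ck_on k UNIV (\<lambda>p. u (reflect p))" if "smooth u" for k and u :: "spacetime \<Rightarrow> complex"
    using that
  proof (induction k arbitrary: u)
    case 0
    then show ?case
      by (auto intro!: continuous_at_imp_continuous_on has_derivative_continuous[OF reflect_has_derivative])
  next
    case (Suc k)
    show ?case
    proof (rule Ck_on_SucI[OF _ reflect_has_derivative[OF Suc.prems]])
      fix b :: spacetime assume "b \<in> Basis"
      then obtain \<mu> where b: "b = axis \<mu> 1" by (auto simp: Basis_vec_def)
      have "(\<Sum>\<nu>\<in>UNIV. (reflect b $ \<nu>) *\<^sub>R pd \<nu> u (reflect p)) = (if \<mu> = None then -1 else 1) *\<^sub>R pd \<mu> u (reflect p)" for p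
        unfolding b by (cases \<mu>) (simp_all add: sum_option axis_def if_distrib[of "\<lambda>c. c *\<^sub>R _"] cong: if_cong)
      then show "Ck_on k UNIV (\<lambda>p. \<Sum>\<nu>\<in>UNIV. (reflect b $ \<nu>) *\<^sub>R pd \<nu> u (reflect p))"
        by (simp only: Ck_on_bounded_linear[OF bounded_linear_scaleR_right open_UNIV Suc.IH[OF smooth_pd[OF Suc.prems]]])
    qed simp
  qed
  note * = this
  assume u: "smooth u"
  show "smooth (\<lambda>p. u (reflect p))"
    unfolding smooth_on_UNIV[of "\<lambda>p. u (reflect p)", symmetric] smooth_on_def by (rule allI, rule *[OF u])
qed

lemma coord_reflect: "coord i (reflect p) = coord i p" by (simp add: coord_def)
lemma sq_reflect: "sq (reflect p) = sq p" by (simp add: sq_def)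
lemma radial_reflect: "radial b (reflect p) = radial b p" by (simp add: radial_def sq_reflect)

lemma euler_reflect: "smooth u \<Longrightarrow> euler (\<lambda>p. u (reflect p)) = (\<lambda>p. euler u (reflect p))"
  by (simp add: euler_def[abs_def] pd_reflect coord_reflect)

definition time_factor :: "(real \<Rightarrow> complex) \<Rightarrow> spacetime \<Rightarrow> complex" where
  "time_factor a p = a (p $ None)"

lemma smooth_time_factor: "smooth a \<Longrightarrow> smooth (time_factor a)"
  unfolding time_factor_def[abs_def] by (rule smooth_compose[OF _ smooth_nth])

lemma pd_time_factor:
  assumes "smooth a" "\<And>t. (a has_vector_derivative a' t) (at t)"
  shows "pd None (time_factor a) = time_factor a'" and "pd (Some i) (time_factor a) = (\<lambda>p. 0)"
proof -
  show "pd None (time_factor a) = time_factor a'"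
  proof
    fix p show "pd None (time_factor a) p = time_factor a' p"
    proof (rule pd_axis_eqI[OF smooth_time_factor[OF assms(1)]])
      have "((a \<circ> (\<lambda>s. p $ None + s)) has_vector_derivative 1 *\<^sub>R a' (p $ None)) (at 0)"
        by (rule vector_diff_chain_at) (use assms(2)[of "p $ None"] in \<open>auto intro!: derivative_eq_intros\<close>)
      then show "((\<lambda>s. time_factor a (p + s *\<^sub>R axis None 1)) has_vector_derivative time_factor a' p) (at 0)"
        by (simp add: time_factor_def o_def axis_def)
    qed
  qed
  show "pd (Some i) (time_factor a) = (\<lambda>p. 0)"
    by (rule ext, rule pd_axis_eqI[OF smooth_time_factor[OF assms(1)]]) (simp add: time_factor_def axis_def)
qed

context warped
begin

lemma elliptic_add: "smooth u \<Longrightarrow> smooth v \<Longrightarrow> elliptic \<beta> (\<lambda>p. u p + v p) p = elliptic \<beta> u p + elliptic \<beta> v p"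
  by (simp add: elliptic_eq smooth_\<beta> smooth_intros smooth_euler euler_add laplacian_def pd_add smooth_pd sum.distrib algebra_simps)

lemma wave_add: "smooth u \<Longrightarrow> smooth v \<Longrightarrow> wave (\<lambda>p. u p + v p) p = wave u p + wave v p"
  by (simp add: wave_def elliptic_add pd_add smooth_pd algebra_simps)

lemma elliptic_time_factor:
  assumes "smooth a" "\<And>t. (a has_vector_derivative a' t) (at t)" "smooth u"
  shows "elliptic \<beta> (\<lambda>p. time_factor a p * u p) p = time_factor a p * elliptic \<beta> u p"
proof -
  note a = smooth_time_factor[OF assms(1)]
  have 0: "pd (Some i) (\<lambda>p. time_factor a p * w p) = (\<lambda>p. time_factor a p * pd (Some i) w p)" if "smooth w" for w i
    by (simp add: pd_mult a that pd_time_factor[OF assms(1,2)])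
  have 1: "euler (\<lambda>p. time_factor a p * w p) = (\<lambda>p. time_factor a p * euler w p)" if "smooth w" for w
    unfolding euler_def[abs_def] 0[OF that] by (simp add: sum_distrib_left mult_ac)
  show ?thesis
    by (simp add: elliptic_eq smooth_\<beta> smooth_intros a assms(3) 1 smooth_euler laplacian_def 0 smooth_pd)
      (simp add: sum_distrib_left algebra_simps)
qed

lemma wave_reflect:
  assumes "smooth u"
  shows "wave (\<lambda>p. u (reflect p)) p = wave u (reflect p)"
proof -
  have n: "pd None (pd None (\<lambda>p. u (reflect p))) p = pd None (pd None u) (reflect p)"
    unfolding pd_reflect(1)[OF assms] by (simp add: pd_minus pd_reflect smooth_reflect smooth_pd assms)
  have "elliptic \<beta> (\<lambda>p. u (reflect p)) p = elliptic \<beta> u (reflect p)"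
    by (simp add: elliptic_eq smooth_\<beta> smooth_reflect assms euler_reflect smooth_euler laplacian_def pd_reflect smooth_pd
        euler_radial radial_reflect)
  then show ?thesis by (simp add: wave_def n radial_reflect)
qed

text \<open>The coefficients do not depend on t, so T commutes with the operator and energy
  estimates apply to T u as well.\<close>

lemma wave_pd_None:
  assumes u: "smooth u"
  shows "wave (pd None u) p = pd None (wave u) p"
proof -
  have "pd None (\<lambda>q. radial \<rho> q * pd None (pd None u) q) p = radial \<rho> p * pd None (pd None (pd None u)) p"
    by (simp add: pd_mult smooth_radial smooth_\<rho> smooth_pd u pd_radial)
  moreover have "pd None (elliptic \<beta> u) p = elliptic \<beta> (pd None u) p"
  proof -
    have f: "flux (pd None u) i = pd None (flux u i)" for i
      unfolding flux_def[abs_def]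
      by (simp add: pd_add pd_mult smooth_intros smooth_pd smooth_radial smooth_\<beta> smooth_coord smooth_euler u
          pd_radial pd_coord pd_None_euler pd_commute[OF u, of None])
    have e: "elliptic \<beta> u = (\<lambda>p. \<Sum>i\<in>UNIV. pd (Some i) (flux u i) p)" using elliptic_flux[OF u] by (simp add: fun_eq_iff)
    have "pd None (elliptic \<beta> u) p = (\<Sum>i\<in>UNIV. pd None (pd (Some i) (flux u i)) p)"
      unfolding e by (subst pd_sum) (auto intro!: smooth_pd smooth_flux u)
    also have "\<dots> = (\<Sum>i\<in>UNIV. pd (Some i) (pd None (flux u i)) p)"
      by (subst pd_commute[OF smooth_flux[OF u]]) simp
    finally show ?thesis by (simp add: elliptic_flux smooth_pd u f)
  qed
  ultimately show ?thesis
    unfolding wave_def[abs_def]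
    by (subst pd_diff) (auto intro!: smooth_intros smooth_radial smooth_\<rho> smooth_pd smooth_elliptic smooth_\<beta> u)
qed

text \<open>The parallelogram identity with the density of u - v discarded. A termwise estimate
  would fail where \<beta> is negative; nonnegativity belongs to the whole quadratic form.\<close>

lemma wave_density_add_le:
  assumes "smooth u" "smooth v"
  shows "wave_density (\<lambda>p. u p + v p) p \<le> 2 * wave_density u p + 2 * wave_density v p"
proof -
  have par: "(norm (a + b))\<^sup>2 + (norm (a - b))\<^sup>2 = 2 * (norm a)\<^sup>2 + 2 * (norm b)\<^sup>2" for a b :: complex
    by (simp only: cmod_power2 plus_complex.simps minus_complex.simps) (simp add: power2_eq_square algebra_simps)
  have "wave_density (\<lambda>p. u p + v p) p + wave_density (\<lambda>p. u p - v p) p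
    = \<rho> (sq p) * ((norm (pd None u p + pd None v p))\<^sup>2 + (norm (pd None u p - pd None v p))\<^sup>2)
      + (\<Sum>i\<in>UNIV. (norm (pd (Some i) u p + pd (Some i) v p))\<^sup>2 + (norm (pd (Some i) u p - pd (Some i) v p))\<^sup>2)
      + \<beta> (sq p) * ((norm (euler u p + euler v p))\<^sup>2 + (norm (euler u p - euler v p))\<^sup>2)"
    using assms by (simp add: wave_density_def pd_add pd_diff euler_add euler_diff sum.distrib algebra_simps)
  also have "\<dots> = 2 * wave_density u p + 2 * wave_density v p"
    unfolding par by (simp add: wave_density_def sum.distrib sum_distrib_left algebra_simps)
  finally show ?thesis using density_nonneg[of "\<lambda>p. u p - v p" p] by linarith
qed

lemma wave_density_cmult:
  assumes "smooth u"
  shows "wave_density (\<lambda>p. c * u p) p = (norm c)\<^sup>2 * wave_density u p"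
  using assms by (simp add: wave_density_def pd_cmult euler_cmult norm_mult power_mult_distrib sum_distrib_left algebra_simps)

lemma wave_density_reflect:
  assumes "smooth u"
  shows "wave_density (\<lambda>p. u (reflect p)) p = wave_density u (reflect p)"
  using assms by (simp add: wave_density_def pd_reflect euler_reflect sq_reflect)

lemma wave_density_forward_supported:
  "forward_supported R u \<Longrightarrow> p $ None < -1 \<or> norm (space_part p) > R + p $ None + 1 \<Longrightarrow> wave_density u p = 0"
  using forward_supportedD[OF forward_supported_cdensity] by (simp add: cdensity_eq)

end

section \<open>Resonant solutions\<close>

definition phase :: "real \<Rightarrow> real \<Rightarrow> complex" where
  "phase \<omega> t = exp (of_real t * (- (\<i> * of_real \<omega>)))"

lemma norm_phase [simp]: "norm (phase \<omega> t) = 1"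
  by (simp add: phase_def norm_exp_eq_Re)

lemma smooth_phase: "smooth (phase \<omega>)"
  unfolding phase_def[abs_def] by (rule smooth_exp_mult)

lemma phase_minus: "phase (- \<omega>) (- t) = phase \<omega> t"
  by (simp add: phase_def)

lemma phase_derivative: "(phase \<omega> has_vector_derivative - (\<i> * of_real \<omega>) * phase \<omega> t) (at t)"
  unfolding phase_def[abs_def]
  by (rule has_vector_derivative_real_field) (auto intro!: derivative_eq_intros)

lemma modulated_phase_derivative:
  fixes \<theta> :: "real \<Rightarrow> real"
  assumes "smooth \<theta>"
  shows "((\<lambda>t. of_real (\<theta> t) * phase \<omega> t) has_vector_derivative
    (of_real (deriv \<theta> t) - of_real (\<theta> t) * (\<i> * of_real \<omega>)) * phase \<omega> t) (at t)"
proof -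
  have "((\<lambda>t. complex_of_real (\<theta> t)) has_vector_derivative of_real (deriv \<theta> t)) (at t)"
    by (rule bounded_linear.has_vector_derivative[OF bounded_linear_of_real
          smooth_real_deriv(1)[OF assms, unfolded has_real_derivative_iff_has_vector_derivative]])
  from has_vector_derivative_mult[OF this phase_derivative[of \<omega> t]] show ?thesis
    by (simp add: algebra_simps)
qed

lemma rot_time_factor: "smooth a \<Longrightarrow> (\<And>t. (a has_vector_derivative a' t) (at t)) \<Longrightarrow> rot i j (time_factor a) p = 0"
  by (simp add: rot_def pd_time_factor(2)[where a=a and a'=a'])

lemma smooth_step_deriv_bound:
  fixes \<theta> :: "real \<Rightarrow> real"
  assumes \<theta>: "smooth \<theta>" "\<And>t. t \<le> -1 \<Longrightarrow> \<theta> t = 0" "\<And>t. t \<ge> 1 \<Longrightarrow> \<theta> t = 1"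
  shows "\<exists>D\<ge>0. \<forall>t. \<bar>deriv \<theta> t\<bar> \<le> D"
proof -
  have "bounded (deriv \<theta> ` {-1..1})"
    by (intro compact_imp_bounded compact_continuous_image smooth_continuous_on smooth_real_deriv(2) \<theta>(1)) simp
  then obtain D where "\<forall>y\<in>deriv \<theta> ` {-1..1}. norm y \<le> D"
    unfolding bounded_iff by (rule exE)
  then have D: "\<bar>deriv \<theta> t\<bar> \<le> D" if "-1 \<le> t" "t \<le> 1" for t
    using that by simp
  have "\<bar>deriv \<theta> t\<bar> \<le> \<bar>D\<bar>" for t
  proof (cases "-1 \<le> t \<and> t \<le> 1")
    case True
    then show ?thesis using D[of t] by simp
  next
    case False
    then consider "t < -1" | "t > 1" by linarith
    then have "deriv \<theta> t = 0"
    proof cases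
      case 1
      show ?thesis by (rule deriv_locally_constant[of "{..<-1}" _ _ 0]) (use 1 \<theta>(2) in auto)
    next
      case 2
      show ?thesis by (rule deriv_locally_constant[of "{1<..}" _ _ 1]) (use 2 \<theta>(3) in auto)
    qed
    then show ?thesis by simp
  qed
  then show ?thesis using abs_ge_zero by blast
qed

section \<open>The oscillating quasimode, its energy and its corrector\<close>

context quasimode
begin

definition freq :: "nat \<Rightarrow> real" where
  "freq l = sqrt (real l * (real l + 2))"

definition quasi :: "nat \<Rightarrow> spacetime \<Rightarrow> complex" where
  "quasi l p = time_factor (phase (freq l)) p * mode l p"

lemma freq_sq: "(freq l)\<^sup>2 = real l * (real l + 2)"
  by (simp add: freq_def)

lemma smooth_quasi: "smooth (quasi l)"
  unfolding quasi_def[abs_def] by (intro smooth_intros smooth_time_factor smooth_phase smooth_mode)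

lemma pd_None_mode: "pd None (mode l) = (\<lambda>p. 0)"
  unfolding mode_def[abs_def]
  by (simp add: pd_mult smooth_radial smooth_profiles smooth_intros smooth_zeta pd_radial pd_power pd_zeta)

lemma pd_None_quasi: "pd None (quasi l) = (\<lambda>p. - (\<i> * of_real (freq l)) * quasi l p)"
  unfolding quasi_def[abs_def]
  by (simp add: pd_mult smooth_time_factor smooth_phase smooth_mode pd_None_mode pd_time_factor(1)[OF smooth_phase phase_derivative])
    (simp add: time_factor_def mult.assoc)

lemma wave_quasi:
  assumes "l \<ge> 2"
  shows "wave (quasi l) p = - (phase (freq l) (p $ None) * mode_error l p)"
proof -
  have n: "pd None (pd None (quasi l)) p = - (of_nat l * (of_nat l + 2)) * quasi l p"
  proof -
    have "- (\<i> * w) * (- (\<i> * w) * q) = (\<i> * \<i>) * (w * w) * q" for w q by (simp add: mult_ac)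
    then have "pd None (pd None (quasi l)) p = - of_real ((freq l)\<^sup>2) * quasi l p"
      unfolding pd_None_quasi pd_cmult[OF smooth_quasi] by (simp only: i_squared of_real_power power2_eq_square of_real_mult) simp
    then show ?thesis unfolding freq_sq by simp
  qed
  have "elliptic \<beta> (quasi l) p = time_factor (phase (freq l)) p * elliptic \<beta> (mode l) p"
    unfolding quasi_def[abs_def] by (rule elliptic_time_factor[OF smooth_phase phase_derivative smooth_mode])
  then show ?thesis
    unfolding wave_def n elliptic_mode[OF assms] by (simp add: quasi_def time_factor_def mode_error_def algebra_simps)
qed

lemma wave_density_quasi:
  "wave_density (quasi l) p = (freq l)\<^sup>2 * (\<rho> (sq p) * (norm (mode l p))\<^sup>2) + wave_density (mode l) p"
proof -
  have s: "pd (Some i) (quasi l) p = time_factor (phase (freq l)) p * pd (Some i) (mode l) p" for i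
    unfolding quasi_def[abs_def]
    by (simp add: pd_mult smooth_time_factor smooth_phase smooth_mode pd_time_factor(2)[OF smooth_phase phase_derivative])
  have e: "euler (quasi l) p = time_factor (phase (freq l)) p * euler (mode l) p"
    unfolding euler_def s by (simp add: sum_distrib_left mult_ac)
  have u: "norm (time_factor (phase (freq l)) p) = 1" by (simp add: time_factor_def)
  show ?thesis
    unfolding wave_density_def s e pd_None_quasi pd_None_mode norm_mult u
    by (simp add: quasi_def norm_mult u power_mult_distrib)
qed

lemma pd_mode_outside: "norm x > out_radius \<Longrightarrow> pd (Some i) (mode l) (event t x) = 0"
  by (rule pd_space_eq_0[OF smooth_mode mode_outside(1)])

lemma wave_density_mode_outside: "norm x > out_radius \<Longrightarrow> wave_density (mode l) (event t x) = 0"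
  by (simp add: wave_density_def pd_None_mode euler_def pd_mode_outside)

lemma wave_density_quasi_outside: "norm x > out_radius \<Longrightarrow> wave_density (quasi l) (event t x) = 0"
  by (simp add: wave_density_quasi wave_density_mode_outside mode_outside)

lemma masses_nonneg: "0 \<le> mode_mass l" "0 \<le> error_mass l" "0 \<le> trapped_mass l"
  unfolding mode_mass_def error_mass_def trapped_mass_def
  by (auto intro!: Bochner_Integration.integral_nonneg mult_nonneg_nonneg divide_nonneg_nonneg less_imp_le[OF \<rho>_pos] simp: indicator_def)

text \<open>Integrating the divergence of \<open>flux * cnj mode\<close> turns the gradient part of the energy into the pairing
  of the mode with \<open>elliptic mode = - freq\<^sup>2 \<rho> mode + error\<close>.\<close>

lemma energy_mode:
  assumes l: "l \<ge> 2"
  shows "energy (mode l) 0 \<le> (freq l)\<^sup>2 * mode_mass l + (mode_mass l + error_mass l) / 2"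
proof -
  define u where "u = mode l"
  have u: "smooth u" unfolding u_def by (rule smooth_mode)
  define w where "w i p = flux u i p * cnj (u p)" for i p
  have w: "smooth (w i)" for i unfolding w_def[abs_def] by (intro smooth_intros smooth_flux u smooth_cnj)
  have cc: "cnj (coord i p) = coord i p" for i p by (simp add: coord_def)
  have div: "(\<Sum>i\<in>UNIV. pd (Some i) (w i) p) = elliptic \<beta> u p * cnj (u p) + of_real (wave_density u p)" for p
  proof -
    have "pd (Some i) (w i) p = pd (Some i) (flux u i) p * cnj (u p)
      + (pd (Some i) u p * cnj (pd (Some i) u p) + radial \<beta> p * euler u p * (coord i p * cnj (pd (Some i) u p)))" for i
      unfolding w_def[abs_def] by (simp add: pd_mult u smooth_flux smooth_cnj pd_cnj) (simp add: flux_def algebra_simps)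
    then have "(\<Sum>i\<in>UNIV. pd (Some i) (w i) p) = elliptic \<beta> u p * cnj (u p)
      + ((\<Sum>i\<in>UNIV. pd (Some i) u p * cnj (pd (Some i) u p)) + radial \<beta> p * euler u p * cnj (euler u p))"
      by (simp add: sum.distrib elliptic_flux[OF u] sum_distrib_right sum_distrib_left[symmetric] euler_def[of u p] cc)
    moreover have "cdensity u p = (\<Sum>i\<in>UNIV. pd (Some i) u p * cnj (pd (Some i) u p)) + radial \<beta> p * euler u p * cnj (euler u p)"
      by (simp add: cdensity_def u_def pd_None_mode)
    ultimately show ?thesis unfolding cdensity_eq by (simp only:)
  qed
  have wz: "norm x > out_radius \<Longrightarrow> w i (event 0 x) = 0" for i x by (simp add: w_def u_def mode_outside)
  have pt: "wave_density u (event 0 x) \<le> ((freq l)\<^sup>2 + 1/2) * (\<rho> ((norm x)\<^sup>2) * (norm (u (event 0 x)))\<^sup>2)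
      + (norm (mode_error l (event 0 x)))\<^sup>2 / \<rho> ((norm x)\<^sup>2) / 2 + Re (\<Sum>i\<in>UNIV. pd (Some i) (w i) (event 0 x))" for x
  proof -
    define p a b r where "p = event 0 x" and "a = mode_error l p" and "b = u p" and "r = \<rho> (sq p)"
    have r: "r > 0" by (simp add: r_def \<rho>_pos)
    have "elliptic \<beta> u p * cnj b = - of_real ((freq l)\<^sup>2) * of_real r * (b * cnj b) + a * cnj b"
      unfolding u_def elliptic_mode[OF l] freq_sq by (simp add: a_def b_def u_def mode_error_def radial_def r_def algebra_simps)
    then have "Re (elliptic \<beta> u p * cnj b) = - ((freq l)\<^sup>2 * (r * (norm b)\<^sup>2)) + Re (a * cnj b)"
      by (simp add: complex_norm_square[symmetric] del: of_real_power) 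
    moreover have "- Re (a * cnj b) \<le> norm a * norm b"
      using abs_Re_le_cmod[of "a * cnj b"] by (simp add: norm_mult)
    moreover have "norm a * norm b \<le> (norm a)\<^sup>2 / r / 2 + r * (norm b)\<^sup>2 / 2"
    proof -
      have "0 \<le> (norm a - r * norm b)\<^sup>2 / r" using r by simp
      also have "\<dots> = (norm a)\<^sup>2 / r + r * (norm b)\<^sup>2 - 2 * (norm a * norm b)"
        using r by (simp add: power2_eq_square field_simps)
      finally show ?thesis by simp
    qed
    ultimately have "wave_density u p \<le> ((freq l)\<^sup>2 + 1/2) * (r * (norm b)\<^sup>2) + (norm a)\<^sup>2 / r / 2
      + (Re (elliptic \<beta> u p * cnj b) + wave_density u p)"
      by (simp add: algebra_simps)
    then show ?thesis unfolding p_def[symmetric] div by (simp add: a_def b_def r_def p_def)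
  qed
  have iw: "integrable lborel (\<lambda>x. pd (Some i) (w i) (event 0 x))" for i
    by (rule integrable_slice[OF smooth_continuous_on[OF smooth_pd[OF w]] pd_space_eq_0[OF w wz]])
  have int: "(\<integral>x. k * F x + H x / 2 + Re (\<Sum>i\<in>UNIV. W i x) \<partial>lborel)
      = k * (\<integral>x. F x \<partial>lborel) + (\<integral>x. H x \<partial>lborel) / 2 + Re (\<Sum>i\<in>UNIV. \<integral>x. W i x \<partial>lborel)"
    if "integrable lborel F" "integrable lborel H" "\<And>i. integrable lborel (W i)"
    for k F H and W :: "3 \<Rightarrow> real^3 \<Rightarrow> complex"
    using that by (simp add: integral_Re)
  have "energy u 0 \<le> (\<integral>x. ((freq l)\<^sup>2 + 1/2) * (\<rho> ((norm x)\<^sup>2) * (norm (u (event 0 x)))\<^sup>2)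
      + (norm (mode_error l (event 0 x)))\<^sup>2 / \<rho> ((norm x)\<^sup>2) / 2 + Re (\<Sum>i\<in>UNIV. pd (Some i) (w i) (event 0 x)) \<partial>lborel)"
    unfolding energy_def
  proof (rule integral_mono[OF _ _ pt])
    show "integrable lborel (\<lambda>x. wave_density u (event 0 x))"
      unfolding u_def by (rule integrable_slice[OF continuous_density[OF smooth_mode] wave_density_mode_outside])
  qed (intro Bochner_Integration.integrable_add integrable_mult_right integrable_divide_zero integrable_Re
      Bochner_Integration.integrable_sum iw integrable_masses(1)[of l, folded u_def] integrable_masses(2))
  also have "\<dots> = ((freq l)\<^sup>2 + 1/2) * mode_mass l + error_mass l / 2 + Re (\<Sum>i\<in>UNIV. \<integral>x. pd (Some i) (w i) (event 0 x) \<partial>lborel)"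
    unfolding mode_mass_def error_mass_def u_def[symmetric]
    by (rule int[OF integrable_masses(1)[of l, folded u_def] integrable_masses(2) iw])
  also have "(\<Sum>i\<in>UNIV. \<integral>x. pd (Some i) (w i) (event 0 x) \<partial>lborel) = 0"
    by (simp add: integral_pd_space[OF w wz])
  finally show ?thesis by (simp add: u_def algebra_simps add_divide_distrib)
qed

lemma freq_ge_1: "l \<ge> 2 \<Longrightarrow> (freq l)\<^sup>2 \<ge> 1"
proof -
  assume "l \<ge> 2"
  then have "1 * 1 \<le> real l * (real l + 2)" by (intro mult_mono) auto
  then show ?thesis by (simp add: freq_sq)
qed

lemma energy_quasi:
  assumes l: "l \<ge> 2"
  shows "energy (quasi l) 0 \<le> 3 * (freq l)\<^sup>2 * mode_mass l + error_mass l"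
proof -
  have i: "integrable lborel (\<lambda>x. wave_density (mode l) (event 0 x))"
    by (rule integrable_slice[OF continuous_density[OF smooth_mode] wave_density_mode_outside])
  have "energy (quasi l) 0 = (freq l)\<^sup>2 * mode_mass l + energy (mode l) 0"
    unfolding energy_def wave_density_quasi mode_mass_def using i integrable_masses(1)[of l] by simp
  moreover have "mode_mass l \<le> (freq l)\<^sup>2 * mode_mass l"
    using mult_right_mono[OF freq_ge_1[OF l] masses_nonneg(1)[of l]] by simp
  \<comment> \<open>Here x is freq^2 times the mass; since freq^2 \<ge> 1, it absorbs the bare mass
    m.\<close>
  moreover have "A \<le> 3 * x + e" if "A = x + B" "m \<le> x" "B \<le> x + (m + e) / 2" "0 \<le> m" "0 \<le> e" for A B x m e :: real
    using that by (simp add: field_simps)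
  ultimately show ?thesis using energy_mode[OF l] masses_nonneg[of l] unfolding mult.assoc by blast
qed

text \<open>The error times a switched on oscillation lives in r \<le> \<open>out_radius\<close>, t
  \<ge> -1 and has highest weight, so the solver applies. As only the amplitude depends on time, the
  time derivative of c solves the same kind of equation, with amplitude at most D +
  |\<omega>|.\<close>

lemma corrector_exists:
  fixes \<theta> :: "real \<Rightarrow> real"
  assumes \<theta>: "smooth \<theta>" "\<And>t. 0 \<le> \<theta> t" "\<And>t. \<theta> t \<le> 1" "\<And>t. t \<le> -1 \<Longrightarrow> \<theta> t = 0" and D: "\<And>t. \<bar>deriv \<theta> t\<bar> \<le> D"
  shows "\<exists>c. smooth c \<and> forward_supported out_radius c
    \<and> (\<forall>p. wave c p = of_real (\<theta> (p $ None)) * phase \<omega> (p $ None) * mode_error l p)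
    \<and> (\<forall>t\<ge>-1. energy c t \<le> exp 1 * (t + 2)\<^sup>2 * error_mass l)
    \<and> energy (pd None c) 0 \<le> exp 1 * 4 * ((D + \<bar>\<omega>\<bar>)\<^sup>2 * error_mass l)"
proof -
  define a where "a t = of_real (\<theta> t) * phase \<omega> t" for t
  define a' where "a' t = (of_real (deriv \<theta> t) - of_real (\<theta> t) * (\<i> * of_real \<omega>)) * phase \<omega> t" for t
  have a: "smooth a" unfolding a_def[abs_def] by (intro smooth_intros smooth_of_real \<theta>(1) smooth_phase)
  have a': "(a has_vector_derivative a' t) (at t)" for t
    unfolding a_def[abs_def] a'_def by (rule modulated_phase_derivative[OF \<theta>(1)])
  define G where "G p = time_factor a p * mode_error l p" for p
  have G: "smooth G" "highest_weight l G"
    unfolding G_def[abs_def]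
    by (intro smooth_intros smooth_time_factor a smooth_mode_error)
      (intro highest_weight_mult smooth_time_factor a smooth_mode_error rot_time_factor[OF a a'],
        unfold mode_error_def[abs_def], rule highest_weight_radial_zeta[OF smooth_profiles(2)])
  have me: "mode_error l p = 0" if "norm (space_part p) > out_radius" for p
    using mode_outside(2)[OF that, of l "p $ None"] by simp
  have fs: "forward_supported out_radius G"
    unfolding forward_supported_def
  proof (intro allI impI)
    fix p :: spacetime assume "p $ None < -1 \<or> norm (space_part p) > out_radius + p $ None + 1"
    then consider "p $ None < -1" | "norm (space_part p) > out_radius" by linarith
    then show "G p = 0" by cases (simp_all add: G_def time_factor_def a_def \<theta>(4) me)
  qed
  obtain c where c: "smooth c" "forward_supported out_radius c" "\<And>p. wave c p = G p"
    using wave_exists[OF G(1) fs G(2)] radii by force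
  have wt: "wave (pd None c) p = time_factor a' p * mode_error l p" for p
  proof -
    have m0: "pd None (mode_error l) = (\<lambda>p. 0)"
      unfolding mode_error_def[abs_def]
      by (simp add: pd_mult smooth_radial smooth_profiles smooth_intros smooth_zeta pd_radial pd_power pd_zeta)
    have "wave c = G" using c(3) by (simp add: fun_eq_iff)
    then show ?thesis
      unfolding wave_pd_None[OF c(1)]
      by (simp add: G_def[abs_def] pd_mult smooth_time_factor a smooth_mode_error m0 pd_time_factor(1)[OF a a'])
  qed
  have b: "(\<integral>x. (norm (time_factor g (event t x) * mode_error l (event t x)))\<^sup>2 / \<rho> ((norm x)\<^sup>2) \<partial>lborel) \<le> K\<^sup>2 * error_mass l"
    if "\<And>t. norm (g t) \<le> K" for g K t
  proof -
    have "(\<integral>x. (norm (time_factor g (event t x) * mode_error l (event t x)))\<^sup>2 / \<rho> ((norm x)\<^sup>2) \<partial>lborel)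
      = (norm (g t))\<^sup>2 * error_mass l"
      unfolding error_mass_def mode_event(2)[of l t] by (simp add: time_factor_def norm_mult power_mult_distrib flip: times_divide_eq_right)
    then show ?thesis using that[of t] masses_nonneg(2)[of l] by (simp add: mult_right_mono power_mono)
  qed
  have na: "norm (a t) \<le> 1" for t using \<theta>(2,3) by (simp add: a_def norm_mult)
  have na': "norm (a' t) \<le> D + \<bar>\<omega>\<bar>" for t
  proof -
    have "norm (a' t) \<le> norm (complex_of_real (deriv \<theta> t)) + norm (of_real (\<theta> t) * (\<i> * of_real \<omega>))"
      unfolding a'_def norm_mult[of _ "phase _ _"] norm_phase by (simp only: mult_1_right norm_triangle_ineq4)
    also have "\<dots> \<le> D + 1 * \<bar>\<omega>\<bar>"
      using D[of t] mult_right_mono[OF \<theta>(3)[of t] abs_ge_zero[of \<omega>]] \<theta>(2)[of t] by (simp add: norm_mult)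
    finally show ?thesis by simp
  qed
  have e1: "energy c t \<le> exp 1 * (t + 2)\<^sup>2 * error_mass l" if "t \<ge> -1" for t
    by (rule energy_estimate[OF c(1,2) _ that]) (use b[OF na] in \<open>simp add: c(3) G_def\<close>)
  have "energy (pd None c) 0 \<le> exp 1 * (0 + 2)\<^sup>2 * ((D + \<bar>\<omega>\<bar>)\<^sup>2 * error_mass l)"
    by (rule energy_estimate[OF smooth_pd[OF c(1)] forward_supported_pd[OF c(2)]])
      (use b[OF na'] in \<open>simp_all add: wt\<close>)
  then show ?thesis using c e1 by (intro exI[of _ c]) (simp add: G_def time_factor_def a_def mult_ac)
qed

end

section \<open>Exact solutions near the quasimode\<close>

context quasimode
begin

definition trapped_energy :: "(spacetime \<Rightarrow> complex) \<Rightarrow> real \<Rightarrow> real" where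
  "trapped_energy u t = (\<integral>x. indicator (cball 0 in_radius) x * wave_density u (event t x) \<partial>lborel)"

lemma integrable_forward_supported:
  "smooth u \<Longrightarrow> forward_supported R u \<Longrightarrow> integrable lborel (\<lambda>x. wave_density u (event t x))"
  by (rule integrable_slice[where R="R + t + 1", OF continuous_density wave_density_forward_supported]) auto

lemma wave_density_sum_le:
  assumes "smooth q" "smooth c" "smooth d"
  shows "wave_density (\<lambda>p. q p + (c p + d (reflect p))) p
    \<le> 2 * wave_density q p + 4 * wave_density c p + 4 * wave_density d (reflect p)"
proof -
  note d = smooth_reflect[OF assms(3)]
  have "smooth (\<lambda>p. c p + d (reflect p))" by (intro smooth_intros assms d)
  from wave_density_add_le[OF assms(1) this, of p] wave_density_add_le[OF assms(2) d, of p]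
  show ?thesis unfolding wave_density_reflect[OF assms(3)] by linarith
qed

text \<open>Splitting twice by the parallelogram bound costs the factors 2, 4, 4, and reflection
  preserves the energy at t = 0. Where all three densities vanish, so does the upper bound, and
  nonnegativity forces the density of the sum to be 0.\<close>

lemma energy_sum_le:
  assumes s: "smooth q" "smooth c" "smooth d" and fs: "forward_supported R c" "forward_supported R d"
    and q: "\<And>x. norm x > R \<Longrightarrow> wave_density q (event 0 x) = 0"
  shows "energy (\<lambda>p. q p + (c p + d (reflect p))) 0 \<le> 2 * energy q 0 + 4 * energy c 0 + 4 * energy d 0"
    and "norm x > R + \<bar>t\<bar> + 1 \<Longrightarrow> wave_density q (event t x) = 0 \<Longrightarrow>
      wave_density (\<lambda>p. q p + (c p + d (reflect p))) (event t x) = 0"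
proof -
  let ?u = "\<lambda>p. q p + (c p + d (reflect p))"
  have u: "smooth ?u" by (intro smooth_intros s smooth_reflect)
  show z: "wave_density ?u (event t x) = 0" if "norm x > R + \<bar>t\<bar> + 1" "wave_density q (event t x) = 0" for t x
  proof -
    have "wave_density c (event t x) = 0" "wave_density d (event (- t) x) = 0"
      using that(1) by (auto intro!: wave_density_forward_supported[OF fs(1)] wave_density_forward_supported[OF fs(2)])
    then have "wave_density ?u (event t x) \<le> 0"
      using wave_density_sum_le[OF s, of "event t x"] that(2) by simp
    then show ?thesis using density_nonneg[of ?u "event t x"] by simp
  qed
  have "integrable lborel (\<lambda>x. wave_density ?u (event 0 x))"
    by (rule integrable_slice[OF continuous_density[OF u], of "R + 1"]) (use z[where t=0] q in auto)
  moreover have iq: "integrable lborel (\<lambda>x. wave_density q (event 0 x))"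
    by (rule integrable_slice[OF continuous_density[OF s(1)] q])
  note ic = integrable_forward_supported[OF s(2) fs(1), of 0] and id = integrable_forward_supported[OF s(3) fs(2), of 0]
  ultimately have "energy ?u 0 \<le> (\<integral>x. 2 * wave_density q (event 0 x) + 4 * wave_density c (event 0 x) + 4 * wave_density d (event 0 x) \<partial>lborel)"
    unfolding energy_def
    by (intro integral_mono Bochner_Integration.integrable_add integrable_mult_right iq ic id)
      (use wave_density_sum_le[OF s, of "event 0 x" for x] in simp_all)
  also have "\<dots> = 2 * energy q 0 + 4 * energy c 0 + 4 * energy d 0"
    using iq ic id by (simp add: energy_def)
  finally show "energy ?u 0 \<le> 2 * energy q 0 + 4 * energy c 0 + 4 * energy d 0" .
qed

text \<open>The corrector is split symmetrically between the two time directions: sources supported in \<open>t \<ge> -1\<close>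
  and \<open>t \<le> 1\<close> each allow the solver with the appropriate support, and keep the data at \<open>t = 0\<close> compactly supported.\<close>

theorem resonant_solution:
  "\<exists>K>0. \<forall>l\<ge>2. \<exists>\<psi>. smooth \<psi> \<and> (\<forall>p. wave \<psi> p = 0)
    \<and> (\<forall>t x. norm x > out_radius + \<bar>t\<bar> + 1 \<longrightarrow> wave_density \<psi> (event t x) = 0)
    \<and> (\<forall>x. norm x > out_radius + 1 \<longrightarrow> wave_density (pd None \<psi>) (event 0 x) = 0)
    \<and> energy \<psi> 0 \<le> K * ((freq l)\<^sup>2 * mode_mass l + error_mass l)
    \<and> energy (pd None \<psi>) 0 \<le> K * (freq l)\<^sup>2 * ((freq l)\<^sup>2 * mode_mass l + error_mass l)
    \<and> (\<forall>\<tau>>1. (freq l)\<^sup>2 * trapped_mass l / 2 - 2 * (exp 1 * (\<tau> + 2)\<^sup>2 * error_mass l) \<le> trapped_energy \<psi> \<tau>)"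
proof -
  obtain \<theta> :: "real \<Rightarrow> real" where \<theta>: "smooth \<theta>" "\<And>t. 0 \<le> \<theta> t" "\<And>t. \<theta> t \<le> 1" "\<And>t. t \<le> -1 \<Longrightarrow> \<theta> t = 0"
      "\<And>t. t \<ge> 1 \<Longrightarrow> \<theta> t = 1" "\<And>t. \<theta> t + \<theta> (- t) = 1"
    using smooth_step_exists by blast
  obtain D where D: "D \<ge> 0" "\<And>t. \<bar>deriv \<theta> t\<bar> \<le> D"
    using smooth_step_deriv_bound[OF \<theta>(1,4,5)] by blast
  \<comment> \<open>The quasimode contributes 2 times 3, and each corrector 4 times 4 e; the factor
    2 D^2 + 2 compares (D + |\<omega>|)^2 with \<omega>^2.\<close>
  define K where "K = 6 + 32 * exp 1 * (2 * D\<^sup>2 + 2)"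
  have K: "K > 0" "6 \<le> K" "2 + 32 * exp 1 \<le> K" "2 + 32 * exp 1 * (2 * D\<^sup>2 + 2) \<le> K"
  proof -
    have "32 * exp 1 * 1 \<le> 32 * exp (1::real) * (2 * D\<^sup>2 + 2)" by (intro mult_left_mono) auto
    moreover have "0 < 32 * exp (1::real)" by simp
    ultimately show "K > 0" "6 \<le> K" "2 + 32 * exp 1 \<le> K" "2 + 32 * exp 1 * (2 * D\<^sup>2 + 2) \<le> K"
      unfolding K_def by linarith+
  qed
  have "\<exists>\<psi>. smooth \<psi> \<and> (\<forall>p. wave \<psi> p = 0)
    \<and> (\<forall>t x. norm x > out_radius + \<bar>t\<bar> + 1 \<longrightarrow> wave_density \<psi> (event t x) = 0)
    \<and> (\<forall>x. norm x > out_radius + 1 \<longrightarrow> wave_density (pd None \<psi>) (event 0 x) = 0)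
    \<and> energy \<psi> 0 \<le> K * ((freq l)\<^sup>2 * mode_mass l + error_mass l)
    \<and> energy (pd None \<psi>) 0 \<le> K * (freq l)\<^sup>2 * ((freq l)\<^sup>2 * mode_mass l + error_mass l)
    \<and> (\<forall>\<tau>>1. (freq l)\<^sup>2 * trapped_mass l / 2 - 2 * (exp 1 * (\<tau> + 2)\<^sup>2 * error_mass l) \<le> trapped_energy \<psi> \<tau>)"
    if l: "l \<ge> 2" for l
  proof -
    define \<omega> where "\<omega> = freq l"
    define M E where "M = mode_mass l" and "E = error_mass l"
    have ME: "M \<ge> 0" "E \<ge> 0" unfolding M_def E_def by (rule masses_nonneg)+
    have w1: "\<omega>\<^sup>2 \<ge> 1" unfolding \<omega>_def by (rule freq_ge_1[OF l])
    note ex = corrector_exists[OF \<theta>(1-4) D(2), where l=l]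
    obtain c where c: "smooth c" "forward_supported out_radius c"
        "\<And>p. wave c p = of_real (\<theta> (p $ None)) * phase \<omega> (p $ None) * mode_error l p"
        "\<And>t. t \<ge> -1 \<Longrightarrow> energy c t \<le> exp 1 * (t + 2)\<^sup>2 * E"
        "energy (pd None c) 0 \<le> exp 1 * 4 * ((D + \<bar>\<omega>\<bar>)\<^sup>2 * E)"
      using ex[of \<omega>] unfolding E_def by blast
    \<comment> \<open>The negative frequency anticipates the reflection, which reverses the
      phase.\<close>
    obtain d where d: "smooth d" "forward_supported out_radius d"
        "\<And>p. wave d p = of_real (\<theta> (p $ None)) * phase (- \<omega>) (p $ None) * mode_error l p"
        "\<And>t. t \<ge> -1 \<Longrightarrow> energy d t \<le> exp 1 * (t + 2)\<^sup>2 * E"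
        "energy (pd None d) 0 \<le> exp 1 * 4 * ((D + \<bar>\<omega>\<bar>)\<^sup>2 * E)"
      using ex[of "- \<omega>"] unfolding E_def abs_minus_cancel by blast
    define \<psi> where "\<psi> = (\<lambda>p. quasi l p + (c p + d (reflect p)))"
    have \<psi>: "smooth \<psi>" unfolding \<psi>_def by (intro smooth_intros smooth_quasi c d smooth_reflect)
    have w0: "wave \<psi> p = 0" for p
    proof -
      have "wave \<psi> p = wave (quasi l) p + (wave c p + wave (\<lambda>p. d (reflect p)) p)"
        unfolding \<psi>_def using smooth_quasi c(1) smooth_reflect[OF d(1)] by (simp add: wave_add smooth_intros)
      also have "wave (\<lambda>p. d (reflect p)) p = of_real (\<theta> (- (p $ None))) * phase \<omega> (p $ None) * mode_error l p"
      proof -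
        have "mode_error l (reflect p) = mode_error l p"
          using mode_event(2)[of l "- (p $ None)" "space_part p"] mode_event(2)[of l "p $ None" "space_part p"]
          by (simp add: reflect_def)
        then show ?thesis by (simp add: wave_reflect[OF d(1)] d(3) phase_minus)
      qed
      \<comment> \<open>The switching functions of the two time directions add up to 1, so the two
        sources together cancel the error of the quasimode at every time.\<close>
      also have "wave (quasi l) p = - ((of_real (\<theta> (p $ None)) + of_real (\<theta> (- (p $ None)))) * phase \<omega> (p $ None) * mode_error l p)"
        unfolding of_real_add[symmetric] \<theta>(6) by (simp add: wave_quasi[OF l] \<omega>_def)
      finally show ?thesis by (simp add: c(3) algebra_simps)
    qed
    have supp: "wave_density \<psi> (event t x) = 0" if "norm x > out_radius + \<bar>t\<bar> + 1" for t x
      unfolding \<psi>_def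
      by (rule energy_sum_le(2)[OF smooth_quasi c(1) d(1) c(2) d(2)])
        (use that in \<open>auto simp: wave_density_quasi_outside\<close>)
    define Q where "Q = (\<lambda>p. - (\<i> * of_real \<omega>) * quasi l p)"
    \<comment> \<open>The sign compensates the one that reflection produces in a time
      derivative.\<close>
    define d' where "d' = (\<lambda>p. (-1) * pd None d p)"
    have Q: "smooth Q" unfolding Q_def by (intro smooth_intros smooth_quasi)
    have dQ: "wave_density Q p = \<omega>\<^sup>2 * wave_density (quasi l) p" for p
      unfolding Q_def wave_density_cmult[OF smooth_quasi] by (simp add: norm_mult)
    have d': "smooth d'" "forward_supported out_radius d'"
      unfolding d'_def by (intro smooth_intros smooth_pd d) (rule forward_supported_mult[OF forward_supported_pd[OF d(2)]])
    have pd\<psi>: "pd None \<psi> = (\<lambda>p. Q p + (pd None c p + d' (reflect p)))"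
      unfolding \<psi>_def Q_def d'_def
      by (simp add: pd_add smooth_quasi c(1) smooth_reflect d(1) smooth_intros pd_None_quasi pd_reflect \<omega>_def)
    have supp': "wave_density (pd None \<psi>) (event 0 x) = 0" if "norm x > out_radius + 1" for x
      unfolding pd\<psi>
      by (rule energy_sum_le(2)[OF Q smooth_pd[OF c(1)] d'(1) forward_supported_pd[OF c(2)] d'(2)])
        (use that in \<open>auto simp: dQ wave_density_quasi_outside\<close>)
    have eq: "energy (quasi l) 0 \<le> 3 * \<omega>\<^sup>2 * M + E"
      unfolding M_def E_def \<omega>_def by (rule energy_quasi[OF l])
    have "energy \<psi> 0 \<le> 2 * energy (quasi l) 0 + 4 * energy c 0 + 4 * energy d 0"
      unfolding \<psi>_def
      by (rule energy_sum_le(1)[OF smooth_quasi c(1) d(1) c(2) d(2)]) (simp add: wave_density_quasi_outside)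
    also have "\<dots> \<le> 6 * (\<omega>\<^sup>2 * M) + (2 + 32 * exp 1) * E"
      using eq c(4)[of 0] d(4)[of 0] by (simp add: algebra_simps)
    also have "\<dots> \<le> K * (\<omega>\<^sup>2 * M) + K * E"
      using K ME by (intro add_mono mult_right_mono) auto
    finally have e0: "energy \<psi> 0 \<le> K * (\<omega>\<^sup>2 * M + E)" by (simp add: algebra_simps)
    have eQ: "energy Q 0 = \<omega>\<^sup>2 * energy (quasi l) 0" unfolding energy_def dQ by simp
    have ed': "energy d' 0 = energy (pd None d) 0"
      unfolding energy_def d'_def wave_density_cmult[OF smooth_pd[OF d(1)]] by simp
    have Dw: "(D + \<bar>\<omega>\<bar>)\<^sup>2 \<le> (2 * D\<^sup>2 + 2) * \<omega>\<^sup>2"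
    proof -
      have "(D + \<bar>\<omega>\<bar>)\<^sup>2 \<le> 2 * D\<^sup>2 + 2 * \<omega>\<^sup>2"
        using zero_le_power2[of "D - \<bar>\<omega>\<bar>"] by (simp add: power2_eq_square algebra_simps)
      also have "\<dots> \<le> 2 * D\<^sup>2 * \<omega>\<^sup>2 + 2 * \<omega>\<^sup>2"
        using mult_left_mono[OF w1, of "2 * D\<^sup>2"] by simp
      finally show ?thesis by (simp add: algebra_simps)
    qed
    have "energy (pd None \<psi>) 0 \<le> 2 * energy Q 0 + 4 * energy (pd None c) 0 + 4 * energy d' 0"
      unfolding pd\<psi>
      by (rule energy_sum_le(1)[OF Q smooth_pd[OF c(1)] d'(1) forward_supported_pd[OF c(2)] d'(2)])
        (simp add: wave_density_quasi_outside dQ)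
    also have "\<dots> \<le> 2 * \<omega>\<^sup>2 * (3 * \<omega>\<^sup>2 * M + E) + 32 * exp 1 * ((D + \<bar>\<omega>\<bar>)\<^sup>2 * E)"
      using mult_left_mono[OF eq, of "2 * \<omega>\<^sup>2"] c(5) d(5) unfolding eQ ed' by simp
    also have "\<dots> \<le> 2 * \<omega>\<^sup>2 * (3 * \<omega>\<^sup>2 * M + E) + 32 * exp 1 * ((2 * D\<^sup>2 + 2) * \<omega>\<^sup>2 * E)"
      using mult_right_mono[OF Dw ME(2)] by simp
    also have "\<dots> = \<omega>\<^sup>2 * (6 * (\<omega>\<^sup>2 * M) + (2 + 32 * exp 1 * (2 * D\<^sup>2 + 2)) * E)"
      by (simp add: algebra_simps)
    also have "\<dots> \<le> \<omega>\<^sup>2 * (K * (\<omega>\<^sup>2 * M) + K * E)"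
      using K ME by (intro mult_left_mono add_mono mult_right_mono) auto
    finally have e1: "energy (pd None \<psi>) 0 \<le> K * \<omega>\<^sup>2 * (\<omega>\<^sup>2 * M + E)" by (simp add: algebra_simps)
    have "(freq l)\<^sup>2 * trapped_mass l / 2 - 2 * (exp 1 * (\<tau> + 2)\<^sup>2 * error_mass l) \<le> trapped_energy \<psi> \<tau>" if \<tau>: "\<tau> > 1" for \<tau>
    proof -
      let ?I = "indicator (cball (0::real^3) in_radius) :: real^3 \<Rightarrow> real"
      let ?m = "\<lambda>x. \<rho> ((norm x)\<^sup>2) * (norm (mode l (event 0 x)))\<^sup>2"
      \<comment> \<open>After time 1 the reflected corrector has disappeared, so only the forward
        one is subtracted; the quasimode is recovered as \<psi> minus both correctors, which costs
        the factors 2.\<close>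
      have pt: "\<omega>\<^sup>2 / 2 * (?I x * ?m x) - 2 * wave_density c (event \<tau> x) \<le> ?I x * wave_density \<psi> (event \<tau> x)" for x
      proof (cases "x \<in> cball 0 in_radius")
        case False
        then show ?thesis using density_nonneg[of c "event \<tau> x"] by simp
      next
        case True
        let ?r = "\<lambda>p. c p + d (reflect p)"
        have r: "smooth ?r" by (intro smooth_intros c d smooth_reflect)
        have r': "smooth (\<lambda>p. (-1) * ?r p)" by (intro smooth_intros r)
        have q: "quasi l = (\<lambda>p. \<psi> p + (-1) * ?r p)" by (simp add: \<psi>_def)
        have "wave_density d (event (- \<tau>) x) = 0"
          using \<tau> by (intro wave_density_forward_supported[OF d(2)]) auto
        then have "wave_density ?r (event \<tau> x) \<le> 2 * wave_density c (event \<tau> x)"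
          using wave_density_add_le[OF c(1) smooth_reflect[OF d(1)], of "event \<tau> x"] by (simp add: wave_density_reflect[OF d(1)])
        moreover have "wave_density (quasi l) (event \<tau> x) \<le> 2 * wave_density \<psi> (event \<tau> x) + 2 * wave_density ?r (event \<tau> x)"
          unfolding q using wave_density_add_le[OF \<psi> r', of "event \<tau> x"] wave_density_cmult[OF r, of "-1" "event \<tau> x"] by simp
        moreover have "\<omega>\<^sup>2 * ?m x \<le> wave_density (quasi l) (event \<tau> x)"
          unfolding wave_density_quasi \<omega>_def mode_event(1)[of l \<tau>] using density_nonneg[of "mode l" "event \<tau> x"] by simp
        ultimately show ?thesis using True by simp
      qed
      have i1: "integrable lborel (\<lambda>x. ?I x * ?m x)"
        using integrable_mult_indicator[OF _ integrable_masses(1)[of l], of "cball 0 in_radius"] by simp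
      have i2: "integrable lborel (\<lambda>x. ?I x * wave_density \<psi> (event \<tau> x))"
        using integrable_mult_indicator[OF _ integrable_slice[OF continuous_density[OF \<psi>], of "out_radius + \<bar>\<tau>\<bar> + 1" \<tau>, OF supp],
            of "cball 0 in_radius"] by simp
      note i3 = integrable_forward_supported[OF c(1,2), of \<tau>]
      have "\<omega>\<^sup>2 / 2 * trapped_mass l - 2 * energy c \<tau> = (\<integral>x. \<omega>\<^sup>2 / 2 * (?I x * ?m x) - 2 * wave_density c (event \<tau> x) \<partial>lborel)"
        unfolding trapped_mass_def energy_def using i1 i3 by simp
      also have "\<dots> \<le> trapped_energy \<psi> \<tau>"
        unfolding trapped_energy_def
        by (rule integral_mono[OF _ i2 pt]) (intro Bochner_Integration.integrable_diff integrable_mult_right i1 i3)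
      finally show ?thesis using c(4)[of \<tau>] \<tau> by (simp add: \<omega>_def E_def)
    qed
    then show ?thesis using \<psi> w0 supp supp' e0 e1 unfolding \<omega>_def M_def E_def by blast
  qed
  then show ?thesis using K(1) by blast
qed

end

text \<open>The base is 1/2 divided by 81/100. The bound reduces to exp(1/3) \<le> 81/50, that is,
  to e \<le> 3 < (81/50)^3.\<close>

lemma power_50_81_le: "(50/81::real) ^ l \<le> exp (- (real l / 3))"
proof -
  have "exp (1/3) \<le> (81/50::real)"
  proof (rule ccontr)
    assume "\<not> ?thesis"
    then have "(81/50::real) ^ 3 \<le> exp (1/3) ^ 3" by (intro power_mono) auto
    also have "\<dots> = exp 1" by (simp flip: exp_of_nat_mult)
    also have "\<dots> \<le> 3" by (rule exp_le)
    finally show False by (simp add: power3_eq_cube)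
  qed
  then have "50/81 \<le> exp (- (1/3::real))"
    by (simp add: exp_minus field_simps)
  then have "(50/81) ^ l \<le> exp (- (1/3::real)) ^ l" by (intro power_mono) auto
  then show ?thesis by (simp flip: exp_of_nat_mult)
qed

section \<open>Comparison of masses and choice of the degree\<close>

context quasimode
begin

text \<open>Every power of 1/2 is written as (50/81)^l (81/100)^l, and the second factor is at most
  a multiple of the trapped mass. Thus everything is measured against the trapped mass, the error
  with an additional factor exp(-l/3).\<close>

lemma mass_ratio_bounds:
  "\<exists>A>0. \<forall>l\<ge>2. trapped_mass l > 0
     \<and> (freq l)\<^sup>2 * mode_mass l + error_mass l \<le> A * (freq l)\<^sup>2 * trapped_mass l
     \<and> error_mass l \<le> A * (freq l)\<^sup>2 * exp (- (real l / 3)) * trapped_mass l"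
proof -
  obtain C1 where C1: "C1 > 0" "\<And>l. mode_mass l \<le> trapped_mass l + C1 * (1/2) ^ l"
    using mode_mass_bound by blast
  obtain C2 where C2: "C2 > 0" "\<And>l. l \<ge> 2 \<Longrightarrow> error_mass l \<le> C2 * (real l + 1)\<^sup>2 * (1/2) ^ l"
    using error_mass_bound by blast
  obtain c where c: "c > 0" "\<And>l. c * (81/100) ^ l \<le> trapped_mass l"
    using trapped_mass_bound by blast
  define A where "A = 1 + (C1 + 2 * C2) / c"
  have "trapped_mass l > 0
     \<and> (freq l)\<^sup>2 * mode_mass l + error_mass l \<le> A * (freq l)\<^sup>2 * trapped_mass l
     \<and> error_mass l \<le> A * (freq l)\<^sup>2 * exp (- (real l / 3)) * trapped_mass l"
    if l: "l \<ge> 2" for l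
  proof -
    define T w q where "T = trapped_mass l" and "w = (freq l)\<^sup>2" and "q = exp (- (real l / 3))"
    have w: "w \<ge> 1" unfolding w_def by (rule freq_ge_1[OF l])
    have q: "0 < q" "q \<le> 1" by (simp_all add: q_def)
    have "0 < c * (81/100) ^ l" using c(1) by simp
    then have T: "T > 0" using c(2)[of l] by (simp add: T_def)
    have "(1/2) ^ l = (50/81) ^ l * (81/100::real) ^ l" by (simp flip: power_mult_distrib)
    also have "\<dots> \<le> q * (T / c)"
      using power_50_81_le[of l] c by (intro mult_mono) (auto simp: q_def T_def field_simps)
    finally have half: "(1/2) ^ l \<le> q * (T / c)" .
    have half': "(1/2) ^ l \<le> T / c"
      using half mult_right_mono[OF q(2), of "T / c"] T c(1) by simp
    \<comment> \<open>As freq^2 = l (l + 2) = (l + 1)^2 - 1, the polynomial factor of the error is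
      absorbed by freq^2.\<close>
    have "(real l + 1)\<^sup>2 = w + 1" unfolding w_def freq_sq by (simp add: power2_eq_square algebra_simps)
    then have l2: "(real l + 1)\<^sup>2 \<le> 2 * w" using w by simp
    have e: "error_mass l \<le> (2 * C2 / c) * (w * q * T)"
    proof -
      have "error_mass l \<le> C2 * (real l + 1)\<^sup>2 * (1/2) ^ l" by (rule C2(2)[OF l])
      also have "\<dots> \<le> C2 * (2 * w) * (q * (T / c))"
        using l2 half C2(1) w by (intro mult_mono) auto
      finally show ?thesis by (simp add: mult_ac)
    qed
    have A1: "2 * C2 / c \<le> A" using C1(1) c(1) by (simp add: A_def add_divide_distrib add_nonneg_nonneg)
    have nn: "0 \<le> w * q * T" using w q T by simp
    have e1: "error_mass l \<le> A * w * q * T"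
      using order_trans[OF e mult_right_mono[OF A1 nn]] by (simp add: mult_ac)
    have "w * mode_mass l + error_mass l \<le> w * (T + C1 * (T / c)) + (2 * C2 / c) * (w * 1 * T)"
    proof (intro add_mono mult_left_mono order_trans[OF C1(2)[of l]] order_trans[OF e])
      show "w * q * T \<le> w * 1 * T" using w q T by (intro mult_right_mono mult_left_mono) auto
    qed (use half' C1(1) C2(1) c(1) w in \<open>simp_all add: T_def\<close>)
    also have "\<dots> = A * w * T" by (simp add: A_def algebra_simps add_divide_distrib)
    finally show ?thesis using T e1 unfolding T_def w_def q_def by simp
  qed
  moreover have "A > 0" using C1(1) C2(1) c(1) by (simp add: A_def add_pos_nonneg)
  ultimately show ?thesis by blast
qed

text \<open>The choice \<open>l \<approx> 9 log \<tau>\<close> makes the error, of relative size \<open>exp (- l / 3)\<close>, beat the polynomial growth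
  of the corrector's energy, at the price of a loss \<open>freq\<^sup>2 \<approx> log\<^sup>2 \<tau>\<close> in the derivative.\<close>

theorem slow_decay:
  fixes h :: "real \<Rightarrow> real"
  assumes h: "\<And>t. t \<ge> 0 \<Longrightarrow> h t \<ge> 0" and h_lim: "((\<lambda>t. h t * (ln (2 + t))\<^sup>2) \<longlongrightarrow> 0) at_top"
  shows "\<exists>t0>0. \<forall>\<tau>>t0. \<exists>\<psi>. smooth \<psi> \<and> (\<forall>p. wave \<psi> p = 0)
    \<and> (\<forall>t x. norm x > out_radius + \<bar>t\<bar> + 1 \<longrightarrow> wave_density \<psi> (event t x) = 0)
    \<and> (\<forall>x. norm x > out_radius + 1 \<longrightarrow> wave_density (pd None \<psi>) (event 0 x) = 0)
    \<and> h \<tau> * ((out_radius + 2) * energy \<psi> 0 + energy (pd None \<psi>) 0) < trapped_energy \<psi> \<tau>"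
proof -
  obtain K where K: "K > 0" and sol: "\<And>l. l \<ge> 2 \<Longrightarrow> \<exists>\<psi>. smooth \<psi> \<and> (\<forall>p. wave \<psi> p = 0)
    \<and> (\<forall>t x. norm x > out_radius + \<bar>t\<bar> + 1 \<longrightarrow> wave_density \<psi> (event t x) = 0)
    \<and> (\<forall>x. norm x > out_radius + 1 \<longrightarrow> wave_density (pd None \<psi>) (event 0 x) = 0)
    \<and> energy \<psi> 0 \<le> K * ((freq l)\<^sup>2 * mode_mass l + error_mass l)
    \<and> energy (pd None \<psi>) 0 \<le> K * (freq l)\<^sup>2 * ((freq l)\<^sup>2 * mode_mass l + error_mass l)
    \<and> (\<forall>\<tau>>1. (freq l)\<^sup>2 * trapped_mass l / 2 - 2 * (exp 1 * (\<tau> + 2)\<^sup>2 * error_mass l) \<le> trapped_energy \<psi> \<tau>)"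
    using resonant_solution by blast
  obtain A where A: "A > 0" and mass: "\<And>l. l \<ge> 2 \<Longrightarrow> trapped_mass l > 0
     \<and> (freq l)\<^sup>2 * mode_mass l + error_mass l \<le> A * (freq l)\<^sup>2 * trapped_mass l
     \<and> error_mass l \<le> A * (freq l)\<^sup>2 * exp (- (real l / 3)) * trapped_mass l"
    using mass_ratio_bounds by blast
  define F where "F = 2 * exp 1 * A"
  \<comment> \<open>The summand 3 is 2 + 1: the energy of \<psi> enters with
    \<open>out_radius + 2\<close>, enlarged by freq^2 \<ge> 1, and that of T \<psi> with 1.\<close>
  define B where "B = (out_radius + 3) * K * A"
  have F: "F > 0" using A by (simp add: F_def)
  have R: "out_radius > 0" using radii by simp
  have B: "B > 0" using A K R by (simp add: B_def)
  have "\<forall>\<^sub>F t in at_top. h t * (ln (2 + t))\<^sup>2 < 1 / (480 * B)"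
    using order_tendstoD(2)[OF h_lim, of "1 / (480 * B)"] B by simp
  \<comment> \<open>480 is 4 times 120: freq^2 will be at most 120 times the squared logarithm, and
    a quarter of \<open>w * T\<close> is what remains for the trapped energy after the
    corrector.\<close>
  then obtain t1 where t1: "\<And>t. t \<ge> t1 \<Longrightarrow> h t * (ln (2 + t))\<^sup>2 < 1 / (480 * B)"
    unfolding eventually_at_top_linorder by blast
  \<comment> \<open>The bound \<tau> \<ge> 4 F makes F/(\<tau> + 2) at most 1/4.\<close>
  define t0 where "t0 = max 1 (max t1 (4 * F))"
  have "\<exists>\<psi>. smooth \<psi> \<and> (\<forall>p. wave \<psi> p = 0)
    \<and> (\<forall>t x. norm x > out_radius + \<bar>t\<bar> + 1 \<longrightarrow> wave_density \<psi> (event t x) = 0)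
    \<and> (\<forall>x. norm x > out_radius + 1 \<longrightarrow> wave_density (pd None \<psi>) (event 0 x) = 0)
    \<and> h \<tau> * ((out_radius + 2) * energy \<psi> 0 + energy (pd None \<psi>) 0) < trapped_energy \<psi> \<tau>"
    if "\<tau> > t0" for \<tau>
  proof -
    have \<tau>: "\<tau> > 1" "\<tau> \<ge> t1" "\<tau> \<ge> 4 * F" using that by (auto simp: t0_def)
    define L where "L = ln (2 + \<tau>)"
    \<comment> \<open>With 9 L the factor exp(-l/3) is at most (2 + \<tau>)^(-3), one power better
      than the quadratic growth of the corrector's energy.\<close>
    define l where "l = nat \<lceil>9 * L\<rceil>"
    have "exp 1 \<le> 2 + \<tau>" using exp_le \<tau>(1) by linarith
    then have L: "L \<ge> 1" using \<tau>(1) by (simp add: L_def ln_ge_iff)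
    have l: "9 * L \<le> real l" "real l \<le> 9 * L + 1" using L by (auto simp: l_def)
    have l2: "l \<ge> 2" using l L by linarith
    define T w where "T = trapped_mass l" and "w = (freq l)\<^sup>2"
    have T: "T > 0" and mE: "w * mode_mass l + error_mass l \<le> A * w * T"
      and E: "error_mass l \<le> A * w * exp (- (real l / 3)) * T"
      using mass[OF l2] by (auto simp: T_def w_def)
    have w: "w \<ge> 1" unfolding w_def by (rule freq_ge_1[OF l2])
    have wL: "w \<le> 120 * L\<^sup>2"
    proof -
      have "w = real l * (real l + 2)" by (simp add: w_def freq_sq)
      also have "\<dots> \<le> (10 * L) * (12 * L)" using l L by (intro mult_mono) auto
      finally show ?thesis by (simp add: power2_eq_square)
    qed
    have q: "exp (- (real l / 3)) \<le> 1 / (\<tau> + 2) ^ 3"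
    proof -
      have "exp (- (real l / 3)) \<le> exp (- (3 * L))" using l by simp
      also have "\<dots> = 1 / exp L ^ 3" by (simp add: exp_minus field_simps flip: exp_of_nat_mult)
      also have "exp L = \<tau> + 2" using \<tau> by (simp add: L_def)
      finally show ?thesis .
    qed
    have err: "2 * (exp 1 * (\<tau> + 2)\<^sup>2 * error_mass l) \<le> w * T / 4"
    proof -
      have "2 * (exp 1 * (\<tau> + 2)\<^sup>2 * error_mass l) \<le> 2 * (exp 1 * (\<tau> + 2)\<^sup>2 * (A * w * exp (- (real l / 3)) * T))"
        by (intro mult_left_mono E) auto
      also have "\<dots> = (F * ((\<tau> + 2)\<^sup>2 * exp (- (real l / 3)))) * (w * T)" by (simp add: F_def mult_ac)
      also have "\<dots> \<le> (1 / 4) * (w * T)"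
      proof (rule mult_right_mono)
        have "(\<tau> + 2)\<^sup>2 * exp (- (real l / 3)) \<le> (\<tau> + 2)\<^sup>2 * (1 / (\<tau> + 2) ^ 3)"
          by (intro mult_left_mono q) auto
        also have "\<dots> = 1 / (\<tau> + 2)" using \<tau> by (simp add: power2_eq_square power3_eq_cube)
        finally have "F * ((\<tau> + 2)\<^sup>2 * exp (- (real l / 3))) \<le> F * (1 / (\<tau> + 2))" using F by (intro mult_left_mono) auto
        also have "\<dots> \<le> 1 / 4" using \<tau> by (simp add: field_simps)
        finally show "F * ((\<tau> + 2)\<^sup>2 * exp (- (real l / 3))) \<le> 1 / 4" .
        show "0 \<le> w * T" using w T by simp
      qed
      finally show ?thesis by simp
    qed
    from sol[OF l2] obtain \<psi> where \<psi>: "smooth \<psi>" "\<forall>p. wave \<psi> p = 0"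
        "\<forall>t x. norm x > out_radius + \<bar>t\<bar> + 1 \<longrightarrow> wave_density \<psi> (event t x) = 0"
        "\<forall>x. norm x > out_radius + 1 \<longrightarrow> wave_density (pd None \<psi>) (event 0 x) = 0"
        and e0: "energy \<psi> 0 \<le> K * (w * mode_mass l + error_mass l)"
        and e1: "energy (pd None \<psi>) 0 \<le> K * w * (w * mode_mass l + error_mass l)"
        and et: "w * T / 2 - 2 * (exp 1 * (\<tau> + 2)\<^sup>2 * error_mass l) \<le> trapped_energy \<psi> \<tau>"
      unfolding w_def T_def using \<tau>(1) by blast
    have "(out_radius + 2) * energy \<psi> 0 + energy (pd None \<psi>) 0 \<le> B * w * (w * T)"
    proof -
      have "energy \<psi> 0 \<le> K * (A * w * T)"
        using e0 mult_left_mono[OF mE less_imp_le[OF K]] by linarith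
      also have "\<dots> \<le> w * (K * (A * w * T))"
        using mult_right_mono[OF w, of "K * (A * w * T)"] K A T w by simp
      finally have 1: "(out_radius + 2) * energy \<psi> 0 \<le> (out_radius + 2) * (w * (K * (A * w * T)))"
        using R by (intro mult_left_mono) auto
      have "energy (pd None \<psi>) 0 \<le> K * w * (A * w * T)"
        by (rule order_trans[OF e1 mult_left_mono[OF mE]]) (use K w in simp)
      then show ?thesis using 1 by (simp add: B_def algebra_simps)
    qed
    then have "h \<tau> * ((out_radius + 2) * energy \<psi> 0 + energy (pd None \<psi>) 0) \<le> h \<tau> * (B * w * (w * T))"
      using h[of \<tau>] \<tau>(1) by (intro mult_left_mono) auto
    also have "\<dots> = (B * (h \<tau> * w)) * (w * T)" by (simp add: mult_ac)
    also have "\<dots> < (1 / 4) * (w * T)"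
    proof (rule mult_strict_right_mono)
      have "h \<tau> * w \<le> h \<tau> * (120 * L\<^sup>2)" using h[of \<tau>] \<tau>(1) wL by (intro mult_left_mono) auto
      then have "h \<tau> * w < 120 * (1 / (480 * B))" using t1[OF \<tau>(2)] by (simp add: L_def)
      then show "B * (h \<tau> * w) < 1 / 4" using B by (simp add: field_simps)
      show "0 < w * T" using w T by simp
    qed
    also have "\<dots> \<le> trapped_energy \<psi> \<tau>" using et err by (simp add: field_simps)
    finally show ?thesis using \<psi> by blast
  qed
  moreover have "t0 > 0" by (simp add: t0_def)
  ultimately show ?thesis by blast
qed

text \<open>The density vanishes beyond radius R, so the weight matters only on a ball, where it is
  bounded by W.\<close>

lemma weighted_energy_le:
  assumes u: "smooth u" and z: "\<And>x. norm x > R \<Longrightarrow> wave_density u (event c x) = 0"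
    and w: "\<And>x. norm x \<le> R \<Longrightarrow> w x \<le> W" and W: "W \<ge> 0"
  shows "weighted_energy f u c UNIV w \<le> ennreal (W * energy u c / 2)"
proof -
  have "w x * wave_density u (event c x) / 2 \<le> W * wave_density u (event c x) / 2" for x
    using z[of x] w[of x] density_nonneg[of u "event c x"] by (cases "norm x \<le> R") (auto intro: mult_right_mono)
  then have "weighted_energy f u c UNIV w \<le> (\<integral>\<^sup>+x. ennreal (W * wave_density u (event c x) / 2) \<partial>lborel)"
    unfolding weighted_energy_eq[OF u] by (intro nn_integral_mono) (simp add: ennreal_leI)
  also have "\<dots> = ennreal (\<integral>x. W * wave_density u (event c x) / 2 \<partial>lborel)"
    using integrable_slice[OF continuous_density[OF u] z] W density_nonneg by (intro nn_integral_eq_integral) auto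
  finally show ?thesis by (simp add: energy_def)
qed

lemma weighted_energy_trapped:
  assumes u: "smooth u" and z: "\<And>x. norm x > R \<Longrightarrow> wave_density u (event c x) = 0"
  shows "weighted_energy f u c {x. norm x \<le> 3 * pi / 4} (\<lambda>x. 1) = ennreal (trapped_energy u c / 2)"
proof -
  have i: "integrable lborel (\<lambda>x. indicator (cball 0 in_radius) x * wave_density u (event c x))"
    using integrable_mult_indicator[OF _ integrable_slice[OF continuous_density[OF u] z], of "cball 0 in_radius"] by simp
  have "weighted_energy f u c {x. norm x \<le> 3 * pi / 4} (\<lambda>x. 1)
    = (\<integral>\<^sup>+x. ennreal (indicator (cball 0 in_radius) x * wave_density u (event c x) / 2) \<partial>lborel)"
    unfolding weighted_energy_eq[OF u]
    by (rule nn_integral_cong) (auto simp: in_radius_def indicator_def)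
  also have "\<dots> = ennreal (\<integral>x. indicator (cball 0 in_radius) x * wave_density u (event c x) / 2 \<partial>lborel)"
    using i density_nonneg by (intro nn_integral_eq_integral) auto
  finally show ?thesis by (simp add: trapped_energy_def)
qed

end

section \<open>Return to the geometric formulation\<close>

theorem proposition12p1:
  fixes f h :: "real \<Rightarrow> real"
  assumes f_nonneg: "\<And>r. r \<ge> 0 \<Longrightarrow> f r \<ge> 0"
    and f_smooth: "smooth_on_closed {0..} f"
    and f_sin: "\<And>r. 0 \<le> r \<Longrightarrow> r \<le> 7 * pi / 8 \<Longrightarrow> f r = (sin r)\<^sup>2"
    and f_pos: "\<And>r. 7 * pi / 8 \<le> r \<Longrightarrow> r \<le> pi \<Longrightarrow> f r > 0"
    and f_flat: "\<And>r. r \<ge> pi \<Longrightarrow> f r = r\<^sup>2"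
    and h_nonneg: "\<And>t. t \<ge> 0 \<Longrightarrow> h t \<ge> 0"
    and h_lim: "((\<lambda>t. h t * (ln (2 + t))\<^sup>2) \<longlongrightarrow> 0) at_top"
  shows "\<exists>t0>0. \<forall>\<tau>>t0. \<exists>\<psi> :: spacetime \<Rightarrow> complex.
    smooth \<psi> \<and>
    (\<forall>p. wave_op (g_metric f) \<psi> p = 0) \<and>
    (\<forall>c. weighted_energy f \<psi> c UNIV (\<lambda>x. 1) < \<infinity>) \<and>
    weighted_energy f \<psi> 0 UNIV (\<lambda>x. 1 + norm x) < \<infinity> \<and>
    weighted_energy f (T_deriv \<psi>) 0 UNIV (\<lambda>x. 1) < \<infinity> \<and>
    weighted_energy f \<psi> \<tau> {x. norm x \<le> 3 * pi / 4} (\<lambda>x. 1)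
      > ennreal (h \<tau>) *
        (weighted_energy f \<psi> 0 UNIV (\<lambda>x. 1 + norm x)
         + weighted_energy f (T_deriv \<psi>) 0 UNIV (\<lambda>x. 1))"
proof -
  have f_outer: "f r > 0" if "r > 7 * pi / 8" for r
    using f_pos[of r] f_flat[of r] that pi_gt_zero by (cases "r \<le> pi") auto
  obtain \<rho> \<beta> S where "trapped \<rho> \<beta> f S"
    using trapped_exists[OF f_smooth f_sin f_outer] by blast
  then interpret trapped \<rho> \<beta> f S .
  have lt: "in_radius\<^sup>2 < out_radius\<^sup>2"
    using pi_gt_zero by (intro power_strict_mono) (auto simp: in_radius_def out_radius_def)
  obtain X :: "real \<Rightarrow> real" where X: "smooth X" "\<And>s. 0 \<le> X s" "\<And>s. X s \<le> 1"
      "\<And>s. s \<le> in_radius\<^sup>2 \<Longrightarrow> X s = 1" "\<And>s. s \<ge> out_radius\<^sup>2 \<Longrightarrow> X s = 0"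
    using plateau_exists[OF lt] by blast
  interpret quasimode \<rho> \<beta> f S X by unfold_locales (fact X)+
  obtain t0 where t0: "t0 > 0" and ex: "\<And>\<tau>. \<tau> > t0 \<Longrightarrow> \<exists>\<psi>. smooth \<psi> \<and> (\<forall>p. wave \<psi> p = 0)
    \<and> (\<forall>t x. norm x > out_radius + \<bar>t\<bar> + 1 \<longrightarrow> wave_density \<psi> (event t x) = 0)
    \<and> (\<forall>x. norm x > out_radius + 1 \<longrightarrow> wave_density (pd None \<psi>) (event 0 x) = 0)
    \<and> h \<tau> * ((out_radius + 2) * energy \<psi> 0 + energy (pd None \<psi>) 0) < trapped_energy \<psi> \<tau>"
    using slow_decay[OF h_nonneg h_lim] by blast
  show ?thesis
  proof (intro exI[of _ t0] conjI t0 allI impI)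
    fix \<tau> assume \<tau>: "t0 < \<tau>"
    obtain \<psi> where \<psi>: "smooth \<psi>" "\<And>p. wave \<psi> p = 0"
        and z: "\<And>t x. norm x > out_radius + \<bar>t\<bar> + 1 \<Longrightarrow> wave_density \<psi> (event t x) = 0"
        and z': "\<And>x. norm x > out_radius + 1 \<Longrightarrow> wave_density (pd None \<psi>) (event 0 x) = 0"
        and low: "h \<tau> * ((out_radius + 2) * energy \<psi> 0 + energy (pd None \<psi>) 0) < trapped_energy \<psi> \<tau>"
      using ex[OF \<tau>] by blast
    have R: "out_radius > 0" using radii by simp
    have e: "energy u c \<ge> 0" for u c
      unfolding energy_def by (intro Bochner_Integration.integral_nonneg density_nonneg)
    have W1: "weighted_energy f \<psi> c UNIV (\<lambda>x. 1) \<le> ennreal (1 * energy \<psi> c / 2)" for c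
      by (rule weighted_energy_le[OF \<psi>(1) z]) auto
    \<comment> \<open>At t = 0 the solution lives in r \<le> \<open>out_radius + 1\<close>, where 1
      + r is at most \<open>out_radius + 2\<close>.\<close>
    have W2: "weighted_energy f \<psi> 0 UNIV (\<lambda>x. 1 + norm x) \<le> ennreal ((out_radius + 2) * energy \<psi> 0 / 2)"
      by (rule weighted_energy_le[OF \<psi>(1), of "out_radius + 1"]) (use z[where t=0] R in auto)
    have W3: "weighted_energy f (T_deriv \<psi>) 0 UNIV (\<lambda>x. 1) \<le> ennreal (1 * energy (pd None \<psi>) 0 / 2)"
      unfolding T_deriv_eq by (rule weighted_energy_le[OF smooth_pd[OF \<psi>(1)] z']) auto
    have "ennreal (h \<tau>) * (weighted_energy f \<psi> 0 UNIV (\<lambda>x. 1 + norm x) + weighted_energy f (T_deriv \<psi>) 0 UNIV (\<lambda>x. 1))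
      \<le> ennreal (h \<tau>) * (ennreal ((out_radius + 2) * energy \<psi> 0 / 2) + ennreal (1 * energy (pd None \<psi>) 0 / 2))"
      by (intro mult_left_mono add_mono W2 W3) simp
    also have "\<dots> = ennreal (h \<tau> * ((out_radius + 2) * energy \<psi> 0 + energy (pd None \<psi>) 0) / 2)"
      using e R h_nonneg[of \<tau>] \<tau> t0 by (simp add: ennreal_plus[symmetric] ennreal_mult[symmetric] add_divide_distrib del: ennreal_plus)
    also have "\<dots> < ennreal (trapped_energy \<psi> \<tau> / 2)"
    proof (rule ennreal_lessI)
      have "0 \<le> h \<tau> * ((out_radius + 2) * energy \<psi> 0 + energy (pd None \<psi>) 0)"
        using e R h_nonneg[of \<tau>] \<tau> t0 by (intro mult_nonneg_nonneg add_nonneg_nonneg) auto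
      then show "0 < trapped_energy \<psi> \<tau> / 2" using low by simp
      show "h \<tau> * ((out_radius + 2) * energy \<psi> 0 + energy (pd None \<psi>) 0) / 2 < trapped_energy \<psi> \<tau> / 2"
        using low by simp
    qed
    also have "\<dots> = weighted_energy f \<psi> \<tau> {x. norm x \<le> 3 * pi / 4} (\<lambda>x. 1)"
      by (rule weighted_energy_trapped[OF \<psi>(1) z, symmetric])
    finally have "ennreal (h \<tau>) * (weighted_energy f \<psi> 0 UNIV (\<lambda>x. 1 + norm x) + weighted_energy f (T_deriv \<psi>) 0 UNIV (\<lambda>x. 1))
      < weighted_energy f \<psi> \<tau> {x. norm x \<le> 3 * pi / 4} (\<lambda>x. 1)" .
    moreover have "wave_op (g_metric f) \<psi> p = 0" for p
      by (simp add: wave_op_eq[OF \<psi>(1)] \<psi>(2))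
    ultimately show "\<exists>\<psi>. smooth \<psi> \<and>
      (\<forall>p. wave_op (g_metric f) \<psi> p = 0) \<and>
      (\<forall>c. weighted_energy f \<psi> c UNIV (\<lambda>x. 1) < \<infinity>) \<and>
      weighted_energy f \<psi> 0 UNIV (\<lambda>x. 1 + norm x) < \<infinity> \<and>
      weighted_energy f (T_deriv \<psi>) 0 UNIV (\<lambda>x. 1) < \<infinity> \<and>
      weighted_energy f \<psi> \<tau> {x. norm x \<le> 3 * pi / 4} (\<lambda>x. 1)
        > ennreal (h \<tau>) *
          (weighted_energy f \<psi> 0 UNIV (\<lambda>x. 1 + norm x)
           + weighted_energy f (T_deriv \<psi>) 0 UNIV (\<lambda>x. 1))"
      using \<psi>(1) le_less_trans[OF W1] le_less_trans[OF W2] le_less_trans[OF W3]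
      by (intro exI[of _ \<psi>] conjI allI) simp_all
  qed
qed

end
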